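(* Let $(\mathcal C,\circ,I,\bullet,J)$ be a $\bullet$-braided duoidal category with a reversion. Assume that $\mathcal C$ has, and $\bullet$ preserves, binary intersections. Then the category $\mathrm{Hopf}^{\mathrm m}_{\mathrm{coc}}(\mathcal C,\circ,\bullet)$ of cocommutative Hopf monoids $H$ whose unit morphism $u_H:I\to H$ is a monomorphism in $\mathcal C$ is protomodular.
   Context: Conventions: composition is juxtaposition (right to left), an object also denotes its identity morphism, associativity constraints are suppressed. Duoidal category $(\mathcal C,\circ,I,\bullet,J)$: a category with monoidal structures $(\mathcal C,\circ,I)$, $(\mathcal C,\bullet,J)$ (left/right unit constraints $l^\circ,r^\circ$, resp. $l^\bullet,r^\bullet$), a natural transformation $\zeta_{A,B,C,D}:(A\bullet B)\circ(C\bullet D)\to(A\circ C)\bullet(B\circ D)$ and morphisms $\Delta_I:I\to I\bullet I$, $m_J:J\circ J\to J$, $\varepsilon_I=u_J:I\to J$ such that $(J,m_J,u_J)$ is a monoid in $(\mathcal C,\circ,I)$, $(I,\Delta_I,\varepsilon_I)$ is a comonoid in $(\mathcal C,\bullet,J)$, and $\zeta_{A,B,C\circ E,D\circ F}((A\bullet B)\circ\zeta_{C,D,E,F})=\zeta_{A\circ C,B\circ D,E,F}(\zeta_{A,B,C,D}\circ(E\bullet F))$, $((A\circ D)\bullet\zeta_{B,C,E,F})\zeta_{A,B\bullet C,D,E\bullet F}=(\zeta_{A,B,D,E}\bullet(C\circ F))\zeta_{A\bullet B,C,D\bullet E,F}$, $(l^\circ_A\bullet l^\circ_B)\zeta_{I,I,A,B}(\Delta_I\circ(A\bullet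 B))=l^\circ_{A\bullet B}$, $(r^\circ_A\bullet r^\circ_B)\zeta_{A,B,I,I}((A\bullet B)\circ\Delta_I)=r^\circ_{A\bullet B}$, $l^\bullet_{A\circ B}(m_J\bullet(A\circ B))\zeta_{J,A,J,B}=l^\bullet_A\circ l^\bullet_B$, $r^\bullet_{A\circ B}((A\circ B)\bullet m_J)\zeta_{A,J,B,J}=r^\bullet_A\circ r^\bullet_B$. It is $\bullet$-braided if $(\mathcal C,\bullet,J)$ has a braiding $\sigma_{X,Y}:X\bullet Y\to Y\bullet X$ with $\sigma_{A\circ C,B\circ D}\zeta_{A,B,C,D}=\zeta_{B,A,D,C}(\sigma_{A,B}\circ\sigma_{C,D})$ and $\sigma_{I,I}\Delta_I=\Delta_I$. A binary intersection is a pullback of two monomorphisms with common codomain; "$\bullet$ preserves binary intersections" means all functors $X\bullet(-)$ and $(-)\bullet X$ do. Bimonoid: $(H,m_H,u_H,\Delta_H,\varepsilon_H)$ with $(H,m_H,u_H)$ a monoid in $(\mathcal C,\circ,I)$, $(H,\Delta_H,\varepsilon_H)$ a comonoid in $(\mathcal C,\bullet,J)$ and $\Delta_Hm_H=(m_H\bullet m_H)\zeta_{H,H,H,H}(\Delta_H\circ\Delta_H)$, $\varepsilon_Hm_H=m_J(\varepsilon_H\circ\varepsilon_H)$, $\Delta_Hu_H=(u_H\bullet u_H)\Delta_I$, $\varepsilon_Hu_H=\varepsilon_I$; morphisms are morphisms of monoids and comonoids. $H$ is cocommutative if $\sigma_{H,H}\Delta_H=\Delta_H$. Reversion: a functor $(-)^-:\mathcal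 C\to\mathcal C$ with lax monoidal structures $(\phi^\circ_{X,Y}:X^-\circ Y^-\to(Y\circ X)^-,\ \phi^\circ_0:I\to I^-)$ from $(\mathcal C,\circ^{\mathrm{rev}})$ to $(\mathcal C,\circ)$ and $(\phi^\bullet_{X,Y}:X^-\bullet Y^-\to(Y\bullet X)^-,\ \phi^\bullet_0:J\to J^-)$ from $(\mathcal C,\bullet^{\mathrm{rev}})$ to $(\mathcal C,\bullet)$ ($\mathrm{rev}$ = reversed tensor product), forming a double lax monoidal functor $(\mathcal C,\circ^{\mathrm{rev}},\bullet^{\mathrm{rev}})\to(\mathcal C,\circ,\bullet)$, i.e. $\phi^\bullet_{C\circ A,D\circ B}(\phi^\circ_{A,C}\bullet\phi^\circ_{B,D})\zeta_{A^-,B^-,C^-,D^-}=(\zeta_{D,C,B,A})^-\phi^\circ_{B\bullet A,D\bullet C}(\phi^\bullet_{A,B}\circ\phi^\bullet_{C,D})$, $\phi^\bullet_{I,I}(\phi^\circ_0\bullet\phi^\circ_0)\Delta_I=(\Delta_I)^-\phi^\circ_0$, $(m_J)^-\phi^\circ_{J,J}(\phi^\bullet_0\circ\phi^\bullet_0)=\phi^\bullet_0m_J$, $\phi^\bullet_0\varepsilon_I=(\varepsilon_I)^-\phi^\circ_0$; together with natural transformations $\gamma_{X,Y,Z,T}:((X\bullet Y^-)\circ Z)\bullet T\to X\circ(Z\bullet(Y\circ T))$, $\delta_{X,Y,Z,T}:X\bullet(Y\circ(Z^-\bullet T))\to((X\circ Z)\bullet Y)\circ T$, $\widetilde\gamma_{X,Y,Z,T}:X^-\bullet((Y\bullet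 Z)\circ T)\to Z\circ((X\circ Y)^-\bullet T)$, $\widetilde\delta_{X,Y,Z,T}:(X\circ(Y\bullet Z))\bullet T^-\to(X\bullet(Z\circ T)^-)\circ Y$. Put $\psi_{X,Y}=\gamma_{J,X,I,Y}(((l^\bullet_{X^-})^{-1}\circ I)\bullet Y)((r^\circ_{X^-})^{-1}\bullet Y):X^-\bullet Y\to J\circ(I\bullet(X\circ Y))$, $\varphi_{X,Y}=\delta_{X,I,Y,J}(X\bullet(I\circ(r^\bullet_{Y^-})^{-1}))(X\bullet(l^\circ_{Y^-})^{-1}):X\bullet Y^-\to((X\circ Y)\bullet I)\circ J$, $\widetilde\psi_{X,Y}=l^\circ_{(X\circ Y)^-}(I\circ r^\bullet_{(X\circ Y)^-})\widetilde\gamma_{X,Y,I,J}:X^-\bullet((Y\bullet I)\circ J)\to(X\circ Y)^-$, $\widetilde\varphi_{X,Y}=r^\circ_{(X\circ Y)^-}(l^\bullet_{(X\circ Y)^-}\circ I)\widetilde\delta_{J,I,X,Y}:(J\circ(I\bullet X))\bullet Y^-\to(X\circ Y)^-$. Axioms, for all objects ($\Delta_J:J\to J\bullet J$ is the inverse unit constraint): (R1) $\gamma_{X,Y,Z\circ U,T\circ V}\zeta_{(X\bullet Y^-)\circ Z,T,U,V}=(X\circ\zeta_{Z,Y\circ T,U,V})(\gamma_{X,Y,Z,T}\circ(U\bullet V))$. (R2) $((X\circ T)\bullet\gamma_{Y,Z,U,V})(\zeta_{X,Y\bullet Z^-,T,U}\bullet V)=\zeta_{X,Y,T,U\bullet(Z\circ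 V)}\gamma_{X\bullet Y,Z,T\bullet U,V}$. (R3) $\delta_{X\circ Z,Y\circ T,U,V}\zeta_{X,Y,Z,T\circ(U^-\bullet V)}=(\zeta_{X,Y,Z\circ U,T}\circ V)((X\bullet Y)\circ\delta_{Z,T,U,V})$. (R4) $(\delta_{X,Y,T,U}\bullet(Z\circ V))(X\bullet\zeta_{Y,Z,T^-\bullet U,V})=\zeta_{(X\circ T)\bullet Y,Z,U,V}\delta_{X,Y\bullet Z,T,U\bullet V}$. (R5) $\delta_{X,Y,T,U\bullet(Z\circ V)}(X\bullet\gamma_{Y,Z,T^-\bullet U,V})=\gamma_{(X\circ T)\bullet Y,Z,U,V}(\delta_{X,Y\bullet Z^-,T,U}\bullet V)$. (R6) $l^\circ_{I\bullet I}(I\circ(I\bullet l^\circ_I))\gamma_{I,I,I,I}(((I\bullet\phi^\circ_0)\Delta_I\circ I)\bullet I)=l^\circ_I\bullet I$. (R7) $r^\circ_{I\bullet I}((r^\circ_I\bullet I)\circ I)\delta_{I,I,I,I}(I\bullet(I\circ(\phi^\circ_0\bullet I)\Delta_I))=I\bullet r^\circ_I$. (R8) $\gamma_{X\circ Z,Y,J\circ J,U}((\delta_{X,Y^-,Z,J}\circ J)\bullet U)(((X\bullet(Y^-\circ(r^\bullet_{Z^-})^{-1}))\circ J)\bullet U)=(X\circ Z\circ\zeta_{J,Y,J,U})(X\circ Z\circ(l^\bullet_Y)^{-1}\circ(l^\bullet_U)^{-1})(X\circ l^\bullet_{Z\circ Y\circ U})\gamma_{X,Z\circ Y,J,U}(((X\bullet\phi^\circ_{Y,Z})\circ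 J)\bullet U)$. (R9) $\delta_{X,J\circ J,Z,Y\circ U}(X\bullet(J\circ\gamma_{J,Y,Z^-,U}))(X\bullet(J\circ(((l^\bullet_{Y^-})^{-1}\circ Z^-)\bullet U)))=(\zeta_{X,J,Z,J}\circ Y\circ U)((r^\bullet_X)^{-1}\circ(r^\bullet_Z)^{-1}\circ Y\circ U)(r^\bullet_{X\circ Z\circ Y}\circ U)\delta_{X,J,Z\circ Y,U}(X\bullet(J\circ(\phi^\circ_{Y,Z}\bullet U)))$. (R10) $\widetilde\varphi_{X\circ Y,Z}(\psi_{X,Y}\bullet Z^-)=\widetilde\psi_{X,Y\circ Z}(X^-\bullet\varphi_{Y,Z})$. (R11) $(r^\circ_X)^-l^\circ_{(X\circ I)^-}(I\circ r^\bullet_{(X\circ I)^-})\widetilde\gamma_{X,I,I,J}(X^-\bullet(\Delta_I\circ J))=r^\bullet_{X^-}(X^-\bullet l^\circ_J)$. (R12) $(l^\circ_X)^-r^\circ_{(I\circ X)^-}(l^\bullet_{(I\circ X)^-}\circ I)\widetilde\delta_{J,I,I,X}((J\circ\Delta_I)\bullet X^-)=l^\bullet_{X^-}(r^\circ_J\bullet X^-)$. (R13) $\gamma_{X,Y,T\bullet(Z\circ U),V}(\gamma_{X\bullet Y^-,Z,T,U}\bullet V)=(X\circ(T\bullet\zeta_{Z,Y,U,V}))\gamma_{X,Z\bullet Y,T,U\bullet V}(((X\bullet\phi^\bullet_{Y,Z})\circ T)\bullet U\bullet V)$. (R14) $\delta_{X,(Y\circ T)\bullet Z,U,V}(X\bullet\delta_{Y,Z,T,U^-\bullet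 V})=((\zeta_{X,Y,U,T}\bullet Z)\circ V)\delta_{X\bullet Y,Z,U\bullet T,V}(X\bullet Y\bullet(Z\circ(\phi^\bullet_{T,U}\bullet V)))$. (R15) $(X\circ\gamma_{Z,T,U,Y\circ V})\gamma_{X,Y,(Z\bullet T^-)\circ U,V}=\gamma_{X\circ Z,T\circ Y,U,V}((((X\circ Z)\bullet\phi^\circ_{Y,T})\circ U)\bullet V)((\zeta_{X,Y^-,Z,T^-}\circ U)\bullet V)$. (R16) $(\delta_{X\circ U,Y,Z,T}\circ V)\delta_{X,Y\circ(Z^-\bullet T),U,V}=\delta_{X,Y,U\circ Z,T\circ V}(X\bullet(Y\circ(\phi^\circ_{Z,U}\bullet(T\circ V))))(X\bullet(Y\circ\zeta_{Z^-,T,U^-,V}))$. (R17) $r^\circ_J(J\circ r^\bullet_I)(J\circ(I\bullet m_J))\gamma_{J,J,I,J}(((J\bullet\phi^\bullet_0)\Delta_J\circ I)\bullet J)=r^\bullet_J(r^\circ_J\bullet J)$. (R18) $l^\circ_J(l^\bullet_I\circ J)((m_J\bullet I)\circ J)\delta_{J,I,J,J}(J\bullet(I\circ(\phi^\bullet_0\bullet J)\Delta_J))=l^\bullet_J(J\bullet l^\circ_J)$. Hopf monoid: a bimonoid $H$ with an antipode, i.e. a morphism $\Sigma_H:H\to H^-$ in $\mathcal C$ such that $((m_H\bullet I)\circ J)\varphi_{H,H}(H\bullet\Sigma_H)\Delta_H=((u_H\bullet I)\circ J)(\Delta_I\circ J)(l^\circ_J)^{-1}\varepsilon_H$ and $(J\circ(I\bullet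 m_H))\psi_{H,H}(\Sigma_H\bullet H)\Delta_H=(J\circ(I\bullet u_H))(J\circ\Delta_I)(r^\circ_J)^{-1}\varepsilon_H$. $\mathrm{Hopf}^{\mathrm m}_{\mathrm{coc}}(\mathcal C,\circ,\bullet)$ is a full subcategory of the category of bimonoids. Protomodular: a category with pullbacks of split epimorphisms along any morphism, such that all inverse image (change-of-base) functors of the fibration of points (split epimorphisms with chosen section, mapped to their codomain) reflect isomorphisms. *)

theory Defs
  imports Main
begin

section \<open>Categories\<close>

text \<open>
  Categories are single-sorted: an object is identified with its identity arrow. So an object also
  denotes its identity morphism, and one function gives the action of a functor on arrows and on
  objects.
\<close>

record 'a cat =
  Arr :: "'a set"
  Dom :: "'a \<Rightarrow> 'a"
  Cod :: "'a \<Rightarrow> 'a"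
  Comp :: "'a \<Rightarrow> 'a \<Rightarrow> 'a"  (infixr \<open>\<cdot>\<index>\<close> 55)

definition Ob :: "'a cat \<Rightarrow> 'a set"
  where "Ob \<C> = {A \<in> Arr \<C>. Dom \<C> A = A}"

definition hom :: "'a cat \<Rightarrow> 'a \<Rightarrow> 'a \<Rightarrow> 'a set"
  where "hom \<C> A B = {f \<in> Arr \<C>. Dom \<C> f = A \<and> Cod \<C> f = B}"

locale category =
  fixes \<C> :: "'a cat" (structure)
  assumes dom_arr: "f \<in> Arr \<C> \<Longrightarrow> Dom \<C> f \<in> Arr \<C>"
    and cod_arr: "f \<in> Arr \<C> \<Longrightarrow> Cod \<C> f \<in> Arr \<C>"
    and dom_dom: "f \<in> Arr \<C> \<Longrightarrow> Dom \<C> (Dom \<C> f) = Dom \<C> f"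
    and cod_dom: "f \<in> Arr \<C> \<Longrightarrow> Cod \<C> (Dom \<C> f) = Dom \<C> f"
    and dom_cod: "f \<in> Arr \<C> \<Longrightarrow> Dom \<C> (Cod \<C> f) = Cod \<C> f"
    and cod_cod: "f \<in> Arr \<C> \<Longrightarrow> Cod \<C> (Cod \<C> f) = Cod \<C> f"
    and comp_hom: "\<lbrakk>f \<in> Arr \<C>; g \<in> Arr \<C>; Dom \<C> g = Cod \<C> f\<rbrakk>
      \<Longrightarrow> g \<cdot> f \<in> hom \<C> (Dom \<C> f) (Cod \<C> g)"
    and comp_dom: "f \<in> Arr \<C> \<Longrightarrow> f \<cdot> Dom \<C> f = f"
    and comp_cod: "f \<in> Arr \<C> \<Longrightarrow> Cod \<C> f \<cdot> f = f"
    and comp_assoc: "\<lbrakk>f \<in> Arr \<C>; g \<in> Arr \<C>; h \<in> Arr \<C>; Dom \<C> g = Cod \<C> f; Dom \<C> h = Cod \<C> g\<rbrakk>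
      \<Longrightarrow> (h \<cdot> g) \<cdot> f = h \<cdot> (g \<cdot> f)"

definition full_subcategory :: "'a cat \<Rightarrow> ('a \<Rightarrow> bool) \<Rightarrow> 'a cat"
  where "full_subcategory \<C> P = \<C>\<lparr>Arr := {f \<in> Arr \<C>. P (Dom \<C> f) \<and> P (Cod \<C> f)}\<rparr>"

definition is_functor :: "'a cat \<Rightarrow> 'b cat \<Rightarrow> ('a \<Rightarrow> 'b) \<Rightarrow> bool"
  where "is_functor \<C> \<D> F \<longleftrightarrow>
    (\<forall>f\<in>Arr \<C>. F f \<in> hom \<D> (F (Dom \<C> f)) (F (Cod \<C> f))) \<and>
    (\<forall>f\<in>Arr \<C>. \<forall>g\<in>Arr \<C>. Dom \<C> g = Cod \<C> f \<longrightarrow> F (g \<cdot>\<^bsub>\<C>\<^esub> f) = F g \<cdot>\<^bsub>\<D>\<^esub> F f)"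

definition mono_arrow :: "'a cat \<Rightarrow> 'a \<Rightarrow> bool"
  where "mono_arrow \<C> f \<longleftrightarrow> f \<in> Arr \<C> \<and>
    (\<forall>X\<in>Ob \<C>. \<forall>g\<in>hom \<C> X (Dom \<C> f). \<forall>h\<in>hom \<C> X (Dom \<C> f).
      f \<cdot>\<^bsub>\<C>\<^esub> g = f \<cdot>\<^bsub>\<C>\<^esub> h \<longrightarrow> g = h)"

definition inverse_arrows :: "'a cat \<Rightarrow> 'a \<Rightarrow> 'a \<Rightarrow> bool"
  where "inverse_arrows \<C> f g \<longleftrightarrow> f \<in> Arr \<C> \<and> g \<in> hom \<C> (Cod \<C> f) (Dom \<C> f) \<and>
    g \<cdot>\<^bsub>\<C>\<^esub> f = Dom \<C> f \<and> f \<cdot>\<^bsub>\<C>\<^esub> g = Cod \<C> f"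

definition iso_arrow :: "'a cat \<Rightarrow> 'a \<Rightarrow> bool"
  where "iso_arrow \<C> f \<longleftrightarrow> (\<exists>g. inverse_arrows \<C> f g)"

definition inverse_arrow :: "'a cat \<Rightarrow> 'a \<Rightarrow> 'a"
  where "inverse_arrow \<C> f = (THE g. inverse_arrows \<C> f g)"

definition reflects_isos :: "'a cat \<Rightarrow> 'b cat \<Rightarrow> ('a \<Rightarrow> 'b) \<Rightarrow> bool"
  where "reflects_isos \<C> \<D> F \<longleftrightarrow> (\<forall>f\<in>Arr \<C>. iso_arrow \<D> (F f) \<longrightarrow> iso_arrow \<C> f)"

text \<open>
  In the following predicates \<open>F\<close> and \<open>G\<close> are functors in one to four variables from powers of the
  category to itself, and the components of the transformation are indexed by objects.
\<close>

definition natural1 ::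
    "'a cat \<Rightarrow> ('a \<Rightarrow> 'a) \<Rightarrow> ('a \<Rightarrow> 'a) \<Rightarrow> ('a \<Rightarrow> 'a) \<Rightarrow> bool"
  where "natural1 \<C> F G \<tau> \<longleftrightarrow>
    (\<forall>A\<in>Ob \<C>. \<tau> A \<in> hom \<C> (F A) (G A)) \<and>
    (\<forall>f\<in>Arr \<C>. \<tau> (Cod \<C> f) \<cdot>\<^bsub>\<C>\<^esub> F f = G f \<cdot>\<^bsub>\<C>\<^esub> \<tau> (Dom \<C> f))"

definition natural2 ::
    "'a cat \<Rightarrow> ('a \<Rightarrow> 'a \<Rightarrow> 'a) \<Rightarrow> ('a \<Rightarrow> 'a \<Rightarrow> 'a) \<Rightarrow> ('a \<Rightarrow> 'a \<Rightarrow> 'a) \<Rightarrow> bool"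
  where "natural2 \<C> F G \<tau> \<longleftrightarrow>
    (\<forall>A\<in>Ob \<C>. \<forall>B\<in>Ob \<C>. \<tau> A B \<in> hom \<C> (F A B) (G A B)) \<and>
    (\<forall>f\<in>Arr \<C>. \<forall>g\<in>Arr \<C>.
      \<tau> (Cod \<C> f) (Cod \<C> g) \<cdot>\<^bsub>\<C>\<^esub> F f g = G f g \<cdot>\<^bsub>\<C>\<^esub> \<tau> (Dom \<C> f) (Dom \<C> g))"

definition natural3 ::
    "'a cat \<Rightarrow> ('a \<Rightarrow> 'a \<Rightarrow> 'a \<Rightarrow> 'a) \<Rightarrow> ('a \<Rightarrow> 'a \<Rightarrow> 'a \<Rightarrow> 'a) \<Rightarrow> ('a \<Rightarrow> 'a \<Rightarrow> 'a \<Rightarrow> 'a) \<Rightarrow> bool"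
  where "natural3 \<C> F G \<tau> \<longleftrightarrow>
    (\<forall>A\<in>Ob \<C>. \<forall>B\<in>Ob \<C>. \<forall>D\<in>Ob \<C>. \<tau> A B D \<in> hom \<C> (F A B D) (G A B D)) \<and>
    (\<forall>f\<in>Arr \<C>. \<forall>g\<in>Arr \<C>. \<forall>h\<in>Arr \<C>.
      \<tau> (Cod \<C> f) (Cod \<C> g) (Cod \<C> h) \<cdot>\<^bsub>\<C>\<^esub> F f g h =
      G f g h \<cdot>\<^bsub>\<C>\<^esub> \<tau> (Dom \<C> f) (Dom \<C> g) (Dom \<C> h))"

definition natural4 ::
    "'a cat \<Rightarrow> ('a \<Rightarrow> 'a \<Rightarrow> 'a \<Rightarrow> 'a \<Rightarrow> 'a) \<Rightarrow> ('a \<Rightarrow> 'a \<Rightarrow> 'a \<Rightarrow> 'a \<Rightarrow> 'a)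
      \<Rightarrow> ('a \<Rightarrow> 'a \<Rightarrow> 'a \<Rightarrow> 'a \<Rightarrow> 'a) \<Rightarrow> bool"
  where "natural4 \<C> F G \<tau> \<longleftrightarrow>
    (\<forall>A\<in>Ob \<C>. \<forall>B\<in>Ob \<C>. \<forall>D\<in>Ob \<C>. \<forall>E\<in>Ob \<C>. \<tau> A B D E \<in> hom \<C> (F A B D E) (G A B D E)) \<and>
    (\<forall>f\<in>Arr \<C>. \<forall>g\<in>Arr \<C>. \<forall>h\<in>Arr \<C>. \<forall>k\<in>Arr \<C>.
      \<tau> (Cod \<C> f) (Cod \<C> g) (Cod \<C> h) (Cod \<C> k) \<cdot>\<^bsub>\<C>\<^esub> F f g h k =
      G f g h k \<cdot>\<^bsub>\<C>\<^esub> \<tau> (Dom \<C> f) (Dom \<C> g) (Dom \<C> h) (Dom \<C> k))"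


section \<open>Pullbacks and protomodular categories\<close>

text \<open>\<open>p\<close> and \<open>q\<close> are the projections to the domains of \<open>f\<close> and \<open>g\<close>, respectively.\<close>

definition is_pullback :: "'a cat \<Rightarrow> 'a \<Rightarrow> 'a \<Rightarrow> 'a \<Rightarrow> 'a \<Rightarrow> bool"
  where "is_pullback \<C> f g p q \<longleftrightarrow>
    f \<in> Arr \<C> \<and> g \<in> Arr \<C> \<and> Cod \<C> f = Cod \<C> g \<and>
    p \<in> Arr \<C> \<and> q \<in> Arr \<C> \<and> Dom \<C> p = Dom \<C> q \<and> Cod \<C> p = Dom \<C> f \<and> Cod \<C> q = Dom \<C> g \<and>
    f \<cdot>\<^bsub>\<C>\<^esub> p = g \<cdot>\<^bsub>\<C>\<^esub> q \<and>
    (\<forall>X\<in>Ob \<C>. \<forall>h\<in>hom \<C> X (Dom \<C> f). \<forall>k\<in>hom \<C> X (Dom \<C> g).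
      f \<cdot>\<^bsub>\<C>\<^esub> h = g \<cdot>\<^bsub>\<C>\<^esub> k \<longrightarrow>
      (\<exists>!u. u \<in> hom \<C> X (Dom \<C> p) \<and> p \<cdot>\<^bsub>\<C>\<^esub> u = h \<and> q \<cdot>\<^bsub>\<C>\<^esub> u = k))"

definition has_binary_intersections :: "'a cat \<Rightarrow> bool"
  where "has_binary_intersections \<C> \<longleftrightarrow>
    (\<forall>f g. mono_arrow \<C> f \<and> mono_arrow \<C> g \<and> Cod \<C> f = Cod \<C> g \<longrightarrow> (\<exists>p q. is_pullback \<C> f g p q))"

definition preserves_binary_intersections :: "'a cat \<Rightarrow> ('a \<Rightarrow> 'a) \<Rightarrow> bool"
  where "preserves_binary_intersections \<C> F \<longleftrightarrow>
    (\<forall>f g p q. mono_arrow \<C> f \<and> mono_arrow \<C> g \<and> is_pullback \<C> f g p q \<longrightarrow>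
      is_pullback \<C> (F f) (F g) (F p) (F q))"

definition is_point :: "'a cat \<Rightarrow> 'a \<Rightarrow> 'a \<times> 'a \<Rightarrow> bool"
  where "is_point \<C> B = (\<lambda>(p, s). p \<in> Arr \<C> \<and> Cod \<C> p = B \<and> s \<in> hom \<C> B (Dom \<C> p) \<and>
    p \<cdot>\<^bsub>\<C>\<^esub> s = B)"

text \<open>
  The fibre over \<open>B\<close> of the fibration of points. An arrow carries its source and target points,
  since the underlying arrow of the base category does not determine them.
\<close>

definition points :: "'a cat \<Rightarrow> 'a \<Rightarrow> (('a \<times> 'a) \<times> 'a \<times> ('a \<times> 'a)) cat"
  where "points \<C> B = \<lparr>
    Arr = {((p, s), f, (q, t)) | p s f q t. is_point \<C> B (p, s) \<and> is_point \<C> B (q, t) \<and>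
             f \<in> hom \<C> (Dom \<C> p) (Dom \<C> q) \<and> q \<cdot>\<^bsub>\<C>\<^esub> f = p \<and> f \<cdot>\<^bsub>\<C>\<^esub> s = t},
    Dom = (\<lambda>(P, f, Q). (P, Dom \<C> (fst P), P)),
    Cod = (\<lambda>(P, f, Q). (Q, Dom \<C> (fst Q), Q)),
    Comp = (\<lambda>(Q', g, R) (P, f, Q). (P, g \<cdot>\<^bsub>\<C>\<^esub> f, R))\<rparr>"

definition chosen_pullback :: "'a cat \<Rightarrow> 'a \<Rightarrow> 'a \<Rightarrow> 'a \<times> 'a"
  where "chosen_pullback \<C> f g = (SOME (p, q). is_pullback \<C> f g p q)"

definition inverse_image_point :: "'a cat \<Rightarrow> 'a \<Rightarrow> 'a \<times> 'a \<Rightarrow> 'a \<times> 'a"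
  where "inverse_image_point \<C> b = (\<lambda>(p, s).
    let (\<pi>, \<rho>) = chosen_pullback \<C> p b
    in (\<rho>, THE t. t \<in> hom \<C> (Dom \<C> b) (Dom \<C> \<rho>) \<and>
                    \<pi> \<cdot>\<^bsub>\<C>\<^esub> t = s \<cdot>\<^bsub>\<C>\<^esub> b \<and> \<rho> \<cdot>\<^bsub>\<C>\<^esub> t = Dom \<C> b))"

text \<open>
  The inverse image functor from the points over the codomain of \<open>b\<close> to the points over its domain.
  Another choice of pullbacks gives a naturally isomorphic functor, so reflection of isomorphisms
  does not depend on the choice.
\<close>

definition inverse_image ::
    "'a cat \<Rightarrow> 'a \<Rightarrow> ('a \<times> 'a) \<times> 'a \<times> ('a \<times> 'a) \<Rightarrow> ('a \<times> 'a) \<times> 'a \<times> ('a \<times> 'a)"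
  where "inverse_image \<C> b = (\<lambda>(P, f, Q).
    let (\<pi>, \<rho>) = chosen_pullback \<C> (fst P) b; (\<pi>', \<rho>') = chosen_pullback \<C> (fst Q) b
    in (inverse_image_point \<C> b P,
        THE u. u \<in> hom \<C> (Dom \<C> \<rho>) (Dom \<C> \<rho>') \<and>
               \<pi>' \<cdot>\<^bsub>\<C>\<^esub> u = f \<cdot>\<^bsub>\<C>\<^esub> \<pi> \<and> \<rho>' \<cdot>\<^bsub>\<C>\<^esub> u = \<rho>,
        inverse_image_point \<C> b Q))"

definition protomodular :: "'a cat \<Rightarrow> bool"
  where "protomodular \<C> \<longleftrightarrow> category \<C> \<and>
    (\<forall>p s b. b \<in> Arr \<C> \<and> is_point \<C> (Cod \<C> b) (p, s) \<longrightarrow> (\<exists>\<pi> \<rho>. is_pullback \<C> p b \<pi> \<rho>)) \<and>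
    (\<forall>b\<in>Arr \<C>. reflects_isos (points \<C> (Cod \<C> b)) (points \<C> (Dom \<C> b)) (inverse_image \<C> b))"


section \<open>Monoidal categories\<close>

text \<open>\<open>assoc T A B D\<close> goes from \<open>(A \<otimes> B) \<otimes> D\<close> to \<open>A \<otimes> (B \<otimes> D)\<close>.\<close>

record 'a monoidal_structure =
  tens :: "'a \<Rightarrow> 'a \<Rightarrow> 'a"  (infix \<open>\<otimes>\<index>\<close> 70)
  unit_ob :: 'a
  assoc :: "'a \<Rightarrow> 'a \<Rightarrow> 'a \<Rightarrow> 'a"
  lunit :: "'a \<Rightarrow> 'a"
  runit :: "'a \<Rightarrow> 'a"

locale monoidal_category = category \<C>
  for \<C> :: "'a cat" (structure) +
  fixes T :: "'a monoidal_structure"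
  assumes tens_hom: "\<lbrakk>f \<in> Arr \<C>; g \<in> Arr \<C>\<rbrakk>
      \<Longrightarrow> f \<otimes>\<^bsub>T\<^esub> g \<in> hom \<C> (Dom \<C> f \<otimes>\<^bsub>T\<^esub> Dom \<C> g) (Cod \<C> f \<otimes>\<^bsub>T\<^esub> Cod \<C> g)"
    and interchange: "\<lbrakk>f \<in> Arr \<C>; f' \<in> Arr \<C>; g \<in> Arr \<C>; g' \<in> Arr \<C>;
        Dom \<C> f' = Cod \<C> f; Dom \<C> g' = Cod \<C> g\<rbrakk>
      \<Longrightarrow> (f' \<cdot> f) \<otimes>\<^bsub>T\<^esub> (g' \<cdot> g) = (f' \<otimes>\<^bsub>T\<^esub> g') \<cdot> (f \<otimes>\<^bsub>T\<^esub> g)"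
    and unit_ob: "unit_ob T \<in> Ob \<C>"
    and assoc_natural: "natural3 \<C> (\<lambda>A B D. (A \<otimes>\<^bsub>T\<^esub> B) \<otimes>\<^bsub>T\<^esub> D) (\<lambda>A B D. A \<otimes>\<^bsub>T\<^esub> (B \<otimes>\<^bsub>T\<^esub> D)) (assoc T)"
    and lunit_natural: "natural1 \<C> (\<lambda>A. unit_ob T \<otimes>\<^bsub>T\<^esub> A) (\<lambda>A. A) (lunit T)"
    and runit_natural: "natural1 \<C> (\<lambda>A. A \<otimes>\<^bsub>T\<^esub> unit_ob T) (\<lambda>A. A) (runit T)"
    and assoc_iso: "\<lbrakk>A \<in> Ob \<C>; B \<in> Ob \<C>; D \<in> Ob \<C>\<rbrakk> \<Longrightarrow> iso_arrow \<C> (assoc T A B D)"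
    and lunit_iso: "A \<in> Ob \<C> \<Longrightarrow> iso_arrow \<C> (lunit T A)"
    and runit_iso: "A \<in> Ob \<C> \<Longrightarrow> iso_arrow \<C> (runit T A)"
    and pentagon: "\<lbrakk>A \<in> Ob \<C>; B \<in> Ob \<C>; D \<in> Ob \<C>; E \<in> Ob \<C>\<rbrakk>
      \<Longrightarrow> assoc T A B (D \<otimes>\<^bsub>T\<^esub> E) \<cdot> assoc T (A \<otimes>\<^bsub>T\<^esub> B) D E =
          (A \<otimes>\<^bsub>T\<^esub> assoc T B D E) \<cdot> assoc T A (B \<otimes>\<^bsub>T\<^esub> D) E \<cdot> (assoc T A B D \<otimes>\<^bsub>T\<^esub> E)"
    and triangle: "\<lbrakk>A \<in> Ob \<C>; B \<in> Ob \<C>\<rbrakk>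
      \<Longrightarrow> (A \<otimes>\<^bsub>T\<^esub> lunit T B) \<cdot> assoc T A (unit_ob T) B = runit T A \<otimes>\<^bsub>T\<^esub> B"

definition reversed :: "'a cat \<Rightarrow> 'a monoidal_structure \<Rightarrow> 'a monoidal_structure"
  where "reversed \<C> T = \<lparr>
    tens = (\<lambda>f g. g \<otimes>\<^bsub>T\<^esub> f),
    unit_ob = unit_ob T,
    assoc = (\<lambda>A B D. inverse_arrow \<C> (assoc T D B A)),
    lunit = runit T,
    runit = lunit T\<rparr>"

definition lax_monoidal_endofunctor ::
    "'a cat \<Rightarrow> 'a monoidal_structure \<Rightarrow> 'a monoidal_structure \<Rightarrow>
      ('a \<Rightarrow> 'a) \<Rightarrow> ('a \<Rightarrow> 'a \<Rightarrow> 'a) \<Rightarrow> 'a \<Rightarrow> bool"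
  where "lax_monoidal_endofunctor \<C> S T F \<phi> \<phi>\<^sub>0 \<longleftrightarrow>
    is_functor \<C> \<C> F \<and>
    natural2 \<C> (\<lambda>A B. F A \<otimes>\<^bsub>T\<^esub> F B) (\<lambda>A B. F (A \<otimes>\<^bsub>S\<^esub> B)) \<phi> \<and>
    \<phi>\<^sub>0 \<in> hom \<C> (unit_ob T) (F (unit_ob S)) \<and>
    (\<forall>A\<in>Ob \<C>. \<forall>B\<in>Ob \<C>. \<forall>D\<in>Ob \<C>.
      F (assoc S A B D) \<cdot>\<^bsub>\<C>\<^esub> \<phi> (A \<otimes>\<^bsub>S\<^esub> B) D \<cdot>\<^bsub>\<C>\<^esub> (\<phi> A B \<otimes>\<^bsub>T\<^esub> F D) =
      \<phi> A (B \<otimes>\<^bsub>S\<^esub> D) \<cdot>\<^bsub>\<C>\<^esub> (F A \<otimes>\<^bsub>T\<^esub> \<phi> B D) \<cdot>\<^bsub>\<C>\<^esub> assoc T (F A) (F B) (F D)) \<and>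
    (\<forall>A\<in>Ob \<C>. F (lunit S A) \<cdot>\<^bsub>\<C>\<^esub> \<phi> (unit_ob S) A \<cdot>\<^bsub>\<C>\<^esub> (\<phi>\<^sub>0 \<otimes>\<^bsub>T\<^esub> F A) = lunit T (F A)) \<and>
    (\<forall>A\<in>Ob \<C>. F (runit S A) \<cdot>\<^bsub>\<C>\<^esub> \<phi> A (unit_ob S) \<cdot>\<^bsub>\<C>\<^esub> (F A \<otimes>\<^bsub>T\<^esub> \<phi>\<^sub>0) = runit T (F A))"

definition braiding :: "'a cat \<Rightarrow> 'a monoidal_structure \<Rightarrow> ('a \<Rightarrow> 'a \<Rightarrow> 'a) \<Rightarrow> bool"
  where "braiding \<C> T \<sigma> \<longleftrightarrow>
    natural2 \<C> (\<lambda>A B. A \<otimes>\<^bsub>T\<^esub> B) (\<lambda>A B. B \<otimes>\<^bsub>T\<^esub> A) \<sigma> \<and>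
    (\<forall>A\<in>Ob \<C>. \<forall>B\<in>Ob \<C>. iso_arrow \<C> (\<sigma> A B)) \<and>
    (\<forall>A\<in>Ob \<C>. \<forall>B\<in>Ob \<C>. \<forall>D\<in>Ob \<C>.
      assoc T B D A \<cdot>\<^bsub>\<C>\<^esub> \<sigma> A (B \<otimes>\<^bsub>T\<^esub> D) \<cdot>\<^bsub>\<C>\<^esub> assoc T A B D =
      (B \<otimes>\<^bsub>T\<^esub> \<sigma> A D) \<cdot>\<^bsub>\<C>\<^esub> assoc T B A D \<cdot>\<^bsub>\<C>\<^esub> (\<sigma> A B \<otimes>\<^bsub>T\<^esub> D)) \<and>
    (\<forall>A\<in>Ob \<C>. \<forall>B\<in>Ob \<C>. \<forall>D\<in>Ob \<C>.
      inverse_arrow \<C> (assoc T D A B) \<cdot>\<^bsub>\<C>\<^esub> \<sigma> (A \<otimes>\<^bsub>T\<^esub> B) D \<cdot>\<^bsub>\<C>\<^esub> inverse_arrow \<C> (assoc T A B D) =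
      (\<sigma> A D \<otimes>\<^bsub>T\<^esub> B) \<cdot>\<^bsub>\<C>\<^esub> inverse_arrow \<C> (assoc T A D B) \<cdot>\<^bsub>\<C>\<^esub> (A \<otimes>\<^bsub>T\<^esub> \<sigma> B D))"

definition monoid_in :: "'a cat \<Rightarrow> 'a monoidal_structure \<Rightarrow> 'a \<Rightarrow> 'a \<Rightarrow> 'a \<Rightarrow> bool"
  where "monoid_in \<C> T M m u \<longleftrightarrow>
    M \<in> Ob \<C> \<and> m \<in> hom \<C> (M \<otimes>\<^bsub>T\<^esub> M) M \<and> u \<in> hom \<C> (unit_ob T) M \<and>
    m \<cdot>\<^bsub>\<C>\<^esub> (m \<otimes>\<^bsub>T\<^esub> M) = m \<cdot>\<^bsub>\<C>\<^esub> (M \<otimes>\<^bsub>T\<^esub> m) \<cdot>\<^bsub>\<C>\<^esub> assoc T M M M \<and>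
    m \<cdot>\<^bsub>\<C>\<^esub> (u \<otimes>\<^bsub>T\<^esub> M) = lunit T M \<and>
    m \<cdot>\<^bsub>\<C>\<^esub> (M \<otimes>\<^bsub>T\<^esub> u) = runit T M"

definition comonoid_in :: "'a cat \<Rightarrow> 'a monoidal_structure \<Rightarrow> 'a \<Rightarrow> 'a \<Rightarrow> 'a \<Rightarrow> bool"
  where "comonoid_in \<C> T M d e \<longleftrightarrow>
    M \<in> Ob \<C> \<and> d \<in> hom \<C> M (M \<otimes>\<^bsub>T\<^esub> M) \<and> e \<in> hom \<C> M (unit_ob T) \<and>
    assoc T M M M \<cdot>\<^bsub>\<C>\<^esub> (d \<otimes>\<^bsub>T\<^esub> M) \<cdot>\<^bsub>\<C>\<^esub> d = (M \<otimes>\<^bsub>T\<^esub> d) \<cdot>\<^bsub>\<C>\<^esub> d \<and>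
    lunit T M \<cdot>\<^bsub>\<C>\<^esub> (e \<otimes>\<^bsub>T\<^esub> M) \<cdot>\<^bsub>\<C>\<^esub> d = M \<and>
    runit T M \<cdot>\<^bsub>\<C>\<^esub> (M \<otimes>\<^bsub>T\<^esub> e) \<cdot>\<^bsub>\<C>\<^esub> d = M"


section \<open>Duoidal categories\<close>

text \<open>
  The monoidal structures \<open>(\<circ>, I)\<close> and \<open>(\<bullet>, J)\<close> are \<open>T\<close> and \<open>S\<close>; the product \<open>\<circ>\<close> is written \<open>\<odot>\<close>.
  The suffixes \<open>c\<close> and \<open>b\<close> mark data of \<open>\<circ>\<close> and \<open>\<bullet>\<close>: associativity constraints \<open>ac\<close>, \<open>ab\<close>, and left
  and right unit constraints \<open>lc\<close>, \<open>lb\<close>, \<open>rc\<close>, \<open>rb\<close>.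
\<close>

locale duoidal_data =
  fixes \<C> :: "'a cat" (structure)
    and T :: "'a monoidal_structure"
    and S :: "'a monoidal_structure"
    and \<zeta> :: "'a \<Rightarrow> 'a \<Rightarrow> 'a \<Rightarrow> 'a \<Rightarrow> 'a"
    and \<Delta>\<^sub>I :: 'a
    and m\<^sub>J :: 'a
    and \<epsilon>\<^sub>I :: 'a
begin

abbreviation circ (infix \<open>\<odot>\<close> 70) where "circ \<equiv> tens T"
abbreviation blt (infix \<open>\<bullet>\<close> 70) where "blt \<equiv> tens S"
abbreviation I where "I \<equiv> unit_ob T"
abbreviation J where "J \<equiv> unit_ob S"
abbreviation ac where "ac \<equiv> assoc T"
abbreviation ab where "ab \<equiv> assoc S"
abbreviation lc where "lc \<equiv> lunit T"
abbreviation lb where "lb \<equiv> lunit S"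
abbreviation rc where "rc \<equiv> runit T"
abbreviation rb where "rb \<equiv> runit S"
abbreviation inv\<^sub>\<C> where "inv\<^sub>\<C> \<equiv> inverse_arrow \<C>"

end

locale duoidal_category =
  duoidal_data \<C> T S \<zeta> \<Delta>\<^sub>I m\<^sub>J \<epsilon>\<^sub>I + circ: monoidal_category \<C> T + blt: monoidal_category \<C> S
  for \<C> :: "'a cat" (structure) and T S \<zeta> \<Delta>\<^sub>I m\<^sub>J \<epsilon>\<^sub>I +
  assumes zeta_natural:
      "natural4 \<C> (\<lambda>A B D E. (A \<bullet> B) \<odot> (D \<bullet> E)) (\<lambda>A B D E. (A \<odot> D) \<bullet> (B \<odot> E)) \<zeta>"
    and J_monoid: "monoid_in \<C> T J m\<^sub>J \<epsilon>\<^sub>I"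
    and I_comonoid: "comonoid_in \<C> S I \<Delta>\<^sub>I \<epsilon>\<^sub>I"
    and zeta_assoc_circ: "\<lbrakk>A \<in> Ob \<C>; B \<in> Ob \<C>; D \<in> Ob \<C>; E \<in> Ob \<C>; F \<in> Ob \<C>; G \<in> Ob \<C>\<rbrakk> \<Longrightarrow>
      \<zeta> A B (D \<odot> F) (E \<odot> G) \<cdot> ((A \<bullet> B) \<odot> \<zeta> D E F G) \<cdot> ac (A \<bullet> B) (D \<bullet> E) (F \<bullet> G) =
      (ac A D F \<bullet> ac B E G) \<cdot> \<zeta> (A \<odot> D) (B \<odot> E) F G \<cdot> (\<zeta> A B D E \<odot> (F \<bullet> G))"
    and zeta_assoc_blt: "\<lbrakk>A \<in> Ob \<C>; B \<in> Ob \<C>; D \<in> Ob \<C>; E \<in> Ob \<C>; F \<in> Ob \<C>; G \<in> Ob \<C>\<rbrakk> \<Longrightarrow>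
      ((A \<odot> E) \<bullet> \<zeta> B D F G) \<cdot> \<zeta> A (B \<bullet> D) E (F \<bullet> G) \<cdot> (ab A B D \<odot> ab E F G) =
      ab (A \<odot> E) (B \<odot> F) (D \<odot> G) \<cdot> (\<zeta> A B E F \<bullet> (D \<odot> G)) \<cdot> \<zeta> (A \<bullet> B) D (E \<bullet> F) G"
    and zeta_lc: "\<lbrakk>A \<in> Ob \<C>; B \<in> Ob \<C>\<rbrakk> \<Longrightarrow>
      (lc A \<bullet> lc B) \<cdot> \<zeta> I I A B \<cdot> (\<Delta>\<^sub>I \<odot> (A \<bullet> B)) = lc (A \<bullet> B)"
    and zeta_rc: "\<lbrakk>A \<in> Ob \<C>; B \<in> Ob \<C>\<rbrakk> \<Longrightarrow>
      (rc A \<bullet> rc B) \<cdot> \<zeta> A B I I \<cdot> ((A \<bullet> B) \<odot> \<Delta>\<^sub>I) = rc (A \<bullet> B)"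
    and zeta_lb: "\<lbrakk>A \<in> Ob \<C>; B \<in> Ob \<C>\<rbrakk> \<Longrightarrow>
      lb (A \<odot> B) \<cdot> (m\<^sub>J \<bullet> (A \<odot> B)) \<cdot> \<zeta> J A J B = lb A \<odot> lb B"
    and zeta_rb: "\<lbrakk>A \<in> Ob \<C>; B \<in> Ob \<C>\<rbrakk> \<Longrightarrow>
      rb (A \<odot> B) \<cdot> ((A \<odot> B) \<bullet> m\<^sub>J) \<cdot> \<zeta> A J B J = rb A \<odot> rb B"

locale bullet_braided_duoidal_category = duoidal_category \<C> T S \<zeta> \<Delta>\<^sub>I m\<^sub>J \<epsilon>\<^sub>I
  for \<C> :: "'a cat" (structure) and T S \<zeta> \<Delta>\<^sub>I m\<^sub>J \<epsilon>\<^sub>I +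
  fixes \<sigma> :: "'a \<Rightarrow> 'a \<Rightarrow> 'a"
  assumes sigma_braiding: "braiding \<C> S \<sigma>"
    and sigma_zeta: "\<lbrakk>A \<in> Ob \<C>; B \<in> Ob \<C>; D \<in> Ob \<C>; E \<in> Ob \<C>\<rbrakk> \<Longrightarrow>
      \<sigma> (A \<odot> D) (B \<odot> E) \<cdot> \<zeta> A B D E = \<zeta> B A E D \<cdot> (\<sigma> A B \<odot> \<sigma> D E)"
    and sigma_Delta: "\<sigma> I I \<cdot> \<Delta>\<^sub>I = \<Delta>\<^sub>I"

definition bullet_preserves_binary_intersections :: "'a cat \<Rightarrow> 'a monoidal_structure \<Rightarrow> bool"
  where "bullet_preserves_binary_intersections \<C> S \<longleftrightarrow>
    (\<forall>X\<in>Ob \<C>. preserves_binary_intersections \<C> (\<lambda>f. X \<otimes>\<^bsub>S\<^esub> f) \<and>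
               preserves_binary_intersections \<C> (\<lambda>f. f \<otimes>\<^bsub>S\<^esub> X))"


section \<open>Bimonoids\<close>

record 'a bimonoid_data =
  und :: 'a
  mult :: 'a
  unt :: 'a
  comult :: 'a
  counit :: 'a

context duoidal_data
begin

definition bimonoid :: "'a bimonoid_data \<Rightarrow> bool"
  where "bimonoid H \<longleftrightarrow>
    monoid_in \<C> T (und H) (mult H) (unt H) \<and>
    comonoid_in \<C> S (und H) (comult H) (counit H) \<and>
    comult H \<cdot> mult H =
      (mult H \<bullet> mult H) \<cdot> \<zeta> (und H) (und H) (und H) (und H) \<cdot> (comult H \<odot> comult H) \<and>
    counit H \<cdot> mult H = m\<^sub>J \<cdot> (counit H \<odot> counit H) \<and>
    comult H \<cdot> unt H = (unt H \<bullet> unt H) \<cdot> \<Delta>\<^sub>I \<and>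
    counit H \<cdot> unt H = \<epsilon>\<^sub>I"

definition bimonoid_morphism :: "'a bimonoid_data \<Rightarrow> 'a \<Rightarrow> 'a bimonoid_data \<Rightarrow> bool"
  where "bimonoid_morphism H f K \<longleftrightarrow>
    f \<in> hom \<C> (und H) (und K) \<and>
    f \<cdot> mult H = mult K \<cdot> (f \<odot> f) \<and> f \<cdot> unt H = unt K \<and>
    comult K \<cdot> f = (f \<bullet> f) \<cdot> comult H \<and> counit K \<cdot> f = counit H"

definition bimonoids :: "('a bimonoid_data \<times> 'a \<times> 'a bimonoid_data) cat"
  where "bimonoids = \<lparr>
    Arr = {(H, f, K) | H f K. bimonoid H \<and> bimonoid K \<and> bimonoid_morphism H f K},
    Dom = (\<lambda>(H, f, K). (H, und H, H)),
    Cod = (\<lambda>(H, f, K). (K, und K, K)),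
    Comp = (\<lambda>(K', g, L) (H, f, K). (H, g \<cdot> f, L))\<rparr>"

end


section \<open>Reversions and Hopf monoids\<close>

text \<open>
  The functor \<open>X \<mapsto> X\<^sup>-\<close> is covariant; \<open>\<phi>c\<close>, \<open>\<phi>c\<^sub>0\<close> and \<open>\<phi>b\<close>, \<open>\<phi>b\<^sub>0\<close> are its lax monoidal structures for \<open>\<circ>\<close>
  and \<open>\<bullet>\<close>. The transformations \<open>\<gamma>'\<close>, \<open>\<delta>'\<close>, \<open>\<psi>'\<close>, \<open>\<phi>'\<close> are the ones usually written with a tilde.
\<close>

locale reversion_data = duoidal_data \<C> T S \<zeta> \<Delta>\<^sub>I m\<^sub>J \<epsilon>\<^sub>I
  for \<C> :: "'a cat" (structure) and T S \<zeta> \<Delta>\<^sub>I m\<^sub>J \<epsilon>\<^sub>I +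
  fixes reverse :: "'a \<Rightarrow> 'a"  (\<open>_\<^sup>-\<close> [1000] 1000)
    and \<phi>c :: "'a \<Rightarrow> 'a \<Rightarrow> 'a" and \<phi>c\<^sub>0 :: 'a
    and \<phi>b :: "'a \<Rightarrow> 'a \<Rightarrow> 'a" and \<phi>b\<^sub>0 :: 'a
    and \<gamma> \<delta> \<gamma>' \<delta>' :: "'a \<Rightarrow> 'a \<Rightarrow> 'a \<Rightarrow> 'a \<Rightarrow> 'a"
begin

abbreviation \<Delta>\<^sub>J where "\<Delta>\<^sub>J \<equiv> inv\<^sub>\<C> (lb J)"

definition \<psi> :: "'a \<Rightarrow> 'a \<Rightarrow> 'a"
  where "\<psi> X Y = \<gamma> J X I Y \<cdot> ((inv\<^sub>\<C> (lb X\<^sup>-) \<odot> I) \<bullet> Y) \<cdot> (inv\<^sub>\<C> (rc X\<^sup>-) \<bullet> Y)"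

definition \<phi> :: "'a \<Rightarrow> 'a \<Rightarrow> 'a"
  where "\<phi> X Y = \<delta> X I Y J \<cdot> (X \<bullet> (I \<odot> inv\<^sub>\<C> (rb Y\<^sup>-))) \<cdot> (X \<bullet> inv\<^sub>\<C> (lc Y\<^sup>-))"

definition \<psi>' :: "'a \<Rightarrow> 'a \<Rightarrow> 'a"
  where "\<psi>' X Y = lc (X \<odot> Y)\<^sup>- \<cdot> (I \<odot> rb (X \<odot> Y)\<^sup>-) \<cdot> \<gamma>' X Y I J"

definition \<phi>' :: "'a \<Rightarrow> 'a \<Rightarrow> 'a"
  where "\<phi>' X Y = rc (X \<odot> Y)\<^sup>- \<cdot> (lb (X \<odot> Y)\<^sup>- \<odot> I) \<cdot> \<delta>' J I X Y"

definition antipode :: "'a bimonoid_data \<Rightarrow> 'a \<Rightarrow> bool"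
  where "antipode H s \<longleftrightarrow>
    s \<in> hom \<C> (und H) (und H)\<^sup>- \<and>
    ((mult H \<bullet> I) \<odot> J) \<cdot> \<phi> (und H) (und H) \<cdot> (und H \<bullet> s) \<cdot> comult H =
      ((unt H \<bullet> I) \<odot> J) \<cdot> (\<Delta>\<^sub>I \<odot> J) \<cdot> inv\<^sub>\<C> (lc J) \<cdot> counit H \<and>
    (J \<odot> (I \<bullet> mult H)) \<cdot> \<psi> (und H) (und H) \<cdot> (s \<bullet> und H) \<cdot> comult H =
      (J \<odot> (I \<bullet> unt H)) \<cdot> (J \<odot> \<Delta>\<^sub>I) \<cdot> inv\<^sub>\<C> (rc J) \<cdot> counit H"

definition Hopf_monoid :: "'a bimonoid_data \<Rightarrow> bool"
  where "Hopf_monoid H \<longleftrightarrow> bimonoid H \<and> (\<exists>s. antipode H s)"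

end

text \<open>
  The axioms \<open>R1\<close> to \<open>R18\<close> are the usual coherence conditions with the suppressed associativity
  constraints written out. The constraints are put where the two sides or consecutive factors differ
  by a rebracketing; by coherence of monoidal categories this is the only possible meaning.
\<close>

locale reversion =
  duoidal_category \<C> T S \<zeta> \<Delta>\<^sub>I m\<^sub>J \<epsilon>\<^sub>I +
  reversion_data \<C> T S \<zeta> \<Delta>\<^sub>I m\<^sub>J \<epsilon>\<^sub>I reverse \<phi>c \<phi>c\<^sub>0 \<phi>b \<phi>b\<^sub>0 \<gamma> \<delta> \<gamma>' \<delta>'
  for \<C> :: "'a cat" (structure) and T S \<zeta> \<Delta>\<^sub>I m\<^sub>J \<epsilon>\<^sub>I
    and reverse :: "'a \<Rightarrow> 'a"  (\<open>_\<^sup>-\<close> [1000] 1000)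
    and \<phi>c \<phi>c\<^sub>0 \<phi>b \<phi>b\<^sub>0 \<gamma> \<delta> \<gamma>' \<delta>' +
  assumes lax_circ: "lax_monoidal_endofunctor \<C> (reversed \<C> T) T reverse \<phi>c \<phi>c\<^sub>0"
    and lax_blt: "lax_monoidal_endofunctor \<C> (reversed \<C> S) S reverse \<phi>b \<phi>b\<^sub>0"
    and double_zeta: "\<lbrakk>A \<in> Ob \<C>; B \<in> Ob \<C>; D \<in> Ob \<C>; E \<in> Ob \<C>\<rbrakk> \<Longrightarrow>
      \<phi>b (D \<odot> A) (E \<odot> B) \<cdot> (\<phi>c A D \<bullet> \<phi>c B E) \<cdot> \<zeta> A\<^sup>- B\<^sup>- D\<^sup>- E\<^sup>- =
      (\<zeta> E D B A)\<^sup>- \<cdot> \<phi>c (B \<bullet> A) (E \<bullet> D) \<cdot> (\<phi>b A B \<odot> \<phi>b D E)"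
    and double_Delta: "\<phi>b I I \<cdot> (\<phi>c\<^sub>0 \<bullet> \<phi>c\<^sub>0) \<cdot> \<Delta>\<^sub>I = \<Delta>\<^sub>I\<^sup>- \<cdot> \<phi>c\<^sub>0"
    and double_mult: "m\<^sub>J\<^sup>- \<cdot> \<phi>c J J \<cdot> (\<phi>b\<^sub>0 \<odot> \<phi>b\<^sub>0) = \<phi>b\<^sub>0 \<cdot> m\<^sub>J"
    and double_counit: "\<phi>b\<^sub>0 \<cdot> \<epsilon>\<^sub>I = \<epsilon>\<^sub>I\<^sup>- \<cdot> \<phi>c\<^sub>0"
    and gamma_natural: "natural4 \<C>
      (\<lambda>X Y Z U. ((X \<bullet> Y\<^sup>-) \<odot> Z) \<bullet> U) (\<lambda>X Y Z U. X \<odot> (Z \<bullet> (Y \<odot> U))) \<gamma>"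
    and delta_natural: "natural4 \<C>
      (\<lambda>X Y Z U. X \<bullet> (Y \<odot> (Z\<^sup>- \<bullet> U))) (\<lambda>X Y Z U. ((X \<odot> Z) \<bullet> Y) \<odot> U) \<delta>"
    and gamma'_natural: "natural4 \<C>
      (\<lambda>X Y Z U. X\<^sup>- \<bullet> ((Y \<bullet> Z) \<odot> U)) (\<lambda>X Y Z U. Z \<odot> ((X \<odot> Y)\<^sup>- \<bullet> U)) \<gamma>'"
    and delta'_natural: "natural4 \<C>
      (\<lambda>X Y Z U. (X \<odot> (Y \<bullet> Z)) \<bullet> U\<^sup>-) (\<lambda>X Y Z U. (X \<bullet> (Z \<odot> U)\<^sup>-) \<odot> Y) \<delta>'"
    and R1: "\<lbrakk>X \<in> Ob \<C>; Y \<in> Ob \<C>; Z \<in> Ob \<C>; W \<in> Ob \<C>; U \<in> Ob \<C>; V \<in> Ob \<C>\<rbrakk> \<Longrightarrow>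
      \<gamma> X Y (Z \<odot> U) (W \<odot> V) \<cdot> (ac (X \<bullet> Y\<^sup>-) Z U \<bullet> (W \<odot> V)) \<cdot> \<zeta> ((X \<bullet> Y\<^sup>-) \<odot> Z) W U V =
      (X \<odot> ((Z \<odot> U) \<bullet> ac Y W V)) \<cdot> (X \<odot> \<zeta> Z (Y \<odot> W) U V) \<cdot>
        ac X (Z \<bullet> (Y \<odot> W)) (U \<bullet> V) \<cdot> (\<gamma> X Y Z W \<odot> (U \<bullet> V))"
    and R2: "\<lbrakk>X \<in> Ob \<C>; Y \<in> Ob \<C>; Z \<in> Ob \<C>; W \<in> Ob \<C>; U \<in> Ob \<C>; V \<in> Ob \<C>\<rbrakk> \<Longrightarrow>
      ((X \<odot> W) \<bullet> \<gamma> Y Z U V) \<cdot> ab (X \<odot> W) ((Y \<bullet> Z\<^sup>-) \<odot> U) V \<cdot>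
        (\<zeta> X (Y \<bullet> Z\<^sup>-) W U \<bullet> V) \<cdot> ((ab X Y Z\<^sup>- \<odot> (W \<bullet> U)) \<bullet> V) =
      \<zeta> X Y W (U \<bullet> (Z \<odot> V)) \<cdot> ((X \<bullet> Y) \<odot> ab W U (Z \<odot> V)) \<cdot> \<gamma> (X \<bullet> Y) Z (W \<bullet> U) V"
    and R3: "\<lbrakk>X \<in> Ob \<C>; Y \<in> Ob \<C>; Z \<in> Ob \<C>; W \<in> Ob \<C>; U \<in> Ob \<C>; V \<in> Ob \<C>\<rbrakk> \<Longrightarrow>
      ((ac X Z U \<bullet> (Y \<odot> W)) \<odot> V) \<cdot> \<delta> (X \<odot> Z) (Y \<odot> W) U V \<cdot>
        ((X \<odot> Z) \<bullet> inv\<^sub>\<C> (ac Y W (U\<^sup>- \<bullet> V))) \<cdot> \<zeta> X Y Z (W \<odot> (U\<^sup>- \<bullet> V)) =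
      (\<zeta> X Y (Z \<odot> U) W \<odot> V) \<cdot> inv\<^sub>\<C> (ac (X \<bullet> Y) ((Z \<odot> U) \<bullet> W) V) \<cdot> ((X \<bullet> Y) \<odot> \<delta> Z W U V)"
    and R4: "\<lbrakk>X \<in> Ob \<C>; Y \<in> Ob \<C>; Z \<in> Ob \<C>; W \<in> Ob \<C>; U \<in> Ob \<C>; V \<in> Ob \<C>\<rbrakk> \<Longrightarrow>
      (\<delta> X Y W U \<bullet> (Z \<odot> V)) \<cdot> inv\<^sub>\<C> (ab X (Y \<odot> (W\<^sup>- \<bullet> U)) (Z \<odot> V)) \<cdot>
        (X \<bullet> \<zeta> Y Z (W\<^sup>- \<bullet> U) V) \<cdot> (X \<bullet> ((Y \<bullet> Z) \<odot> inv\<^sub>\<C> (ab W\<^sup>- U V))) =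
      \<zeta> ((X \<odot> W) \<bullet> Y) Z U V \<cdot> (inv\<^sub>\<C> (ab (X \<odot> W) Y Z) \<odot> (U \<bullet> V)) \<cdot> \<delta> X (Y \<bullet> Z) W (U \<bullet> V)"
    and R5: "\<lbrakk>X \<in> Ob \<C>; Y \<in> Ob \<C>; Z \<in> Ob \<C>; W \<in> Ob \<C>; U \<in> Ob \<C>; V \<in> Ob \<C>\<rbrakk> \<Longrightarrow>
      \<delta> X Y W (U \<bullet> (Z \<odot> V)) \<cdot> (X \<bullet> (Y \<odot> ab W\<^sup>- U (Z \<odot> V))) \<cdot>
        (X \<bullet> \<gamma> Y Z (W\<^sup>- \<bullet> U) V) \<cdot> ab X ((Y \<bullet> Z\<^sup>-) \<odot> (W\<^sup>- \<bullet> U)) V =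
      \<gamma> ((X \<odot> W) \<bullet> Y) Z U V \<cdot> ((inv\<^sub>\<C> (ab (X \<odot> W) Y Z\<^sup>-) \<odot> U) \<bullet> V) \<cdot>
        (\<delta> X (Y \<bullet> Z\<^sup>-) W U \<bullet> V)"
    and R6: "lc (I \<bullet> I) \<cdot> (I \<odot> (I \<bullet> lc I)) \<cdot> \<gamma> I I I I \<cdot> ((((I \<bullet> \<phi>c\<^sub>0) \<cdot> \<Delta>\<^sub>I) \<odot> I) \<bullet> I) =
      lc I \<bullet> I"
    and R7: "rc (I \<bullet> I) \<cdot> ((rc I \<bullet> I) \<odot> I) \<cdot> \<delta> I I I I \<cdot> (I \<bullet> (I \<odot> ((\<phi>c\<^sub>0 \<bullet> I) \<cdot> \<Delta>\<^sub>I))) =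
      I \<bullet> rc I"
    and R8: "\<lbrakk>X \<in> Ob \<C>; Y \<in> Ob \<C>; Z \<in> Ob \<C>; U \<in> Ob \<C>\<rbrakk> \<Longrightarrow>
      \<gamma> (X \<odot> Z) Y (J \<odot> J) U \<cdot> (ac ((X \<odot> Z) \<bullet> Y\<^sup>-) J J \<bullet> U) \<cdot>
        ((\<delta> X Y\<^sup>- Z J \<odot> J) \<bullet> U) \<cdot> (((X \<bullet> (Y\<^sup>- \<odot> inv\<^sub>\<C> (rb Z\<^sup>-))) \<odot> J) \<bullet> U) =
      ((X \<odot> Z) \<odot> \<zeta> J Y J U) \<cdot> ((X \<odot> Z) \<odot> (inv\<^sub>\<C> (lb Y) \<odot> inv\<^sub>\<C> (lb U))) \<cdot>
        inv\<^sub>\<C> (ac X Z (Y \<odot> U)) \<cdot> (X \<odot> ac Z Y U) \<cdot> (X \<odot> lb ((Z \<odot> Y) \<odot> U)) \<cdot>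
        \<gamma> X (Z \<odot> Y) J U \<cdot> (((X \<bullet> \<phi>c Y Z) \<odot> J) \<bullet> U)"
    and R9: "\<lbrakk>X \<in> Ob \<C>; Y \<in> Ob \<C>; Z \<in> Ob \<C>; U \<in> Ob \<C>\<rbrakk> \<Longrightarrow>
      \<delta> X (J \<odot> J) Z (Y \<odot> U) \<cdot> (X \<bullet> inv\<^sub>\<C> (ac J J (Z\<^sup>- \<bullet> (Y \<odot> U)))) \<cdot>
        (X \<bullet> (J \<odot> \<gamma> J Y Z\<^sup>- U)) \<cdot> (X \<bullet> (J \<odot> ((inv\<^sub>\<C> (lb Y\<^sup>-) \<odot> Z\<^sup>-) \<bullet> U))) =
      (\<zeta> X J Z J \<odot> (Y \<odot> U)) \<cdot> ((inv\<^sub>\<C> (rb X) \<odot> inv\<^sub>\<C> (rb Z)) \<odot> (Y \<odot> U)) \<cdot>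
        ac (X \<odot> Z) Y U \<cdot> (inv\<^sub>\<C> (ac X Z Y) \<odot> U) \<cdot> (rb (X \<odot> (Z \<odot> Y)) \<odot> U) \<cdot>
        \<delta> X J (Z \<odot> Y) U \<cdot> (X \<bullet> (J \<odot> (\<phi>c Y Z \<bullet> U)))"
    and R10: "\<lbrakk>X \<in> Ob \<C>; Y \<in> Ob \<C>; Z \<in> Ob \<C>\<rbrakk> \<Longrightarrow>
      (ac X Y Z)\<^sup>- \<cdot> \<phi>' (X \<odot> Y) Z \<cdot> (\<psi> X Y \<bullet> Z\<^sup>-) =
      \<psi>' X (Y \<odot> Z) \<cdot> (X\<^sup>- \<bullet> \<phi> Y Z) \<cdot> ab X\<^sup>- Y Z\<^sup>-"
    and R11: "X \<in> Ob \<C> \<Longrightarrow>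
      (rc X)\<^sup>- \<cdot> lc (X \<odot> I)\<^sup>- \<cdot> (I \<odot> rb (X \<odot> I)\<^sup>-) \<cdot> \<gamma>' X I I J \<cdot> (X\<^sup>- \<bullet> (\<Delta>\<^sub>I \<odot> J)) =
      rb X\<^sup>- \<cdot> (X\<^sup>- \<bullet> lc J)"
    and R12: "X \<in> Ob \<C> \<Longrightarrow>
      (lc X)\<^sup>- \<cdot> rc (I \<odot> X)\<^sup>- \<cdot> (lb (I \<odot> X)\<^sup>- \<odot> I) \<cdot> \<delta>' J I I X \<cdot> ((J \<odot> \<Delta>\<^sub>I) \<bullet> X\<^sup>-) =
      lb X\<^sup>- \<cdot> (rc J \<bullet> X\<^sup>-)"
    and R13: "\<lbrakk>X \<in> Ob \<C>; Y \<in> Ob \<C>; Z \<in> Ob \<C>; W \<in> Ob \<C>; U \<in> Ob \<C>; V \<in> Ob \<C>\<rbrakk> \<Longrightarrow>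
      (X \<odot> ab W (Z \<odot> U) (Y \<odot> V)) \<cdot> \<gamma> X Y (W \<bullet> (Z \<odot> U)) V \<cdot> (\<gamma> (X \<bullet> Y\<^sup>-) Z W U \<bullet> V) =
      (X \<odot> (W \<bullet> \<zeta> Z Y U V)) \<cdot> \<gamma> X (Z \<bullet> Y) W (U \<bullet> V) \<cdot> (((X \<bullet> \<phi>b Y Z) \<odot> W) \<bullet> (U \<bullet> V)) \<cdot>
        ab ((X \<bullet> (Y\<^sup>- \<bullet> Z\<^sup>-)) \<odot> W) U V \<cdot> (((ab X Y\<^sup>- Z\<^sup>- \<odot> W) \<bullet> U) \<bullet> V)"
    and R14: "\<lbrakk>X \<in> Ob \<C>; Y \<in> Ob \<C>; Z \<in> Ob \<C>; W \<in> Ob \<C>; U \<in> Ob \<C>; V \<in> Ob \<C>\<rbrakk> \<Longrightarrow>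
      \<delta> X ((Y \<odot> W) \<bullet> Z) U V \<cdot> (X \<bullet> \<delta> Y Z W (U\<^sup>- \<bullet> V)) \<cdot>
        (X \<bullet> (Y \<bullet> (Z \<odot> ab W\<^sup>- U\<^sup>- V))) \<cdot> ab X Y (Z \<odot> ((W\<^sup>- \<bullet> U\<^sup>-) \<bullet> V)) =
      (ab (X \<odot> U) (Y \<odot> W) Z \<odot> V) \<cdot> ((\<zeta> X Y U W \<bullet> Z) \<odot> V) \<cdot> \<delta> (X \<bullet> Y) Z (U \<bullet> W) V \<cdot>
        ((X \<bullet> Y) \<bullet> (Z \<odot> (\<phi>b W U \<bullet> V)))"
    and R15: "\<lbrakk>X \<in> Ob \<C>; Y \<in> Ob \<C>; Z \<in> Ob \<C>; W \<in> Ob \<C>; U \<in> Ob \<C>; V \<in> Ob \<C>\<rbrakk> \<Longrightarrow>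
      (X \<odot> \<gamma> Z W U (Y \<odot> V)) \<cdot> \<gamma> X Y ((Z \<bullet> W\<^sup>-) \<odot> U) V \<cdot> (ac (X \<bullet> Y\<^sup>-) (Z \<bullet> W\<^sup>-) U \<bullet> V) =
      ac X Z (U \<bullet> (W \<odot> (Y \<odot> V))) \<cdot> ((X \<odot> Z) \<odot> (U \<bullet> ac W Y V)) \<cdot> \<gamma> (X \<odot> Z) (W \<odot> Y) U V \<cdot>
        ((((X \<odot> Z) \<bullet> \<phi>c Y W) \<odot> U) \<bullet> V) \<cdot> ((\<zeta> X Y\<^sup>- Z W\<^sup>- \<odot> U) \<bullet> V)"
    and R16: "\<lbrakk>X \<in> Ob \<C>; Y \<in> Ob \<C>; Z \<in> Ob \<C>; W \<in> Ob \<C>; U \<in> Ob \<C>; V \<in> Ob \<C>\<rbrakk> \<Longrightarrow>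
      ((ac X U Z \<bullet> Y) \<odot> (W \<odot> V)) \<cdot> ac (((X \<odot> U) \<odot> Z) \<bullet> Y) W V \<cdot>
        (\<delta> (X \<odot> U) Y Z W \<odot> V) \<cdot> \<delta> X (Y \<odot> (Z\<^sup>- \<bullet> W)) U V =
      \<delta> X Y (U \<odot> Z) (W \<odot> V) \<cdot> (X \<bullet> (Y \<odot> (\<phi>c Z U \<bullet> (W \<odot> V)))) \<cdot>
        (X \<bullet> (Y \<odot> \<zeta> Z\<^sup>- W U\<^sup>- V)) \<cdot> (X \<bullet> ac Y (Z\<^sup>- \<bullet> W) (U\<^sup>- \<bullet> V))"
    and R17: "rc J \<cdot> (J \<odot> rb I) \<cdot> (J \<odot> (I \<bullet> m\<^sub>J)) \<cdot> \<gamma> J J I J \<cdot>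
        ((((J \<bullet> \<phi>b\<^sub>0) \<cdot> \<Delta>\<^sub>J) \<odot> I) \<bullet> J) =
      rb J \<cdot> (rc J \<bullet> J)"
    and R18: "lc J \<cdot> (lb I \<odot> J) \<cdot> ((m\<^sub>J \<bullet> I) \<odot> J) \<cdot> \<delta> J I J J \<cdot>
        (J \<bullet> (I \<odot> ((\<phi>b\<^sub>0 \<bullet> J) \<cdot> \<Delta>\<^sub>J))) =
      lb J \<cdot> (J \<bullet> lc J)"

locale bullet_braided_duoidal_category_with_reversion =
  bullet_braided_duoidal_category \<C> T S \<zeta> \<Delta>\<^sub>I m\<^sub>J \<epsilon>\<^sub>I \<sigma> +
  reversion \<C> T S \<zeta> \<Delta>\<^sub>I m\<^sub>J \<epsilon>\<^sub>I reverse \<phi>c \<phi>c\<^sub>0 \<phi>b \<phi>b\<^sub>0 \<gamma> \<delta> \<gamma>' \<delta>'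
  for \<C> :: "'a cat" (structure) and T S \<zeta> \<Delta>\<^sub>I m\<^sub>J \<epsilon>\<^sub>I \<sigma>
    and reverse :: "'a \<Rightarrow> 'a"  (\<open>_\<^sup>-\<close> [1000] 1000)
    and \<phi>c \<phi>c\<^sub>0 \<phi>b \<phi>b\<^sub>0 \<gamma> \<delta> \<gamma>' \<delta>'
begin

definition cocommutative :: "'a bimonoid_data \<Rightarrow> bool"
  where "cocommutative H \<longleftrightarrow> \<sigma> (und H) (und H) \<cdot> comult H = comult H"

definition Hopf_m_coc :: "('a bimonoid_data \<times> 'a \<times> 'a bimonoid_data) cat"
  where "Hopf_m_coc = full_subcategory bimonoids
    (\<lambda>(H, f, K). Hopf_monoid H \<and> cocommutative H \<and> mono_arrow \<C> (unt H))"

end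

end

theory Submission
  imports Defs
begin

text \<open>
  Let \<open>p : A \<rightarrow> B\<close> be a split epimorphism of cocommutative Hopf monoids with section \<open>s\<close>. Its kernel \<open>K\<close> is
  the intersection of the graph \<open>A \<rightarrow> A \<bullet> B\<close> of \<open>p\<close> with \<open>A \<bullet> I \<rightarrow> A \<bullet> B\<close>; it is a cocommutative
  comonoid because \<open>\<bullet>\<close> preserves intersections. The reversion replaces the division
  \<open>a \<mapsto> a (s (p a))\<inverse>\<close> of the Cartesian case and gives a smash product decomposition of \<open>A\<close> as \<open>K \<circ> B\<close>.
  For \<open>c : C \<rightarrow> B\<close> the same division shows that \<open>K \<circ> C\<close>, with the projections \<open>k \<circ> x \<mapsto> k s(c x)\<close>
  and \<open>k \<circ> x \<mapsto> x\<close>, is the pullback of \<open>p\<close> along \<open>c\<close> among cocommutative comonoids. The multiplication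
  comes from this universal property, and the antipode from a presentation of \<open>K \<circ> C \<rightarrow> A \<bullet> C\<close> as
  a split equalizer of two monoid morphisms. A morphism \<open>f\<close> of points over \<open>B\<close> induces \<open>f\<^sub>K \<circ> C\<close> between
  the pullbacks. An inverse of it, evaluated at the unit of \<open>C\<close>, determines an arrow from the kernel of
  the codomain to the domain of \<open>f\<close>, and the smash product decompositions turn this into an inverse of \<open>f\<close>.
\<close>

section \<open>Calculus in monoidal categories\<close>

text \<open>An antipode takes values in the reverse of H, and its equations hold only after
  \<open>\<phi>\<close> and \<open>\<psi>\<close>, in (H \<bullet> I) \<odot> J and J \<odot> (I
  \<bullet> H), where I and J are different objects. So a quotient a h^-1 lives in (A \<bullet> I)
  \<odot> J. The factor J is cancelled against a further factor V by \<open>Lam\<close>, an arrow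
  from (N \<odot> J) \<bullet> V to N \<odot> V that is invertible for the cofree I-comodule N = A
  \<bullet> I. The factor I explains the shape of the kernel: the unit of B enters as A \<bullet> I
  \<rightarrow> A \<bullet> B, and the second leg K \<rightarrow> A \<bullet> I of the intersection
  is the place where quotients land. K is a split equalizer inside A \<bullet> I and therefore
  survives - \<odot> V, although nothing is assumed about \<odot> and limits. In the same way, the
  reversion is not assumed to preserve any limit, but it preserves the split equalizer that yields
  the antipode of the pullback. The braiding is not a symmetry, so exchanges of factors are made
  only on pairs out of a cocommutative comonoid.\<close>

context category
begin

lemma ob_arr [simp]: "A \<in> Ob \<C> \<Longrightarrow> A \<in> Arr \<C>"
  and ob_dom [simp]: "A \<in> Ob \<C> \<Longrightarrow> Dom \<C> A = A"
  by (auto simp: Ob_def)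

lemma ob_cod [simp]: "A \<in> Ob \<C> \<Longrightarrow> Cod \<C> A = A"
  by (metis cod_dom ob_arr ob_dom)

lemma dom_ob [simp]: "f \<in> Arr \<C> \<Longrightarrow> Dom \<C> f \<in> Ob \<C>"
  by (simp add: Ob_def dom_arr dom_dom del: ob_arr ob_dom)

lemma cod_ob [simp]: "f \<in> Arr \<C> \<Longrightarrow> Cod \<C> f \<in> Ob \<C>"
  by (simp add: Ob_def cod_arr dom_cod del: ob_arr ob_dom)

lemma comp_arr [simp]: "\<lbrakk>f \<in> Arr \<C>; g \<in> Arr \<C>; Dom \<C> g = Cod \<C> f\<rbrakk> \<Longrightarrow> g \<cdot> f \<in> Arr \<C>"
  and dom_comp [simp]: "\<lbrakk>f \<in> Arr \<C>; g \<in> Arr \<C>; Dom \<C> g = Cod \<C> f\<rbrakk> \<Longrightarrow> Dom \<C> (g \<cdot> f) = Dom \<C> f"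
  and cod_comp [simp]: "\<lbrakk>f \<in> Arr \<C>; g \<in> Arr \<C>; Dom \<C> g = Cod \<C> f\<rbrakk> \<Longrightarrow> Cod \<C> (g \<cdot> f) = Cod \<C> g"
  using comp_hom[of f g] by (auto simp: hom_def)

lemma comp_ob_right [simp]: "\<lbrakk>A \<in> Ob \<C>; f \<in> Arr \<C>; Dom \<C> f = A\<rbrakk> \<Longrightarrow> f \<cdot> A = f"
  using comp_dom by auto

lemma comp_ob_left [simp]: "\<lbrakk>A \<in> Ob \<C>; f \<in> Arr \<C>; Cod \<C> f = A\<rbrakk> \<Longrightarrow> A \<cdot> f = f"
  using comp_cod by auto

lemma comp_assoc' [simp]:
  "\<lbrakk>f \<in> Arr \<C>; g \<in> Arr \<C>; h \<in> Arr \<C>; Dom \<C> g = Cod \<C> f; Dom \<C> h = Cod \<C> g\<rbrakk>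
      \<Longrightarrow> (h \<cdot> g) \<cdot> f = h \<cdot> g \<cdot> f"
  by (rule comp_assoc)

lemma homD [dest]: "f \<in> hom \<C> A B \<Longrightarrow> f \<in> Arr \<C>"
  "f \<in> hom \<C> A B \<Longrightarrow> Dom \<C> f = A" "f \<in> hom \<C> A B \<Longrightarrow> Cod \<C> f = B"
  by (auto simp: hom_def)

lemma homI [intro]: "\<lbrakk>f \<in> Arr \<C>; Dom \<C> f = A; Cod \<C> f = B\<rbrakk> \<Longrightarrow> f \<in> hom \<C> A B"
  by (auto simp: hom_def)

text \<open>The rules \<open>ext2\<close> and \<open>ext3\<close> turn an equation between composites into a rewrite rule for
  right-nested composites.\<close>

lemma ext2:
  assumes "f \<cdot> g = h" "f \<in> Arr \<C>" "g \<in> Arr \<C>" "Dom \<C> f = Cod \<C> g"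
    and "x \<in> Arr \<C>" "Cod \<C> x = Dom \<C> g"
  shows "f \<cdot> g \<cdot> x = h \<cdot> x"
  using assms comp_assoc[of x g f] by simp

lemma ext3:
  assumes "f \<cdot> g \<cdot> h = k" "f \<in> Arr \<C>" "g \<in> Arr \<C>" "h \<in> Arr \<C>"
    "Dom \<C> f = Cod \<C> g" "Dom \<C> g = Cod \<C> h"
    and "x \<in> Arr \<C>" "Cod \<C> x = Dom \<C> h"
  shows "f \<cdot> g \<cdot> h \<cdot> x = k \<cdot> x"
  using assms comp_assoc[of x h g] comp_assoc[of x "g \<cdot> h" f] by simp

lemma inverse_arrows_unique:
  assumes "inverse_arrows \<C> f g" "inverse_arrows \<C> f g'"
  shows "g = g'"
proof -
  have "f \<in> Arr \<C>" "g \<in> hom \<C> (Cod \<C> f) (Dom \<C> f)" "g' \<in> hom \<C> (Cod \<C> f) (Dom \<C> f)"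
    and e: "g \<cdot> f = Dom \<C> f" "f \<cdot> g' = Cod \<C> f"
    using assms by (auto simp: inverse_arrows_def)
  then show ?thesis
    using comp_assoc[of g' f g] by (auto simp: hom_def)
qed

lemma inverse_arrow_eqI: "inverse_arrows \<C> f g \<Longrightarrow> inverse_arrow \<C> f = g"
  unfolding inverse_arrow_def using inverse_arrows_unique by blast

lemma inverse_arrows_inverse:
  assumes "iso_arrow \<C> f"
  shows "inverse_arrows \<C> f (inverse_arrow \<C> f)"
  using assms inverse_arrow_eqI by (auto simp: iso_arrow_def)

lemma inverse_arrows_sym: "inverse_arrows \<C> f g \<Longrightarrow> inverse_arrows \<C> g f"
  by (auto simp: inverse_arrows_def hom_def)

lemma iso_arr: "iso_arrow \<C> f \<Longrightarrow> f \<in> Arr \<C>"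
  by (auto simp: iso_arrow_def inverse_arrows_def)

lemma inv_arr:
  assumes "iso_arrow \<C> f"
  shows "inverse_arrow \<C> f \<in> Arr \<C>" "Dom \<C> (inverse_arrow \<C> f) = Cod \<C> f"
    "Cod \<C> (inverse_arrow \<C> f) = Dom \<C> f"
    "inverse_arrow \<C> f \<cdot> f = Dom \<C> f" "f \<cdot> inverse_arrow \<C> f = Cod \<C> f"
  using inverse_arrows_inverse[OF assms] by (auto simp: inverse_arrows_def hom_def)

lemma iso_inverse [simp]: "iso_arrow \<C> f \<Longrightarrow> iso_arrow \<C> (inverse_arrow \<C> f)"
  using inverse_arrows_sym[OF inverse_arrows_inverse] by (auto simp: iso_arrow_def)

lemma iso_ob [simp]: "A \<in> Ob \<C> \<Longrightarrow> iso_arrow \<C> A"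
  unfolding iso_arrow_def inverse_arrows_def by (rule exI[of _ A]) auto

lemma iso_mono:
  assumes "iso_arrow \<C> f" "f \<cdot> x = f \<cdot> y" "x \<in> Arr \<C>" "y \<in> Arr \<C>" "Cod \<C> x = Dom \<C> f" "Cod \<C> y = Dom \<C> f"
  shows "x = y"
proof -
  note i = inv_arr[OF assms(1)] iso_arr[OF assms(1)]
  have "x = (inverse_arrow \<C> f \<cdot> f) \<cdot> x" using i assms by (simp del: comp_assoc')
  also have "\<dots> = inverse_arrow \<C> f \<cdot> f \<cdot> y" using comp_assoc[of x f] i assms by metis
  also have "\<dots> = (inverse_arrow \<C> f \<cdot> f) \<cdot> y" using comp_assoc[of y f] i assms by metis
  also have "\<dots> = y" using i assms by (simp del: comp_assoc')
  finally show ?thesis .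
qed

lemma iso_epi:
  assumes "iso_arrow \<C> f" "x \<cdot> f = y \<cdot> f" "x \<in> Arr \<C>" "y \<in> Arr \<C>" "Dom \<C> x = Cod \<C> f" "Dom \<C> y = Cod \<C> f"
  shows "x = y"
proof -
  note i = inv_arr[OF assms(1)] iso_arr[OF assms(1)]
  have "x = x \<cdot> f \<cdot> inverse_arrow \<C> f" using i assms by simp
  also have "\<dots> = (y \<cdot> f) \<cdot> inverse_arrow \<C> f" using comp_assoc[of _ f x] i assms by metis
  also have "\<dots> = y \<cdot> f \<cdot> inverse_arrow \<C> f" using comp_assoc[of _ f y] i assms by metis
  also have "\<dots> = y" using i assms by simp
  finally show ?thesis .
qed

lemma split_mono:
  assumes "r \<cdot> f = Dom \<C> f" "f \<in> Arr \<C>" "r \<in> Arr \<C>" "Dom \<C> r = Cod \<C> f"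
    and "f \<cdot> x = f \<cdot> y" "x \<in> Arr \<C>" "y \<in> Arr \<C>" "Cod \<C> x = Dom \<C> f" "Cod \<C> y = Dom \<C> f"
  shows "x = y"
  using assms comp_cod comp_assoc by metis

lemma split_epi:
  assumes "f \<cdot> r = Cod \<C> f" "f \<in> Arr \<C>" "r \<in> Arr \<C>" "Dom \<C> f = Cod \<C> r"
    and "x \<cdot> f = y \<cdot> f" "x \<in> Arr \<C>" "y \<in> Arr \<C>" "Dom \<C> x = Cod \<C> f" "Dom \<C> y = Cod \<C> f"
  shows "x = y"
  using assms comp_dom comp_assoc by metis

lemma mono_cancel:
  assumes "mono_arrow \<C> f" "f \<cdot> x = f \<cdot> y" "x \<in> Arr \<C>" "y \<in> Arr \<C>"
    "Cod \<C> x = Dom \<C> f" "Cod \<C> y = Dom \<C> f" "Dom \<C> x = Dom \<C> y"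
  shows "x = y"
proof -
  have "x \<in> hom \<C> (Dom \<C> x) (Dom \<C> f)" "y \<in> hom \<C> (Dom \<C> x) (Dom \<C> f)" "Dom \<C> x \<in> Ob \<C>"
    using assms by (auto simp: hom_def)
  then show ?thesis using assms(1,2) unfolding mono_arrow_def by blast
qed

lemma mono_arrowI:
  assumes "f \<in> Arr \<C>"
    and "\<And>x y. \<lbrakk>x \<in> Arr \<C>; y \<in> Arr \<C>; Dom \<C> x = Dom \<C> y; Cod \<C> x = Dom \<C> f; Cod \<C> y = Dom \<C> f; f \<cdot> x = f \<cdot> y\<rbrakk> \<Longrightarrow> x = y"
  shows "mono_arrow \<C> f"
  using assms by (auto simp: mono_arrow_def hom_def)

end

section \<open>Interchange, naturality and coherence of the unit constraints\<close>

context monoidal_category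
begin

abbreviation (input) tensor (infix \<open>\<star>\<close> 70) where "f \<star> g \<equiv> f \<otimes>\<^bsub>T\<^esub> g"
abbreviation (input) \<I> where "\<I> \<equiv> unit_ob T"
abbreviation (input) inv_assoc where "inv_assoc X Y Z \<equiv> inverse_arrow \<C> (assoc T X Y Z)"
abbreviation (input) inv_lunit where "inv_lunit X \<equiv> inverse_arrow \<C> (lunit T X)"
abbreviation (input) inv_runit where "inv_runit X \<equiv> inverse_arrow \<C> (runit T X)"

lemma tens_arr [simp]: "\<lbrakk>f \<in> Arr \<C>; g \<in> Arr \<C>\<rbrakk> \<Longrightarrow> f \<star> g \<in> Arr \<C>"
  and dom_tens [simp]: "\<lbrakk>f \<in> Arr \<C>; g \<in> Arr \<C>\<rbrakk> \<Longrightarrow> Dom \<C> (f \<star> g) = Dom \<C> f \<star> Dom \<C> g"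
  and cod_tens [simp]: "\<lbrakk>f \<in> Arr \<C>; g \<in> Arr \<C>\<rbrakk> \<Longrightarrow> Cod \<C> (f \<star> g) = Cod \<C> f \<star> Cod \<C> g"
  using tens_hom by (auto simp: hom_def)

lemma tens_ob [simp]: "\<lbrakk>A \<in> Ob \<C>; B \<in> Ob \<C>\<rbrakk> \<Longrightarrow> A \<star> B \<in> Ob \<C>"
  by (metis dom_ob dom_tens ob_arr ob_dom tens_arr)

lemma unit_ob' [simp]: "\<I> \<in> Ob \<C>" by (rule unit_ob)

text \<open>Interchange is oriented so that \<open>simp\<close> fuses composites of tensor products
  into tensor products of composites; together with right-nested composition this gives a normal
  form. A step that has to split a tensor product is therefore written out by hand.\<close>

lemma merge [simp]: "\<lbrakk>f \<in> Arr \<C>; f' \<in> Arr \<C>; g \<in> Arr \<C>; g' \<in> Arr \<C>; Dom \<C> f' = Cod \<C> f; Dom \<C> g' = Cod \<C> g\<rbrakk>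
      \<Longrightarrow> (f' \<star> g') \<cdot> (f \<star> g) = (f' \<cdot> f) \<star> (g' \<cdot> g)"
  by (rule interchange[symmetric])

lemma merge_ext [simp]: "\<lbrakk>f \<in> Arr \<C>; f' \<in> Arr \<C>; g \<in> Arr \<C>; g' \<in> Arr \<C>; Dom \<C> f' = Cod \<C> f; Dom \<C> g' = Cod \<C> g;
   x \<in> Arr \<C>; Cod \<C> x = Dom \<C> f \<star> Dom \<C> g\<rbrakk>
      \<Longrightarrow> (f' \<star> g') \<cdot> (f \<star> g) \<cdot> x = ((f' \<cdot> f) \<star> (g' \<cdot> g)) \<cdot> x"
  by (rule ext2) auto

lemma assoc_arr [simp]:
  assumes "X \<in> Ob \<C>" "Y \<in> Ob \<C>" "Z \<in> Ob \<C>"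
  shows "assoc T X Y Z \<in> Arr \<C>" "Dom \<C> (assoc T X Y Z) = (X \<star> Y) \<star> Z" "Cod \<C> (assoc T X Y Z) = X \<star> (Y \<star> Z)"
  using assoc_natural assms by (auto simp: natural3_def)

lemma lunit_arr [simp]:
  assumes "X \<in> Ob \<C>"
  shows "lunit T X \<in> Arr \<C>" "Dom \<C> (lunit T X) = \<I> \<star> X" "Cod \<C> (lunit T X) = X"
  using lunit_natural assms by (auto simp: natural1_def)

lemma runit_arr [simp]:
  assumes "X \<in> Ob \<C>"
  shows "runit T X \<in> Arr \<C>" "Dom \<C> (runit T X) = X \<star> \<I>" "Cod \<C> (runit T X) = X"
  using runit_natural assms by (auto simp: natural1_def)

lemma inv_assoc_arr [simp]:
  assumes "X \<in> Ob \<C>" "Y \<in> Ob \<C>" "Z \<in> Ob \<C>"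
  shows "inv_assoc X Y Z \<in> Arr \<C>" "Dom \<C> (inv_assoc X Y Z) = X \<star> (Y \<star> Z)"
    "Cod \<C> (inv_assoc X Y Z) = (X \<star> Y) \<star> Z"
    "assoc T X Y Z \<cdot> inv_assoc X Y Z = X \<star> (Y \<star> Z)"
    "inv_assoc X Y Z \<cdot> assoc T X Y Z = (X \<star> Y) \<star> Z"
  using inv_arr[OF assoc_iso] assms by simp_all

lemma inv_lunit_arr [simp]:
  assumes "X \<in> Ob \<C>"
  shows "inv_lunit X \<in> Arr \<C>" "Dom \<C> (inv_lunit X) = X" "Cod \<C> (inv_lunit X) = \<I> \<star> X"
    "lunit T X \<cdot> inv_lunit X = X" "inv_lunit X \<cdot> lunit T X = \<I> \<star> X"
  using inv_arr[OF lunit_iso] assms by simp_all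

lemma inv_runit_arr [simp]:
  assumes "X \<in> Ob \<C>"
  shows "inv_runit X \<in> Arr \<C>" "Dom \<C> (inv_runit X) = X" "Cod \<C> (inv_runit X) = X \<star> \<I>"
    "runit T X \<cdot> inv_runit X = X" "inv_runit X \<cdot> runit T X = X \<star> \<I>"
  using inv_arr[OF runit_iso] assms by simp_all

lemma cancel_ext [simp]:
  assumes "X \<in> Ob \<C>" "x \<in> Arr \<C>"
  shows "Cod \<C> x = X \<Longrightarrow> lunit T X \<cdot> inv_lunit X \<cdot> x = x"
    "Cod \<C> x = \<I> \<star> X \<Longrightarrow> inv_lunit X \<cdot> lunit T X \<cdot> x = x"
    "Cod \<C> x = X \<Longrightarrow> runit T X \<cdot> inv_runit X \<cdot> x = x"
    "Cod \<C> x = X \<star> \<I> \<Longrightarrow> inv_runit X \<cdot> runit T X \<cdot> x = x"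
    "\<lbrakk>Y \<in> Ob \<C>; Z \<in> Ob \<C>; Cod \<C> x = X \<star> (Y \<star> Z)\<rbrakk> \<Longrightarrow> assoc T X Y Z \<cdot> inv_assoc X Y Z \<cdot> x = x"
    "\<lbrakk>Y \<in> Ob \<C>; Z \<in> Ob \<C>; Cod \<C> x = (X \<star> Y) \<star> Z\<rbrakk> \<Longrightarrow> inv_assoc X Y Z \<cdot> assoc T X Y Z \<cdot> x = x"
  using assms
  by (simp_all add: ext2[OF inv_lunit_arr(4)] ext2[OF inv_lunit_arr(5)] ext2[OF inv_runit_arr(4)]
    ext2[OF inv_runit_arr(5)] ext2[OF inv_assoc_arr(4)] ext2[OF inv_assoc_arr(5)])

lemma assoc_nat:
  assumes "f \<in> Arr \<C>" "g \<in> Arr \<C>" "h \<in> Arr \<C>" "Cod \<C> f = X" "Cod \<C> g = Y" "Cod \<C> h = Z"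
  shows "assoc T X Y Z \<cdot> ((f \<star> g) \<star> h) = (f \<star> (g \<star> h)) \<cdot> assoc T (Dom \<C> f) (Dom \<C> g) (Dom \<C> h)"
  using assoc_natural assms by (auto simp: natural3_def)

lemma lunit_nat:
  assumes "f \<in> Arr \<C>" "Cod \<C> f = X"
  shows "lunit T X \<cdot> (\<I> \<star> f) = f \<cdot> lunit T (Dom \<C> f)"
  using lunit_natural assms by (auto simp: natural1_def)

lemma runit_nat:
  assumes "f \<in> Arr \<C>" "Cod \<C> f = X"
  shows "runit T X \<cdot> (f \<star> \<I>) = f \<cdot> runit T (Dom \<C> f)"
  using runit_natural assms by (auto simp: natural1_def)

lemma inv_lunit_nat:
  assumes "f \<in> Arr \<C>" "Cod \<C> f = X"
  shows "inv_lunit X \<cdot> f = (\<I> \<star> f) \<cdot> inv_lunit (Dom \<C> f)"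
proof -
  have "X \<in> Ob \<C>" using assms cod_ob by blast
  moreover have "inv_lunit X \<cdot> (f \<cdot> lunit T (Dom \<C> f)) \<cdot> inv_lunit (Dom \<C> f) = inv_lunit X \<cdot> (lunit T X \<cdot> (\<I> \<star> f)) \<cdot> inv_lunit (Dom \<C> f)"
    using lunit_nat assms by simp
  ultimately show ?thesis using assms by simp
qed

lemma inv_runit_nat:
  assumes "f \<in> Arr \<C>" "Cod \<C> f = X"
  shows "inv_runit X \<cdot> f = (f \<star> \<I>) \<cdot> inv_runit (Dom \<C> f)"
proof -
  have "X \<in> Ob \<C>" using assms cod_ob by blast
  moreover have "inv_runit X \<cdot> (f \<cdot> runit T (Dom \<C> f)) \<cdot> inv_runit (Dom \<C> f) = inv_runit X \<cdot> (runit T X \<cdot> (f \<star> \<I>)) \<cdot> inv_runit (Dom \<C> f)"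
    using runit_nat assms by simp
  ultimately show ?thesis using assms by simp
qed

lemma inv_assoc_nat:
  assumes "f \<in> Arr \<C>" "g \<in> Arr \<C>" "h \<in> Arr \<C>" "Cod \<C> f = X" "Cod \<C> g = Y" "Cod \<C> h = Z"
  shows "inv_assoc X Y Z \<cdot> (f \<star> (g \<star> h)) = ((f \<star> g) \<star> h) \<cdot> inv_assoc (Dom \<C> f) (Dom \<C> g) (Dom \<C> h)"
proof -
  have "X \<in> Ob \<C>" "Y \<in> Ob \<C>" "Z \<in> Ob \<C>" using assms cod_ob by blast+
  moreover have "inv_assoc X Y Z \<cdot> ((f \<star> (g \<star> h)) \<cdot> assoc T (Dom \<C> f) (Dom \<C> g) (Dom \<C> h)) \<cdot> inv_assoc (Dom \<C> f) (Dom \<C> g) (Dom \<C> h)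
     = inv_assoc X Y Z \<cdot> (assoc T X Y Z \<cdot> ((f \<star> g) \<star> h)) \<cdot> inv_assoc (Dom \<C> f) (Dom \<C> g) (Dom \<C> h)"
    using assoc_nat assms by simp
  ultimately show ?thesis using assms by simp
qed

text \<open>Tensoring with the unit object is isomorphic to the identity functor through
  \<open>lunit\<close>, hence faithful. So a coherence law may be proved after adding one more unit
  factor.\<close>

lemma tens_left_cancel:
  assumes "\<I> \<star> f = \<I> \<star> g" "f \<in> Arr \<C>" "g \<in> Arr \<C>" "Dom \<C> f = Dom \<C> g" "Cod \<C> f = Cod \<C> g"
  shows "f = g"
proof -
  have "(f \<cdot> lunit T (Dom \<C> f)) = (g \<cdot> lunit T (Dom \<C> f))"
    using lunit_nat[of f "Cod \<C> f"] lunit_nat[of g "Cod \<C> f"] assms by simp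
  then have "(f \<cdot> lunit T (Dom \<C> f)) \<cdot> inv_lunit (Dom \<C> f) = (g \<cdot> lunit T (Dom \<C> f)) \<cdot> inv_lunit (Dom \<C> f)"
    by simp
  then show ?thesis using assms by simp
qed

lemma tens_right_cancel:
  assumes "f \<star> \<I> = g \<star> \<I>" "f \<in> Arr \<C>" "g \<in> Arr \<C>" "Dom \<C> f = Dom \<C> g" "Cod \<C> f = Cod \<C> g"
  shows "f = g"
proof -
  have "(f \<cdot> runit T (Dom \<C> f)) = (g \<cdot> runit T (Dom \<C> f))"
    using runit_nat[of f "Cod \<C> f"] runit_nat[of g "Cod \<C> f"] assms by simp
  then have "(f \<cdot> runit T (Dom \<C> f)) \<cdot> inv_runit (Dom \<C> f) = (g \<cdot> runit T (Dom \<C> f)) \<cdot> inv_runit (Dom \<C> f)"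
    by simp
  then show ?thesis using assms by simp
qed

lemma iso_structure [simp]:
  assumes "X \<in> Ob \<C>"
  shows "iso_arrow \<C> (lunit T X)" "iso_arrow \<C> (runit T X)"
    "\<lbrakk>Y \<in> Ob \<C>; Z \<in> Ob \<C>\<rbrakk> \<Longrightarrow> iso_arrow \<C> (assoc T X Y Z)"
  using assms assoc_iso lunit_iso runit_iso by auto

lemma iso_tens:
  assumes "iso_arrow \<C> f" "iso_arrow \<C> g"
  shows "iso_arrow \<C> (f \<star> g)"
proof -
  note i = inv_arr[OF assms(1)] iso_arr[OF assms(1)] inv_arr[OF assms(2)] iso_arr[OF assms(2)]
  have "inverse_arrows \<C> (f \<star> g) (inverse_arrow \<C> f \<star> inverse_arrow \<C> g)"
    using i by (auto simp: inverse_arrows_def)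
  then show ?thesis by (auto simp: iso_arrow_def)
qed

text \<open>A classical consequence of pentagon and triangle. After tensoring with the unit on the
  left, the pentagon with two unit entries and two instances of the triangle identify both sides,
  and \<open>tens_left_cancel\<close> removes the extra factor.\<close>

lemma lunit_tens:
  assumes "X \<in> Ob \<C>" "Y \<in> Ob \<C>"
  shows "lunit T (X \<star> Y) \<cdot> assoc T \<I> X Y = lunit T X \<star> Y"
proof -
  note [simp] = assms
  let ?l = "lunit T (X \<star> Y) \<cdot> assoc T \<I> X Y"
  let ?a = "assoc T \<I> (\<I> \<star> X) Y" and ?b = "assoc T \<I> \<I> X \<star> Y"
  have "(\<I> \<star> ?l) \<cdot> ?a \<cdot> ?b = (\<I> \<star> lunit T (X \<star> Y)) \<cdot> (\<I> \<star> assoc T \<I> X Y) \<cdot> ?a \<cdot> ?b"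
    by simp
  also have "\<dots> = (\<I> \<star> lunit T (X \<star> Y)) \<cdot> assoc T \<I> \<I> (X \<star> Y) \<cdot> assoc T (\<I> \<star> \<I>) X Y"
    by (simp only: pentagon unit_ob' assms)
  also have "\<dots> = (runit T \<I> \<star> (X \<star> Y)) \<cdot> assoc T (\<I> \<star> \<I>) X Y"
    by (simp add: ext2[OF triangle])
  also have "\<dots> = assoc T \<I> X Y \<cdot> ((runit T \<I> \<star> X) \<star> Y)"
    by (simp add: assoc_nat)
  also have "\<dots> = assoc T \<I> X Y \<cdot> (((\<I> \<star> lunit T X) \<cdot> assoc T \<I> \<I> X) \<star> Y)"
    by (simp add: triangle)
  also have "\<dots> = assoc T \<I> X Y \<cdot> ((\<I> \<star> lunit T X) \<star> Y) \<cdot> ?b"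
    by simp
  also have "\<dots> = (\<I> \<star> (lunit T X \<star> Y)) \<cdot> ?a \<cdot> ?b"
    using ext2[OF assoc_nat, of \<I> "lunit T X" Y \<I> X Y ?b] by simp
  finally have "(\<I> \<star> ?l) \<cdot> ?a \<cdot> ?b = (\<I> \<star> (lunit T X \<star> Y)) \<cdot> ?a \<cdot> ?b" .
  then have "((\<I> \<star> ?l) \<cdot> ?a) \<cdot> ?b = ((\<I> \<star> (lunit T X \<star> Y)) \<cdot> ?a) \<cdot> ?b"
    by simp
  then have "(\<I> \<star> ?l) \<cdot> ?a = (\<I> \<star> (lunit T X \<star> Y)) \<cdot> ?a"
    by (rule iso_epi[rotated]) (auto simp: iso_tens)
  then have "\<I> \<star> ?l = \<I> \<star> (lunit T X \<star> Y)"
    by (rule iso_epi[rotated]) auto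
  then show ?thesis by (rule tens_left_cancel) auto
qed

text \<open>Mirror image of \<open>lunit_tens\<close>: the extra unit factor stands on the right,
  and the two unit entries of the pentagon are the last ones.\<close>

lemma runit_tens:
  assumes "X \<in> Ob \<C>" "Y \<in> Ob \<C>"
  shows "(X \<star> runit T Y) \<cdot> assoc T X Y \<I> = runit T (X \<star> Y)"
proof -
  note [simp] = assms
  let ?a = "assoc T X Y \<I>"
  have "?a \<cdot> (runit T (X \<star> Y) \<star> \<I>) = ?a \<cdot> ((X \<star> Y) \<star> lunit T \<I>) \<cdot> assoc T (X \<star> Y) \<I> \<I>"
    by (simp add: triangle)
  also have "\<dots> = (X \<star> (Y \<star> lunit T \<I>)) \<cdot> assoc T X Y (\<I> \<star> \<I>) \<cdot> assoc T (X \<star> Y) \<I> \<I>"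
    by (simp add: ext2[OF assoc_nat])
  also have "\<dots> = (X \<star> (Y \<star> lunit T \<I>)) \<cdot> (X \<star> assoc T Y \<I> \<I>) \<cdot> assoc T X (Y \<star> \<I>) \<I> \<cdot> (?a \<star> \<I>)"
    by (simp only: pentagon unit_ob' assms)
  also have "\<dots> = (X \<star> (runit T Y \<star> \<I>)) \<cdot> assoc T X (Y \<star> \<I>) \<I> \<cdot> (?a \<star> \<I>)"
    by (simp add: triangle)
  also have "\<dots> = ?a \<cdot> (((X \<star> runit T Y) \<cdot> ?a) \<star> \<I>)"
    using ext2[OF assoc_nat, of X "runit T Y" \<I> X Y \<I> "?a \<star> \<I>"] by simp
  finally have "runit T (X \<star> Y) \<star> \<I> = ((X \<star> runit T Y) \<cdot> ?a) \<star> \<I>"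
    by (rule iso_mono[rotated]) auto
  then show ?thesis by (rule tens_right_cancel[symmetric]) auto
qed

text \<open>Naturality of \<open>runit\<close> at its own component gives
  \<open>runit T (\<I> \<star> \<I>) = runit T \<I> \<star> \<I>\<close>. The triangle then makes
  the two constraints at the unit agree after tensoring with the unit.\<close>

lemma lunit_unit: "lunit T \<I> = runit T \<I>"
proof -
  have "runit T \<I> \<cdot> runit T (\<I> \<star> \<I>) = runit T \<I> \<cdot> (runit T \<I> \<star> \<I>)"
    by (simp add: runit_nat)
  then have "runit T (\<I> \<star> \<I>) = runit T \<I> \<star> \<I>"
    by (rule iso_mono[rotated]) auto
  then have "(\<I> \<star> lunit T \<I>) \<cdot> assoc T \<I> \<I> \<I> = (\<I> \<star> runit T \<I>) \<cdot> assoc T \<I> \<I> \<I>"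
    by (simp add: triangle runit_tens)
  then have "\<I> \<star> lunit T \<I> = \<I> \<star> runit T \<I>"
    by (rule iso_epi[rotated]) auto
  then show ?thesis by (rule tens_left_cancel) auto
qed

end

lemma natural4_arr:
  assumes "natural4 \<C> F G \<tau>" "W \<in> Ob \<C>" "X \<in> Ob \<C>" "Y \<in> Ob \<C>" "Z \<in> Ob \<C>"
  shows "\<tau> W X Y Z \<in> Arr \<C>" "Dom \<C> (\<tau> W X Y Z) = F W X Y Z" "Cod \<C> (\<tau> W X Y Z) = G W X Y Z"
proof -
  have "\<tau> W X Y Z \<in> hom \<C> (F W X Y Z) (G W X Y Z)"
    using assms unfolding natural4_def by blast
  then show "\<tau> W X Y Z \<in> Arr \<C>" "Dom \<C> (\<tau> W X Y Z) = F W X Y Z" "Cod \<C> (\<tau> W X Y Z) = G W X Y Z"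
    by (auto simp: hom_def)
qed

lemma natural2_arr:
  assumes "natural2 \<C> F G \<tau>" "X \<in> Ob \<C>" "Y \<in> Ob \<C>"
  shows "\<tau> X Y \<in> Arr \<C>" "Dom \<C> (\<tau> X Y) = F X Y" "Cod \<C> (\<tau> X Y) = G X Y"
proof -
  have "\<tau> X Y \<in> hom \<C> (F X Y) (G X Y)"
    using assms unfolding natural2_def by blast
  then show "\<tau> X Y \<in> Arr \<C>" "Dom \<C> (\<tau> X Y) = F X Y" "Cod \<C> (\<tau> X Y) = G X Y"
    by (auto simp: hom_def)
qed

lemma natural2_nat:
  assumes "natural2 \<C> F G \<tau>" "f \<in> Arr \<C>" "g \<in> Arr \<C>" "Cod \<C> f = X" "Cod \<C> g = Y"
  shows "\<tau> X Y \<cdot>\<^bsub>\<C>\<^esub> F f g = G f g \<cdot>\<^bsub>\<C>\<^esub> \<tau> (Dom \<C> f) (Dom \<C> g)"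
  using assms unfolding natural2_def by blast

lemma reversed_simps [simp]:
  "tens (reversed \<C> T) f g = g \<otimes>\<^bsub>T\<^esub> f" "unit_ob (reversed \<C> T) = unit_ob T"
  "lunit (reversed \<C> T) = runit T" "runit (reversed \<C> T) = lunit T"
  by (simp_all add: reversed_def)

context monoidal_category
begin

lemma assoc_inv_runit: "\<lbrakk>X \<in> Ob \<C>; Y \<in> Ob \<C>\<rbrakk> \<Longrightarrow> assoc T X Y \<I> \<cdot> inv_runit (X \<star> Y) = X \<star> inv_runit Y"
  by (rule iso_mono[of "X \<star> runit T Y"])
    (simp_all add: iso_tens ext2[OF runit_tens])

lemma inv_assoc_inv_runit: "\<lbrakk>X \<in> Ob \<C>; Y \<in> Ob \<C>\<rbrakk> \<Longrightarrow> inv_assoc X Y \<I> \<cdot> (X \<star> inv_runit Y) = inv_runit (X \<star> Y)"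
  using assoc_inv_runit[of X Y, symmetric] by simp

lemma assoc_inv_lunit: "\<lbrakk>X \<in> Ob \<C>; Y \<in> Ob \<C>\<rbrakk> \<Longrightarrow> assoc T \<I> X Y \<cdot> (inv_lunit X \<star> Y) = inv_lunit (X \<star> Y)"
  by (rule iso_mono[of "lunit T (X \<star> Y)"]) (simp_all add: ext2[OF lunit_tens])

lemma triangle_inv: "\<lbrakk>X \<in> Ob \<C>; Y \<in> Ob \<C>\<rbrakk> \<Longrightarrow> assoc T X \<I> Y \<cdot> (inv_runit X \<star> Y) = X \<star> inv_lunit Y"
  by (rule iso_mono[of "X \<star> lunit T Y"]) (simp_all add: iso_tens ext2[OF triangle])

lemma inv_triangle: "\<lbrakk>X \<in> Ob \<C>; Y \<in> Ob \<C>\<rbrakk> \<Longrightarrow> (runit T X \<star> Y) \<cdot> inv_assoc X \<I> Y = X \<star> lunit T Y"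
  using triangle[of X Y, symmetric] by simp

lemma inv_triangle_inv: "\<lbrakk>X \<in> Ob \<C>; Y \<in> Ob \<C>\<rbrakk> \<Longrightarrow> inv_assoc X \<I> Y \<cdot> (X \<star> inv_lunit Y) = inv_runit X \<star> Y"
  using triangle_inv[of X Y, symmetric] by simp

end

section \<open>Calculus of \<zeta> and of the comonoid I\<close>

context duoidal_category
begin

abbreviation aci where "aci X Y Z \<equiv> inv\<^sub>\<C> (ac X Y Z)"
abbreviation abi where "abi X Y Z \<equiv> inv\<^sub>\<C> (ab X Y Z)"
abbreviation lci where "lci X \<equiv> inv\<^sub>\<C> (lc X)"
abbreviation lbi where "lbi X \<equiv> inv\<^sub>\<C> (lb X)"
abbreviation rci where "rci X \<equiv> inv\<^sub>\<C> (rc X)"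
abbreviation rbi where "rbi X \<equiv> inv\<^sub>\<C> (rb X)"

lemma zeta_arr [simp]:
  assumes "W \<in> Ob \<C>" "X \<in> Ob \<C>" "Y \<in> Ob \<C>" "Z \<in> Ob \<C>"
  shows "\<zeta> W X Y Z \<in> Arr \<C>" "Dom \<C> (\<zeta> W X Y Z) = (W \<bullet> X) \<odot> (Y \<bullet> Z)"
    "Cod \<C> (\<zeta> W X Y Z) = (W \<odot> Y) \<bullet> (X \<odot> Z)"
  using natural4_arr[OF zeta_natural assms] by simp_all

lemma zeta_nat:
  assumes "f \<in> Arr \<C>" "g \<in> Arr \<C>" "h \<in> Arr \<C>" "k \<in> Arr \<C>"
    "Cod \<C> f = W" "Cod \<C> g = X" "Cod \<C> h = Y" "Cod \<C> k = Z"
  shows "\<zeta> W X Y Z \<cdot> ((f \<bullet> g) \<odot> (h \<bullet> k)) =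
    ((f \<odot> h) \<bullet> (g \<odot> k)) \<cdot> \<zeta> (Dom \<C> f) (Dom \<C> g) (Dom \<C> h) (Dom \<C> k)"
  using zeta_natural assms by (auto simp: natural4_def)

lemma unit_arrs [simp]:
  "\<Delta>\<^sub>I \<in> Arr \<C>" "Dom \<C> \<Delta>\<^sub>I = I" "Cod \<C> \<Delta>\<^sub>I = I \<bullet> I"
  "\<epsilon>\<^sub>I \<in> Arr \<C>" "Dom \<C> \<epsilon>\<^sub>I = I" "Cod \<C> \<epsilon>\<^sub>I = J"
  "m\<^sub>J \<in> Arr \<C>" "Dom \<C> m\<^sub>J = J \<odot> J" "Cod \<C> m\<^sub>J = J"
  using I_comonoid J_monoid by (auto simp: comonoid_in_def monoid_in_def)

lemma I_counit_left: "(\<epsilon>\<^sub>I \<bullet> I) \<cdot> \<Delta>\<^sub>I = lbi I"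
proof -
  have "lbi I \<cdot> lb I \<cdot> (\<epsilon>\<^sub>I \<bullet> I) \<cdot> \<Delta>\<^sub>I = lbi I \<cdot> I"
    using I_comonoid by (simp add: comonoid_in_def)
  then show ?thesis by simp
qed

lemma I_counit_right: "(I \<bullet> \<epsilon>\<^sub>I) \<cdot> \<Delta>\<^sub>I = rbi I"
proof -
  have "rbi I \<cdot> rb I \<cdot> (I \<bullet> \<epsilon>\<^sub>I) \<cdot> \<Delta>\<^sub>I = rbi I \<cdot> I"
    using I_comonoid by (simp add: comonoid_in_def)
  then show ?thesis by simp
qed

text \<open>The unit law \<open>zeta_rc\<close> solved for the composite that contains \<zeta>, the
  form in which it can rewrite a subterm.\<close>

lemma zeta_rc_inv:
  assumes [simp]: "X \<in> Ob \<C>" "Y \<in> Ob \<C>"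
  shows "\<zeta> X Y I I \<cdot> ((X \<bullet> Y) \<odot> \<Delta>\<^sub>I) = (rci X \<bullet> rci Y) \<cdot> rc (X \<bullet> Y)"
proof -
  have "(rci X \<bullet> rci Y) \<cdot> (rc X \<bullet> rc Y) \<cdot> \<zeta> X Y I I \<cdot> ((X \<bullet> Y) \<odot> \<Delta>\<^sub>I) = (rci X \<bullet> rci Y) \<cdot> rc (X \<bullet> Y)"
    by (simp only: zeta_rc assms)
  then show ?thesis by simp
qed

lemma zeta_lc_inv:
  assumes [simp]: "X \<in> Ob \<C>" "Y \<in> Ob \<C>"
  shows "\<zeta> I I X Y \<cdot> (\<Delta>\<^sub>I \<odot> (X \<bullet> Y)) = (lci X \<bullet> lci Y) \<cdot> lc (X \<bullet> Y)"
proof -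
  have "(lci X \<bullet> lci Y) \<cdot> (lc X \<bullet> lc Y) \<cdot> \<zeta> I I X Y \<cdot> (\<Delta>\<^sub>I \<odot> (X \<bullet> Y)) = (lci X \<bullet> lci Y) \<cdot> lc (X \<bullet> Y)"
    by (simp only: zeta_lc assms)
  then show ?thesis by simp
qed

end

section \<open>The reversion functor, its transformations, and \<delta> at the unit object\<close>

context reversion
begin

lemmas lax_circ' = lax_circ[unfolded lax_monoidal_endofunctor_def reversed_simps]
lemmas lax_blt' = lax_blt[unfolded lax_monoidal_endofunctor_def reversed_simps]
lemmas rev_functor = lax_circ'[THEN conjunct1, unfolded is_functor_def]
lemmas phic_natural = lax_circ'[THEN conjunct2, THEN conjunct1]
lemmas phib_natural = lax_blt'[THEN conjunct2, THEN conjunct1]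

lemma rev_arr [simp]: "f \<in> Arr \<C> \<Longrightarrow> f\<^sup>- \<in> Arr \<C>"
  and dom_rev [simp]: "f \<in> Arr \<C> \<Longrightarrow> Dom \<C> f\<^sup>- = (Dom \<C> f)\<^sup>-"
  and cod_rev [simp]: "f \<in> Arr \<C> \<Longrightarrow> Cod \<C> f\<^sup>- = (Cod \<C> f)\<^sup>-"
  using rev_functor[THEN conjunct1] unfolding hom_def by blast+

lemma rev_ob [simp]: "A \<in> Ob \<C> \<Longrightarrow> A\<^sup>- \<in> Ob \<C>"
  using circ.dom_ob[of "A\<^sup>-"] by simp

lemma rev_merge [simp]: "\<lbrakk>f \<in> Arr \<C>; g \<in> Arr \<C>; Dom \<C> g = Cod \<C> f\<rbrakk> \<Longrightarrow> g\<^sup>- \<cdot> f\<^sup>- = (g \<cdot> f)\<^sup>-"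
  using rev_functor[THEN conjunct2] by metis

lemma rev_merge_ext [simp]: "\<lbrakk>f \<in> Arr \<C>; g \<in> Arr \<C>; Dom \<C> g = Cod \<C> f; x \<in> Arr \<C>; Cod \<C> x = (Dom \<C> f)\<^sup>-\<rbrakk>
   \<Longrightarrow> g\<^sup>- \<cdot> f\<^sup>- \<cdot> x = (g \<cdot> f)\<^sup>- \<cdot> x"
  by (rule circ.ext2) auto

lemma lax_arr [simp]:
  assumes "X \<in> Ob \<C>" "Y \<in> Ob \<C>"
  shows "\<phi>c X Y \<in> Arr \<C>" "Dom \<C> (\<phi>c X Y) = X\<^sup>- \<odot> Y\<^sup>-" "Cod \<C> (\<phi>c X Y) = (Y \<odot> X)\<^sup>-"
    "\<phi>b X Y \<in> Arr \<C>" "Dom \<C> (\<phi>b X Y) = X\<^sup>- \<bullet> Y\<^sup>-" "Cod \<C> (\<phi>b X Y) = (Y \<bullet> X)\<^sup>-"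
  using natural2_arr[OF phic_natural assms] natural2_arr[OF phib_natural assms] by simp_all

lemma lax_unit_arr [simp]:
  "\<phi>c\<^sub>0 \<in> Arr \<C>" "Dom \<C> \<phi>c\<^sub>0 = I" "Cod \<C> \<phi>c\<^sub>0 = I\<^sup>-"
  "\<phi>b\<^sub>0 \<in> Arr \<C>" "Dom \<C> \<phi>b\<^sub>0 = J" "Cod \<C> \<phi>b\<^sub>0 = J\<^sup>-"
  using lax_circ'[THEN conjunct2, THEN conjunct2, THEN conjunct1]
    lax_blt'[THEN conjunct2, THEN conjunct2, THEN conjunct1]
  unfolding hom_def by blast+

text \<open>The source product is reversed, so the left unit law of the lax functor has
  \<open>rc\<close> under the reverse but \<open>lc\<close> outside.\<close>

lemma phic_unit:
  assumes "X \<in> Ob \<C>"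
  shows "(rc X)\<^sup>- \<cdot> \<phi>c I X \<cdot> (\<phi>c\<^sub>0 \<odot> X\<^sup>-) = lc X\<^sup>-"
  using lax_circ' assms by blast

lemma gamma_arr [simp]:
  assumes "W \<in> Ob \<C>" "X \<in> Ob \<C>" "Y \<in> Ob \<C>" "Z \<in> Ob \<C>"
  shows "\<gamma> W X Y Z \<in> Arr \<C>" "Dom \<C> (\<gamma> W X Y Z) = ((W \<bullet> X\<^sup>-) \<odot> Y) \<bullet> Z"
    "Cod \<C> (\<gamma> W X Y Z) = W \<odot> (Y \<bullet> (X \<odot> Z))"
  using natural4_arr[OF gamma_natural assms] by simp_all

lemma delta_arr [simp]:
  assumes "W \<in> Ob \<C>" "X \<in> Ob \<C>" "Y \<in> Ob \<C>" "Z \<in> Ob \<C>"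
  shows "\<delta> W X Y Z \<in> Arr \<C>" "Dom \<C> (\<delta> W X Y Z) = W \<bullet> (X \<odot> (Y\<^sup>- \<bullet> Z))"
    "Cod \<C> (\<delta> W X Y Z) = ((W \<odot> Y) \<bullet> X) \<odot> Z"
  using natural4_arr[OF delta_natural assms] by simp_all

lemma gamma'_arr [simp]:
  assumes "W \<in> Ob \<C>" "X \<in> Ob \<C>" "Y \<in> Ob \<C>" "Z \<in> Ob \<C>"
  shows "\<gamma>' W X Y Z \<in> Arr \<C>" "Dom \<C> (\<gamma>' W X Y Z) = W\<^sup>- \<bullet> ((X \<bullet> Y) \<odot> Z)"
    "Cod \<C> (\<gamma>' W X Y Z) = Y \<odot> ((W \<odot> X)\<^sup>- \<bullet> Z)"
  using natural4_arr[OF gamma'_natural assms] by simp_all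

lemma delta'_arr [simp]:
  assumes "W \<in> Ob \<C>" "X \<in> Ob \<C>" "Y \<in> Ob \<C>" "Z \<in> Ob \<C>"
  shows "\<delta>' W X Y Z \<in> Arr \<C>" "Dom \<C> (\<delta>' W X Y Z) = (W \<odot> (X \<bullet> Y)) \<bullet> Z\<^sup>-"
    "Cod \<C> (\<delta>' W X Y Z) = (W \<bullet> (Y \<odot> Z)\<^sup>-) \<odot> X"
  using natural4_arr[OF delta'_natural assms] by simp_all

lemma gamma_nat:
  assumes "f \<in> Arr \<C>" "g \<in> Arr \<C>" "h \<in> Arr \<C>" "k \<in> Arr \<C>"
    "Cod \<C> f = W" "Cod \<C> g = X" "Cod \<C> h = Y" "Cod \<C> k = Z"
  shows "\<gamma> W X Y Z \<cdot> (((f \<bullet> g\<^sup>-) \<odot> h) \<bullet> k) =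
    (f \<odot> (h \<bullet> (g \<odot> k))) \<cdot> \<gamma> (Dom \<C> f) (Dom \<C> g) (Dom \<C> h) (Dom \<C> k)"
  using gamma_natural assms by (auto simp: natural4_def)

lemma delta_nat:
  assumes "f \<in> Arr \<C>" "g \<in> Arr \<C>" "h \<in> Arr \<C>" "k \<in> Arr \<C>"
    "Cod \<C> f = W" "Cod \<C> g = X" "Cod \<C> h = Y" "Cod \<C> k = Z"
  shows "\<delta> W X Y Z \<cdot> (f \<bullet> (g \<odot> (h\<^sup>- \<bullet> k))) =
    (((f \<odot> h) \<bullet> g) \<odot> k) \<cdot> \<delta> (Dom \<C> f) (Dom \<C> g) (Dom \<C> h) (Dom \<C> k)"
  using delta_natural assms by (auto simp: natural4_def)

lemma gamma'_nat:
  assumes "f \<in> Arr \<C>" "g \<in> Arr \<C>" "h \<in> Arr \<C>" "k \<in> Arr \<C>"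
    "Cod \<C> f = W" "Cod \<C> g = X" "Cod \<C> h = Y" "Cod \<C> k = Z"
  shows "\<gamma>' W X Y Z \<cdot> (f\<^sup>- \<bullet> ((g \<bullet> h) \<odot> k)) =
    (h \<odot> ((f \<odot> g)\<^sup>- \<bullet> k)) \<cdot> \<gamma>' (Dom \<C> f) (Dom \<C> g) (Dom \<C> h) (Dom \<C> k)"
  using gamma'_natural assms by (auto simp: natural4_def)

lemma delta'_nat:
  assumes "f \<in> Arr \<C>" "g \<in> Arr \<C>" "h \<in> Arr \<C>" "k \<in> Arr \<C>"
    "Cod \<C> f = W" "Cod \<C> g = X" "Cod \<C> h = Y" "Cod \<C> k = Z"
  shows "\<delta>' W X Y Z \<cdot> ((f \<odot> (g \<bullet> h)) \<bullet> k\<^sup>-) =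
    ((f \<bullet> (h \<odot> k)\<^sup>-) \<odot> g) \<cdot> \<delta>' (Dom \<C> f) (Dom \<C> g) (Dom \<C> h) (Dom \<C> k)"
  using delta'_natural assms by (auto simp: natural4_def)

text \<open>The comultiplication of I with one leg composed with the lax unit
  \<open>\<phi>c\<^sub>0\<close>. These are the composites on which \<open>R7\<close> and
  \<open>R6\<close> evaluate \<delta> and \<gamma>.\<close>

definition dl where "dl = (\<phi>c\<^sub>0 \<bullet> I) \<cdot> \<Delta>\<^sub>I"
definition dr where "dr = (I \<bullet> \<phi>c\<^sub>0) \<cdot> \<Delta>\<^sub>I"

lemma dl_dr_arr [simp]:
  "dl \<in> Arr \<C>" "Dom \<C> dl = I" "Cod \<C> dl = I\<^sup>- \<bullet> I"
  "dr \<in> Arr \<C>" "Dom \<C> dr = I" "Cod \<C> dr = I \<bullet> I\<^sup>-"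
  by (simp_all add: dl_def dr_def)

lemma delta_unit_unit: "\<delta> I I I I \<cdot> (I \<bullet> (I \<odot> dl)) = ((rci I \<bullet> I) \<odot> I) \<cdot> rci (I \<bullet> I) \<cdot> (I \<bullet> rc I)"
proof -
  have "((rci I \<bullet> I) \<odot> I) \<cdot> rci (I \<bullet> I) \<cdot> rc (I \<bullet> I) \<cdot> ((rc I \<bullet> I) \<odot> I) \<cdot> \<delta> I I I I \<cdot> (I \<bullet> (I \<odot> dl)) =
      ((rci I \<bullet> I) \<odot> I) \<cdot> rci (I \<bullet> I) \<cdot> (I \<bullet> rc I)"
    by (simp only: R7 dl_def)
  then show ?thesis by simp
qed

text \<open>\<open>R7\<close> is the case X = Y = I. The compatibility \<open>R3\<close> of \<delta>
  with \<zeta> spreads it to all X and Y: after \<zeta>, the objects X \<odot> I and Y \<odot> I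
  stand for X and Y.\<close>

lemma delta_unit:
  assumes [simp]: "X \<in> Ob \<C>" "Y \<in> Ob \<C>"
  shows "\<delta> X Y I I \<cdot> (X \<bullet> (Y \<odot> dl)) = rci ((X \<odot> I) \<bullet> Y) \<cdot> (rci X \<bullet> rc Y)"
proof -
  let ?e = "((X \<bullet> Y) \<odot> (I \<bullet> (I \<odot> dl)))"
  let ?R = "((X \<odot> rc I) \<bullet> rc Y) \<odot> I"
  let ?z = "\<zeta> X Y I I" and ?m = "(X \<bullet> Y) \<odot> (I \<bullet> rc I)"
  have tri: "(X \<odot> rc I) \<cdot> ac X I I = rc X \<odot> I" "(rc Y \<odot> I) \<cdot> aci Y I I = Y \<odot> rc I"
    using circ.triangle[of X I] circ.inv_triangle[of Y I] circ.lunit_unit by simp_all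
  have "?R \<cdot> (\<zeta> X Y (I \<odot> I) I \<odot> I) \<cdot> aci (X \<bullet> Y) ((I \<odot> I) \<bullet> I) I \<cdot> ((X \<bullet> Y) \<odot> \<delta> I I I I) \<cdot> ?e
    = ?R \<cdot> (\<zeta> X Y (I \<odot> I) I \<odot> I) \<cdot> aci (X \<bullet> Y) ((I \<odot> I) \<bullet> I) I \<cdot> ((X \<bullet> Y) \<odot> ((rci I \<bullet> I) \<odot> I)) \<cdot> ((X \<bullet> Y) \<odot> rci (I \<bullet> I)) \<cdot> ?m"
    by (simp add: delta_unit_unit)
  also have "\<dots> = ?R \<cdot> (\<zeta> X Y (I \<odot> I) I \<odot> I) \<cdot> (((X \<bullet> Y) \<odot> (rci I \<bullet> I)) \<odot> I) \<cdot> aci (X \<bullet> Y) (I \<bullet> I) I \<cdot> ((X \<bullet> Y) \<odot> rci (I \<bullet> I)) \<cdot> ?m"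
    using circ.ext2[OF circ.inv_assoc_nat[of "X \<bullet> Y" "rci I \<bullet> I" I "X \<bullet> Y" "(I \<odot> I) \<bullet> I" I], of "((X \<bullet> Y) \<odot> rci (I \<bullet> I)) \<cdot> ?m"] by simp
  also have "\<dots> = (((X \<odot> I) \<bullet> rc Y) \<odot> I) \<cdot> (?z \<odot> I) \<cdot> rci ((X \<bullet> Y) \<odot> (I \<bullet> I)) \<cdot> ?m"
    using circ.ext2[OF circ.inv_assoc_inv_runit[of "X \<bullet> Y" "I \<bullet> I"], of ?m]
      zeta_nat[of X Y "rci I" I X Y "I \<odot> I" I] by simp
  also have "\<dots> = rci ((X \<odot> I) \<bullet> Y) \<cdot> (((X \<odot> I) \<bullet> rc Y) \<cdot> ?z) \<cdot> ?m"
    using circ.ext2[OF circ.inv_runit_nat[of "((X \<odot> I) \<bullet> rc Y) \<cdot> ?z" "(X \<odot> I) \<bullet> Y"], of ?m] by simp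
  finally have right: "?R \<cdot> (\<zeta> X Y (I \<odot> I) I \<odot> I) \<cdot> aci (X \<bullet> Y) ((I \<odot> I) \<bullet> I) I \<cdot> ((X \<bullet> Y) \<odot> \<delta> I I I I) \<cdot> ?e
    = rci ((X \<odot> I) \<bullet> Y) \<cdot> (((X \<odot> I) \<bullet> rc Y) \<cdot> ?z) \<cdot> ?m" .
  have "?R \<cdot> ((ac X I I \<bullet> (Y \<odot> I)) \<odot> I) \<cdot> \<delta> (X \<odot> I) (Y \<odot> I) I I \<cdot>
        ((X \<odot> I) \<bullet> aci Y I (I\<^sup>- \<bullet> I)) \<cdot> \<zeta> X Y I (I \<odot> (I\<^sup>- \<bullet> I)) \<cdot> ?e
    = (((rc X \<odot> I) \<bullet> rc Y) \<odot> I) \<cdot> \<delta> (X \<odot> I) (Y \<odot> I) I I \<cdot>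
        ((X \<odot> I) \<bullet> aci Y I (I\<^sup>- \<bullet> I)) \<cdot> ((X \<odot> I) \<bullet> (Y \<odot> (I \<odot> dl))) \<cdot> \<zeta> X Y I (I \<odot> I)"
    using tri zeta_nat[of X Y I "I \<odot> dl" X Y I "I \<odot> (I\<^sup>- \<bullet> I)"] by simp
  also have "\<dots> = (((rc X \<odot> I) \<bullet> rc Y) \<odot> I) \<cdot> \<delta> (X \<odot> I) (Y \<odot> I) I I \<cdot>
        ((X \<odot> I) \<bullet> (((Y \<odot> I) \<odot> dl) \<cdot> aci Y I I)) \<cdot> \<zeta> X Y I (I \<odot> I)"
    using circ.inv_assoc_nat[of Y I dl Y I "I\<^sup>- \<bullet> I"] by simp
  also have "\<dots> = \<delta> X Y I I \<cdot> (rc X \<bullet> (rc Y \<odot> (I\<^sup>- \<bullet> I))) \<cdot>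
        ((X \<odot> I) \<bullet> (((Y \<odot> I) \<odot> dl) \<cdot> aci Y I I)) \<cdot> \<zeta> X Y I (I \<odot> I)"
    using circ.ext2[OF delta_nat[of "rc X" "rc Y" I I X Y I I], of "((X \<odot> I) \<bullet> (((Y \<odot> I) \<odot> dl) \<cdot> aci Y I I)) \<cdot> \<zeta> X Y I (I \<odot> I)"]
    by simp
  also have "\<dots> = \<delta> X Y I I \<cdot> (rc X \<bullet> ((Y \<odot> dl) \<cdot> (rc Y \<odot> I) \<cdot> aci Y I I)) \<cdot> \<zeta> X Y I (I \<odot> I)"
    by simp
  also have "\<dots> = \<delta> X Y I I \<cdot> (rc X \<bullet> (Y \<odot> dl)) \<cdot> ((X \<odot> I) \<bullet> (Y \<odot> rc I)) \<cdot> \<zeta> X Y I (I \<odot> I)"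
    unfolding tri by simp
  also have "\<dots> = (\<delta> X Y I I \<cdot> (rc X \<bullet> (Y \<odot> dl)) \<cdot> ?z) \<cdot> ?m"
    using zeta_nat[of X Y I "rc I" X Y I I] by simp
  finally have "(\<delta> X Y I I \<cdot> (rc X \<bullet> (Y \<odot> dl)) \<cdot> ?z) \<cdot> ?m = (rci ((X \<odot> I) \<bullet> Y) \<cdot> ((X \<odot> I) \<bullet> rc Y) \<cdot> ?z) \<cdot> ?m"
    using right arg_cong[OF R3[of X Y I I I I], of "\<lambda>f. ?R \<cdot> f \<cdot> ?e"] by simp
  then have "\<delta> X Y I I \<cdot> (rc X \<bullet> (Y \<odot> dl)) \<cdot> ?z = rci ((X \<odot> I) \<bullet> Y) \<cdot> ((X \<odot> I) \<bullet> rc Y) \<cdot> ?z"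
    by (rule circ.iso_epi[rotated]) (simp_all add: circ.iso_tens blt.iso_tens)
  \<comment> \<open>The common factor \<open>\<zeta> X Y I I\<close> need not be invertible, but
    composed with \<open>(X \<bullet> Y) \<odot> \<Delta>\<^sub>I\<close> it consists of unit
    constraints.\<close>
  from arg_cong[OF this, of "\<lambda>f. f \<cdot> ((X \<bullet> Y) \<odot> \<Delta>\<^sub>I) \<cdot> rci (X \<bullet> Y) \<cdot> (X \<bullet> rc Y)"]
  show ?thesis
    using circ.ext2[OF zeta_rc_inv[of X Y], of "rci (X \<bullet> Y) \<cdot> (X \<bullet> rc Y)"] by simp
qed

end

section \<open>Comodules over the unit object\<close>

context reversion
begin

lemma gamma_unit_unit: "\<gamma> I I I I \<cdot> ((dr \<odot> I) \<bullet> I) = (I \<odot> (I \<bullet> lci I)) \<cdot> lci (I \<bullet> I) \<cdot> (lc I \<bullet> I)"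
proof -
  have "(I \<odot> (I \<bullet> lci I)) \<cdot> lci (I \<bullet> I) \<cdot> lc (I \<bullet> I) \<cdot> (I \<odot> (I \<bullet> lc I)) \<cdot> \<gamma> I I I I \<cdot> ((dr \<odot> I) \<bullet> I) =
      (I \<odot> (I \<bullet> lci I)) \<cdot> lci (I \<bullet> I) \<cdot> (lc I \<bullet> I)"
    by (simp only: R6 dr_def)
  then show ?thesis by simp
qed

text \<open>Mirror image of \<open>delta_unit\<close>: \<open>R6\<close> is the case U = V = I, and
  \<open>R1\<close> with the other four objects equal to I spreads it to all U and V.\<close>

lemma gamma_unit:
  assumes [simp]: "U \<in> Ob \<C>" "V \<in> Ob \<C>"
  shows "\<gamma> I I U V \<cdot> ((dr \<odot> U) \<bullet> V) = lci (U \<bullet> (I \<odot> V)) \<cdot> (lc U \<bullet> lci V)"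
proof -
  let ?e = "((dr \<odot> I) \<bullet> I) \<odot> (U \<bullet> V)"
  let ?L = "I \<odot> (lc U \<bullet> (I \<odot> lc V))"
  let ?z = "\<zeta> I I U V" and ?m = "(lc I \<bullet> I) \<odot> (U \<bullet> V)"
  have tri: "(I \<odot> lc V) \<cdot> ac I I V = lc I \<odot> V" "(I \<odot> lc U) \<cdot> ac I I U = lc I \<odot> U"
    using circ.triangle[of I V] circ.triangle[of I U] circ.lunit_unit by simp_all
  have "?L \<cdot> (I \<odot> ((I \<odot> U) \<bullet> ac I I V)) \<cdot> (I \<odot> \<zeta> I (I \<odot> I) U V) \<cdot>
        ac I (I \<bullet> (I \<odot> I)) (U \<bullet> V) \<cdot> (\<gamma> I I I I \<odot> (U \<bullet> V)) \<cdot> ?e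
    = (I \<odot> (lc U \<bullet> (lc I \<odot> V))) \<cdot> (I \<odot> \<zeta> I (I \<odot> I) U V) \<cdot>
        ac I (I \<bullet> (I \<odot> I)) (U \<bullet> V) \<cdot> ((I \<odot> (I \<bullet> lci I)) \<odot> (U \<bullet> V)) \<cdot> (lci (I \<bullet> I) \<odot> (U \<bullet> V)) \<cdot> ?m"
    by (simp add: gamma_unit_unit tri)
  also have "\<dots> = (I \<odot> (lc U \<bullet> (lc I \<odot> V))) \<cdot> (I \<odot> \<zeta> I (I \<odot> I) U V) \<cdot>
        (I \<odot> ((I \<bullet> lci I) \<odot> (U \<bullet> V))) \<cdot> ac I (I \<bullet> I) (U \<bullet> V) \<cdot> (lci (I \<bullet> I) \<odot> (U \<bullet> V)) \<cdot> ?m"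
    using circ.ext2[OF circ.assoc_nat[of I "I \<bullet> lci I" "U \<bullet> V" I "I \<bullet> (I \<odot> I)" "U \<bullet> V"], of "(lci (I \<bullet> I) \<odot> (U \<bullet> V)) \<cdot> ?m"] by simp
  also have "\<dots> = (I \<odot> (lc U \<bullet> (I \<odot> V))) \<cdot> (I \<odot> ?z) \<cdot> lci ((I \<bullet> I) \<odot> (U \<bullet> V)) \<cdot> ?m"
    using circ.ext2[OF circ.assoc_inv_lunit[of "I \<bullet> I" "U \<bullet> V"], of ?m]
      zeta_nat[of I "lci I" U V I "I \<odot> I" U V] by simp
  also have "\<dots> = lci (U \<bullet> (I \<odot> V)) \<cdot> ((lc U \<bullet> (I \<odot> V)) \<cdot> ?z) \<cdot> ?m"
    using circ.ext2[OF circ.inv_lunit_nat[of "(lc U \<bullet> (I \<odot> V)) \<cdot> ?z" "U \<bullet> (I \<odot> V)"], of ?m] by simp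
  finally have right: "?L \<cdot> (I \<odot> ((I \<odot> U) \<bullet> ac I I V)) \<cdot> (I \<odot> \<zeta> I (I \<odot> I) U V) \<cdot>
        ac I (I \<bullet> (I \<odot> I)) (U \<bullet> V) \<cdot> (\<gamma> I I I I \<odot> (U \<bullet> V)) \<cdot> ?e
    = lci (U \<bullet> (I \<odot> V)) \<cdot> ((lc U \<bullet> (I \<odot> V)) \<cdot> ?z) \<cdot> ?m" .
  have "?L \<cdot> \<gamma> I I (I \<odot> U) (I \<odot> V) \<cdot> (ac (I \<bullet> I\<^sup>-) I U \<bullet> (I \<odot> V)) \<cdot> \<zeta> ((I \<bullet> I\<^sup>-) \<odot> I) I U V \<cdot> ?e
    = ?L \<cdot> \<gamma> I I (I \<odot> U) (I \<odot> V) \<cdot> (ac (I \<bullet> I\<^sup>-) I U \<bullet> (I \<odot> V)) \<cdot> (((dr \<odot> I) \<odot> U) \<bullet> (I \<odot> V)) \<cdot> \<zeta> (I \<odot> I) I U V"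
    using zeta_nat[of "dr \<odot> I" I U V "(I \<bullet> I\<^sup>-) \<odot> I" I U V] by simp
  also have "\<dots> = ?L \<cdot> \<gamma> I I (I \<odot> U) (I \<odot> V) \<cdot> (((dr \<odot> (I \<odot> U)) \<cdot> ac I I U) \<bullet> (I \<odot> V)) \<cdot> \<zeta> (I \<odot> I) I U V"
    using circ.assoc_nat[of dr I U "I \<bullet> I\<^sup>-" I U] by simp
  also have "\<dots> = \<gamma> I I U V \<cdot> (((I \<bullet> I\<^sup>-) \<odot> lc U) \<bullet> lc V) \<cdot> (((dr \<odot> (I \<odot> U)) \<cdot> ac I I U) \<bullet> (I \<odot> V)) \<cdot> \<zeta> (I \<odot> I) I U V"
    using circ.ext2[OF gamma_nat[of I I "lc U" "lc V" I I U V], of "(((dr \<odot> (I \<odot> U)) \<cdot> ac I I U) \<bullet> (I \<odot> V)) \<cdot> \<zeta> (I \<odot> I) I U V"]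
    by simp
  also have "\<dots> = \<gamma> I I U V \<cdot> (((dr \<odot> U) \<cdot> (I \<odot> lc U) \<cdot> ac I I U) \<bullet> lc V) \<cdot> \<zeta> (I \<odot> I) I U V"
    by simp
  also have "\<dots> = \<gamma> I I U V \<cdot> ((dr \<odot> U) \<bullet> lc V) \<cdot> ((lc I \<odot> U) \<bullet> (I \<odot> V)) \<cdot> \<zeta> (I \<odot> I) I U V"
    unfolding tri by simp
  also have "\<dots> = (\<gamma> I I U V \<cdot> ((dr \<odot> U) \<bullet> lc V) \<cdot> ?z) \<cdot> ?m"
    using zeta_nat[of "lc I" I U V I I U V] by simp
  finally have "(\<gamma> I I U V \<cdot> ((dr \<odot> U) \<bullet> lc V) \<cdot> ?z) \<cdot> ?m = (lci (U \<bullet> (I \<odot> V)) \<cdot> (lc U \<bullet> (I \<odot> V)) \<cdot> ?z) \<cdot> ?m"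
    using right arg_cong[OF R1[of I I I I U V], of "\<lambda>f. ?L \<cdot> f \<cdot> ?e"] by simp
  then have "\<gamma> I I U V \<cdot> ((dr \<odot> U) \<bullet> lc V) \<cdot> ?z = lci (U \<bullet> (I \<odot> V)) \<cdot> (lc U \<bullet> (I \<odot> V)) \<cdot> ?z"
    by (rule circ.iso_epi[rotated]) (simp_all add: circ.iso_tens blt.iso_tens)
  from arg_cong[OF this, of "\<lambda>f. f \<cdot> (\<Delta>\<^sub>I \<odot> (U \<bullet> V)) \<cdot> lci (U \<bullet> V) \<cdot> (lc U \<bullet> V)"]
  show ?thesis
    using circ.ext2[OF zeta_lc_inv[of U V], of "lci (U \<bullet> V) \<cdot> (lc U \<bullet> V)"] by simp
qed

text \<open>When the two monoidal structures agree, \<open>Lam\<close> and the map \<open>lam\<close> defined below are unit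
  constraints; in general they are mutually inverse for cofree \<open>I\<close>-comodules \<open>N\<close>.\<close>

definition Lam where
  "Lam N n V = (N \<odot> (lb V \<cdot> (J \<bullet> lc V))) \<cdot> \<gamma> N I J V \<cdot> ((((N \<bullet> \<phi>c\<^sub>0) \<cdot> n) \<odot> J) \<bullet> V)"

definition Lam' where
  "Lam' V N n = ((rb V \<cdot> (rc V \<bullet> J)) \<odot> N) \<cdot> \<delta> V J I N \<cdot> (V \<bullet> (J \<odot> ((\<phi>c\<^sub>0 \<bullet> N) \<cdot> n)))"

lemma Lam_arr [simp]:
  assumes "N \<in> Ob \<C>" "n \<in> Arr \<C>" "Dom \<C> n = N" "Cod \<C> n = N \<bullet> I" "V \<in> Ob \<C>"
  shows "Lam N n V \<in> Arr \<C>" "Dom \<C> (Lam N n V) = (N \<odot> J) \<bullet> V" "Cod \<C> (Lam N n V) = N \<odot> V"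
  using assms by (simp_all add: Lam_def)

lemma Lam'_arr [simp]:
  assumes "N \<in> Ob \<C>" "n \<in> Arr \<C>" "Dom \<C> n = N" "Cod \<C> n = I \<bullet> N" "V \<in> Ob \<C>"
  shows "Lam' V N n \<in> Arr \<C>" "Dom \<C> (Lam' V N n) = V \<bullet> (J \<odot> N)" "Cod \<C> (Lam' V N n) = V \<odot> N"
  using assms by (simp_all add: Lam'_def)

text \<open>Colinearity moves f past the coaction that begins \<open>Lam\<close>; the rest is
  naturality of \<gamma> and of the unit constraints.\<close>

lemma Lam_nat:
  assumes [simp]: "N \<in> Ob \<C>" "n \<in> Arr \<C>" "Dom \<C> n = N" "Cod \<C> n = N \<bullet> I"
    "N' \<in> Ob \<C>" "n' \<in> Arr \<C>" "Dom \<C> n' = N'" "Cod \<C> n' = N' \<bullet> I"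
    "f \<in> Arr \<C>" "Dom \<C> f = N" "Cod \<C> f = N'" "g \<in> Arr \<C>" "Dom \<C> g = V" "Cod \<C> g = V'"
    and colin: "n' \<cdot> f = (f \<bullet> I) \<cdot> n"
  shows "Lam N' n' V' \<cdot> ((f \<odot> J) \<bullet> g) = (f \<odot> g) \<cdot> Lam N n V"
proof -
  have [simp]: "V \<in> Ob \<C>" "V' \<in> Ob \<C>" using circ.dom_ob[of g] circ.cod_ob[of g] by simp_all
  let ?c = "((((N \<bullet> \<phi>c\<^sub>0) \<cdot> n) \<odot> J) \<bullet> V)"
  have "Lam N' n' V' \<cdot> ((f \<odot> J) \<bullet> g) = (N' \<odot> (lb V' \<cdot> (J \<bullet> lc V'))) \<cdot> \<gamma> N' I J V' \<cdot> ((((N' \<bullet> \<phi>c\<^sub>0) \<cdot> n' \<cdot> f) \<odot> J) \<bullet> g)"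
    by (simp add: Lam_def)
  also have "\<dots> = (N' \<odot> (lb V' \<cdot> (J \<bullet> lc V'))) \<cdot> \<gamma> N' I J V' \<cdot> (((f \<bullet> I\<^sup>-) \<odot> J) \<bullet> g) \<cdot> ?c"
    by (simp add: colin)
  also have "\<dots> = (f \<odot> (lb V' \<cdot> (J \<bullet> (lc V' \<cdot> (I \<odot> g))))) \<cdot> \<gamma> N I J V \<cdot> ?c"
    using circ.ext2[OF gamma_nat[of f I J g N' I J V'], of ?c] by simp
  also have "\<dots> = (f \<odot> ((lb V' \<cdot> (J \<bullet> g)) \<cdot> (J \<bullet> lc V))) \<cdot> \<gamma> N I J V \<cdot> ?c"
    using circ.lunit_nat[of g V'] by simp
  also have "\<dots> = (f \<odot> g) \<cdot> Lam N n V"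
    using blt.lunit_nat[of g V'] by (simp add: Lam_def)
  finally show ?thesis .
qed

lemma Lam'_nat:
  assumes [simp]: "N \<in> Ob \<C>" "n \<in> Arr \<C>" "Dom \<C> n = N" "Cod \<C> n = I \<bullet> N"
    "N' \<in> Ob \<C>" "n' \<in> Arr \<C>" "Dom \<C> n' = N'" "Cod \<C> n' = I \<bullet> N'"
    "f \<in> Arr \<C>" "Dom \<C> f = N" "Cod \<C> f = N'" "g \<in> Arr \<C>" "Dom \<C> g = V" "Cod \<C> g = V'"
    and colin: "n' \<cdot> f = (I \<bullet> f) \<cdot> n"
  shows "Lam' V' N' n' \<cdot> (g \<bullet> (J \<odot> f)) = (g \<odot> f) \<cdot> Lam' V N n"
proof -
  have [simp]: "V \<in> Ob \<C>" "V' \<in> Ob \<C>" using circ.dom_ob[of g] circ.cod_ob[of g] by simp_all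
  let ?c = "V \<bullet> (J \<odot> ((\<phi>c\<^sub>0 \<bullet> N) \<cdot> n))"
  have "Lam' V' N' n' \<cdot> (g \<bullet> (J \<odot> f)) = ((rb V' \<cdot> (rc V' \<bullet> J)) \<odot> N') \<cdot> \<delta> V' J I N' \<cdot> (g \<bullet> (J \<odot> ((\<phi>c\<^sub>0 \<bullet> N') \<cdot> n' \<cdot> f)))"
    by (simp add: Lam'_def)
  also have "\<dots> = ((rb V' \<cdot> (rc V' \<bullet> J)) \<odot> N') \<cdot> \<delta> V' J I N' \<cdot> (g \<bullet> (J \<odot> (I\<^sup>- \<bullet> f))) \<cdot> ?c"
    by (simp add: colin)
  also have "\<dots> = ((rb V' \<cdot> ((rc V' \<cdot> (g \<odot> I)) \<bullet> J)) \<odot> f) \<cdot> \<delta> V J I N \<cdot> ?c"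
    using circ.ext2[OF delta_nat[of g J I f V' J I N'], of ?c] by simp
  also have "\<dots> = (((rb V' \<cdot> (g \<bullet> J)) \<cdot> (rc V \<bullet> J)) \<odot> f) \<cdot> \<delta> V J I N \<cdot> ?c"
    using circ.runit_nat[of g V'] by simp
  also have "\<dots> = (g \<odot> f) \<cdot> Lam' V N n"
    using blt.runit_nat[of g V'] by (simp add: Lam'_def)
  finally show ?thesis .
qed

text \<open>For N = I the coaction inside \<open>Lam\<close> is \<open>dr\<close>, so
  \<open>gamma_unit\<close> leaves only unit constraints.\<close>

lemma Lam_unit:
  assumes [simp]: "V \<in> Ob \<C>"
  shows "Lam I \<Delta>\<^sub>I V = lci V \<cdot> lb V \<cdot> (lc J \<bullet> V)"
proof -
  have "Lam I \<Delta>\<^sub>I V = (I \<odot> (lb V \<cdot> (J \<bullet> lc V))) \<cdot> lci (J \<bullet> (I \<odot> V)) \<cdot> (lc J \<bullet> lci V)"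
    by (simp add: Lam_def dr_def[symmetric] gamma_unit)
  also have "\<dots> = lci V \<cdot> lb V \<cdot> (J \<bullet> lc V) \<cdot> (lc J \<bullet> lci V)"
    using circ.ext2[OF circ.inv_lunit_nat[of "lb V \<cdot> (J \<bullet> lc V)" V], of "lc J \<bullet> lci V"] by simp
  finally show ?thesis by simp
qed

lemma Lam'_unit:
  assumes [simp]: "V \<in> Ob \<C>"
  shows "Lam' V I \<Delta>\<^sub>I = rci V \<cdot> rb V \<cdot> (V \<bullet> rc J)"
proof -
  have "Lam' V I \<Delta>\<^sub>I = ((rb V \<cdot> (rc V \<bullet> J)) \<odot> I) \<cdot> rci ((V \<odot> I) \<bullet> J) \<cdot> (rci V \<bullet> rc J)"
    by (simp add: Lam'_def dl_def[symmetric] delta_unit)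
  also have "\<dots> = rci V \<cdot> rb V \<cdot> (rc V \<bullet> J) \<cdot> (rci V \<bullet> rc J)"
    using circ.ext2[OF circ.inv_runit_nat[of "rb V \<cdot> (rc V \<bullet> J)" V], of "rci V \<bullet> rc J"] by simp
  finally show ?thesis by simp
qed

end

section \<open>Cofree comodules over I\<close>

context duoidal_category
begin

text \<open>The coaction of the cofree right I-comodule X \<bullet> I; \<open>co'\<close> is the
  coaction of the cofree left comodule I \<bullet> X. It is for comodules of this kind that
  \<open>Lam\<close> is inverted.\<close>

definition co where "co X = abi X I I \<cdot> (X \<bullet> \<Delta>\<^sub>I)"
definition co' where "co' X = ab I I X \<cdot> (\<Delta>\<^sub>I \<bullet> X)"

lemma co_arr [simp]:
  assumes "X \<in> Ob \<C>"
  shows "co X \<in> Arr \<C>" "Dom \<C> (co X) = X \<bullet> I" "Cod \<C> (co X) = (X \<bullet> I) \<bullet> I"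
    "co' X \<in> Arr \<C>" "Dom \<C> (co' X) = I \<bullet> X" "Cod \<C> (co' X) = I \<bullet> (I \<bullet> X)"
  using assms by (simp_all add: co_def co'_def)

lemma co_nat:
  assumes [simp]: "f \<in> Arr \<C>" "Dom \<C> f = X" "Cod \<C> f = Y"
  shows "co Y \<cdot> (f \<bullet> I) = ((f \<bullet> I) \<bullet> I) \<cdot> co X"
proof -
  have [simp]: "X \<in> Ob \<C>" "Y \<in> Ob \<C>" using circ.dom_ob[of f] circ.cod_ob[of f] by simp_all
  show ?thesis using circ.ext2[OF blt.inv_assoc_nat[of f I I Y I I], of "X \<bullet> \<Delta>\<^sub>I"] by (simp add: co_def)
qed

lemma co'_nat:
  assumes [simp]: "f \<in> Arr \<C>" "Dom \<C> f = X" "Cod \<C> f = Y"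
  shows "co' Y \<cdot> (I \<bullet> f) = (I \<bullet> (I \<bullet> f)) \<cdot> co' X"
proof -
  have [simp]: "X \<in> Ob \<C>" "Y \<in> Ob \<C>" using circ.dom_ob[of f] circ.cod_ob[of f] by simp_all
  show ?thesis using circ.ext2[OF blt.assoc_nat[of I I f I I Y], of "\<Delta>\<^sub>I \<bullet> X"] by (simp add: co'_def)
qed

lemma I_coassoc: "ab I I I \<cdot> (\<Delta>\<^sub>I \<bullet> I) \<cdot> \<Delta>\<^sub>I = (I \<bullet> \<Delta>\<^sub>I) \<cdot> \<Delta>\<^sub>I"
  using I_comonoid by (simp add: comonoid_in_def)

lemma I_coassoc_inv: "abi I I I \<cdot> (I \<bullet> \<Delta>\<^sub>I) \<cdot> \<Delta>\<^sub>I = (\<Delta>\<^sub>I \<bullet> I) \<cdot> \<Delta>\<^sub>I"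
  by (simp flip: I_coassoc)

text \<open>Coassociativity of I makes \<open>(u \<bullet> I) \<cdot> \<Delta>\<^sub>I\<close> a
  colinear arrow from I to X \<bullet> I. With u the unit of a monoid, \<open>Lam_nat\<close> then
  applies to the right-hand side of an antipode equation.\<close>

lemma co_unit:
  assumes [simp]: "u \<in> Arr \<C>" "Dom \<C> u = I" "Cod \<C> u = X"
  shows "co X \<cdot> (u \<bullet> I) \<cdot> \<Delta>\<^sub>I = (((u \<bullet> I) \<cdot> \<Delta>\<^sub>I) \<bullet> I) \<cdot> \<Delta>\<^sub>I"
proof -
  have [simp]: "X \<in> Ob \<C>" using circ.cod_ob[of u] by simp_all
  have "co X \<cdot> (u \<bullet> I) \<cdot> \<Delta>\<^sub>I = ((u \<bullet> I) \<bullet> I) \<cdot> co I \<cdot> \<Delta>\<^sub>I"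
    using circ.ext2[OF co_nat[of u I X], of \<Delta>\<^sub>I] by simp
  then show ?thesis by (simp add: co_def I_coassoc_inv)
qed

lemma co'_unit:
  assumes [simp]: "u \<in> Arr \<C>" "Dom \<C> u = I" "Cod \<C> u = X"
  shows "co' X \<cdot> (I \<bullet> u) \<cdot> \<Delta>\<^sub>I = (I \<bullet> ((I \<bullet> u) \<cdot> \<Delta>\<^sub>I)) \<cdot> \<Delta>\<^sub>I"
proof -
  have [simp]: "X \<in> Ob \<C>" using circ.cod_ob[of u] by simp_all
  have "co' X \<cdot> (I \<bullet> u) \<cdot> \<Delta>\<^sub>I = (I \<bullet> (I \<bullet> u)) \<cdot> co' I \<cdot> \<Delta>\<^sub>I"
    using circ.ext2[OF co'_nat[of u I X], of \<Delta>\<^sub>I] by simp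
  then show ?thesis by (simp add: co'_def I_coassoc)
qed

end

section \<open>The transformations \<open>\<phi>\<close> and \<open>\<psi>\<close> after
  cancellation of J\<close>

context reversion
begin

lemma phi_arr [simp]:
  assumes "X \<in> Ob \<C>" "Y \<in> Ob \<C>"
  shows "\<phi> X Y \<in> Arr \<C>" "Dom \<C> (\<phi> X Y) = X \<bullet> Y\<^sup>-" "Cod \<C> (\<phi> X Y) = ((X \<odot> Y) \<bullet> I) \<odot> J"
    "\<psi> X Y \<in> Arr \<C>" "Dom \<C> (\<psi> X Y) = X\<^sup>- \<bullet> Y" "Cod \<C> (\<psi> X Y) = J \<odot> (I \<bullet> (X \<odot> Y))"
  using assms by (simp_all add: \<phi>_def \<psi>_def)

lemma phi_nat:
  assumes [simp]: "f \<in> Arr \<C>" "g \<in> Arr \<C>" "Dom \<C> f = X" "Cod \<C> f = X'" "Dom \<C> g = Y" "Cod \<C> g = Y'"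
  shows "\<phi> X' Y' \<cdot> (f \<bullet> g\<^sup>-) = (((f \<odot> g) \<bullet> I) \<odot> J) \<cdot> \<phi> X Y"
proof -
  have [simp]: "X \<in> Ob \<C>" "X' \<in> Ob \<C>" "Y \<in> Ob \<C>" "Y' \<in> Ob \<C>"
    using circ.dom_ob[of f] circ.cod_ob[of f] circ.dom_ob[of g] circ.cod_ob[of g] by simp_all
  have "((I \<odot> rbi Y'\<^sup>-) \<cdot> lci Y'\<^sup>-) \<cdot> g\<^sup>- = (I \<odot> (g\<^sup>- \<bullet> J)) \<cdot> (I \<odot> rbi Y\<^sup>-) \<cdot> lci Y\<^sup>-"
    using circ.inv_lunit_nat[of "g\<^sup>-" "Y'\<^sup>-"] blt.inv_runit_nat[of "g\<^sup>-" "Y'\<^sup>-"] by simp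
  then have "\<phi> X' Y' \<cdot> (f \<bullet> g\<^sup>-) = \<delta> X' I Y' J \<cdot> (f \<bullet> (I \<odot> (g\<^sup>- \<bullet> J))) \<cdot> (X \<bullet> ((I \<odot> rbi Y\<^sup>-) \<cdot> lci Y\<^sup>-))"
    by (simp add: \<phi>_def)
  then show ?thesis
    using circ.ext2[OF delta_nat[of f I g J X' I Y' J], of "X \<bullet> ((I \<odot> rbi Y\<^sup>-) \<cdot> lci Y\<^sup>-)"] by (simp add: \<phi>_def)
qed

lemma psi_nat:
  assumes [simp]: "f \<in> Arr \<C>" "g \<in> Arr \<C>" "Dom \<C> f = X" "Cod \<C> f = X'" "Dom \<C> g = Y" "Cod \<C> g = Y'"
  shows "\<psi> X' Y' \<cdot> (f\<^sup>- \<bullet> g) = (J \<odot> (I \<bullet> (f \<odot> g))) \<cdot> \<psi> X Y"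
proof -
  have [simp]: "X \<in> Ob \<C>" "X' \<in> Ob \<C>" "Y \<in> Ob \<C>" "Y' \<in> Ob \<C>"
    using circ.dom_ob[of f] circ.cod_ob[of f] circ.dom_ob[of g] circ.cod_ob[of g] by simp_all
  have "((lbi X'\<^sup>- \<odot> I) \<cdot> rci X'\<^sup>-) \<cdot> f\<^sup>- = ((J \<bullet> f\<^sup>-) \<odot> I) \<cdot> (lbi X\<^sup>- \<odot> I) \<cdot> rci X\<^sup>-"
    using circ.inv_runit_nat[of "f\<^sup>-" "X'\<^sup>-"] blt.inv_lunit_nat[of "f\<^sup>-" "X'\<^sup>-"] by simp
  then have "\<psi> X' Y' \<cdot> (f\<^sup>- \<bullet> g) = \<gamma> J X' I Y' \<cdot> (((J \<bullet> f\<^sup>-) \<odot> I) \<bullet> g) \<cdot> (((lbi X\<^sup>- \<odot> I) \<cdot> rci X\<^sup>-) \<bullet> Y)"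
    by (simp add: \<psi>_def)
  then show ?thesis
    using circ.ext2[OF gamma_nat[of J f I g J X' I Y'], of "((lbi X\<^sup>- \<odot> I) \<cdot> rci X\<^sup>-) \<bullet> Y"] by (simp add: \<psi>_def)
qed

text \<open>\<open>\<phi>\<close> is \<delta> with J as its last variable, and \<open>Lam\<close>
  replaces this J by V. The exchange law \<open>R5\<close> turns \<gamma> after \<delta> into
  \<delta> after \<gamma>; the new inner \<gamma> has first variables I and is evaluated by
  \<open>gamma_unit\<close>.\<close>

lemma Lam_phi:
  assumes [simp]: "X \<in> Ob \<C>" "W \<in> Ob \<C>" "V \<in> Ob \<C>"
  shows "Lam ((X \<odot> W) \<bullet> I) (co (X \<odot> W)) V \<cdot> (\<phi> X W \<bullet> V) =
    \<delta> X I W V \<cdot> (X \<bullet> lci (W\<^sup>- \<bullet> V)) \<cdot> ab X W\<^sup>- V"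
proof -
  let ?W = "W\<^sup>-" and ?XW = "X \<odot> W"
  \<comment> \<open>\<open>?q\<close> supplies the factors \<open>I \<bullet> I\<^sup>-\<close> and
    J that the left side of \<open>R5\<close> expects in front of the first \<gamma>;
    \<open>?k\<close> is the tail of \<open>Lam\<close>.\<close>
  let ?q = "(dr \<odot> rbi ?W) \<cdot> lci ?W" and ?q' = "(I \<odot> rbi ?W) \<cdot> lci ?W"
  let ?k = "(?XW \<bullet> I) \<odot> (lb V \<cdot> (J \<bullet> lc V))"
  have "?k \<cdot> \<gamma> (?XW \<bullet> I) I J V \<cdot> ((abi ?XW I I\<^sup>- \<odot> J) \<bullet> V) \<cdot> (\<delta> X (I \<bullet> I\<^sup>-) W J \<bullet> V) \<cdot> ((X \<bullet> ?q) \<bullet> V)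
    = ?k \<cdot> \<gamma> (?XW \<bullet> I) I J V \<cdot> (((abi ?XW I I\<^sup>- \<cdot> (?XW \<bullet> dr)) \<odot> J) \<bullet> V) \<cdot> (\<phi> X W \<bullet> V)"
    using circ.ext2[OF delta_nat[of X dr W J X "I \<bullet> I\<^sup>-" W J], of "X \<bullet> ?q'"] by (simp add: \<phi>_def)
  also have "\<dots> = Lam (?XW \<bullet> I) (co ?XW) V \<cdot> (\<phi> X W \<bullet> V)"
    using circ.ext2[OF blt.inv_assoc_nat[of ?XW I \<phi>c\<^sub>0 ?XW I "I\<^sup>-"], of "?XW \<bullet> \<Delta>\<^sub>I"]
    by (simp add: Lam_def co_def dr_def)
  finally have left: "?k \<cdot> \<gamma> (?XW \<bullet> I) I J V \<cdot> ((abi ?XW I I\<^sup>- \<odot> J) \<bullet> V) \<cdot> (\<delta> X (I \<bullet> I\<^sup>-) W J \<bullet> V) \<cdot> ((X \<bullet> ?q) \<bullet> V)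
    = Lam (?XW \<bullet> I) (co ?XW) V \<cdot> (\<phi> X W \<bullet> V)" .
  have "\<gamma> I I (?W \<bullet> J) V \<cdot> (?q \<bullet> V) = \<gamma> I I (?W \<bullet> J) V \<cdot> ((dr \<odot> (?W \<bullet> J)) \<bullet> V) \<cdot> (?q' \<bullet> V)"
    by simp
  also have "\<dots> = lci ((?W \<bullet> J) \<bullet> (I \<odot> V)) \<cdot> (lc (?W \<bullet> J) \<bullet> lci V) \<cdot> (?q' \<bullet> V)"
    using circ.ext2[OF gamma_unit[of "?W \<bullet> J" V], of "?q' \<bullet> V"] by simp
  also have "\<dots> = lci ((?W \<bullet> J) \<bullet> (I \<odot> V)) \<cdot> (rbi ?W \<bullet> lci V)"
    using circ.ext2[OF circ.lunit_nat[of "rbi ?W" "?W \<bullet> J"], of "lci ?W"] by simp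
  finally have g: "\<gamma> I I (?W \<bullet> J) V \<cdot> (?q \<bullet> V) = lci ((?W \<bullet> J) \<bullet> (I \<odot> V)) \<cdot> (rbi ?W \<bullet> lci V)" .
  let ?v = "lbi (I \<odot> V) \<cdot> lci V"
  have "(I \<odot> ab ?W J (I \<odot> V)) \<cdot> \<gamma> I I (?W \<bullet> J) V \<cdot> (?q \<bullet> V)
    = lci (?W \<bullet> (J \<bullet> (I \<odot> V))) \<cdot> ab ?W J (I \<odot> V) \<cdot> (rbi ?W \<bullet> (I \<odot> V)) \<cdot> (?W \<bullet> lci V)"
    using circ.ext2[OF circ.inv_lunit_nat[of "ab ?W J (I \<odot> V)" "?W \<bullet> (J \<bullet> (I \<odot> V))", symmetric], of "rbi ?W \<bullet> lci V"]
    by (simp add: g)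
  also have "\<dots> = lci (?W \<bullet> (J \<bullet> (I \<odot> V))) \<cdot> (?W \<bullet> ?v)"
    using circ.ext2[OF blt.triangle_inv[of ?W "I \<odot> V"], of "?W \<bullet> lci V"] by simp
  also have "\<dots> = (I \<odot> (?W \<bullet> ?v)) \<cdot> lci (?W \<bullet> V)"
    by (simp add: circ.inv_lunit_nat)
  finally have g': "(I \<odot> ab ?W J (I \<odot> V)) \<cdot> \<gamma> I I (?W \<bullet> J) V \<cdot> (?q \<bullet> V) = (I \<odot> (?W \<bullet> ?v)) \<cdot> lci (?W \<bullet> V)" .
  have v: "lb V \<cdot> (J \<bullet> lc V) \<cdot> ?v = V"
    using circ.ext2[OF blt.lunit_nat[of "lc V" V], of ?v] by simp
  have "?k \<cdot> \<delta> X I W (J \<bullet> (I \<odot> V)) \<cdot> (X \<bullet> (I \<odot> ab ?W J (I \<odot> V))) \<cdot>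
        (X \<bullet> \<gamma> I I (?W \<bullet> J) V) \<cdot> ab X ((I \<bullet> I\<^sup>-) \<odot> (?W \<bullet> J)) V \<cdot> ((X \<bullet> ?q) \<bullet> V)
    = ?k \<cdot> \<delta> X I W (J \<bullet> (I \<odot> V)) \<cdot> (X \<bullet> (I \<odot> ab ?W J (I \<odot> V))) \<cdot>
        (X \<bullet> \<gamma> I I (?W \<bullet> J) V) \<cdot> (X \<bullet> (?q \<bullet> V)) \<cdot> ab X ?W V"
    using blt.assoc_nat[of X ?q V X "(I \<bullet> I\<^sup>-) \<odot> (?W \<bullet> J)" V] by simp
  also have "\<dots> = ?k \<cdot> \<delta> X I W (J \<bullet> (I \<odot> V)) \<cdot> (X \<bullet> ((I \<odot> ab ?W J (I \<odot> V)) \<cdot> \<gamma> I I (?W \<bullet> J) V \<cdot> (?q \<bullet> V))) \<cdot> ab X ?W V"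
    by simp
  also have "\<dots> = ?k \<cdot> \<delta> X I W (J \<bullet> (I \<odot> V)) \<cdot> (X \<bullet> (I \<odot> (?W \<bullet> ?v))) \<cdot> (X \<bullet> lci (?W \<bullet> V)) \<cdot> ab X ?W V"
    unfolding g' by simp
  also have "\<dots> = ((?XW \<bullet> I) \<odot> (lb V \<cdot> (J \<bullet> lc V) \<cdot> ?v)) \<cdot> \<delta> X I W V \<cdot> (X \<bullet> lci (?W \<bullet> V)) \<cdot> ab X ?W V"
    using circ.ext2[OF delta_nat[of X I W ?v X I W "J \<bullet> (I \<odot> V)"], of "(X \<bullet> lci (?W \<bullet> V)) \<cdot> ab X ?W V"] by simp
  also have "\<dots> = \<delta> X I W V \<cdot> (X \<bullet> lci (?W \<bullet> V)) \<cdot> ab X ?W V"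
    unfolding v by simp
  finally show ?thesis
    using left arg_cong[OF R5[of X I I W J V], of "\<lambda>f. ?k \<cdot> f \<cdot> ((X \<bullet> ?q) \<bullet> V)"] by simp
qed

text \<open>Mirror image of \<open>Lam_phi\<close>. In this instance of \<open>R5\<close> it is the
  inner \<delta> that is evaluated, by \<open>delta_unit\<close>.\<close>

lemma Lam'_psi:
  assumes [simp]: "V \<in> Ob \<C>" "W \<in> Ob \<C>" "X \<in> Ob \<C>"
  shows "Lam' V (I \<bullet> (W \<odot> X)) (co' (W \<odot> X)) \<cdot> (V \<bullet> \<psi> W X) \<cdot> ab V W\<^sup>- X =
    \<gamma> V W I X \<cdot> (rci (V \<bullet> W\<^sup>-) \<bullet> X)"
proof -
  let ?W = "W\<^sup>-" and ?WX = "W \<odot> X"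
  let ?q = "(lbi ?W \<odot> dl) \<cdot> rci ?W" and ?q' = "(lbi ?W \<odot> I) \<cdot> rci ?W"
  let ?k = "rb V \<cdot> (rc V \<bullet> J)"
  let ?K = "?k \<odot> (I \<bullet> ?WX)"
  have g: "\<gamma> J W (I\<^sup>- \<bullet> I) X \<cdot> (?q \<bullet> X) = (J \<odot> (dl \<bullet> ?WX)) \<cdot> \<psi> W X"
    using circ.ext2[OF gamma_nat[of J W dl X J W "I\<^sup>- \<bullet> I" X], of "?q' \<bullet> X"] by (simp add: \<psi>_def)
  have "ab (I\<^sup>-) I ?WX \<cdot> (dl \<bullet> ?WX) = (\<phi>c\<^sub>0 \<bullet> (I \<bullet> ?WX)) \<cdot> co' ?WX"
    using circ.ext2[OF blt.assoc_nat[of \<phi>c\<^sub>0 I ?WX "I\<^sup>-" I ?WX], of "\<Delta>\<^sub>I \<bullet> ?WX"] by (simp add: dl_def co'_def)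
  then have g': "(J \<odot> ab (I\<^sup>-) I ?WX) \<cdot> \<gamma> J W (I\<^sup>- \<bullet> I) X \<cdot> (?q \<bullet> X) = (J \<odot> ((\<phi>c\<^sub>0 \<bullet> (I \<bullet> ?WX)) \<cdot> co' ?WX)) \<cdot> \<psi> W X"
    using circ.ext2[of "J \<odot> ab (I\<^sup>-) I ?WX" "J \<odot> (dl \<bullet> ?WX)" _ "\<psi> W X", OF refl] by (simp add: g)
  have "?K \<cdot> \<delta> V J I (I \<bullet> ?WX) \<cdot> (V \<bullet> (J \<odot> ab (I\<^sup>-) I ?WX)) \<cdot>
        (V \<bullet> \<gamma> J W (I\<^sup>- \<bullet> I) X) \<cdot> ab V ((J \<bullet> ?W) \<odot> (I\<^sup>- \<bullet> I)) X \<cdot> ((V \<bullet> ?q) \<bullet> X)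
     = ?K \<cdot> \<delta> V J I (I \<bullet> ?WX) \<cdot> (V \<bullet> ((J \<odot> ab (I\<^sup>-) I ?WX) \<cdot> \<gamma> J W (I\<^sup>- \<bullet> I) X \<cdot> (?q \<bullet> X))) \<cdot> ab V ?W X"
    using blt.assoc_nat[of V ?q X V "(J \<bullet> ?W) \<odot> (I\<^sup>- \<bullet> I)" X] by simp
  also have "\<dots> = Lam' V (I \<bullet> ?WX) (co' ?WX) \<cdot> (V \<bullet> \<psi> W X) \<cdot> ab V ?W X"
    unfolding g' by (simp add: Lam'_def)
  finally have left: "?K \<cdot> \<delta> V J I (I \<bullet> ?WX) \<cdot> (V \<bullet> (J \<odot> ab (I\<^sup>-) I ?WX)) \<cdot>
        (V \<bullet> \<gamma> J W (I\<^sup>- \<bullet> I) X) \<cdot> ab V ((J \<bullet> ?W) \<odot> (I\<^sup>- \<bullet> I)) X \<cdot> ((V \<bullet> ?q) \<bullet> X)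
     = Lam' V (I \<bullet> ?WX) (co' ?WX) \<cdot> (V \<bullet> \<psi> W X) \<cdot> ab V ?W X" .
  let ?r = "rbi (V \<odot> I) \<cdot> rci V"
  have k: "?k \<cdot> ?r = V"
    using circ.ext2[OF blt.runit_nat[of "rc V" V], of ?r] by simp
  have "\<delta> V (J \<bullet> ?W) I I \<cdot> (V \<bullet> ?q) = \<delta> V (J \<bullet> ?W) I I \<cdot> (V \<bullet> ((J \<bullet> ?W) \<odot> dl)) \<cdot> (V \<bullet> ?q')"
    by simp
  also have "\<dots> = rci ((V \<odot> I) \<bullet> (J \<bullet> ?W)) \<cdot> (rci V \<bullet> rc (J \<bullet> ?W)) \<cdot> (V \<bullet> ?q')"
    using circ.ext2[OF delta_unit[of V "J \<bullet> ?W"], of "V \<bullet> ?q'"] by simp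
  also have "\<dots> = rci ((V \<odot> I) \<bullet> (J \<bullet> ?W)) \<cdot> (rci V \<bullet> lbi ?W)"
    using circ.ext2[OF circ.runit_nat[of "lbi ?W" "J \<bullet> ?W"], of "rci ?W"] by simp
  finally have d: "\<delta> V (J \<bullet> ?W) I I \<cdot> (V \<bullet> ?q) = rci ((V \<odot> I) \<bullet> (J \<bullet> ?W)) \<cdot> ((V \<odot> I) \<bullet> lbi ?W) \<cdot> (rci V \<bullet> ?W)"
    by simp
  have "(abi (V \<odot> I) J ?W \<odot> I) \<cdot> \<delta> V (J \<bullet> ?W) I I \<cdot> (V \<bullet> ?q)
     = rci (((V \<odot> I) \<bullet> J) \<bullet> ?W) \<cdot> abi (V \<odot> I) J ?W \<cdot> ((V \<odot> I) \<bullet> lbi ?W) \<cdot> (rci V \<bullet> ?W)"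
    unfolding d using circ.ext2[OF circ.inv_runit_nat[of "abi (V \<odot> I) J ?W" "((V \<odot> I) \<bullet> J) \<bullet> ?W", symmetric], of "rci V \<bullet> lbi ?W"] by simp
  also have "\<dots> = rci (((V \<odot> I) \<bullet> J) \<bullet> ?W) \<cdot> (?r \<bullet> ?W)"
    using circ.ext2[OF blt.inv_triangle_inv[of "V \<odot> I" ?W], of "rci V \<bullet> ?W"] by simp
  also have "\<dots> = ((?r \<bullet> ?W) \<odot> I) \<cdot> rci (V \<bullet> ?W)"
    by (simp add: circ.inv_runit_nat)
  finally have d': "(abi (V \<odot> I) J ?W \<odot> I) \<cdot> \<delta> V (J \<bullet> ?W) I I \<cdot> (V \<bullet> ?q) = ((?r \<bullet> ?W) \<odot> I) \<cdot> rci (V \<bullet> ?W)" .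
  have "?K \<cdot> \<gamma> ((V \<odot> I) \<bullet> J) W I X \<cdot> ((abi (V \<odot> I) J ?W \<odot> I) \<bullet> X) \<cdot> (\<delta> V (J \<bullet> ?W) I I \<bullet> X) \<cdot> ((V \<bullet> ?q) \<bullet> X)
     = ?K \<cdot> \<gamma> ((V \<odot> I) \<bullet> J) W I X \<cdot> (((abi (V \<odot> I) J ?W \<odot> I) \<cdot> \<delta> V (J \<bullet> ?W) I I \<cdot> (V \<bullet> ?q)) \<bullet> X)"
    by simp
  also have "\<dots> = ?K \<cdot> \<gamma> ((V \<odot> I) \<bullet> J) W I X \<cdot> (((?r \<bullet> ?W) \<odot> I) \<bullet> X) \<cdot> (rci (V \<bullet> ?W) \<bullet> X)"
    unfolding d' by simp
  also have "\<dots> = ((?k \<cdot> ?r) \<odot> (I \<bullet> ?WX)) \<cdot> \<gamma> V W I X \<cdot> (rci (V \<bullet> ?W) \<bullet> X)"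
    using circ.ext2[OF gamma_nat[of ?r W I X "(V \<odot> I) \<bullet> J" W I X], of "rci (V \<bullet> ?W) \<bullet> X"] by simp
  also have "\<dots> = \<gamma> V W I X \<cdot> (rci (V \<bullet> ?W) \<bullet> X)"
    unfolding k by simp
  finally show ?thesis
    using left arg_cong[OF R5[of V J W I I X], of "\<lambda>f. ?K \<cdot> f \<cdot> ((V \<bullet> ?q) \<bullet> X)"] by simp
qed

end

context monoidal_category
begin

lemma inv_pentagon:
  assumes [simp]: "W \<in> Ob \<C>" "X \<in> Ob \<C>" "Y \<in> Ob \<C>" "Z \<in> Ob \<C>"
  shows "inv_assoc (W \<star> X) Y Z \<cdot> inv_assoc W X (Y \<star> Z) \<cdot> (W \<star> assoc T X Y Z) =
    (inv_assoc W X Y \<star> Z) \<cdot> inv_assoc W (X \<star> Y) Z"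
proof -
  let ?p = "(inv_assoc W X Y \<star> Z) \<cdot> inv_assoc W (X \<star> Y) Z"
  have "inv_assoc (W \<star> X) Y Z \<cdot> inv_assoc W X (Y \<star> Z) \<cdot> (W \<star> assoc T X Y Z)
    = inv_assoc (W \<star> X) Y Z \<cdot> inv_assoc W X (Y \<star> Z) \<cdot> ((W \<star> assoc T X Y Z) \<cdot> assoc T W (X \<star> Y) Z \<cdot> (assoc T W X Y \<star> Z)) \<cdot> ?p"
    by simp
  also have "\<dots> = inv_assoc (W \<star> X) Y Z \<cdot> inv_assoc W X (Y \<star> Z) \<cdot> (assoc T W X (Y \<star> Z) \<cdot> assoc T (W \<star> X) Y Z) \<cdot> ?p"
    by (simp only: pentagon assms)
  also have "\<dots> = ?p" by simp
  finally show ?thesis .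
qed

end

section \<open>Laws of the cofree coaction and the candidate for the inverse of
  \<open>Lam\<close>\<close>

context duoidal_category
begin

lemma co_coassoc:
  assumes [simp]: "X \<in> Ob \<C>"
  shows "co (X \<bullet> I) \<cdot> co X = (co X \<bullet> I) \<cdot> co X"
proof -
  have "co (X \<bullet> I) \<cdot> co X = abi (X \<bullet> I) I I \<cdot> abi X I (I \<bullet> I) \<cdot> (X \<bullet> (I \<bullet> \<Delta>\<^sub>I)) \<cdot> (X \<bullet> \<Delta>\<^sub>I)"
    using circ.ext2[OF blt.inv_assoc_nat[of X I \<Delta>\<^sub>I X I "I \<bullet> I"], of "X \<bullet> \<Delta>\<^sub>I"] by (simp add: co_def)
  also have "\<dots> = (abi (X \<bullet> I) I I \<cdot> abi X I (I \<bullet> I) \<cdot> (X \<bullet> ab I I I)) \<cdot> (X \<bullet> ((\<Delta>\<^sub>I \<bullet> I) \<cdot> \<Delta>\<^sub>I))"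
    by (simp add: I_coassoc)
  also have "\<dots> = ((abi X I I \<bullet> I) \<cdot> abi X (I \<bullet> I) I) \<cdot> (X \<bullet> ((\<Delta>\<^sub>I \<bullet> I) \<cdot> \<Delta>\<^sub>I))"
    by (simp only: blt.inv_pentagon assms circ.unit_ob')
  also have "\<dots> = (abi X I I \<bullet> I) \<cdot> abi X (I \<bullet> I) I \<cdot> (X \<bullet> (\<Delta>\<^sub>I \<bullet> I)) \<cdot> (X \<bullet> \<Delta>\<^sub>I)"
    by simp
  also have "\<dots> = (co X \<bullet> I) \<cdot> co X"
    using circ.ext2[OF blt.inv_assoc_nat[of X \<Delta>\<^sub>I I X "I \<bullet> I" I], of "X \<bullet> \<Delta>\<^sub>I"] by (simp add: co_def)
  finally show ?thesis .
qed

lemma co_counit: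
  assumes [simp]: "X \<in> Ob \<C>"
  shows "rb (X \<bullet> I) \<cdot> ((X \<bullet> I) \<bullet> \<epsilon>\<^sub>I) \<cdot> co X = X \<bullet> I"
proof -
  have "((X \<bullet> I) \<bullet> \<epsilon>\<^sub>I) \<cdot> co X = abi X I J \<cdot> (X \<bullet> rbi I)"
    using circ.ext2[OF blt.inv_assoc_nat[of X I \<epsilon>\<^sub>I X I J, symmetric], of "X \<bullet> \<Delta>\<^sub>I"] by (simp add: co_def I_counit_right)
  then show ?thesis by (simp add: blt.inv_assoc_inv_runit)
qed

text \<open>The counit removes the inner one of the two copies of I; in \<open>co_counit\<close> it
  removes the outer one.\<close>

lemma co_counit_left:
  assumes [simp]: "X \<in> Ob \<C>"
  shows "((rb X \<cdot> (X \<bullet> \<epsilon>\<^sub>I)) \<bullet> I) \<cdot> co X = X \<bullet> I"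
proof -
  have "((X \<bullet> \<epsilon>\<^sub>I) \<bullet> I) \<cdot> co X = abi X J I \<cdot> (X \<bullet> lbi I)"
    using circ.ext2[OF blt.inv_assoc_nat[of X \<epsilon>\<^sub>I I X J I, symmetric], of "X \<bullet> \<Delta>\<^sub>I"] by (simp add: co_def I_counit_left)
  then have "(rb X \<bullet> I) \<cdot> ((X \<bullet> \<epsilon>\<^sub>I) \<bullet> I) \<cdot> co X = (rb X \<bullet> I) \<cdot> abi X J I \<cdot> (X \<bullet> lbi I)"
    by simp
  then show ?thesis using circ.ext2[OF blt.inv_triangle[of X I], of "X \<bullet> lbi I"] by simp
qed

lemma mJ_unit: "m\<^sub>J \<cdot> (\<epsilon>\<^sub>I \<odot> J) = lc J" "m\<^sub>J \<cdot> (J \<odot> \<epsilon>\<^sub>I) = rc J"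
  using J_monoid by (simp_all add: monoid_in_def)

definition lam where "lam N n V = ((N \<odot> J) \<bullet> lc V) \<cdot> \<zeta> N I J V \<cdot> (n \<odot> lbi V)"

lemma lam_arr [simp]:
  assumes "N \<in> Ob \<C>" "n \<in> Arr \<C>" "Dom \<C> n = N" "Cod \<C> n = N \<bullet> I" "V \<in> Ob \<C>"
  shows "lam N n V \<in> Arr \<C>" "Dom \<C> (lam N n V) = N \<odot> V" "Cod \<C> (lam N n V) = (N \<odot> J) \<bullet> V"
  using assms by (simp_all add: lam_def)

text \<open>Since \<open>lc J\<close> equals
  \<open>m\<^sub>J \<cdot> (\<epsilon>\<^sub>I \<odot> J)\<close>, the counit of I can be moved
  through \<zeta>, after which the unit law \<open>zeta_lb\<close> applies.\<close>

lemma zeta_collapse_left: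
  assumes [simp]: "V \<in> Ob \<C>"
  shows "lb V \<cdot> (lc J \<bullet> lc V) \<cdot> \<zeta> I I J V = lc V \<cdot> ((lb I \<cdot> (\<epsilon>\<^sub>I \<bullet> I)) \<odot> lb V)"
proof -
  have "lb (I \<odot> V) \<cdot> (lc J \<bullet> (I \<odot> V)) \<cdot> \<zeta> I I J V = lb (I \<odot> V) \<cdot> (m\<^sub>J \<bullet> (I \<odot> V)) \<cdot> ((\<epsilon>\<^sub>I \<odot> J) \<bullet> (I \<odot> V)) \<cdot> \<zeta> I I J V"
    by (simp add: mJ_unit)
  also have "\<dots> = lb (I \<odot> V) \<cdot> (m\<^sub>J \<bullet> (I \<odot> V)) \<cdot> \<zeta> J I J V \<cdot> ((\<epsilon>\<^sub>I \<bullet> I) \<odot> (J \<bullet> V))"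
    using zeta_nat[of \<epsilon>\<^sub>I I J V J I J V] by simp
  also have "\<dots> = (lb I \<odot> lb V) \<cdot> ((\<epsilon>\<^sub>I \<bullet> I) \<odot> (J \<bullet> V))"
    using circ.ext3[OF zeta_lb[of I V], of "(\<epsilon>\<^sub>I \<bullet> I) \<odot> (J \<bullet> V)"] by simp
  finally have "lb (I \<odot> V) \<cdot> (lc J \<bullet> (I \<odot> V)) \<cdot> \<zeta> I I J V = (lb I \<cdot> (\<epsilon>\<^sub>I \<bullet> I)) \<odot> lb V" by simp
  from arg_cong[OF this, of "\<lambda>f. lc V \<cdot> f"] show ?thesis
    using circ.ext2[OF blt.lunit_nat[of "lc V" V], of "(lc J \<bullet> (I \<odot> V)) \<cdot> \<zeta> I I J V"] by simp
qed

lemma zeta_collapse_right: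
  assumes [simp]: "N \<in> Ob \<C>" "n \<in> Arr \<C>" "Dom \<C> n = N" "Cod \<C> n = N \<bullet> I"
    and counit: "rb N \<cdot> (N \<bullet> \<epsilon>\<^sub>I) \<cdot> n = N"
  shows "rb (N \<odot> J) \<cdot> ((N \<odot> J) \<bullet> lc J) \<cdot> \<zeta> N I J J \<cdot> (n \<odot> lbi J) = N \<odot> J"
proof -
  have "rb (N \<odot> J) \<cdot> ((N \<odot> J) \<bullet> lc J) \<cdot> \<zeta> N I J J \<cdot> (n \<odot> lbi J)
    = rb (N \<odot> J) \<cdot> ((N \<odot> J) \<bullet> m\<^sub>J) \<cdot> ((N \<odot> J) \<bullet> (\<epsilon>\<^sub>I \<odot> J)) \<cdot> \<zeta> N I J J \<cdot> (n \<odot> lbi J)"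
    by (simp add: mJ_unit)
  also have "\<dots> = rb (N \<odot> J) \<cdot> ((N \<odot> J) \<bullet> m\<^sub>J) \<cdot> \<zeta> N J J J \<cdot> ((N \<bullet> \<epsilon>\<^sub>I) \<odot> (J \<bullet> J)) \<cdot> (n \<odot> lbi J)"
    using circ.ext2[OF zeta_nat[of N \<epsilon>\<^sub>I J J N J J J], of "n \<odot> lbi J"] by simp
  also have "\<dots> = (rb N \<odot> rb J) \<cdot> ((N \<bullet> \<epsilon>\<^sub>I) \<odot> (J \<bullet> J)) \<cdot> (n \<odot> lbi J)"
    using circ.ext3[OF zeta_rb[of N J], of "((N \<bullet> \<epsilon>\<^sub>I) \<odot> (J \<bullet> J)) \<cdot> (n \<odot> lbi J)"] by simp
  also have "\<dots> = N \<odot> J" by (simp add: counit flip: blt.lunit_unit)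
  finally show ?thesis .
qed

end

section \<open>Convolution equations with J replaced by an arbitrary object; invertibility of
  \<open>Lam\<close>\<close>

context reversion
begin

text \<open>The right antipode equation lives in an object ending in \<odot> J. Applying
  \<open>Lam\<close> beside an arrow v replaces this J by V. If w stands for a pair x, x^-1, the
  conclusion says that their product beside v is the unit beside v. \<open>Lam_phi\<close> rewrites
  the left side, \<open>Lam_unit\<close> the right side.\<close>

lemma right_inverse_extend:
  assumes [simp]: "M \<in> Ob \<C>" "m \<in> Arr \<C>" "Dom \<C> m = M \<odot> M" "Cod \<C> m = M"
    "u \<in> Arr \<C>" "Dom \<C> u = I" "Cod \<C> u = M"
    "w \<in> Arr \<C>" "Cod \<C> w = M \<bullet> M\<^sup>-" "e \<in> Arr \<C>" "Dom \<C> e = Dom \<C> w" "Cod \<C> e = J"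
    "v \<in> Arr \<C>" "Cod \<C> v = V"
    and inverse: "((m \<bullet> I) \<odot> J) \<cdot> \<phi> M M \<cdot> w = (((u \<bullet> I) \<cdot> \<Delta>\<^sub>I) \<odot> J) \<cdot> lci J \<cdot> e"
  shows "((m \<bullet> I) \<odot> V) \<cdot> \<delta> M I M V \<cdot> (M \<bullet> lci (M\<^sup>- \<bullet> V)) \<cdot> ab M M\<^sup>- V \<cdot> (w \<bullet> v) =
    (((u \<bullet> I) \<cdot> \<Delta>\<^sub>I) \<odot> V) \<cdot> lci V \<cdot> lb V \<cdot> (e \<bullet> v)"
proof -
  have [simp]: "V \<in> Ob \<C>" using circ.cod_ob[of v] by simp
  have "((m \<bullet> I) \<odot> V) \<cdot> \<delta> M I M V \<cdot> (M \<bullet> lci (M\<^sup>- \<bullet> V)) \<cdot> ab M M\<^sup>- V \<cdot> (w \<bullet> v)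
    = ((m \<bullet> I) \<odot> V) \<cdot> Lam ((M \<odot> M) \<bullet> I) (co (M \<odot> M)) V \<cdot> (\<phi> M M \<bullet> V) \<cdot> (w \<bullet> v)"
    using circ.ext2[OF Lam_phi[of M M V], of "w \<bullet> v"] by simp
  also have "\<dots> = Lam (M \<bullet> I) (co M) V \<cdot> (((m \<bullet> I) \<odot> J) \<bullet> V) \<cdot> ((\<phi> M M \<cdot> w) \<bullet> v)"
    using circ.ext2[OF Lam_nat[of "(M \<odot> M) \<bullet> I" "co (M \<odot> M)" "M \<bullet> I" "co M" "m \<bullet> I" V V V, OF _ _ _ _ _ _ _ _ _ _ _ _ _ _ co_nat],
       of "(\<phi> M M \<cdot> w) \<bullet> v"] by simp
  also have "\<dots> = Lam (M \<bullet> I) (co M) V \<cdot> ((((u \<bullet> I) \<cdot> \<Delta>\<^sub>I) \<odot> J) \<bullet> V) \<cdot> ((lci J \<cdot> e) \<bullet> v)"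
    by (simp add: inverse)
  also have "\<dots> = (((u \<bullet> I) \<cdot> \<Delta>\<^sub>I) \<odot> V) \<cdot> Lam I \<Delta>\<^sub>I V \<cdot> ((lci J \<cdot> e) \<bullet> v)"
    using circ.ext2[OF Lam_nat[of I "\<Delta>\<^sub>I" "M \<bullet> I" "co M" "(u \<bullet> I) \<cdot> \<Delta>\<^sub>I" V V V],
       of "(lci J \<cdot> e) \<bullet> v"] co_unit[of u M] by simp
  also have "\<dots> = (((u \<bullet> I) \<cdot> \<Delta>\<^sub>I) \<odot> V) \<cdot> lci V \<cdot> lb V \<cdot> (e \<bullet> v)"
    by (simp add: Lam_unit)
  finally show ?thesis .
qed

text \<open>The same with J on the other side: \<open>Lam'_psi\<close> and \<open>Lam'_unit\<close>
  exchange J for V in the left antipode equation.\<close>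

lemma left_inverse_extend:
  assumes [simp]: "M \<in> Ob \<C>" "m \<in> Arr \<C>" "Dom \<C> m = M \<odot> M" "Cod \<C> m = M"
    "u \<in> Arr \<C>" "Dom \<C> u = I" "Cod \<C> u = M"
    "w \<in> Arr \<C>" "Cod \<C> w = M\<^sup>- \<bullet> M" "e \<in> Arr \<C>" "Dom \<C> e = Dom \<C> w" "Cod \<C> e = J"
    "v \<in> Arr \<C>" "Cod \<C> v = V"
    and inverse: "(J \<odot> (I \<bullet> m)) \<cdot> \<psi> M M \<cdot> w = (J \<odot> ((I \<bullet> u) \<cdot> \<Delta>\<^sub>I)) \<cdot> rci J \<cdot> e"
  shows "(V \<odot> (I \<bullet> m)) \<cdot> \<gamma> V M I M \<cdot> (rci (V \<bullet> M\<^sup>-) \<bullet> M) \<cdot> abi V M\<^sup>- M \<cdot> (v \<bullet> w) =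
    (V \<odot> ((I \<bullet> u) \<cdot> \<Delta>\<^sub>I)) \<cdot> rci V \<cdot> rb V \<cdot> (v \<bullet> e)"
proof -
  have [simp]: "V \<in> Ob \<C>" using circ.cod_ob[of v] by simp
  have "(V \<odot> (I \<bullet> m)) \<cdot> \<gamma> V M I M \<cdot> (rci (V \<bullet> M\<^sup>-) \<bullet> M) \<cdot> abi V M\<^sup>- M \<cdot> (v \<bullet> w)
    = (V \<odot> (I \<bullet> m)) \<cdot> Lam' V (I \<bullet> (M \<odot> M)) (co' (M \<odot> M)) \<cdot> (V \<bullet> \<psi> M M) \<cdot> (v \<bullet> w)"
    using circ.ext3[OF Lam'_psi[of V M M], of "abi V M\<^sup>- M \<cdot> (v \<bullet> w)"] by simp
  also have "\<dots> = Lam' V (I \<bullet> M) (co' M) \<cdot> (V \<bullet> (J \<odot> (I \<bullet> m))) \<cdot> (v \<bullet> (\<psi> M M \<cdot> w))"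
    using circ.ext2[OF Lam'_nat[of "I \<bullet> (M \<odot> M)" "co' (M \<odot> M)" "I \<bullet> M" "co' M" "I \<bullet> m" V V V, OF _ _ _ _ _ _ _ _ _ _ _ _ _ _ co'_nat],
       of "v \<bullet> (\<psi> M M \<cdot> w)"] by simp
  also have "\<dots> = Lam' V (I \<bullet> M) (co' M) \<cdot> (V \<bullet> (J \<odot> ((I \<bullet> u) \<cdot> \<Delta>\<^sub>I))) \<cdot> (v \<bullet> (rci J \<cdot> e))"
    by (simp add: inverse)
  also have "\<dots> = (V \<odot> ((I \<bullet> u) \<cdot> \<Delta>\<^sub>I)) \<cdot> Lam' V I \<Delta>\<^sub>I \<cdot> (v \<bullet> (rci J \<cdot> e))"
    using circ.ext2[OF Lam'_nat[of I "\<Delta>\<^sub>I" "I \<bullet> M" "co' M" "(I \<bullet> u) \<cdot> \<Delta>\<^sub>I" V V V],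
       of "v \<bullet> (rci J \<cdot> e)"] co'_unit[of u M] by simp
  also have "\<dots> = (V \<odot> ((I \<bullet> u) \<cdot> \<Delta>\<^sub>I)) \<cdot> rci V \<cdot> rb V \<cdot> (v \<bullet> e)"
    by (simp add: Lam'_unit)
  finally show ?thesis .
qed

lemma phi_unit:
  assumes [simp]: "X \<in> Ob \<C>"
  shows "\<phi> X I \<cdot> (X \<bullet> \<phi>c\<^sub>0) = (((X \<odot> I) \<bullet> I) \<odot> \<epsilon>\<^sub>I) \<cdot> rci ((X \<odot> I) \<bullet> I) \<cdot> (rci X \<bullet> I)"
proof -
  have "rbi I\<^sup>- \<cdot> \<phi>c\<^sub>0 = (I\<^sup>- \<bullet> \<epsilon>\<^sub>I) \<cdot> dl"
    using blt.inv_runit_nat[of \<phi>c\<^sub>0 "I\<^sup>-"] by (simp add: dl_def flip: I_counit_right)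
  then have "(I \<odot> rbi I\<^sup>-) \<cdot> lci I\<^sup>- \<cdot> \<phi>c\<^sub>0 = (I \<odot> (I\<^sup>- \<bullet> \<epsilon>\<^sub>I)) \<cdot> (I \<odot> dl) \<cdot> lci I"
    using circ.inv_lunit_nat[of \<phi>c\<^sub>0 "I\<^sup>-"] by simp
  then have "\<phi> X I \<cdot> (X \<bullet> \<phi>c\<^sub>0) = \<delta> X I I J \<cdot> (X \<bullet> (I \<odot> (I\<^sup>- \<bullet> \<epsilon>\<^sub>I))) \<cdot> (X \<bullet> ((I \<odot> dl) \<cdot> lci I))"
    by (simp add: \<phi>_def)
  also have "\<dots> = (((X \<odot> I) \<bullet> I) \<odot> \<epsilon>\<^sub>I) \<cdot> \<delta> X I I I \<cdot> (X \<bullet> (I \<odot> dl)) \<cdot> (X \<bullet> lci I)"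
    using circ.ext2[OF delta_nat[of X I I \<epsilon>\<^sub>I X I I J], of "X \<bullet> ((I \<odot> dl) \<cdot> lci I)"] by simp
  also have "\<dots> = (((X \<odot> I) \<bullet> I) \<odot> \<epsilon>\<^sub>I) \<cdot> rci ((X \<odot> I) \<bullet> I) \<cdot> (rci X \<bullet> rc I) \<cdot> (X \<bullet> lci I)"
    using circ.ext2[OF delta_unit[of X I], of "X \<bullet> lci I"] by simp
  finally show ?thesis by (simp add: circ.lunit_unit)
qed

text \<open>The instance V = I of \<open>Lam_lam\<close> with \<open>lam\<close> written out. It
  comes from \<open>Lam_phi\<close> at W = I, precomposed with \<open>\<phi>c\<^sub>0\<close>, where
  \<open>phi_unit\<close> and \<open>delta_unit\<close> evaluate the two sides.\<close>

lemma Lam_co_unit: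
  assumes [simp]: "X \<in> Ob \<C>"
  shows "Lam (X \<bullet> I) (co X) I \<cdot> ((((X \<bullet> I) \<odot> \<epsilon>\<^sub>I) \<cdot> rci (X \<bullet> I)) \<bullet> I) \<cdot> co X = rci (X \<bullet> I)"
proof -
  let ?Y = "X \<odot> I"
  have "ab X (I\<^sup>-) I \<cdot> ((X \<bullet> \<phi>c\<^sub>0) \<bullet> I) \<cdot> co X = X \<bullet> dl"
    using circ.ext2[OF blt.assoc_nat[of X \<phi>c\<^sub>0 I X "I\<^sup>-" I], of "co X"] by (simp add: co_def dl_def)
  then have "Lam (?Y \<bullet> I) (co ?Y) I \<cdot> ((\<phi> X I \<cdot> (X \<bullet> \<phi>c\<^sub>0)) \<bullet> I) \<cdot> co X
      = \<delta> X I I I \<cdot> (X \<bullet> lci (I\<^sup>- \<bullet> I)) \<cdot> (X \<bullet> dl)"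
    using circ.ext2[OF Lam_phi[of X I I], of "((X \<bullet> \<phi>c\<^sub>0) \<bullet> I) \<cdot> co X"] by simp
  also have "\<dots> = \<delta> X I I I \<cdot> (X \<bullet> (I \<odot> dl)) \<cdot> (X \<bullet> lci I)"
    using circ.inv_lunit_nat[of dl "I\<^sup>- \<bullet> I"] by simp
  also have "\<dots> = rci (?Y \<bullet> I) \<cdot> (rci X \<bullet> rc I) \<cdot> (X \<bullet> lci I)"
    using circ.ext2[OF delta_unit[of X I], of "X \<bullet> lci I"] by simp
  also have "\<dots> = rci (?Y \<bullet> I) \<cdot> (rci X \<bullet> I)" by (simp add: circ.lunit_unit)
  finally have "((rc X \<bullet> I) \<odot> I) \<cdot> Lam (?Y \<bullet> I) (co ?Y) I \<cdot> ((\<phi> X I \<cdot> (X \<bullet> \<phi>c\<^sub>0)) \<bullet> I) \<cdot> co X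
      = ((rc X \<bullet> I) \<odot> I) \<cdot> rci (?Y \<bullet> I) \<cdot> (rci X \<bullet> I)" by simp
  also have "\<dots> = rci (X \<bullet> I)"
    using circ.ext2[OF circ.inv_runit_nat[of "rc X \<bullet> I" "X \<bullet> I", symmetric], of "rci X \<bullet> I"] by simp
  finally have *: "Lam (X \<bullet> I) (co X) I \<cdot> (((rc X \<bullet> I) \<odot> J) \<bullet> I) \<cdot> ((\<phi> X I \<cdot> (X \<bullet> \<phi>c\<^sub>0)) \<bullet> I) \<cdot> co X = rci (X \<bullet> I)"
    using circ.ext2[OF Lam_nat[of "?Y \<bullet> I" "co ?Y" "X \<bullet> I" "co X" "rc X \<bullet> I" I I I, OF _ _ _ _ _ _ _ _ _ _ _ _ _ _ co_nat],
       of "((\<phi> X I \<cdot> (X \<bullet> \<phi>c\<^sub>0)) \<bullet> I) \<cdot> co X"] by simp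
  have "((rc X \<bullet> I) \<odot> J) \<cdot> \<phi> X I \<cdot> (X \<bullet> \<phi>c\<^sub>0) = ((X \<bullet> I) \<odot> \<epsilon>\<^sub>I) \<cdot> ((rc X \<bullet> I) \<odot> I) \<cdot> rci (?Y \<bullet> I) \<cdot> (rci X \<bullet> I)"
    by (simp add: phi_unit)
  also have "\<dots> = ((X \<bullet> I) \<odot> \<epsilon>\<^sub>I) \<cdot> rci (X \<bullet> I)"
    using circ.ext2[OF circ.inv_runit_nat[of "rc X \<bullet> I" "X \<bullet> I", symmetric], of "rci X \<bullet> I"] by simp
  finally show ?thesis using * by simp
qed

text \<open>\<open>R1\<close> moves \<gamma> past \<zeta> and thereby separates the factor V, which
  reduces the claim to the case V = I in \<open>Lam_co_unit\<close>. What remains near V is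
  \<open>zeta_collapse_left\<close>.\<close>

lemma Lam_lam:
  assumes [simp]: "X \<in> Ob \<C>" "V \<in> Ob \<C>"
  shows "Lam (X \<bullet> I) (co X) V \<cdot> lam (X \<bullet> I) (co X) V = (X \<bullet> I) \<odot> V"
proof -
  define N where "N = X \<bullet> I"
  define n where "n = co X"
  have [simp]: "N \<in> Ob \<C>" "n \<in> Arr \<C>" "Dom \<C> n = N" "Cod \<C> n = N \<bullet> I" by (simp_all add: N_def n_def)
  define \<nu> where "\<nu> = (N \<bullet> \<phi>c\<^sub>0) \<cdot> n"
  have [simp]: "\<nu> \<in> Arr \<C>" "Dom \<C> \<nu> = N" "Cod \<C> \<nu> = N \<bullet> I\<^sup>-" by (simp_all add: \<nu>_def)
  define q where "q = lb I \<cdot> (\<epsilon>\<^sub>I \<bullet> lc I)"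
  have [simp]: "q \<in> Arr \<C>" "Dom \<C> q = I \<bullet> (I \<odot> I)" "Cod \<C> q = I" by (simp_all add: q_def)
  \<comment> \<open>\<open>\<Phi>\<close> collects what happens to N; the object V does not occur in
    it. The fact \<open>reg\<close> below says that \<open>\<Phi>\<close> is trivial once its second
    factor is sent to I by q.\<close>
  define \<Phi> where "\<Phi> = \<gamma> N I I I \<cdot> (((\<nu> \<odot> I) \<cdot> rci N) \<bullet> I) \<cdot> n"
  have [simp]: "\<Phi> \<in> Arr \<C>" "Dom \<C> \<Phi> = N" "Cod \<C> \<Phi> = N \<odot> (I \<bullet> (I \<odot> I))" by (simp_all add: \<Phi>_def)
  have "rci N = Lam N n I \<cdot> (((N \<odot> \<epsilon>\<^sub>I) \<cdot> rci N) \<bullet> I) \<cdot> n"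
    using Lam_co_unit[of X] by (simp add: N_def n_def)
  also have "\<dots> = (N \<odot> (lb I \<cdot> (J \<bullet> lc I))) \<cdot> \<gamma> N I J I \<cdot> (((N \<bullet> I\<^sup>-) \<odot> \<epsilon>\<^sub>I) \<bullet> I) \<cdot> (((\<nu> \<odot> I) \<cdot> rci N) \<bullet> I) \<cdot> n"
    by (simp add: Lam_def \<nu>_def)
  also have "\<dots> = (N \<odot> q) \<cdot> \<Phi>"
    using circ.ext2[OF gamma_nat[of N I \<epsilon>\<^sub>I I N I J I], of "(((\<nu> \<odot> I) \<cdot> rci N) \<bullet> I) \<cdot> n"]
    by (simp add: q_def \<Phi>_def)
  finally have reg: "(N \<odot> q) \<cdot> \<Phi> = rci N" ..
  let ?k = "N \<odot> (lb V \<cdot> (J \<bullet> lc V))" and ?X = "((rci N \<bullet> I) \<cdot> n) \<odot> lbi V"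
  let ?k' = "N \<odot> (lb V \<cdot> (lc J \<bullet> (lc V \<cdot> (I \<odot> lc V))))"
  let ?T = "((((\<nu> \<odot> I) \<cdot> rci N) \<bullet> I) \<cdot> n) \<odot> lbi V"
  have "Lam N n V \<cdot> lam N n V = ?k \<cdot> \<gamma> N I J V \<cdot> ((\<nu> \<odot> J) \<bullet> lc V) \<cdot> \<zeta> N I J V \<cdot> (n \<odot> lbi V)"
    by (simp add: Lam_def lam_def \<nu>_def)
  also have "\<dots> = ?k \<cdot> \<gamma> N I J V \<cdot> ((\<nu> \<odot> J) \<bullet> lc V) \<cdot> ((rc N \<odot> J) \<bullet> (I \<odot> V)) \<cdot> \<zeta> (N \<odot> I) I J V \<cdot> ?X"
    using circ.ext2[OF zeta_nat[of "rc N" I J V N I J V], of ?X] by simp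
  also have "\<dots> = ?k \<cdot> \<gamma> N I J V \<cdot> (((\<nu> \<odot> lc J) \<cdot> ac N I J) \<bullet> lc V) \<cdot> \<zeta> (N \<odot> I) I J V \<cdot> ?X"
    by (simp flip: circ.triangle)
  also have "\<dots> = ?k \<cdot> \<gamma> N I J V \<cdot> (((N \<bullet> I\<^sup>-) \<odot> lc J) \<bullet> lc V) \<cdot> ((ac (N \<bullet> I\<^sup>-) I J \<cdot> ((\<nu> \<odot> I) \<odot> J)) \<bullet> (I \<odot> V)) \<cdot> \<zeta> (N \<odot> I) I J V \<cdot> ?X"
    using circ.assoc_nat[of \<nu> I J "N \<bullet> I\<^sup>-" I J] by simp
  also have "\<dots> = ?k' \<cdot> \<gamma> N I (I \<odot> J) (I \<odot> V) \<cdot> ((ac (N \<bullet> I\<^sup>-) I J \<cdot> ((\<nu> \<odot> I) \<odot> J)) \<bullet> (I \<odot> V)) \<cdot> \<zeta> (N \<odot> I) I J V \<cdot> ?X"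
    using circ.ext2[OF gamma_nat[of N I "lc J" "lc V" N I J V], of "((ac (N \<bullet> I\<^sup>-) I J \<cdot> ((\<nu> \<odot> I) \<odot> J)) \<bullet> (I \<odot> V)) \<cdot> \<zeta> (N \<odot> I) I J V \<cdot> ?X"] by simp
  also have "\<dots> = ?k' \<cdot> \<gamma> N I (I \<odot> J) (I \<odot> V) \<cdot> (ac (N \<bullet> I\<^sup>-) I J \<bullet> (I \<odot> V)) \<cdot> \<zeta> ((N \<bullet> I\<^sup>-) \<odot> I) I J V \<cdot> ?T"
    using circ.ext2[OF zeta_nat[of "\<nu> \<odot> I" I J V "(N \<bullet> I\<^sup>-) \<odot> I" I J V], of ?X] by simp
  also have "\<dots> = ?k' \<cdot> (N \<odot> ((I \<odot> J) \<bullet> ac I I V)) \<cdot> (N \<odot> \<zeta> I (I \<odot> I) J V) \<cdot> ac N (I \<bullet> (I \<odot> I)) (J \<bullet> V) \<cdot> (\<Phi> \<odot> lbi V)"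
    using arg_cong[OF R1[of N I I I J V], of "\<lambda>f. ?k' \<cdot> f \<cdot> ?T"] by (simp add: \<Phi>_def)
  also have "\<dots> = (N \<odot> (lb V \<cdot> (lc J \<bullet> (lc V \<cdot> ((I \<odot> lc V) \<cdot> ac I I V))) \<cdot> \<zeta> I (I \<odot> I) J V)) \<cdot> ac N (I \<bullet> (I \<odot> I)) (J \<bullet> V) \<cdot> (\<Phi> \<odot> lbi V)"
    by simp
  also have "\<dots> = (N \<odot> (lb V \<cdot> (lc J \<bullet> lc V) \<cdot> ((I \<odot> J) \<bullet> (lc I \<odot> V)) \<cdot> \<zeta> I (I \<odot> I) J V)) \<cdot> ac N (I \<bullet> (I \<odot> I)) (J \<bullet> V) \<cdot> (\<Phi> \<odot> lbi V)"
    by (simp add: circ.triangle circ.lunit_unit)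
  also have "\<dots> = (N \<odot> ((lb V \<cdot> (lc J \<bullet> lc V) \<cdot> \<zeta> I I J V) \<cdot> ((I \<bullet> lc I) \<odot> (J \<bullet> V)))) \<cdot> ac N (I \<bullet> (I \<odot> I)) (J \<bullet> V) \<cdot> (\<Phi> \<odot> lbi V)"
    using zeta_nat[of I "lc I" J V I I J V] by simp
  also have "\<dots> = (N \<odot> (lc V \<cdot> (q \<odot> lb V))) \<cdot> ac N (I \<bullet> (I \<odot> I)) (J \<bullet> V) \<cdot> (\<Phi> \<odot> lbi V)"
    by (simp add: zeta_collapse_left q_def)
  also have "\<dots> = (N \<odot> lc V) \<cdot> ac N I V \<cdot> (((N \<odot> q) \<cdot> \<Phi>) \<odot> V)"
    using circ.ext2[OF circ.assoc_nat[of N q "lb V" N I V], of "\<Phi> \<odot> lbi V"] by simp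
  also have "\<dots> = N \<odot> V"
    unfolding reg by (simp add: circ.triangle_inv)
  finally show ?thesis by (simp add: N_def n_def)
qed

text \<open>Coassociativity moves the coaction of \<open>lam\<close> in front of \<open>Lam\<close>.
  Then \<open>R2\<close> exchanges \<zeta> with \<gamma>, so that \<gamma> occurs with first
  variables I, where \<open>gamma_unit\<close> computes it, and \<open>zeta_collapse_right\<close>
  removes the remaining \<zeta>.\<close>

lemma lam_Lam:
  assumes [simp]: "X \<in> Ob \<C>" "V \<in> Ob \<C>"
  shows "lam (X \<bullet> I) (co X) V \<cdot> Lam (X \<bullet> I) (co X) V = ((X \<bullet> I) \<odot> J) \<bullet> V"
proof -
  define N where "N = X \<bullet> I"
  define n where "n = co X"
  have [simp]: "N \<in> Ob \<C>" "n \<in> Arr \<C>" "Dom \<C> n = N" "Cod \<C> n = N \<bullet> I" by (simp_all add: N_def n_def)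
  have coassoc: "co N \<cdot> n = (n \<bullet> I) \<cdot> n" and counit: "rb N \<cdot> (N \<bullet> \<epsilon>\<^sub>I) \<cdot> n = N"
    using co_coassoc[of X] co_counit[of X] by (simp_all add: N_def n_def)
  let ?G = "N \<odot> J" and ?IV = "I \<odot> V"
  let ?c = "(abi N I I\<^sup>- \<cdot> (N \<bullet> dr)) \<odot> J"
  have c: "((N \<bullet> I) \<bullet> \<phi>c\<^sub>0) \<cdot> co N = abi N I I\<^sup>- \<cdot> (N \<bullet> dr)"
    using circ.ext2[OF blt.inv_assoc_nat[of N I \<phi>c\<^sub>0 N I "I\<^sup>-"], of "N \<bullet> \<Delta>\<^sub>I"] by (simp add: co_def dr_def)
  define g where "g = \<gamma> (N \<bullet> I) I J V \<cdot> (?c \<bullet> V)"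
  have [simp]: "g \<in> Arr \<C>" "Dom \<C> g = ((N \<bullet> I) \<odot> J) \<bullet> V" "Cod \<C> g = (N \<bullet> I) \<odot> (J \<bullet> ?IV)"
    by (simp_all add: g_def)
  have "lb ?IV \<cdot> lb (J \<bullet> ?IV) \<cdot> lbi (J \<bullet> ?IV) = lb ?IV" by simp
  then have l: "(J \<bullet> lb ?IV) \<cdot> lbi (J \<bullet> ?IV) = J \<bullet> ?IV"
    using blt.inv_lunit_nat[of "lb ?IV" ?IV, symmetric] by simp
  let ?e = "(((abi N I I\<^sup>- \<cdot> (N \<bullet> dr)) \<odot> lbi J) \<bullet> V)"
  let ?K = "?G \<bullet> (I \<odot> lb ?IV)"
  have "?K \<cdot> \<zeta> N I J (J \<bullet> ?IV) \<cdot> ((N \<bullet> I) \<odot> ab J J ?IV) \<cdot> \<gamma> (N \<bullet> I) I (J \<bullet> J) V \<cdot> ?e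
      = ?K \<cdot> \<zeta> N I J (J \<bullet> ?IV) \<cdot> ((N \<bullet> I) \<odot> (ab J J ?IV \<cdot> (lbi J \<bullet> ?IV))) \<cdot> g"
    using circ.ext2[OF gamma_nat[of "N \<bullet> I" I "lbi J" V "N \<bullet> I" I "J \<bullet> J" V], of "?c \<bullet> V"] by (simp add: g_def)
  also have "\<dots> = ?K \<cdot> \<zeta> N I J (J \<bullet> ?IV) \<cdot> ((N \<bullet> I) \<odot> lbi (J \<bullet> ?IV)) \<cdot> g"
    by (simp add: blt.assoc_inv_lunit)
  also have "\<dots> = \<zeta> N I J ?IV \<cdot> ((N \<bullet> I) \<odot> ((J \<bullet> lb ?IV) \<cdot> lbi (J \<bullet> ?IV))) \<cdot> g"
    using circ.ext2[OF zeta_nat[of N I J "lb ?IV" N I J ?IV], of "((N \<bullet> I) \<odot> lbi (J \<bullet> ?IV)) \<cdot> g"] by simp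
  also have "\<dots> = \<zeta> N I J ?IV \<cdot> g" unfolding l by simp
  finally have right: "?K \<cdot> \<zeta> N I J (J \<bullet> ?IV) \<cdot> ((N \<bullet> I) \<odot> ab J J ?IV) \<cdot> \<gamma> (N \<bullet> I) I (J \<bullet> J) V \<cdot> ?e = \<zeta> N I J ?IV \<cdot> g" .
  define w where "w = \<zeta> N I J J \<cdot> ((N \<bullet> I) \<odot> lbi J)"
  have [simp]: "w \<in> Arr \<C>" "Dom \<C> w = (N \<bullet> I) \<odot> J" "Cod \<C> w = ?G \<bullet> (I \<odot> J)" by (simp_all add: w_def)
  have "?K \<cdot> (?G \<bullet> \<gamma> I I J V) \<cdot> ab ?G ((I \<bullet> I\<^sup>-) \<odot> J) V \<cdot> (\<zeta> N (I \<bullet> I\<^sup>-) J J \<bullet> V) \<cdot> ((ab N I I\<^sup>- \<odot> (J \<bullet> J)) \<bullet> V) \<cdot> ?e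
      = ?K \<cdot> (?G \<bullet> \<gamma> I I J V) \<cdot> ab ?G ((I \<bullet> I\<^sup>-) \<odot> J) V \<cdot> ((\<zeta> N (I \<bullet> I\<^sup>-) J J \<cdot> ((N \<bullet> dr) \<odot> lbi J)) \<bullet> V)"
    by simp
  also have "\<dots> = ?K \<cdot> (?G \<bullet> \<gamma> I I J V) \<cdot> ab ?G ((I \<bullet> I\<^sup>-) \<odot> J) V \<cdot> ((?G \<bullet> (dr \<odot> J)) \<bullet> V) \<cdot> (w \<bullet> V)"
    using circ.ext2[OF zeta_nat[of N dr J J N "I \<bullet> I\<^sup>-" J J], of "(N \<bullet> I) \<odot> lbi J"] by (simp add: w_def)
  also have "\<dots> = ?K \<cdot> (?G \<bullet> (\<gamma> I I J V \<cdot> ((dr \<odot> J) \<bullet> V))) \<cdot> ab ?G (I \<odot> J) V \<cdot> (w \<bullet> V)"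
    using circ.ext2[OF blt.assoc_nat[of ?G "dr \<odot> J" V ?G "(I \<bullet> I\<^sup>-) \<odot> J" V], of "w \<bullet> V"] by simp
  also have "\<dots> = (?G \<bullet> ((I \<odot> lb ?IV) \<cdot> lci (J \<bullet> ?IV) \<cdot> (lc J \<bullet> lci V))) \<cdot> ab ?G (I \<odot> J) V \<cdot> (w \<bullet> V)"
    by (simp add: gamma_unit)
  also have "\<dots> = (?G \<bullet> (lci ?IV \<cdot> lb ?IV \<cdot> (lc J \<bullet> lci V))) \<cdot> ab ?G (I \<odot> J) V \<cdot> (w \<bullet> V)"
    using circ.ext2[OF circ.inv_lunit_nat[of "lb ?IV" ?IV], of "lc J \<bullet> lci V"] by simp
  finally have zg: "\<zeta> N I J ?IV \<cdot> g = (?G \<bullet> (lci ?IV \<cdot> lb ?IV \<cdot> (lc J \<bullet> lci V))) \<cdot> ab ?G (I \<odot> J) V \<cdot> (w \<bullet> V)"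
    using right arg_cong[OF R2[of N I I J J V], of "\<lambda>f. ?K \<cdot> f \<cdot> ?e"] by simp
  have "lc V \<cdot> (I \<odot> lc V) \<cdot> lci ?IV = lc V"
    using circ.lunit_nat[of "lc V" V] circ.inv_lunit_nat[of "lc V" V] by simp
  then have "lc V \<cdot> (I \<odot> lc V) \<cdot> lci ?IV \<cdot> lb ?IV \<cdot> (lc J \<bullet> lci V) = lc V \<cdot> lb ?IV \<cdot> (lc J \<bullet> lci V)"
    using circ.ext3[of "lc V" "I \<odot> lc V" "lci ?IV" "lc V" "lb ?IV \<cdot> (lc J \<bullet> lci V)"] by simp
  also have "\<dots> = lb V \<cdot> (lc J \<bullet> V)"
    using circ.ext2[OF blt.lunit_nat[of "lc V" V, symmetric], of "lc J \<bullet> lci V"] by simp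
  finally have v: "lc V \<cdot> (I \<odot> lc V) \<cdot> lci ?IV \<cdot> lb ?IV \<cdot> (lc J \<bullet> lci V) = lb V \<cdot> (lc J \<bullet> V)" .
  have "lam N n V \<cdot> Lam N n V = (?G \<bullet> lc V) \<cdot> \<zeta> N I J V \<cdot> ((N \<bullet> I) \<odot> lbi V) \<cdot> (n \<odot> V) \<cdot> Lam N n V"
    by (simp add: lam_def)
  also have "\<dots> = (?G \<bullet> lc V) \<cdot> \<zeta> N I J V \<cdot> ((N \<bullet> I) \<odot> lbi V) \<cdot> Lam (N \<bullet> I) (co N) V \<cdot> ((n \<odot> J) \<bullet> V)"
    using Lam_nat[of N n "N \<bullet> I" "co N" n V V V] coassoc by simp
  also have "\<dots> = (?G \<bullet> lc V) \<cdot> \<zeta> N I J V \<cdot> ((N \<bullet> I) \<odot> (J \<bullet> lc V)) \<cdot> g \<cdot> ((n \<odot> J) \<bullet> V)"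
    by (simp add: Lam_def c g_def)
  also have "\<dots> = (?G \<bullet> (lc V \<cdot> (I \<odot> lc V))) \<cdot> (\<zeta> N I J ?IV \<cdot> g) \<cdot> ((n \<odot> J) \<bullet> V)"
    using circ.ext2[OF zeta_nat[of N I J "lc V" N I J V], of "g \<cdot> ((n \<odot> J) \<bullet> V)"] by simp
  also have "\<dots> = (?G \<bullet> (lc V \<cdot> (I \<odot> lc V) \<cdot> lci ?IV \<cdot> lb ?IV \<cdot> (lc J \<bullet> lci V))) \<cdot> ab ?G (I \<odot> J) V \<cdot> ((w \<cdot> (n \<odot> J)) \<bullet> V)"
    unfolding zg by simp
  also have "\<dots> = (?G \<bullet> lb V) \<cdot> (?G \<bullet> (lc J \<bullet> V)) \<cdot> ab ?G (I \<odot> J) V \<cdot> ((w \<cdot> (n \<odot> J)) \<bullet> V)"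
    unfolding v by simp
  also have "\<dots> = (?G \<bullet> lb V) \<cdot> ab ?G J V \<cdot> (((?G \<bullet> lc J) \<cdot> w \<cdot> (n \<odot> J)) \<bullet> V)"
    using circ.ext2[OF blt.assoc_nat[of ?G "lc J" V ?G J V], of "(w \<cdot> (n \<odot> J)) \<bullet> V"] by simp
  also have "\<dots> = (rb ?G \<cdot> (?G \<bullet> lc J) \<cdot> \<zeta> N I J J \<cdot> (n \<odot> lbi J)) \<bullet> V"
    using circ.ext2[OF blt.triangle[of ?G V], of "((?G \<bullet> lc J) \<cdot> w \<cdot> (n \<odot> J)) \<bullet> V"] by (simp add: w_def)
  also have "\<dots> = ?G \<bullet> V"
    using zeta_collapse_right[of N n] counit by simp
  finally show ?thesis by (simp add: N_def n_def)
qed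

end

section \<open>Hopf modules\<close>

text \<open>X is a right module over the Hopf monoid B. From it two objects are formed, (X \<bullet>
  I) \<odot> H and X \<bullet> H, and the aim is a section of the canonical arrow \<open>Gam\<close>
  between them. The actions used later are those of B on A along s, of B on A \<bullet> B along the
  graph of s, and of C on A along the composite of c and s.\<close>

locale Hopf_module = reversion +
  fixes B s X a
  assumes Hopf: "bimonoid B" "antipode B s"
    and X_ob [simp]: "X \<in> Ob \<C>"
    and action_hom: "a \<in> hom \<C> (X \<odot> und B) X"
    and action_assoc: "a \<cdot> (a \<odot> und B) = a \<cdot> (X \<odot> mult B) \<cdot> ac X (und B) (und B)"
    and action_unit: "a \<cdot> (X \<odot> unt B) = rc X"
begin

abbreviation H where "H \<equiv> und B"

lemma Hopf_arr [simp]: "H \<in> Ob \<C>" "mult B \<in> Arr \<C>" "Dom \<C> (mult B) = H \<odot> H" "Cod \<C> (mult B) = H"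
  "unt B \<in> Arr \<C>" "Dom \<C> (unt B) = I" "Cod \<C> (unt B) = H"
  "comult B \<in> Arr \<C>" "Dom \<C> (comult B) = H" "Cod \<C> (comult B) = H \<bullet> H"
  "counit B \<in> Arr \<C>" "Dom \<C> (counit B) = H" "Cod \<C> (counit B) = J"
  "s \<in> Arr \<C>" "Dom \<C> s = H" "Cod \<C> s = H\<^sup>-"
  "a \<in> Arr \<C>" "Dom \<C> a = X \<odot> H" "Cod \<C> a = X"
  using Hopf action_hom by (auto simp: bimonoid_def monoid_in_def comonoid_in_def antipode_def hom_def)

abbreviation N where "N \<equiv> X \<bullet> I"
abbreviation G where "G \<equiv> N \<odot> J"
abbreviation LamN where "LamN \<equiv> Lam N (co X) H"
abbreviation lamN where "lamN \<equiv> lam N (co X) H"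
abbreviation pr where "pr Y \<equiv> rb Y \<cdot> (Y \<bullet> \<epsilon>\<^sub>I)"

text \<open>On elements, \<open>kap\<close> is \<open>(x, h) \<mapsto> x h\<inverse>\<close> and \<open>Gam\<close> is \<open>(x, h) \<mapsto> (x h, h)\<close>.\<close>

definition kap where "kap = ((a \<bullet> I) \<odot> J) \<cdot> \<phi> X H \<cdot> (X \<bullet> s)"
definition Gam where "Gam = (a \<bullet> lc H) \<cdot> \<zeta> X I H H \<cdot> (N \<odot> comult B)"

lemma kap_Gam_arr [simp]: "kap \<in> Arr \<C>" "Dom \<C> kap = X \<bullet> H" "Cod \<C> kap = G"
  "Gam \<in> Arr \<C>" "Dom \<C> Gam = N \<odot> H" "Cod \<C> Gam = X \<bullet> H"
  by (simp_all add: kap_def Gam_def)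

lemma antipode_right:
  "((mult B \<bullet> I) \<odot> J) \<cdot> \<phi> H H \<cdot> (H \<bullet> s) \<cdot> comult B = (((unt B \<bullet> I) \<cdot> \<Delta>\<^sub>I) \<odot> J) \<cdot> lci J \<cdot> counit B"
proof -
  have "((mult B \<bullet> I) \<odot> J) \<cdot> \<phi> H H \<cdot> (H \<bullet> s) \<cdot> comult B =
      ((unt B \<bullet> I) \<odot> J) \<cdot> (\<Delta>\<^sub>I \<odot> J) \<cdot> lci J \<cdot> counit B"
    using Hopf(2) unfolding antipode_def by blast
  then show ?thesis by simp
qed

lemma antipode_left:
  "(J \<odot> (I \<bullet> mult B)) \<cdot> \<psi> H H \<cdot> (s \<bullet> H) \<cdot> comult B = (J \<odot> ((I \<bullet> unt B) \<cdot> \<Delta>\<^sub>I)) \<cdot> rci J \<cdot> counit B"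
proof -
  have "(J \<odot> (I \<bullet> mult B)) \<cdot> \<psi> H H \<cdot> (s \<bullet> H) \<cdot> comult B =
      (J \<odot> (I \<bullet> unt B)) \<cdot> (J \<odot> \<Delta>\<^sub>I) \<cdot> rci J \<cdot> counit B"
    using Hopf(2) unfolding antipode_def by blast
  then show ?thesis by simp
qed

lemma counit_left: "lb H \<cdot> (counit B \<bullet> H) \<cdot> comult B = H"
  and coassoc: "ab H H H \<cdot> (comult B \<bullet> H) \<cdot> comult B = (H \<bullet> comult B) \<cdot> comult B"
  using Hopf(1) by (auto simp: bimonoid_def comonoid_in_def)

text \<open>An instance of the compatibility \<open>R3\<close> of \<delta> with \<zeta>, arranged so
  that \<open>\<phi> H H\<close> appears, the arrow to which the antipode equation applies.\<close>

lemma delta_zeta: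
  "\<delta> (X \<odot> H) I H J \<cdot> ((X \<odot> H) \<bullet> (I \<odot> rbi H\<^sup>-)) \<cdot> \<zeta> X I H H\<^sup>- =
    ((aci X H H \<bullet> rc I) \<odot> J) \<cdot> (\<zeta> X I (H \<odot> H) I \<odot> J) \<cdot> aci N ((H \<odot> H) \<bullet> I) J \<cdot> (N \<odot> \<phi> H H)"
proof -
  let ?e = "N \<odot> (H \<bullet> ((I \<odot> rbi H\<^sup>-) \<cdot> lci H\<^sup>-))"
  let ?K = "(aci X H H \<bullet> rc I) \<odot> J"
  have c: "aci I I (H\<^sup>- \<bullet> J) \<cdot> (I \<odot> ((I \<odot> rbi H\<^sup>-) \<cdot> lci H\<^sup>-)) = rci I \<odot> rbi H\<^sup>-"
    using circ.ext2[OF circ.inv_assoc_nat[of I I "rbi H\<^sup>-" I I "H\<^sup>- \<bullet> J"], of "I \<odot> lci H\<^sup>-"]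
      circ.inv_triangle_inv[of I "H\<^sup>-"] by simp
  have "?K \<cdot> ((ac X H H \<bullet> (I \<odot> I)) \<odot> J) \<cdot> \<delta> (X \<odot> H) (I \<odot> I) H J \<cdot>
        ((X \<odot> H) \<bullet> aci I I (H\<^sup>- \<bullet> J)) \<cdot> \<zeta> X I H (I \<odot> (H\<^sup>- \<bullet> J)) \<cdot> ?e
     = ((((X \<odot> H) \<odot> H) \<bullet> rc I) \<odot> J) \<cdot> \<delta> (X \<odot> H) (I \<odot> I) H J \<cdot>
        ((X \<odot> H) \<bullet> (aci I I (H\<^sup>- \<bullet> J) \<cdot> (I \<odot> ((I \<odot> rbi H\<^sup>-) \<cdot> lci H\<^sup>-)))) \<cdot> \<zeta> X I H H\<^sup>-"
    using zeta_nat[of X I H "(I \<odot> rbi H\<^sup>-) \<cdot> lci H\<^sup>-" X I H "I \<odot> (H\<^sup>- \<bullet> J)"] by simp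
  also have "\<dots> = ((((X \<odot> H) \<odot> H) \<bullet> rc I) \<odot> J) \<cdot> \<delta> (X \<odot> H) (I \<odot> I) H J \<cdot>
        ((X \<odot> H) \<bullet> (rci I \<odot> (H\<^sup>- \<bullet> J))) \<cdot> ((X \<odot> H) \<bullet> (I \<odot> rbi H\<^sup>-)) \<cdot> \<zeta> X I H H\<^sup>-"
    unfolding c by simp
  also have "\<dots> = \<delta> (X \<odot> H) I H J \<cdot> ((X \<odot> H) \<bullet> (I \<odot> rbi H\<^sup>-)) \<cdot> \<zeta> X I H H\<^sup>-"
    using circ.ext2[OF delta_nat[of "X \<odot> H" "rci I" H J "X \<odot> H" "I \<odot> I" H J],
       of "((X \<odot> H) \<bullet> (I \<odot> rbi H\<^sup>-)) \<cdot> \<zeta> X I H H\<^sup>-"] by simp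
  finally have left: "?K \<cdot> ((ac X H H \<bullet> (I \<odot> I)) \<odot> J) \<cdot> \<delta> (X \<odot> H) (I \<odot> I) H J \<cdot>
        ((X \<odot> H) \<bullet> aci I I (H\<^sup>- \<bullet> J)) \<cdot> \<zeta> X I H (I \<odot> (H\<^sup>- \<bullet> J)) \<cdot> ?e
     = \<delta> (X \<odot> H) I H J \<cdot> ((X \<odot> H) \<bullet> (I \<odot> rbi H\<^sup>-)) \<cdot> \<zeta> X I H H\<^sup>-" .
  have p: "N \<odot> \<phi> H H = (N \<odot> \<delta> H I H J) \<cdot> ?e" by (simp add: \<phi>_def)
  show ?thesis
    unfolding left[symmetric] p
    using arg_cong[OF R3[of X I H I H J], of "\<lambda>f. ?K \<cdot> f \<cdot> ?e"] by simp
qed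

text \<open>On elements, (x h_1) h_2^-1 is x with the counit of h. Naturality of
  \<open>\<phi>\<close> and associativity of the action bring the copies of h together,
  \<open>delta_zeta\<close> exposes \<open>\<phi> H H\<close>, and the right antipode equation
  replaces them by the unit.\<close>

lemma kap_Gam: "kap \<cdot> Gam = N \<odot> counit B"
proof -
  let ?d = "comult B"
  let ?w = "(H \<bullet> s) \<cdot> ?d"
  let ?u = "(unt B \<bullet> I) \<cdot> \<Delta>\<^sub>I"
  have "kap \<cdot> Gam = ((a \<bullet> I) \<odot> J) \<cdot> \<phi> X H \<cdot> (a \<bullet> (s \<cdot> lc H)) \<cdot> \<zeta> X I H H \<cdot> (N \<odot> ?d)"
    by (simp add: kap_def Gam_def)
  also have "\<dots> = ((a \<bullet> I) \<odot> J) \<cdot> \<phi> X H \<cdot> (a \<bullet> H\<^sup>-) \<cdot> ((X \<odot> H) \<bullet> lc H\<^sup>-) \<cdot> ((X \<odot> H) \<bullet> (I \<odot> s)) \<cdot> \<zeta> X I H H \<cdot> (N \<odot> ?d)"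
    by (simp add: circ.lunit_nat)
  also have "\<dots> = ((a \<bullet> I) \<odot> J) \<cdot> \<phi> X H \<cdot> (a \<bullet> H\<^sup>-) \<cdot> ((X \<odot> H) \<bullet> lc H\<^sup>-) \<cdot> \<zeta> X I H H\<^sup>- \<cdot> (N \<odot> ?w)"
    using circ.ext2[OF zeta_nat[of X I H s X I H "H\<^sup>-"], of "N \<odot> ?d"] by simp
  also have "\<dots> = (((a \<cdot> (a \<odot> H)) \<bullet> I) \<odot> J) \<cdot> \<phi> (X \<odot> H) H \<cdot> ((X \<odot> H) \<bullet> lc H\<^sup>-) \<cdot> \<zeta> X I H H\<^sup>- \<cdot> (N \<odot> ?w)"
    using circ.ext2[OF phi_nat[of a H "X \<odot> H" X H H], of "((X \<odot> H) \<bullet> lc H\<^sup>-) \<cdot> \<zeta> X I H H\<^sup>- \<cdot> (N \<odot> ?w)"] by simp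
  also have "\<dots> = (((a \<cdot> (a \<odot> H)) \<bullet> I) \<odot> J) \<cdot> (\<delta> (X \<odot> H) I H J \<cdot> ((X \<odot> H) \<bullet> (I \<odot> rbi H\<^sup>-)) \<cdot> \<zeta> X I H H\<^sup>-) \<cdot> (N \<odot> ?w)"
    by (simp add: \<phi>_def)
  also have "\<dots> = (((a \<cdot> (X \<odot> mult B)) \<bullet> rc I) \<odot> J) \<cdot> (\<zeta> X I (H \<odot> H) I \<odot> J) \<cdot> aci N ((H \<odot> H) \<bullet> I) J \<cdot> (N \<odot> (\<phi> H H \<cdot> ?w))"
    unfolding delta_zeta by (simp add: action_assoc)
  also have "\<dots> = ((a \<bullet> rc I) \<odot> J) \<cdot> (\<zeta> X I H I \<odot> J) \<cdot> ((N \<odot> (mult B \<bullet> I)) \<odot> J) \<cdot> aci N ((H \<odot> H) \<bullet> I) J \<cdot> (N \<odot> (\<phi> H H \<cdot> ?w))"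
    using zeta_nat[of X I "mult B" I X I H I] by simp
  also have "\<dots> = ((a \<bullet> rc I) \<odot> J) \<cdot> (\<zeta> X I H I \<odot> J) \<cdot> aci N (H \<bullet> I) J \<cdot> (N \<odot> (((mult B \<bullet> I) \<odot> J) \<cdot> \<phi> H H \<cdot> ?w))"
    using circ.ext2[OF circ.inv_assoc_nat[of N "mult B \<bullet> I" J N "H \<bullet> I" J], of "N \<odot> (\<phi> H H \<cdot> ?w)"] by simp
  also have "\<dots> = ((a \<bullet> rc I) \<odot> J) \<cdot> (\<zeta> X I H I \<odot> J) \<cdot> aci N (H \<bullet> I) J \<cdot> (N \<odot> (?u \<odot> J)) \<cdot> (N \<odot> (lci J \<cdot> counit B))"
    by (simp add: antipode_right)
  also have "\<dots> = ((a \<bullet> rc I) \<odot> J) \<cdot> ((\<zeta> X I H I \<cdot> (N \<odot> ?u)) \<odot> J) \<cdot> aci N I J \<cdot> (N \<odot> lci J) \<cdot> (N \<odot> counit B)"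
    using circ.ext2[OF circ.inv_assoc_nat[of N ?u J N "H \<bullet> I" J], of "N \<odot> (lci J \<cdot> counit B)"] by simp
  also have "\<dots> = ((a \<bullet> rc I) \<odot> J) \<cdot> ((\<zeta> X I H I \<cdot> (N \<odot> ?u)) \<odot> J) \<cdot> (rci N \<odot> counit B)"
    using circ.ext2[OF circ.inv_triangle_inv[of N J], of "N \<odot> counit B"] by simp
  also have "\<dots> = (((a \<cdot> (X \<odot> unt B)) \<bullet> rc I) \<odot> J) \<cdot> ((\<zeta> X I I I \<cdot> (N \<odot> \<Delta>\<^sub>I)) \<odot> J) \<cdot> (rci N \<odot> counit B)"
    using circ.ext2[OF zeta_nat[of X I "unt B" I X I H I], of "N \<odot> \<Delta>\<^sub>I"] by simp
  also have "\<dots> = N \<odot> counit B"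
    unfolding action_unit zeta_rc_inv[OF X_ob circ.unit_ob'] by simp
  finally show ?thesis .
qed

text \<open>Discarding the inner copy of I in the cofree comodule cancels its coaction, by
  \<open>co_counit_left\<close>, so only \<open>\<phi>c\<^sub>0\<close> remains.\<close>

lemma Lam_pr:
  assumes [simp]: "Y \<in> Ob \<C>" "V \<in> Ob \<C>"
  shows "(pr Y \<odot> V) \<cdot> Lam (Y \<bullet> I) (co Y) V = (Y \<odot> (lb V \<cdot> (J \<bullet> lc V))) \<cdot> \<gamma> Y I J V \<cdot> (((Y \<bullet> \<phi>c\<^sub>0) \<odot> J) \<bullet> V)"
proof -
  let ?c = "((((Y \<bullet> I) \<bullet> \<phi>c\<^sub>0) \<cdot> co Y) \<odot> J) \<bullet> V"
  have "(pr Y \<odot> V) \<cdot> Lam (Y \<bullet> I) (co Y) V = (Y \<odot> (lb V \<cdot> (J \<bullet> lc V))) \<cdot> (pr Y \<odot> (J \<bullet> (I \<odot> V))) \<cdot> \<gamma> (Y \<bullet> I) I J V \<cdot> ?c"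
    by (simp add: Lam_def)
  also have "\<dots> = (Y \<odot> (lb V \<cdot> (J \<bullet> lc V))) \<cdot> \<gamma> Y I J V \<cdot> (((pr Y \<bullet> I\<^sup>-) \<odot> J) \<bullet> V) \<cdot> ?c"
    using circ.ext2[OF gamma_nat[of "pr Y" I J V Y I J V], of ?c] by simp
  also have "\<dots> = (Y \<odot> (lb V \<cdot> (J \<bullet> lc V))) \<cdot> \<gamma> Y I J V \<cdot> ((((Y \<bullet> \<phi>c\<^sub>0) \<cdot> (pr Y \<bullet> I) \<cdot> co Y) \<odot> J) \<bullet> V)"
    by simp
  finally show ?thesis by (simp only: co_counit_left assms) simp
qed

text \<open>This is \<open>R8\<close> at Y = I, where \<open>\<phi>c I H\<close> is cancelled by the
  lax unit law. A composite of \<delta> and \<gamma> becomes a single \<gamma>: the product (x h^-1)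
  h' is rebracketed so that h^-1 meets h', as the left antipode equation requires.\<close>

lemma gamma_phi:
  "(pr (X \<odot> H) \<odot> H) \<cdot> Lam ((X \<odot> H) \<bullet> I) (co (X \<odot> H)) H \<cdot> (\<phi> X H \<bullet> H) =
    aci X H H \<cdot> (X \<odot> lb (H \<odot> H)) \<cdot> \<gamma> X H J H \<cdot> ((((X \<bullet> H\<^sup>-) \<odot> \<epsilon>\<^sub>I) \<cdot> rci (X \<bullet> H\<^sup>-)) \<bullet> H)"
proof -
  let ?XH = "X \<odot> H"
  \<comment> \<open>\<open>?t\<close> fills slots of \<open>R8\<close>:
    \<open>\<phi>c\<^sub>0\<close> produces the slot \<open>I\<^sup>-\<close>, and
    \<open>\<epsilon>\<^sub>I\<close> produces the last J. The multiplication
    \<open>m\<^sub>J\<close> in \<open>?k\<close> collapses the resulting J \<odot> J again.\<close>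
  let ?t = "(((X \<bullet> ((\<phi>c\<^sub>0 \<odot> H\<^sup>-) \<cdot> lci H\<^sup>-)) \<odot> \<epsilon>\<^sub>I) \<cdot> rci (X \<bullet> H\<^sup>-)) \<bullet> H"
  let ?k = "?XH \<odot> (lb H \<cdot> (J \<bullet> lc H) \<cdot> (m\<^sub>J \<bullet> (I \<odot> H)))"
  let ?M = "?XH \<bullet> I\<^sup>-"
  define F where "F = ((?XH \<bullet> \<phi>c\<^sub>0) \<odot> J) \<cdot> \<phi> X H"
  have [simp]: "F \<in> Arr \<C>" "Dom \<C> F = X \<bullet> H\<^sup>-" "Cod \<C> F = ?M \<odot> J" by (simp_all add: F_def)
  have F: "\<delta> X I\<^sup>- H J \<cdot> (X \<bullet> ((\<phi>c\<^sub>0 \<odot> rbi H\<^sup>-) \<cdot> lci H\<^sup>-)) = F"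
    using circ.ext2[OF delta_nat[of X \<phi>c\<^sub>0 H J X "I\<^sup>-" H J], of "X \<bullet> ((I \<odot> rbi H\<^sup>-) \<cdot> lci H\<^sup>-)"]
    by (simp add: F_def \<phi>_def)
  have "((\<delta> X I\<^sup>- H J \<odot> J) \<bullet> H) \<cdot> (((X \<bullet> (I\<^sup>- \<odot> rbi H\<^sup>-)) \<odot> J) \<bullet> H) \<cdot> ?t = ((F \<odot> \<epsilon>\<^sub>I) \<cdot> rci (X \<bullet> H\<^sup>-)) \<bullet> H"
    by (simp flip: F)
  also have "\<dots> = (((?M \<odot> J) \<odot> \<epsilon>\<^sub>I) \<cdot> rci (?M \<odot> J) \<cdot> F) \<bullet> H"
    by (simp add: circ.inv_runit_nat)
  finally have "(ac ?M J J \<bullet> H) \<cdot> ((\<delta> X I\<^sup>- H J \<odot> J) \<bullet> H) \<cdot> (((X \<bullet> (I\<^sup>- \<odot> rbi H\<^sup>-)) \<odot> J) \<bullet> H) \<cdot> ?t =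
      (ac ?M J J \<bullet> H) \<cdot> ((((?M \<odot> J) \<odot> \<epsilon>\<^sub>I) \<cdot> rci (?M \<odot> J) \<cdot> F) \<bullet> H)" by simp
  also have "\<dots> = ((?M \<odot> ((J \<odot> \<epsilon>\<^sub>I) \<cdot> rci J)) \<bullet> H) \<cdot> (F \<bullet> H)"
    using circ.ext2[OF circ.assoc_nat[of ?M J \<epsilon>\<^sub>I ?M J J], of "rci (?M \<odot> J) \<cdot> F"]
      circ.ext2[OF circ.assoc_inv_runit[of ?M J], of F] by simp
  finally have l: "(ac ?M J J \<bullet> H) \<cdot> ((\<delta> X I\<^sup>- H J \<odot> J) \<bullet> H) \<cdot> (((X \<bullet> (I\<^sup>- \<odot> rbi H\<^sup>-)) \<odot> J) \<bullet> H) \<cdot> ?t =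
      ((?M \<odot> ((J \<odot> \<epsilon>\<^sub>I) \<cdot> rci J)) \<bullet> H) \<cdot> (F \<bullet> H)" .
  have mm: "m\<^sub>J \<cdot> (J \<odot> \<epsilon>\<^sub>I) \<cdot> rci J = J"
    using circ.ext2[OF mJ_unit(2), of "rci J"] by simp
  have "?k \<cdot> \<gamma> ?XH I (J \<odot> J) H \<cdot> (ac ?M J J \<bullet> H) \<cdot> ((\<delta> X I\<^sup>- H J \<odot> J) \<bullet> H) \<cdot> (((X \<bullet> (I\<^sup>- \<odot> rbi H\<^sup>-)) \<odot> J) \<bullet> H) \<cdot> ?t
     = ?k \<cdot> \<gamma> ?XH I (J \<odot> J) H \<cdot> ((?M \<odot> ((J \<odot> \<epsilon>\<^sub>I) \<cdot> rci J)) \<bullet> H) \<cdot> (F \<bullet> H)"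
    by (simp only: l)
  also have "\<dots> = (?XH \<odot> (lb H \<cdot> ((m\<^sub>J \<cdot> (J \<odot> \<epsilon>\<^sub>I) \<cdot> rci J) \<bullet> lc H))) \<cdot> \<gamma> ?XH I J H \<cdot> (F \<bullet> H)"
    using circ.ext2[OF gamma_nat[of ?XH I "(J \<odot> \<epsilon>\<^sub>I) \<cdot> rci J" H ?XH I "J \<odot> J" H], of "F \<bullet> H"] by simp
  also have "\<dots> = (?XH \<odot> (lb H \<cdot> (J \<bullet> lc H))) \<cdot> \<gamma> ?XH I J H \<cdot> (F \<bullet> H)"
    unfolding mm ..
  also have "\<dots> = (pr ?XH \<odot> H) \<cdot> Lam (?XH \<bullet> I) (co ?XH) H \<cdot> (\<phi> X H \<bullet> H)"
    using circ.ext2[OF Lam_pr[of ?XH H], of "\<phi> X H \<bullet> H"] by (simp add: F_def)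
  finally have left: "?k \<cdot> \<gamma> ?XH I (J \<odot> J) H \<cdot> (ac ?M J J \<bullet> H) \<cdot> ((\<delta> X I\<^sup>- H J \<odot> J) \<bullet> H) \<cdot> (((X \<bullet> (I\<^sup>- \<odot> rbi H\<^sup>-)) \<odot> J) \<bullet> H) \<cdot> ?t
     = (pr ?XH \<odot> H) \<cdot> Lam (?XH \<bullet> I) (co ?XH) H \<cdot> (\<phi> X H \<bullet> H)" .
  let ?g = "\<gamma> X H J H \<cdot> ((((X \<bullet> H\<^sup>-) \<odot> \<epsilon>\<^sub>I) \<cdot> rci (X \<bullet> H\<^sup>-)) \<bullet> H)"
  have "lb H \<cdot> (J \<bullet> lc H) \<cdot> (m\<^sub>J \<bullet> (I \<odot> H)) \<cdot> \<zeta> J I J H = lc H \<cdot> lb (I \<odot> H) \<cdot> (m\<^sub>J \<bullet> (I \<odot> H)) \<cdot> \<zeta> J I J H"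
    using circ.ext2[OF blt.lunit_nat[of "lc H" H], of "(m\<^sub>J \<bullet> (I \<odot> H)) \<cdot> \<zeta> J I J H"] by simp
  also have "\<dots> = lc H \<cdot> (lb I \<odot> lb H)" by (simp only: zeta_lb circ.unit_ob' Hopf_arr)
  finally have z: "lb H \<cdot> (J \<bullet> lc H) \<cdot> (m\<^sub>J \<bullet> (I \<odot> H)) \<cdot> \<zeta> J I J H = lc H \<cdot> (lb I \<odot> lb H)" .
  have "\<phi>c I H \<cdot> (\<phi>c\<^sub>0 \<odot> H\<^sup>-) \<cdot> lci H\<^sup>- = (rci H)\<^sup>-"
  proof -
    have "(rci H)\<^sup>- \<cdot> (rc H)\<^sup>- \<cdot> \<phi>c I H \<cdot> (\<phi>c\<^sub>0 \<odot> H\<^sup>-) \<cdot> lci H\<^sup>- = (rci H)\<^sup>-"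
      using circ.ext3[OF phic_unit[of H], of "lci H\<^sup>-"] by simp
    then show ?thesis by simp
  qed
  then have "((X \<odot> lb ((H \<odot> I) \<odot> H)) \<cdot> \<gamma> X (H \<odot> I) J H \<cdot> (((X \<bullet> \<phi>c I H) \<odot> J) \<bullet> H)) \<cdot> ?t
     = (X \<odot> lb ((H \<odot> I) \<odot> H)) \<cdot> \<gamma> X (H \<odot> I) J H \<cdot> (((X \<bullet> (rci H)\<^sup>-) \<odot> J) \<bullet> H) \<cdot> ((((X \<bullet> H\<^sup>-) \<odot> \<epsilon>\<^sub>I) \<cdot> rci (X \<bullet> H\<^sup>-)) \<bullet> H)"
    by simp
  also have "\<dots> = (X \<odot> (lb ((H \<odot> I) \<odot> H) \<cdot> (J \<bullet> (rci H \<odot> H)))) \<cdot> ?g"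
    using circ.ext2[OF gamma_nat[of X "rci H" J H X "H \<odot> I" J H], of "(((X \<bullet> H\<^sup>-) \<odot> \<epsilon>\<^sub>I) \<cdot> rci (X \<bullet> H\<^sup>-)) \<bullet> H"]
    by simp
  also have "\<dots> = (X \<odot> (rci H \<odot> H)) \<cdot> (X \<odot> lb (H \<odot> H)) \<cdot> ?g"
    by (simp add: blt.lunit_nat)
  finally have r: "((X \<odot> lb ((H \<odot> I) \<odot> H)) \<cdot> \<gamma> X (H \<odot> I) J H \<cdot> (((X \<bullet> \<phi>c I H) \<odot> J) \<bullet> H)) \<cdot> ?t
     = (X \<odot> (rci H \<odot> H)) \<cdot> (X \<odot> lb (H \<odot> H)) \<cdot> ?g" .
  have "?k \<cdot> (?XH \<odot> \<zeta> J I J H) \<cdot> (?XH \<odot> (lbi I \<odot> lbi H)) \<cdot>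
        aci X H (I \<odot> H) \<cdot> (X \<odot> ac H I H) \<cdot> (X \<odot> lb ((H \<odot> I) \<odot> H)) \<cdot> \<gamma> X (H \<odot> I) J H \<cdot> (((X \<bullet> \<phi>c I H) \<odot> J) \<bullet> H) \<cdot> ?t
     = (?XH \<odot> ((lb H \<cdot> (J \<bullet> lc H) \<cdot> (m\<^sub>J \<bullet> (I \<odot> H)) \<cdot> \<zeta> J I J H) \<cdot> (lbi I \<odot> lbi H))) \<cdot>
        aci X H (I \<odot> H) \<cdot> (X \<odot> ac H I H) \<cdot> ((X \<odot> lb ((H \<odot> I) \<odot> H)) \<cdot> \<gamma> X (H \<odot> I) J H \<cdot> (((X \<bullet> \<phi>c I H) \<odot> J) \<bullet> H)) \<cdot> ?t"
    by simp
  also have "\<dots> = (?XH \<odot> lc H) \<cdot> aci X H (I \<odot> H) \<cdot> (X \<odot> ac H I H) \<cdot> (X \<odot> (rci H \<odot> H)) \<cdot> (X \<odot> lb (H \<odot> H)) \<cdot> ?g"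
    unfolding z r by simp
  also have "\<dots> = (?XH \<odot> lc H) \<cdot> aci X H (I \<odot> H) \<cdot> (X \<odot> (H \<odot> lci H)) \<cdot> (X \<odot> lb (H \<odot> H)) \<cdot> ?g"
    using circ.ext2[OF circ.triangle_inv[of H H], of "lb (H \<odot> H)"] by simp
  also have "\<dots> = aci X H H \<cdot> (X \<odot> lb (H \<odot> H)) \<cdot> ?g"
    using circ.ext2[OF circ.inv_assoc_nat[of X H "lci H" X H "I \<odot> H"], of "(X \<odot> lb (H \<odot> H)) \<cdot> ?g"] by simp
  finally show ?thesis
    using left arg_cong[OF R8[of X I H H], of "\<lambda>f. ?k \<cdot> f \<cdot> ?t"] by simp
qed

text \<open>On elements, (x h_1^-1) h_2 is x with the counit of h. The J in the value of
  \<open>kap\<close> is cancelled against the second copy of h by \<open>Lam\<close>. After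
  associativity of the action and \<open>gamma_phi\<close>, the left antipode equation applies in
  its extended form with V = X.\<close>

lemma division_cancel:
  "a \<cdot> (pr X \<odot> H) \<cdot> LamN \<cdot> (kap \<bullet> H) \<cdot> abi X H H \<cdot> (X \<bullet> comult B) = rb X \<cdot> (X \<bullet> counit B)"
proof -
  let ?XH = "X \<odot> H" and ?d = "comult B"
  let ?L = "Lam (?XH \<bullet> I) (co ?XH) H"
  let ?t = "abi X H H\<^sup>-"
  let ?w = "(s \<bullet> H) \<cdot> ?d"
  have "(kap \<bullet> H) \<cdot> abi X H H \<cdot> (X \<bullet> ?d) = (((a \<bullet> I) \<odot> J) \<bullet> H) \<cdot> (\<phi> X H \<bullet> H) \<cdot> ((X \<bullet> s) \<bullet> H) \<cdot> abi X H H \<cdot> (X \<bullet> ?d)"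
    by (simp add: kap_def)
  also have "\<dots> = (((a \<bullet> I) \<odot> J) \<bullet> H) \<cdot> (\<phi> X H \<bullet> H) \<cdot> abi X H\<^sup>- H \<cdot> (X \<bullet> ?w)"
    using circ.ext2[OF blt.inv_assoc_nat[of X s H X "H\<^sup>-" H], of "X \<bullet> ?d"] by simp
  finally have k: "(kap \<bullet> H) \<cdot> abi X H H \<cdot> (X \<bullet> ?d) = (((a \<bullet> I) \<odot> J) \<bullet> H) \<cdot> (\<phi> X H \<bullet> H) \<cdot> abi X H\<^sup>- H \<cdot> (X \<bullet> ?w)" .
  have "a \<cdot> (pr X \<odot> H) \<cdot> LamN \<cdot> (kap \<bullet> H) \<cdot> abi X H H \<cdot> (X \<bullet> ?d)
    = a \<cdot> (pr X \<odot> H) \<cdot> ((a \<bullet> I) \<odot> H) \<cdot> ?L \<cdot> (\<phi> X H \<bullet> H) \<cdot> abi X H\<^sup>- H \<cdot> (X \<bullet> ?w)"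
    unfolding k using circ.ext2[OF Lam_nat[of "?XH \<bullet> I" "co ?XH" N "co X" "a \<bullet> I" H H H, OF _ _ _ _ _ _ _ _ _ _ _ _ _ _ co_nat],
       of "(\<phi> X H \<bullet> H) \<cdot> abi X H\<^sup>- H \<cdot> (X \<bullet> ?w)"] by simp
  also have "\<dots> = (a \<cdot> (a \<odot> H)) \<cdot> (pr ?XH \<odot> H) \<cdot> ?L \<cdot> (\<phi> X H \<bullet> H) \<cdot> abi X H\<^sup>- H \<cdot> (X \<bullet> ?w)"
  proof -
    have "pr X \<cdot> (a \<bullet> I) = rb X \<cdot> (a \<bullet> J) \<cdot> (?XH \<bullet> \<epsilon>\<^sub>I)" by simp
    also have "\<dots> = a \<cdot> pr ?XH" using circ.ext2[OF blt.runit_nat[of a X], of "?XH \<bullet> \<epsilon>\<^sub>I"] by simp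
    finally have "pr X \<cdot> (a \<bullet> I) = a \<cdot> pr ?XH" .
    then show ?thesis by simp
  qed
  also have "\<dots> = a \<cdot> (X \<odot> mult B) \<cdot> ac X H H \<cdot> ((pr ?XH \<odot> H) \<cdot> ?L \<cdot> (\<phi> X H \<bullet> H)) \<cdot> abi X H\<^sup>- H \<cdot> (X \<bullet> ?w)"
    unfolding action_assoc by simp
  also have "\<dots> = a \<cdot> (X \<odot> (mult B \<cdot> lb (H \<odot> H))) \<cdot> \<gamma> X H J H \<cdot> ((((X \<bullet> H\<^sup>-) \<odot> \<epsilon>\<^sub>I) \<cdot> rci (X \<bullet> H\<^sup>-)) \<bullet> H) \<cdot> abi X H\<^sup>- H \<cdot> (X \<bullet> ?w)"
    unfolding gamma_phi by simp
  also have "\<dots> = a \<cdot> (X \<odot> (mult B \<cdot> lb (H \<odot> H))) \<cdot> (X \<odot> (\<epsilon>\<^sub>I \<bullet> (H \<odot> H))) \<cdot> \<gamma> X H I H \<cdot> (rci (X \<bullet> H\<^sup>-) \<bullet> H) \<cdot> abi X H\<^sup>- H \<cdot> (X \<bullet> ?w)"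
    using circ.ext2[OF gamma_nat[of X H \<epsilon>\<^sub>I H X H J H], of "(rci (X \<bullet> H\<^sup>-) \<bullet> H) \<cdot> abi X H\<^sup>- H \<cdot> (X \<bullet> ?w)"] by simp
  also have "\<dots> = a \<cdot> (X \<odot> (lb H \<cdot> (\<epsilon>\<^sub>I \<bullet> H))) \<cdot> (X \<odot> (I \<bullet> mult B)) \<cdot> \<gamma> X H I H \<cdot> (rci (X \<bullet> H\<^sup>-) \<bullet> H) \<cdot> abi X H\<^sup>- H \<cdot> (X \<bullet> ?w)"
    using circ.ext2[OF blt.lunit_nat[of "mult B" H], of "\<epsilon>\<^sub>I \<bullet> (H \<odot> H)"] by simp
  also have "\<dots> = a \<cdot> (X \<odot> (lb H \<cdot> (\<epsilon>\<^sub>I \<bullet> H))) \<cdot> (X \<odot> ((I \<bullet> unt B) \<cdot> \<Delta>\<^sub>I)) \<cdot> rci X \<cdot> rb X \<cdot> (X \<bullet> counit B)"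
    using left_inverse_extend[of H "mult B" "unt B" ?w "counit B" X X] antipode_left by simp
  also have "\<dots> = a \<cdot> (X \<odot> (lb H \<cdot> (J \<bullet> unt B) \<cdot> (\<epsilon>\<^sub>I \<bullet> I) \<cdot> \<Delta>\<^sub>I)) \<cdot> rci X \<cdot> rb X \<cdot> (X \<bullet> counit B)"
    by simp
  also have "\<dots> = (a \<cdot> (X \<odot> unt B)) \<cdot> rci X \<cdot> rb X \<cdot> (X \<bullet> counit B)"
    unfolding I_counit_left using circ.ext2[OF blt.lunit_nat[of "unt B" H], of "lbi I"] by simp
  also have "\<dots> = rb X \<cdot> (X \<bullet> counit B)"
    unfolding action_unit by simp
  finally show ?thesis .
qed

text \<open>The coaction of H on N \<odot> H, on elements n \<odot> h to (n \<odot> h_1, h_2). The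
  copy of I that accompanies the second leg is absorbed by \<open>lc\<close>.\<close>

definition om where "om = ((N \<odot> H) \<bullet> lc H) \<cdot> \<zeta> N I H H \<cdot> (co X \<odot> comult B)"

lemma om_arr [simp]: "om \<in> Arr \<C>" "Dom \<C> om = N \<odot> H" "Cod \<C> om = (N \<odot> H) \<bullet> H"
  by (simp_all add: om_def)

lemma Gam_om: "Gam = ((a \<cdot> (pr X \<odot> H)) \<bullet> H) \<cdot> om"
proof -
  have "((a \<cdot> (pr X \<odot> H)) \<bullet> H) \<cdot> om = (a \<bullet> lc H) \<cdot> \<zeta> X I H H \<cdot> (((pr X \<bullet> I) \<cdot> co X) \<odot> comult B)"
    using circ.ext2[OF zeta_nat[of "pr X" I H H X I H H], of "co X \<odot> comult B"] by (simp add: om_def)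
  then show ?thesis by (simp only: co_counit_left X_ob Gam_def)
qed

text \<open>Under \<open>lam\<close> the coaction \<open>om\<close> becomes the comultiplication of
  the factor H alone. The associativity law of \<zeta> for \<bullet> combines the two
  comultiplications, and its unit law removes the two copies of I.\<close>

lemma lam_om: "(lamN \<bullet> H) \<cdot> om = abi G H H \<cdot> (G \<bullet> comult B) \<cdot> lamN"
proof -
  let ?n = "co X" and ?d = "comult B"
  have nn: "ab N I I \<cdot> (?n \<bullet> I) \<cdot> ?n = (N \<bullet> \<Delta>\<^sub>I) \<cdot> ?n"
    using co_coassoc[of X, symmetric] by (simp add: co_def[of N])
  have dd: "ab J H H \<cdot> (lbi H \<bullet> H) \<cdot> ?d = (J \<bullet> ?d) \<cdot> lbi H"
    using circ.ext2[OF blt.assoc_inv_lunit[of H H], of ?d] by (simp add: blt.inv_lunit_nat)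
  let ?e = "((?n \<bullet> I) \<cdot> ?n) \<odot> ((lbi H \<bullet> H) \<cdot> ?d)"
  have "(lamN \<bullet> H) \<cdot> om = (((G \<bullet> lc H) \<cdot> \<zeta> N I J H) \<bullet> lc H) \<cdot> ((?n \<odot> lbi H) \<bullet> (I \<odot> H)) \<cdot> \<zeta> N I H H \<cdot> (?n \<odot> ?d)"
    by (simp add: lam_def om_def)
  also have "\<dots> = ((G \<bullet> lc H) \<bullet> lc H) \<cdot> (\<zeta> N I J H \<bullet> (I \<odot> H)) \<cdot> \<zeta> (N \<bullet> I) I (J \<bullet> H) H \<cdot> ?e"
    using circ.ext2[OF zeta_nat[of ?n I "lbi H" H "N \<bullet> I" I "J \<bullet> H" H], of "?n \<odot> ?d"] by simp
  also have "\<dots> = ((G \<bullet> lc H) \<bullet> lc H) \<cdot> abi G (I \<odot> H) (I \<odot> H) \<cdot> ab G (I \<odot> H) (I \<odot> H) \<cdot> (\<zeta> N I J H \<bullet> (I \<odot> H)) \<cdot> \<zeta> (N \<bullet> I) I (J \<bullet> H) H \<cdot> ?e"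
    by simp
  also have "\<dots> = ((G \<bullet> lc H) \<bullet> lc H) \<cdot> abi G (I \<odot> H) (I \<odot> H) \<cdot> (G \<bullet> \<zeta> I I H H) \<cdot> \<zeta> N (I \<bullet> I) J (H \<bullet> H) \<cdot> (ab N I I \<odot> ab J H H) \<cdot> ?e"
    using arg_cong[OF zeta_assoc_blt[of N I I J H H], of "\<lambda>f. ((G \<bullet> lc H) \<bullet> lc H) \<cdot> abi G (I \<odot> H) (I \<odot> H) \<cdot> f \<cdot> ?e"] by simp
  also have "\<dots> = ((G \<bullet> lc H) \<bullet> lc H) \<cdot> abi G (I \<odot> H) (I \<odot> H) \<cdot> (G \<bullet> \<zeta> I I H H) \<cdot> \<zeta> N (I \<bullet> I) J (H \<bullet> H) \<cdot> ((N \<bullet> \<Delta>\<^sub>I) \<odot> (J \<bullet> ?d)) \<cdot> (?n \<odot> lbi H)"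
    by (simp add: nn dd)
  also have "\<dots> = ((G \<bullet> lc H) \<bullet> lc H) \<cdot> abi G (I \<odot> H) (I \<odot> H) \<cdot> (G \<bullet> ((\<zeta> I I H H \<cdot> (\<Delta>\<^sub>I \<odot> (H \<bullet> H))) \<cdot> (I \<odot> ?d))) \<cdot> \<zeta> N I J H \<cdot> (?n \<odot> lbi H)"
    using circ.ext2[OF zeta_nat[of N "\<Delta>\<^sub>I" J ?d N "I \<bullet> I" J "H \<bullet> H"], of "?n \<odot> lbi H"] by simp
  also have "\<dots> = ((G \<bullet> lc H) \<bullet> lc H) \<cdot> abi G (I \<odot> H) (I \<odot> H) \<cdot> (G \<bullet> (lci H \<bullet> lci H)) \<cdot> (G \<bullet> (?d \<cdot> lc H)) \<cdot> \<zeta> N I J H \<cdot> (?n \<odot> lbi H)"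
    unfolding zeta_lc_inv[OF Hopf_arr(1) Hopf_arr(1)] by (simp add: circ.lunit_nat)
  also have "\<dots> = abi G H H \<cdot> (G \<bullet> (?d \<cdot> lc H)) \<cdot> \<zeta> N I J H \<cdot> (?n \<odot> lbi H)"
    using circ.ext2[OF blt.inv_assoc_nat[of G "lc H" "lc H" G H H, symmetric], of "(G \<bullet> ((lci H \<bullet> lci H) \<cdot> ?d \<cdot> lc H)) \<cdot> \<zeta> N I J H \<cdot> (?n \<odot> lbi H)"]
    by simp
  also have "\<dots> = abi G H H \<cdot> (G \<bullet> ?d) \<cdot> lamN" by (simp add: lam_def)
  finally show ?thesis .
qed

lemma om_Lam: "om \<cdot> LamN = (LamN \<bullet> H) \<cdot> abi G H H \<cdot> (G \<bullet> comult B)"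
proof -
  have "om \<cdot> LamN = (LamN \<bullet> H) \<cdot> (lamN \<bullet> H) \<cdot> om \<cdot> LamN"
    using Lam_lam[of X H] by simp
  also have "\<dots> = (LamN \<bullet> H) \<cdot> abi G H H \<cdot> (G \<bullet> comult B) \<cdot> lamN \<cdot> LamN"
    using circ.ext2[OF lam_om, of LamN] by simp
  finally show ?thesis by (simp add: lam_Lam)
qed

text \<open>Coassociativity of H with the factor X carried along on the left; the pentagon accounts
  for the different bracketings.\<close>

lemma comult_unfold:
  "((abi X H H \<cdot> (X \<bullet> comult B)) \<bullet> H) \<cdot> abi X H H \<cdot> (X \<bullet> comult B) =
    abi (X \<bullet> H) H H \<cdot> ((X \<bullet> H) \<bullet> comult B) \<cdot> abi X H H \<cdot> (X \<bullet> comult B)"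
proof -
  let ?d = "comult B"
  have "((abi X H H \<cdot> (X \<bullet> ?d)) \<bullet> H) \<cdot> abi X H H \<cdot> (X \<bullet> ?d) = (abi X H H \<bullet> H) \<cdot> ((X \<bullet> ?d) \<bullet> H) \<cdot> abi X H H \<cdot> (X \<bullet> ?d)"
    by simp
  also have "\<dots> = ((abi X H H \<bullet> H) \<cdot> abi X (H \<bullet> H) H) \<cdot> (X \<bullet> ((?d \<bullet> H) \<cdot> ?d))"
    using circ.ext2[OF blt.inv_assoc_nat[of X ?d H X "H \<bullet> H" H], of "X \<bullet> ?d"] by simp
  also have "\<dots> = abi (X \<bullet> H) H H \<cdot> abi X H (H \<bullet> H) \<cdot> (X \<bullet> (ab H H H \<cdot> (?d \<bullet> H) \<cdot> ?d))"
    by (subst blt.inv_pentagon[symmetric]) simp_all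
  also have "\<dots> = abi (X \<bullet> H) H H \<cdot> ((X \<bullet> H) \<bullet> ?d) \<cdot> abi X H H \<cdot> (X \<bullet> ?d)"
    unfolding coassoc using circ.ext2[OF blt.inv_assoc_nat[of X H ?d X H "H \<bullet> H"], of "X \<bullet> ?d"] by simp
  finally show ?thesis .
qed

lemma counit_unfold: "((rb X \<cdot> (X \<bullet> counit B)) \<bullet> H) \<cdot> abi X H H \<cdot> (X \<bullet> comult B) = X \<bullet> H"
proof -
  have "((rb X \<cdot> (X \<bullet> counit B)) \<bullet> H) \<cdot> abi X H H \<cdot> (X \<bullet> comult B)
     = (rb X \<bullet> H) \<cdot> ((X \<bullet> counit B) \<bullet> H) \<cdot> abi X H H \<cdot> (X \<bullet> comult B)" by simp
  also have "\<dots> = (rb X \<bullet> H) \<cdot> abi X J H \<cdot> (X \<bullet> ((counit B \<bullet> H) \<cdot> comult B))"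
    using circ.ext2[OF blt.inv_assoc_nat[of X "counit B" H X J H], of "X \<bullet> comult B"] by simp
  also have "\<dots> = X \<bullet> (lb H \<cdot> (counit B \<bullet> H) \<cdot> comult B)"
    using circ.ext2[OF blt.inv_triangle[of X H], of "X \<bullet> ((counit B \<bullet> H) \<cdot> comult B)"] by simp
  finally show ?thesis by (simp add: counit_left)
qed

text \<open>On elements, (x, h) goes to x h_1^-1 \<odot> h_2 and then to (x h_1^-1 h_2, h_3), which
  is (x, h) by \<open>division_cancel\<close>. So \<open>Gam\<close> is a split epimorphism.\<close>

lemma Gam_Lam: "Gam \<cdot> LamN \<cdot> (kap \<bullet> H) \<cdot> abi X H H \<cdot> (X \<bullet> comult B) = X \<bullet> H"
proof -
  let ?d = "comult B"
  let ?D = "abi X H H \<cdot> (X \<bullet> ?d)"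
  let ?p = "a \<cdot> (pr X \<odot> H)"
  have "Gam \<cdot> LamN \<cdot> (kap \<bullet> H) \<cdot> ?D = (?p \<bullet> H) \<cdot> (om \<cdot> LamN) \<cdot> (kap \<bullet> H) \<cdot> ?D"
    by (simp add: Gam_om)
  also have "\<dots> = ((?p \<cdot> LamN) \<bullet> H) \<cdot> abi G H H \<cdot> (kap \<bullet> (H \<bullet> H)) \<cdot> ((X \<bullet> H) \<bullet> ?d) \<cdot> ?D"
    unfolding om_Lam by simp
  also have "\<dots> = ((?p \<cdot> LamN \<cdot> (kap \<bullet> H)) \<bullet> H) \<cdot> (abi (X \<bullet> H) H H \<cdot> ((X \<bullet> H) \<bullet> ?d) \<cdot> ?D)"
    using circ.ext2[OF blt.inv_assoc_nat[of kap H H G H H], of "((X \<bullet> H) \<bullet> ?d) \<cdot> ?D"] by simp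
  also have "\<dots> = ((a \<cdot> (pr X \<odot> H) \<cdot> LamN \<cdot> (kap \<bullet> H) \<cdot> ?D) \<bullet> H) \<cdot> ?D"
    by (simp flip: comult_unfold)
  also have "\<dots> = X \<bullet> H"
    unfolding division_cancel by (simp only: counit_unfold)
  finally show ?thesis .
qed

end

section \<open>Convolution inverses\<close>

context duoidal_category
begin

lemma comonoid_arr:
  assumes "comonoid_in \<C> S Z d e"
  shows "Z \<in> Ob \<C>" "d \<in> Arr \<C>" "Dom \<C> d = Z" "Cod \<C> d = Z \<bullet> Z" "e \<in> Arr \<C>" "Dom \<C> e = Z" "Cod \<C> e = J"
  using assms by (auto simp: comonoid_in_def hom_def)

lemma monoid_arr:
  assumes "monoid_in \<C> T M m u"
  shows "M \<in> Ob \<C>" "m \<in> Arr \<C>" "Dom \<C> m = M \<odot> M" "Cod \<C> m = M" "u \<in> Arr \<C>" "Dom \<C> u = I" "Cod \<C> u = M"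
  using assms by (auto simp: monoid_in_def hom_def)

text \<open>For a comonoid Z, \<open>(x \<bullet> y) \<cdot> d\<close> plays the role of the pairing
  of x and y in a Cartesian category. Coassociativity then reads as associativity of pairing, and
  later computations can use this rule in place of the comonoid law.\<close>

lemma pair_assoc:
  assumes Z: "comonoid_in \<C> S Z d e"
    and [simp]: "x \<in> Arr \<C>" "y \<in> Arr \<C>" "z \<in> Arr \<C>" "Dom \<C> x = Z" "Dom \<C> y = Z" "Dom \<C> z = Z"
    and c: "Cod \<C> x = X" "Cod \<C> y = Y" "Cod \<C> z = W"
  shows "ab X Y W \<cdot> (((x \<bullet> y) \<cdot> d) \<bullet> z) \<cdot> d = (x \<bullet> ((y \<bullet> z) \<cdot> d)) \<cdot> d"
proof -
  note [simp] = comonoid_arr[OF Z]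
  have [simp]: "X \<in> Ob \<C>" "Y \<in> Ob \<C>" "W \<in> Ob \<C>" using c circ.cod_ob[of x] circ.cod_ob[of y] circ.cod_ob[of z] by simp_all
  have "ab X Y W \<cdot> (((x \<bullet> y) \<cdot> d) \<bullet> z) \<cdot> d = ab X Y W \<cdot> ((x \<bullet> y) \<bullet> z) \<cdot> (d \<bullet> Z) \<cdot> d" by simp
  also have "\<dots> = (x \<bullet> (y \<bullet> z)) \<cdot> (ab Z Z Z \<cdot> (d \<bullet> Z) \<cdot> d)"
    using circ.ext2[OF blt.assoc_nat[of x y z X Y W], of "(d \<bullet> Z) \<cdot> d"] by (simp add: c)
  also have "\<dots> = (x \<bullet> (y \<bullet> z)) \<cdot> (Z \<bullet> d) \<cdot> d" using Z by (simp add: comonoid_in_def)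
  finally show ?thesis by simp
qed

lemma pair_assoc_inv:
  assumes Z: "comonoid_in \<C> S Z d e"
    and [simp]: "x \<in> Arr \<C>" "y \<in> Arr \<C>" "z \<in> Arr \<C>" "Dom \<C> x = Z" "Dom \<C> y = Z" "Dom \<C> z = Z"
    and c: "Cod \<C> x = X" "Cod \<C> y = Y" "Cod \<C> z = W"
  shows "abi X Y W \<cdot> (x \<bullet> ((y \<bullet> z) \<cdot> d)) \<cdot> d = (((x \<bullet> y) \<cdot> d) \<bullet> z) \<cdot> d"
proof -
  note [simp] = comonoid_arr[OF Z]
  have [simp]: "X \<in> Ob \<C>" "Y \<in> Ob \<C>" "W \<in> Ob \<C>" using c circ.cod_ob[of x] circ.cod_ob[of y] circ.cod_ob[of z] by simp_all
  show ?thesis using pair_assoc[OF assms, symmetric] by (simp add: c)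
qed

lemma pair_counit_left:
  assumes Z: "comonoid_in \<C> S Z d e" and [simp]: "x \<in> Arr \<C>" "Dom \<C> x = Z" and c: "Cod \<C> x = X"
  shows "lb X \<cdot> (e \<bullet> x) \<cdot> d = x"
proof -
  note [simp] = comonoid_arr[OF Z]
  have [simp]: "X \<in> Ob \<C>" using c circ.cod_ob[of x] by simp
  have "lb X \<cdot> (e \<bullet> x) \<cdot> d = x \<cdot> lb Z \<cdot> (e \<bullet> Z) \<cdot> d"
    using circ.ext2[OF blt.lunit_nat[of x X], of "(e \<bullet> Z) \<cdot> d"] by (simp add: c)
  then show ?thesis using Z by (simp add: comonoid_in_def)
qed

lemma pair_counit_right:
  assumes Z: "comonoid_in \<C> S Z d e" and [simp]: "x \<in> Arr \<C>" "Dom \<C> x = Z" and c: "Cod \<C> x = X"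
  shows "rb X \<cdot> (x \<bullet> e) \<cdot> d = x"
proof -
  note [simp] = comonoid_arr[OF Z]
  have [simp]: "X \<in> Ob \<C>" using c circ.cod_ob[of x] by simp
  have "rb X \<cdot> (x \<bullet> e) \<cdot> d = x \<cdot> rb Z \<cdot> (Z \<bullet> e) \<cdot> d"
    using circ.ext2[OF blt.runit_nat[of x X], of "(Z \<bullet> e) \<cdot> d"] by (simp add: c)
  then show ?thesis using Z by (simp add: comonoid_in_def)
qed

end

section \<open>Uniqueness and products of convolution inverses\<close>

context reversion
begin

lemma phi'_arr [simp]:
  assumes "X \<in> Ob \<C>" "Y \<in> Ob \<C>"
  shows "\<phi>' X Y \<in> Arr \<C>" "Dom \<C> (\<phi>' X Y) = (J \<odot> (I \<bullet> X)) \<bullet> Y\<^sup>-" "Cod \<C> (\<phi>' X Y) = (X \<odot> Y)\<^sup>-"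
    "\<psi>' X Y \<in> Arr \<C>" "Dom \<C> (\<psi>' X Y) = X\<^sup>- \<bullet> ((Y \<bullet> I) \<odot> J)" "Cod \<C> (\<psi>' X Y) = (X \<odot> Y)\<^sup>-"
  using assms by (simp_all add: \<phi>'_def \<psi>'_def)

lemma phi'_nat:
  assumes [simp]: "f \<in> Arr \<C>" "g \<in> Arr \<C>" "Dom \<C> f = X" "Cod \<C> f = X'" "Dom \<C> g = Y" "Cod \<C> g = Y'"
  shows "\<phi>' X' Y' \<cdot> ((J \<odot> (I \<bullet> f)) \<bullet> g\<^sup>-) = (f \<odot> g)\<^sup>- \<cdot> \<phi>' X Y"
proof -
  have [simp]: "X \<in> Ob \<C>" "X' \<in> Ob \<C>" "Y \<in> Ob \<C>" "Y' \<in> Ob \<C>"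
    using circ.dom_ob[of f] circ.cod_ob[of f] circ.dom_ob[of g] circ.cod_ob[of g] by simp_all
  have "\<phi>' X' Y' \<cdot> ((J \<odot> (I \<bullet> f)) \<bullet> g\<^sup>-) = rc (X' \<odot> Y')\<^sup>- \<cdot> ((lb (X' \<odot> Y')\<^sup>- \<cdot> (J \<bullet> (f \<odot> g)\<^sup>-)) \<odot> I) \<cdot> \<delta>' J I X Y"
    using delta'_nat[of J I f g J I X' Y'] by (simp add: \<phi>'_def)
  also have "\<dots> = (rc (X' \<odot> Y')\<^sup>- \<cdot> ((f \<odot> g)\<^sup>- \<odot> I)) \<cdot> (lb (X \<odot> Y)\<^sup>- \<odot> I) \<cdot> \<delta>' J I X Y"
    by (simp add: blt.lunit_nat)
  also have "\<dots> = (f \<odot> g)\<^sup>- \<cdot> \<phi>' X Y"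
    by (simp add: circ.runit_nat \<phi>'_def del: circ.merge_ext)
  finally show ?thesis .
qed

lemma psi'_nat:
  assumes [simp]: "f \<in> Arr \<C>" "g \<in> Arr \<C>" "Dom \<C> f = X" "Cod \<C> f = X'" "Dom \<C> g = Y" "Cod \<C> g = Y'"
  shows "\<psi>' X' Y' \<cdot> (f\<^sup>- \<bullet> ((g \<bullet> I) \<odot> J)) = (f \<odot> g)\<^sup>- \<cdot> \<psi>' X Y"
proof -
  have [simp]: "X \<in> Ob \<C>" "X' \<in> Ob \<C>" "Y \<in> Ob \<C>" "Y' \<in> Ob \<C>"
    using circ.dom_ob[of f] circ.cod_ob[of f] circ.dom_ob[of g] circ.cod_ob[of g] by simp_all
  have "\<psi>' X' Y' \<cdot> (f\<^sup>- \<bullet> ((g \<bullet> I) \<odot> J)) = lc (X' \<odot> Y')\<^sup>- \<cdot> (I \<odot> (rb (X' \<odot> Y')\<^sup>- \<cdot> ((f \<odot> g)\<^sup>- \<bullet> J))) \<cdot> \<gamma>' X Y I J"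
    using gamma'_nat[of f g I J X' Y' I J] by (simp add: \<psi>'_def)
  also have "\<dots> = (lc (X' \<odot> Y')\<^sup>- \<cdot> (I \<odot> (f \<odot> g)\<^sup>-)) \<cdot> (I \<odot> rb (X \<odot> Y)\<^sup>-) \<cdot> \<gamma>' X Y I J"
    by (simp add: blt.runit_nat)
  also have "\<dots> = (f \<odot> g)\<^sup>- \<cdot> \<psi>' X Y"
    by (simp add: circ.lunit_nat \<psi>'_def del: circ.merge_ext)
  finally show ?thesis .
qed

text \<open>A convolution inverse of x : Z \<rightarrow> M takes values in the reverse of M. For x
  the identity of a Hopf monoid and y its antipode, this and \<open>left_inverse\<close> are the two
  antipode equations.\<close>

definition right_inverse where
  "right_inverse d e M m u x y \<longleftrightarrow>
    ((m \<bullet> I) \<odot> J) \<cdot> \<phi> M M \<cdot> (x \<bullet> y) \<cdot> d = (((u \<bullet> I) \<cdot> \<Delta>\<^sub>I) \<odot> J) \<cdot> lci J \<cdot> e"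

definition left_inverse where
  "left_inverse d e M m u x y \<longleftrightarrow>
    (J \<odot> (I \<bullet> m)) \<cdot> \<psi> M M \<cdot> (y \<bullet> x) \<cdot> d = (J \<odot> ((I \<bullet> u) \<cdot> \<Delta>\<^sub>I)) \<cdot> rci J \<cdot> e"

text \<open>The usual argument y' = y' x y = y. Both triple products land in the reverse of M.
  \<open>R10\<close> is the associativity that identifies them, while \<open>R12\<close> and
  \<open>R11\<close> evaluate them once y' x or x y has been replaced by the unit.\<close>

lemma left_inverse_eq_right_inverse:
  assumes Z: "comonoid_in \<C> S Z d e" and M: "monoid_in \<C> T M m u"
    and [simp]: "x \<in> Arr \<C>" "Dom \<C> x = Z" "Cod \<C> x = M" "y \<in> Arr \<C>" "Dom \<C> y = Z" "Cod \<C> y = M\<^sup>-"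
      "y' \<in> Arr \<C>" "Dom \<C> y' = Z" "Cod \<C> y' = M\<^sup>-"
    and r: "right_inverse d e M m u x y" and l: "left_inverse d e M m u x y'"
  shows "y' = y"
proof -
  note [simp] = comonoid_arr[OF Z] monoid_arr[OF M]
  have massoc: "m \<cdot> (m \<odot> M) = m \<cdot> (M \<odot> m) \<cdot> ac M M M" and mu: "m \<cdot> (u \<odot> M) = lc M" "m \<cdot> (M \<odot> u) = rc M"
    using M by (auto simp: monoid_in_def)
  \<comment> \<open>\<open>?t\<close> is the triple y', x, y along the iterated comultiplication;
    \<open>?k\<close> is the reverse of the ternary multiplication.\<close>
  let ?t = "(((y' \<bullet> x) \<cdot> d) \<bullet> y) \<cdot> d" and ?k = "(m \<cdot> (M \<odot> m))\<^sup>-"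
  have "?k \<cdot> (ac M M M)\<^sup>- \<cdot> \<phi>' (M \<odot> M) M \<cdot> (\<psi> M M \<bullet> M\<^sup>-) \<cdot> ?t = (m \<cdot> (m \<odot> M))\<^sup>- \<cdot> \<phi>' (M \<odot> M) M \<cdot> ((\<psi> M M \<cdot> (y' \<bullet> x) \<cdot> d) \<bullet> y) \<cdot> d"
    by (simp add: massoc)
  also have "\<dots> = m\<^sup>- \<cdot> (m \<odot> M)\<^sup>- \<cdot> \<phi>' (M \<odot> M) M \<cdot> ((\<psi> M M \<cdot> (y' \<bullet> x) \<cdot> d) \<bullet> y) \<cdot> d"
    by simp
  also have "\<dots> = m\<^sup>- \<cdot> \<phi>' M M \<cdot> ((J \<odot> (I \<bullet> m)) \<bullet> M\<^sup>-) \<cdot> ((\<psi> M M \<cdot> (y' \<bullet> x) \<cdot> d) \<bullet> y) \<cdot> d"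
    using circ.ext2[OF phi'_nat[of m M "M \<odot> M" M M M, symmetric], of "((\<psi> M M \<cdot> (y' \<bullet> x) \<cdot> d) \<bullet> y) \<cdot> d"] by simp
  also have "\<dots> = m\<^sup>- \<cdot> \<phi>' M M \<cdot> (((J \<odot> (I \<bullet> m)) \<cdot> \<psi> M M \<cdot> (y' \<bullet> x) \<cdot> d) \<bullet> y) \<cdot> d" by simp
  also have "\<dots> = m\<^sup>- \<cdot> \<phi>' M M \<cdot> ((J \<odot> (I \<bullet> u)) \<bullet> M\<^sup>-) \<cdot> (((J \<odot> \<Delta>\<^sub>I) \<cdot> rci J \<cdot> e) \<bullet> y) \<cdot> d"
    using l unfolding left_inverse_def by simp
  also have "\<dots> = (m \<cdot> (u \<odot> M))\<^sup>- \<cdot> \<phi>' I M \<cdot> (((J \<odot> \<Delta>\<^sub>I) \<cdot> rci J \<cdot> e) \<bullet> y) \<cdot> d"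
    using circ.ext2[OF phi'_nat[of u M I M M M], of "(((J \<odot> \<Delta>\<^sub>I) \<cdot> rci J \<cdot> e) \<bullet> y) \<cdot> d"] by simp
  also have "\<dots> = ((lc M)\<^sup>- \<cdot> rc (I \<odot> M)\<^sup>- \<cdot> (lb (I \<odot> M)\<^sup>- \<odot> I) \<cdot> \<delta>' J I I M \<cdot> ((J \<odot> \<Delta>\<^sub>I) \<bullet> M\<^sup>-)) \<cdot> ((rci J \<cdot> e) \<bullet> y) \<cdot> d"
    unfolding mu by (simp add: \<phi>'_def)
  also have "\<dots> = y"
    unfolding R12[OF monoid_arr(1)[OF M]] using pair_counit_left[OF Z, of y "M\<^sup>-"] by simp
  finally have left: "?k \<cdot> (ac M M M)\<^sup>- \<cdot> \<phi>' (M \<odot> M) M \<cdot> (\<psi> M M \<bullet> M\<^sup>-) \<cdot> ?t = y" .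
  have "?k \<cdot> \<psi>' M (M \<odot> M) \<cdot> (M\<^sup>- \<bullet> \<phi> M M) \<cdot> ab M\<^sup>- M M\<^sup>- \<cdot> ?t
     = ?k \<cdot> \<psi>' M (M \<odot> M) \<cdot> (y' \<bullet> (\<phi> M M \<cdot> (x \<bullet> y) \<cdot> d)) \<cdot> d"
    using pair_assoc[OF Z, of y' x y] by simp
  also have "\<dots> = m\<^sup>- \<cdot> (M \<odot> m)\<^sup>- \<cdot> \<psi>' M (M \<odot> M) \<cdot> (y' \<bullet> (\<phi> M M \<cdot> (x \<bullet> y) \<cdot> d)) \<cdot> d"
    by simp
  also have "\<dots> = m\<^sup>- \<cdot> \<psi>' M M \<cdot> (M\<^sup>- \<bullet> ((m \<bullet> I) \<odot> J)) \<cdot> (y' \<bullet> (\<phi> M M \<cdot> (x \<bullet> y) \<cdot> d)) \<cdot> d"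
    using circ.ext2[OF psi'_nat[of M m M M "M \<odot> M" M, symmetric], of "(y' \<bullet> (\<phi> M M \<cdot> (x \<bullet> y) \<cdot> d)) \<cdot> d"] by simp
  also have "\<dots> = m\<^sup>- \<cdot> \<psi>' M M \<cdot> (y' \<bullet> (((m \<bullet> I) \<odot> J) \<cdot> \<phi> M M \<cdot> (x \<bullet> y) \<cdot> d)) \<cdot> d" by simp
  also have "\<dots> = m\<^sup>- \<cdot> \<psi>' M M \<cdot> (M\<^sup>- \<bullet> ((u \<bullet> I) \<odot> J)) \<cdot> (y' \<bullet> ((\<Delta>\<^sub>I \<odot> J) \<cdot> lci J \<cdot> e)) \<cdot> d"
    using r unfolding right_inverse_def by simp
  also have "\<dots> = (m \<cdot> (M \<odot> u))\<^sup>- \<cdot> \<psi>' M I \<cdot> (y' \<bullet> ((\<Delta>\<^sub>I \<odot> J) \<cdot> lci J \<cdot> e)) \<cdot> d"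
    using circ.ext2[OF psi'_nat[of M u M M I M], of "(y' \<bullet> ((\<Delta>\<^sub>I \<odot> J) \<cdot> lci J \<cdot> e)) \<cdot> d"] by simp
  also have "\<dots> = ((rc M)\<^sup>- \<cdot> lc (M \<odot> I)\<^sup>- \<cdot> (I \<odot> rb (M \<odot> I)\<^sup>-) \<cdot> \<gamma>' M I I J \<cdot> (M\<^sup>- \<bullet> (\<Delta>\<^sub>I \<odot> J))) \<cdot> (y' \<bullet> (lci J \<cdot> e)) \<cdot> d"
    unfolding mu by (simp add: \<psi>'_def)
  also have "\<dots> = y'"
    unfolding R11[OF monoid_arr(1)[OF M]] using pair_counit_right[OF Z, of y' "M\<^sup>-"] by simp
  finally show ?thesis
    using left arg_cong[OF R10[of M M M], of "\<lambda>f. ?k \<cdot> f \<cdot> ?t"] by simp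
qed

text \<open>The inverse of a pair is the pair of inverses in reversed order, compared by
  \<open>\<phi>b\<close>. \<open>R14\<close> splits \<delta> for \<bullet>-products into two nested
  \<delta>. The inner one multiplies the Y-components to the unit while the inverse of x waits in V;
  the outer one then multiplies the X-components.\<close>

lemma right_inverse_pair:
  assumes Z: "comonoid_in \<C> S Z d e" and X: "monoid_in \<C> T X mX uX" and Y: "monoid_in \<C> T Y mY uY"
    and [simp]: "x \<in> Arr \<C>" "Dom \<C> x = Z" "Cod \<C> x = X" "x' \<in> Arr \<C>" "Dom \<C> x' = Z" "Cod \<C> x' = X\<^sup>-"
      "y \<in> Arr \<C>" "Dom \<C> y = Z" "Cod \<C> y = Y" "y' \<in> Arr \<C>" "Dom \<C> y' = Z" "Cod \<C> y' = Y\<^sup>-"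
    and rx: "right_inverse d e X mX uX x x'" and ry: "right_inverse d e Y mY uY y y'"
  shows "right_inverse d e (X \<bullet> Y) ((mX \<bullet> mY) \<cdot> \<zeta> X Y X Y) ((uX \<bullet> uY) \<cdot> \<Delta>\<^sub>I)
      ((x \<bullet> y) \<cdot> d) (\<phi>b Y X \<cdot> (y' \<bullet> x') \<cdot> d)"
proof -
  note [simp] = comonoid_arr[OF Z] monoid_arr[OF X] monoid_arr[OF Y]
  \<comment> \<open>\<open>?V\<close> is the object used in \<open>right_inverse_extend\<close>. It
    keeps the inverse of x, together with the J of the final equation, available for the outer
    \<delta>.\<close>
  let ?M = "X \<bullet> Y" and ?V = "X\<^sup>- \<bullet> J" and ?u = "(uY \<bullet> I) \<cdot> \<Delta>\<^sub>I"
  define yx where "yx = (y' \<bullet> x') \<cdot> d"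
  have [simp]: "yx \<in> Arr \<C>" "Dom \<C> yx = Z" "Cod \<C> yx = Y\<^sup>- \<bullet> X\<^sup>-" by (simp_all add: yx_def)
  define q where "q = (I \<odot> rbi (Y\<^sup>- \<bullet> X\<^sup>-)) \<cdot> lci (Y\<^sup>- \<bullet> X\<^sup>-)"
  have [simp]: "q \<in> Arr \<C>" "Dom \<C> q = Y\<^sup>- \<bullet> X\<^sup>-" "Cod \<C> q = I \<odot> ((Y\<^sup>- \<bullet> X\<^sup>-) \<bullet> J)" by (simp_all add: q_def)
  let ?v = "rbi X\<^sup>- \<cdot> x'"
  let ?\<tau> = "(((x \<bullet> y) \<cdot> d) \<bullet> (q \<cdot> yx)) \<cdot> d"
  have "(I \<odot> ab Y\<^sup>- X\<^sup>- J) \<cdot> q = (I \<odot> (Y\<^sup>- \<bullet> rbi X\<^sup>-)) \<cdot> lci (Y\<^sup>- \<bullet> X\<^sup>-)"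
    by (simp add: q_def blt.assoc_inv_runit)
  also have "\<dots> = lci (Y\<^sup>- \<bullet> ?V) \<cdot> (Y\<^sup>- \<bullet> rbi X\<^sup>-)"
    by (simp add: circ.inv_lunit_nat)
  finally have q: "(I \<odot> ab Y\<^sup>- X\<^sup>- J) \<cdot> q = lci (Y\<^sup>- \<bullet> ?V) \<cdot> (Y\<^sup>- \<bullet> rbi X\<^sup>-)" .
  have "((mY \<bullet> I) \<odot> ?V) \<cdot> \<delta> Y I Y ?V \<cdot> (y \<bullet> ((I \<odot> ab Y\<^sup>- X\<^sup>- J) \<cdot> q \<cdot> yx)) \<cdot> d
     = ((mY \<bullet> I) \<odot> ?V) \<cdot> \<delta> Y I Y ?V \<cdot> (Y \<bullet> lci (Y\<^sup>- \<bullet> ?V)) \<cdot> (y \<bullet> ((y' \<bullet> ?v) \<cdot> d)) \<cdot> d"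
    using circ.ext2[OF q, of yx] by (simp add: yx_def)
  also have "\<dots> = (((mY \<bullet> I) \<odot> ?V) \<cdot> \<delta> Y I Y ?V \<cdot> (Y \<bullet> lci (Y\<^sup>- \<bullet> ?V)) \<cdot> ab Y Y\<^sup>- ?V \<cdot> (((y \<bullet> y') \<cdot> d) \<bullet> ?v)) \<cdot> d"
    using pair_assoc[OF Z, of y y' ?v] by simp
  also have "\<dots> = (?u \<odot> ?V) \<cdot> lci ?V \<cdot> lb ?V \<cdot> (e \<bullet> ?v) \<cdot> d"
    using right_inverse_extend[of Y mY uY "(y \<bullet> y') \<cdot> d" e ?v ?V] ry[unfolded right_inverse_def] by simp
  also have "\<dots> = (?u \<odot> ?V) \<cdot> lci ?V \<cdot> ?v"
    using pair_counit_left[OF Z, of ?v ?V] by simp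
  finally have inner: "((mY \<bullet> I) \<odot> ?V) \<cdot> \<delta> Y I Y ?V \<cdot> (y \<bullet> ((I \<odot> ab Y\<^sup>- X\<^sup>- J) \<cdot> q \<cdot> yx)) \<cdot> d = (?u \<odot> ?V) \<cdot> lci ?V \<cdot> ?v" .
  let ?K = "(mX \<bullet> (mY \<bullet> I)) \<odot> J"
  have "?K \<cdot> \<delta> X ((Y \<odot> Y) \<bullet> I) X J \<cdot> (X \<bullet> \<delta> Y I Y ?V) \<cdot> (X \<bullet> (Y \<bullet> (I \<odot> ab Y\<^sup>- X\<^sup>- J))) \<cdot> ab X Y (I \<odot> ((Y\<^sup>- \<bullet> X\<^sup>-) \<bullet> J)) \<cdot> ?\<tau>
    = ?K \<cdot> \<delta> X ((Y \<odot> Y) \<bullet> I) X J \<cdot> (x \<bullet> (\<delta> Y I Y ?V \<cdot> (y \<bullet> ((I \<odot> ab Y\<^sup>- X\<^sup>- J) \<cdot> q \<cdot> yx)) \<cdot> d)) \<cdot> d"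
    using pair_assoc[OF Z, of x y "q \<cdot> yx"] by simp
  also have "\<dots> = ((mX \<bullet> (Y \<bullet> I)) \<odot> J) \<cdot> \<delta> X (Y \<bullet> I) X J \<cdot> (X \<bullet> ((mY \<bullet> I) \<odot> ?V)) \<cdot>
      (x \<bullet> (\<delta> Y I Y ?V \<cdot> (y \<bullet> ((I \<odot> ab Y\<^sup>- X\<^sup>- J) \<cdot> q \<cdot> yx)) \<cdot> d)) \<cdot> d"
    using circ.ext2[OF delta_nat[of X "mY \<bullet> I" X J X "Y \<bullet> I" X J], of
      "(x \<bullet> (\<delta> Y I Y ?V \<cdot> (y \<bullet> ((I \<odot> ab Y\<^sup>- X\<^sup>- J) \<cdot> q \<cdot> yx)) \<cdot> d)) \<cdot> d"] by simp
  also have "\<dots> = ((mX \<bullet> (Y \<bullet> I)) \<odot> J) \<cdot> \<delta> X (Y \<bullet> I) X J \<cdot>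
      (x \<bullet> (((mY \<bullet> I) \<odot> ?V) \<cdot> \<delta> Y I Y ?V \<cdot> (y \<bullet> ((I \<odot> ab Y\<^sup>- X\<^sup>- J) \<cdot> q \<cdot> yx)) \<cdot> d)) \<cdot> d" by simp
  also have "\<dots> = ((mX \<bullet> (Y \<bullet> I)) \<odot> J) \<cdot> \<delta> X (Y \<bullet> I) X J \<cdot> (X \<bullet> (?u \<odot> ?V)) \<cdot> (x \<bullet> (lci ?V \<cdot> ?v)) \<cdot> d"
    unfolding inner by simp
  also have "\<dots> = ((mX \<bullet> ?u) \<odot> J) \<cdot> \<delta> X I X J \<cdot> (x \<bullet> (lci ?V \<cdot> ?v)) \<cdot> d"
    using circ.ext2[OF delta_nat[of X ?u X J X "Y \<bullet> I" X J], of "(x \<bullet> (lci ?V \<cdot> ?v)) \<cdot> d"] by simp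
  also have "\<dots> = ((X \<bullet> ?u) \<odot> J) \<cdot> (((mX \<bullet> I) \<odot> J) \<cdot> \<phi> X X \<cdot> (x \<bullet> x') \<cdot> d)"
    using circ.ext2[OF circ.inv_lunit_nat[of "rbi X\<^sup>-" ?V], of x'] by (simp add: \<phi>_def)
  also have "\<dots> = ((uX \<bullet> ?u) \<odot> J) \<cdot> (\<Delta>\<^sub>I \<odot> J) \<cdot> lci J \<cdot> e"
    using rx unfolding right_inverse_def by simp
  finally have L: "?K \<cdot> \<delta> X ((Y \<odot> Y) \<bullet> I) X J \<cdot> (X \<bullet> \<delta> Y I Y ?V) \<cdot> (X \<bullet> (Y \<bullet> (I \<odot> ab Y\<^sup>- X\<^sup>- J))) \<cdot> ab X Y (I \<odot> ((Y\<^sup>- \<bullet> X\<^sup>-) \<bullet> J)) \<cdot> ?\<tau>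
    = ((uX \<bullet> ?u) \<odot> J) \<cdot> (\<Delta>\<^sub>I \<odot> J) \<cdot> lci J \<cdot> e" .
  have "(I \<odot> rbi ?M\<^sup>-) \<cdot> lci ?M\<^sup>- \<cdot> \<phi>b Y X = (I \<odot> (\<phi>b Y X \<bullet> J)) \<cdot> q"
    by (simp add: q_def circ.inv_lunit_nat blt.inv_runit_nat)
  then have "\<phi> ?M ?M \<cdot> (((x \<bullet> y) \<cdot> d) \<bullet> (\<phi>b Y X \<cdot> yx)) \<cdot> d = \<delta> ?M I ?M J \<cdot> (?M \<bullet> (I \<odot> (\<phi>b Y X \<bullet> J))) \<cdot> ?\<tau>"
    using circ.ext3[of "I \<odot> rbi ?M\<^sup>-" "lci ?M\<^sup>-" "\<phi>b Y X" "(I \<odot> (\<phi>b Y X \<bullet> J)) \<cdot> q" yx] by (simp add: \<phi>_def)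
  then have "((((mX \<bullet> mY) \<cdot> \<zeta> X Y X Y) \<bullet> I) \<odot> J) \<cdot> \<phi> ?M ?M \<cdot> (((x \<bullet> y) \<cdot> d) \<bullet> (\<phi>b Y X \<cdot> yx)) \<cdot> d
     = (((mX \<bullet> mY) \<bullet> I) \<odot> J) \<cdot> ((\<zeta> X Y X Y \<bullet> I) \<odot> J) \<cdot> \<delta> ?M I ?M J \<cdot> (?M \<bullet> (I \<odot> (\<phi>b Y X \<bullet> J))) \<cdot> ?\<tau>"
    by simp
  also have "\<dots> = (((mX \<bullet> mY) \<bullet> I) \<odot> J) \<cdot> (abi (X \<odot> X) (Y \<odot> Y) I \<odot> J) \<cdot> (ab (X \<odot> X) (Y \<odot> Y) I \<odot> J) \<cdot> ((\<zeta> X Y X Y \<bullet> I) \<odot> J) \<cdot> \<delta> ?M I ?M J \<cdot> (?M \<bullet> (I \<odot> (\<phi>b Y X \<bullet> J))) \<cdot> ?\<tau>"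
    by simp
  also have "\<dots> = (((mX \<bullet> mY) \<bullet> I) \<odot> J) \<cdot> (abi (X \<odot> X) (Y \<odot> Y) I \<odot> J) \<cdot>
     \<delta> X ((Y \<odot> Y) \<bullet> I) X J \<cdot> (X \<bullet> \<delta> Y I Y ?V) \<cdot> (X \<bullet> (Y \<bullet> (I \<odot> ab Y\<^sup>- X\<^sup>- J))) \<cdot> ab X Y (I \<odot> ((Y\<^sup>- \<bullet> X\<^sup>-) \<bullet> J)) \<cdot> ?\<tau>"
    using arg_cong[OF R14[of X Y I Y X J], of "\<lambda>f. (((mX \<bullet> mY) \<bullet> I) \<odot> J) \<cdot> (abi (X \<odot> X) (Y \<odot> Y) I \<odot> J) \<cdot> f \<cdot> ?\<tau>"] by simp
  also have "\<dots> = (abi X Y I \<odot> J) \<cdot> ?K \<cdot>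
     \<delta> X ((Y \<odot> Y) \<bullet> I) X J \<cdot> (X \<bullet> \<delta> Y I Y ?V) \<cdot> (X \<bullet> (Y \<bullet> (I \<odot> ab Y\<^sup>- X\<^sup>- J))) \<cdot> ab X Y (I \<odot> ((Y\<^sup>- \<bullet> X\<^sup>-) \<bullet> J)) \<cdot> ?\<tau>"
    using blt.inv_assoc_nat[of mX mY I X Y I] by simp
  also have "\<dots> = ((abi X Y I \<cdot> (uX \<bullet> ?u) \<cdot> \<Delta>\<^sub>I) \<odot> J) \<cdot> lci J \<cdot> e"
    unfolding L by simp
  also have "abi X Y I \<cdot> (uX \<bullet> ?u) \<cdot> \<Delta>\<^sub>I = ((uX \<bullet> uY) \<bullet> I) \<cdot> abi I I I \<cdot> (I \<bullet> \<Delta>\<^sub>I) \<cdot> \<Delta>\<^sub>I"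
    using circ.ext2[OF blt.inv_assoc_nat[of uX uY I X Y I], of "(I \<bullet> \<Delta>\<^sub>I) \<cdot> \<Delta>\<^sub>I"] by simp
  also have "\<dots> = (((uX \<bullet> uY) \<cdot> \<Delta>\<^sub>I) \<bullet> I) \<cdot> \<Delta>\<^sub>I"
    unfolding I_coassoc_inv by simp
  finally show ?thesis unfolding right_inverse_def yx_def .
qed

text \<open>Mirror image, with \<open>R13\<close> and \<gamma>: the X-components are multiplied
  first, while the inverse of y waits in \<open>?V\<close>.\<close>

lemma left_inverse_pair:
  assumes Z: "comonoid_in \<C> S Z d e" and X: "monoid_in \<C> T X mX uX" and Y: "monoid_in \<C> T Y mY uY"
    and [simp]: "x \<in> Arr \<C>" "Dom \<C> x = Z" "Cod \<C> x = X" "x' \<in> Arr \<C>" "Dom \<C> x' = Z" "Cod \<C> x' = X\<^sup>-"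
      "y \<in> Arr \<C>" "Dom \<C> y = Z" "Cod \<C> y = Y" "y' \<in> Arr \<C>" "Dom \<C> y' = Z" "Cod \<C> y' = Y\<^sup>-"
    and rx: "left_inverse d e X mX uX x x'" and ry: "left_inverse d e Y mY uY y y'"
  shows "left_inverse d e (X \<bullet> Y) ((mX \<bullet> mY) \<cdot> \<zeta> X Y X Y) ((uX \<bullet> uY) \<cdot> \<Delta>\<^sub>I)
      ((x \<bullet> y) \<cdot> d) (\<phi>b Y X \<cdot> (y' \<bullet> x') \<cdot> d)"
proof -
  note [simp] = comonoid_arr[OF Z] monoid_arr[OF X] monoid_arr[OF Y]
  let ?M = "X \<bullet> Y" and ?V = "J \<bullet> Y\<^sup>-" and ?u = "(I \<bullet> uX) \<cdot> \<Delta>\<^sub>I"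
  define yx where "yx = (y' \<bullet> x') \<cdot> d"
  have [simp]: "yx \<in> Arr \<C>" "Dom \<C> yx = Z" "Cod \<C> yx = Y\<^sup>- \<bullet> X\<^sup>-" by (simp_all add: yx_def)
  define q where "q = ((lbi Y\<^sup>- \<bullet> X\<^sup>-) \<odot> I) \<cdot> rci (Y\<^sup>- \<bullet> X\<^sup>-)"
  have [simp]: "q \<in> Arr \<C>" "Dom \<C> q = Y\<^sup>- \<bullet> X\<^sup>-" "Cod \<C> q = (?V \<bullet> X\<^sup>-) \<odot> I" by (simp_all add: q_def)
  have q: "q = rci (?V \<bullet> X\<^sup>-) \<cdot> (lbi Y\<^sup>- \<bullet> X\<^sup>-)" by (simp add: q_def circ.inv_runit_nat)
  let ?v = "lbi Y\<^sup>- \<cdot> y'"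
  let ?\<tau> = "((((q \<cdot> yx) \<bullet> x) \<cdot> d) \<bullet> y) \<cdot> d"
  have "(?V \<odot> (I \<bullet> mX)) \<cdot> \<gamma> ?V X I X \<cdot> ((q \<cdot> yx) \<bullet> x) \<cdot> d
     = (?V \<odot> (I \<bullet> mX)) \<cdot> \<gamma> ?V X I X \<cdot> (rci (?V \<bullet> X\<^sup>-) \<bullet> X) \<cdot> (((?v \<bullet> x') \<cdot> d) \<bullet> x) \<cdot> d"
    unfolding q by (simp add: yx_def)
  also have "\<dots> = ((?V \<odot> (I \<bullet> mX)) \<cdot> \<gamma> ?V X I X \<cdot> (rci (?V \<bullet> X\<^sup>-) \<bullet> X) \<cdot> abi ?V X\<^sup>- X \<cdot> (?v \<bullet> ((x' \<bullet> x) \<cdot> d))) \<cdot> d"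
    using pair_assoc_inv[OF Z, of ?v x' x] by simp
  also have "\<dots> = (?V \<odot> ?u) \<cdot> rci ?V \<cdot> rb ?V \<cdot> (?v \<bullet> e) \<cdot> d"
    using left_inverse_extend[of X mX uX "(x' \<bullet> x) \<cdot> d" e ?v ?V] rx[unfolded left_inverse_def] by simp
  also have "\<dots> = (?V \<odot> ?u) \<cdot> rci ?V \<cdot> ?v"
    using pair_counit_right[OF Z, of ?v ?V] by simp
  finally have inner: "(?V \<odot> (I \<bullet> mX)) \<cdot> \<gamma> ?V X I X \<cdot> ((q \<cdot> yx) \<bullet> x) \<cdot> d = (?V \<odot> ?u) \<cdot> rci ?V \<cdot> ?v" .
  let ?K = "J \<odot> ((I \<bullet> mX) \<bullet> mY)"
  have "?K \<cdot> \<gamma> J Y (I \<bullet> (X \<odot> X)) Y \<cdot> (\<gamma> ?V X I X \<bullet> Y) \<cdot> ?\<tau>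
     = ?K \<cdot> \<gamma> J Y (I \<bullet> (X \<odot> X)) Y \<cdot> ((\<gamma> ?V X I X \<cdot> ((q \<cdot> yx) \<bullet> x) \<cdot> d) \<bullet> y) \<cdot> d"
    by simp
  also have "\<dots> = (J \<odot> ((I \<bullet> X) \<bullet> mY)) \<cdot> \<gamma> J Y (I \<bullet> X) Y \<cdot> ((?V \<odot> (I \<bullet> mX)) \<bullet> Y) \<cdot> ((\<gamma> ?V X I X \<cdot> ((q \<cdot> yx) \<bullet> x) \<cdot> d) \<bullet> y) \<cdot> d"
    using circ.ext2[OF gamma_nat[of J Y "I \<bullet> mX" Y J Y "I \<bullet> X" Y], of "((\<gamma> ?V X I X \<cdot> ((q \<cdot> yx) \<bullet> x) \<cdot> d) \<bullet> y) \<cdot> d"] by simp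
  also have "\<dots> = (J \<odot> ((I \<bullet> X) \<bullet> mY)) \<cdot> \<gamma> J Y (I \<bullet> X) Y \<cdot> (((?V \<odot> (I \<bullet> mX)) \<cdot> \<gamma> ?V X I X \<cdot> ((q \<cdot> yx) \<bullet> x) \<cdot> d) \<bullet> y) \<cdot> d"
    by simp
  also have "\<dots> = (J \<odot> ((I \<bullet> X) \<bullet> mY)) \<cdot> \<gamma> J Y (I \<bullet> X) Y \<cdot> ((?V \<odot> ?u) \<bullet> Y) \<cdot> ((rci ?V \<cdot> ?v) \<bullet> y) \<cdot> d"
    unfolding inner by simp
  also have "\<dots> = (J \<odot> (?u \<bullet> mY)) \<cdot> \<gamma> J Y I Y \<cdot> ((rci ?V \<cdot> ?v) \<bullet> y) \<cdot> d"
    using circ.ext2[OF gamma_nat[of J Y ?u Y J Y "I \<bullet> X" Y], of "((rci ?V \<cdot> ?v) \<bullet> y) \<cdot> d"] by simp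
  also have "\<dots> = (J \<odot> (?u \<bullet> Y)) \<cdot> ((J \<odot> (I \<bullet> mY)) \<cdot> \<psi> Y Y \<cdot> (y' \<bullet> y) \<cdot> d)"
    using circ.ext2[OF circ.inv_runit_nat[of "lbi Y\<^sup>-" ?V], of y'] by (simp add: \<psi>_def)
  also have "\<dots> = (J \<odot> (?u \<bullet> uY)) \<cdot> (J \<odot> \<Delta>\<^sub>I) \<cdot> rci J \<cdot> e"
    using ry unfolding left_inverse_def by simp
  finally have L: "?K \<cdot> \<gamma> J Y (I \<bullet> (X \<odot> X)) Y \<cdot> (\<gamma> ?V X I X \<bullet> Y) \<cdot> ?\<tau> = (J \<odot> (?u \<bullet> uY)) \<cdot> (J \<odot> \<Delta>\<^sub>I) \<cdot> rci J \<cdot> e" .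
  have "(lbi ?M\<^sup>- \<odot> I) \<cdot> rci ?M\<^sup>- \<cdot> \<phi>b Y X = ((J \<bullet> \<phi>b Y X) \<odot> I) \<cdot> (lbi (Y\<^sup>- \<bullet> X\<^sup>-) \<odot> I) \<cdot> rci (Y\<^sup>- \<bullet> X\<^sup>-)"
    by (simp add: circ.inv_runit_nat blt.inv_lunit_nat)
  also have "\<dots> = ((J \<bullet> \<phi>b Y X) \<odot> I) \<cdot> (ab J Y\<^sup>- X\<^sup>- \<odot> I) \<cdot> q"
    by (simp add: q_def blt.assoc_inv_lunit flip: circ.comp_assoc')
  finally have "((lbi ?M\<^sup>- \<odot> I) \<cdot> rci ?M\<^sup>- \<cdot> \<phi>b Y X) \<cdot> yx = ((J \<bullet> \<phi>b Y X) \<odot> I) \<cdot> (ab J Y\<^sup>- X\<^sup>- \<odot> I) \<cdot> q \<cdot> yx"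
    by simp
  then have "\<psi> ?M ?M \<cdot> ((\<phi>b Y X \<cdot> yx) \<bullet> ((x \<bullet> y) \<cdot> d)) \<cdot> d
     = \<gamma> J ?M I ?M \<cdot> (((J \<bullet> \<phi>b Y X) \<odot> I) \<bullet> ?M) \<cdot> (((ab J Y\<^sup>- X\<^sup>- \<odot> I) \<cdot> q \<cdot> yx) \<bullet> ((x \<bullet> y) \<cdot> d)) \<cdot> d"
    by (simp add: \<psi>_def)
  also have "\<dots> = \<gamma> J ?M I ?M \<cdot> (((J \<bullet> \<phi>b Y X) \<odot> I) \<bullet> ?M) \<cdot> ab ((J \<bullet> (Y\<^sup>- \<bullet> X\<^sup>-)) \<odot> I) X Y \<cdot> (((ab J Y\<^sup>- X\<^sup>- \<odot> I) \<bullet> X) \<bullet> Y) \<cdot> ?\<tau>"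
    using pair_assoc[OF Z, of "(ab J Y\<^sup>- X\<^sup>- \<odot> I) \<cdot> q \<cdot> yx" x y] by simp
  finally have "(J \<odot> (I \<bullet> ((mX \<bullet> mY) \<cdot> \<zeta> X Y X Y))) \<cdot> \<psi> ?M ?M \<cdot> ((\<phi>b Y X \<cdot> yx) \<bullet> ((x \<bullet> y) \<cdot> d)) \<cdot> d
     = (J \<odot> (I \<bullet> (mX \<bullet> mY))) \<cdot> (J \<odot> (I \<bullet> \<zeta> X Y X Y)) \<cdot> \<gamma> J ?M I ?M \<cdot> (((J \<bullet> \<phi>b Y X) \<odot> I) \<bullet> ?M) \<cdot> ab ((J \<bullet> (Y\<^sup>- \<bullet> X\<^sup>-)) \<odot> I) X Y \<cdot> (((ab J Y\<^sup>- X\<^sup>- \<odot> I) \<bullet> X) \<bullet> Y) \<cdot> ?\<tau>"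
    by simp
  also have "\<dots> = (J \<odot> (I \<bullet> (mX \<bullet> mY))) \<cdot> (J \<odot> ab I (X \<odot> X) (Y \<odot> Y)) \<cdot> \<gamma> J Y (I \<bullet> (X \<odot> X)) Y \<cdot> (\<gamma> ?V X I X \<bullet> Y) \<cdot> ?\<tau>"
    using arg_cong[OF R13[of J Y X I X Y], of "\<lambda>f. (J \<odot> (I \<bullet> (mX \<bullet> mY))) \<cdot> f \<cdot> ?\<tau>"] by simp
  also have "\<dots> = (J \<odot> ab I X Y) \<cdot> ?K \<cdot> \<gamma> J Y (I \<bullet> (X \<odot> X)) Y \<cdot> (\<gamma> ?V X I X \<bullet> Y) \<cdot> ?\<tau>"
    using blt.assoc_nat[of I mX mY I X Y] by simp
  also have "\<dots> = (J \<odot> (ab I X Y \<cdot> (?u \<bullet> uY) \<cdot> \<Delta>\<^sub>I)) \<cdot> rci J \<cdot> e"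
    unfolding L by simp
  also have "ab I X Y \<cdot> (?u \<bullet> uY) \<cdot> \<Delta>\<^sub>I = (I \<bullet> (uX \<bullet> uY)) \<cdot> ab I I I \<cdot> (\<Delta>\<^sub>I \<bullet> I) \<cdot> \<Delta>\<^sub>I"
    using circ.ext2[OF blt.assoc_nat[of I uX uY I X Y], of "(\<Delta>\<^sub>I \<bullet> I) \<cdot> \<Delta>\<^sub>I"] by simp
  also have "\<dots> = (I \<bullet> ((uX \<bullet> uY) \<cdot> \<Delta>\<^sub>I)) \<cdot> \<Delta>\<^sub>I"
    unfolding I_coassoc by simp
  finally show ?thesis unfolding left_inverse_def yx_def .
qed

end

section \<open>Comonoids and bimonoids\<close>

context duoidal_category
begin

text \<open>Structures are passed as separate arrows and not as a \<open>bimonoid_data\<close>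
  record, because the comonoids in question, such as the kernel and tensor products, do not come
  with a multiplication.\<close>

definition comonoid_map where
  "comonoid_map Z d e Z' d' e' f \<longleftrightarrow> f \<in> Arr \<C> \<and> Dom \<C> f = Z \<and> Cod \<C> f = Z' \<and> d' \<cdot> f = (f \<bullet> f) \<cdot> d \<and> e' \<cdot> f = e"

definition monoid_map where
  "monoid_map M m u M' m' u' f \<longleftrightarrow> f \<in> Arr \<C> \<and> Dom \<C> f = M \<and> Cod \<C> f = M' \<and> f \<cdot> m = m' \<cdot> (f \<odot> f) \<and> f \<cdot> u = u'"

text \<open>Through \<zeta> the product \<odot> lifts to comonoids for \<bullet>, and the product
  \<bullet> lifts to monoids for \<odot>. These four arrows are the lifted structures.\<close>

abbreviation tens_comult where "tens_comult Z d Z' d' \<equiv> \<zeta> Z Z Z' Z' \<cdot> (d \<odot> d')"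
abbreviation tens_counit where "tens_counit e e' \<equiv> m\<^sub>J \<cdot> (e \<odot> e')"
abbreviation prod_mult where "prod_mult X mX Y mY \<equiv> (mX \<bullet> mY) \<cdot> \<zeta> X Y X Y"
abbreviation prod_unit where "prod_unit uX uY \<equiv> (uX \<bullet> uY) \<cdot> \<Delta>\<^sub>I"

lemma comonoid_laws:
  assumes "comonoid_in \<C> S Z d e"
  shows "ab Z Z Z \<cdot> (d \<bullet> Z) \<cdot> d = (Z \<bullet> d) \<cdot> d" "lb Z \<cdot> (e \<bullet> Z) \<cdot> d = Z" "rb Z \<cdot> (Z \<bullet> e) \<cdot> d = Z"
  using assms by (auto simp: comonoid_in_def)

lemma monoid_laws:
  assumes "monoid_in \<C> T M m u"
  shows "m \<cdot> (m \<odot> M) = m \<cdot> (M \<odot> m) \<cdot> ac M M M" "m \<cdot> (u \<odot> M) = lc M" "m \<cdot> (M \<odot> u) = rc M"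
  using assms by (auto simp: monoid_in_def)

lemma comonoid_inI:
  assumes "Z \<in> Ob \<C>" "d \<in> Arr \<C>" "Dom \<C> d = Z" "Cod \<C> d = Z \<bullet> Z" "e \<in> Arr \<C>" "Dom \<C> e = Z" "Cod \<C> e = J"
    "ab Z Z Z \<cdot> (d \<bullet> Z) \<cdot> d = (Z \<bullet> d) \<cdot> d" "lb Z \<cdot> (e \<bullet> Z) \<cdot> d = Z" "rb Z \<cdot> (Z \<bullet> e) \<cdot> d = Z"
  shows "comonoid_in \<C> S Z d e"
  using assms by (auto simp: comonoid_in_def hom_def)

lemma monoid_inI:
  assumes "M \<in> Ob \<C>" "m \<in> Arr \<C>" "Dom \<C> m = M \<odot> M" "Cod \<C> m = M" "u \<in> Arr \<C>" "Dom \<C> u = I" "Cod \<C> u = M"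
    "m \<cdot> (m \<odot> M) = m \<cdot> (M \<odot> m) \<cdot> ac M M M" "m \<cdot> (u \<odot> M) = lc M" "m \<cdot> (M \<odot> u) = rc M"
  shows "monoid_in \<C> T M m u"
  using assms by (auto simp: monoid_in_def hom_def)

lemma comonoid_counit_inv:
  assumes Z: "comonoid_in \<C> S Z d e"
  shows "(e \<bullet> Z) \<cdot> d = lbi Z" "(Z \<bullet> e) \<cdot> d = rbi Z"
proof -
  note [simp] = comonoid_arr[OF Z]
  have "lbi Z \<cdot> lb Z \<cdot> (e \<bullet> Z) \<cdot> d = lbi Z" "rbi Z \<cdot> rb Z \<cdot> (Z \<bullet> e) \<cdot> d = rbi Z"
    unfolding comonoid_laws[OF Z] by simp_all
  then show "(e \<bullet> Z) \<cdot> d = lbi Z" "(Z \<bullet> e) \<cdot> d = rbi Z" by simp_all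
qed

text \<open>Coassociativity is the associativity law of \<zeta> for \<bullet>; the counit laws come
  from \<open>zeta_lb\<close> and \<open>zeta_rb\<close>.\<close>

lemma comonoid_tens:
  assumes Z: "comonoid_in \<C> S Z d e" and Z': "comonoid_in \<C> S Z' d' e'"
  shows "comonoid_in \<C> S (Z \<odot> Z') (tens_comult Z d Z' d') (tens_counit e e')"
proof -
  note [simp] = comonoid_arr[OF Z] comonoid_arr[OF Z']
  let ?W = "Z \<odot> Z'" and ?D = "tens_comult Z d Z' d'"
  have "ab ?W ?W ?W \<cdot> (?D \<bullet> ?W) \<cdot> ?D = ab ?W ?W ?W \<cdot> (\<zeta> Z Z Z' Z' \<bullet> ?W) \<cdot> ((d \<odot> d') \<bullet> (Z \<odot> Z')) \<cdot> ?D"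
    by simp
  also have "\<dots> = ab ?W ?W ?W \<cdot> (\<zeta> Z Z Z' Z' \<bullet> ?W) \<cdot> \<zeta> (Z \<bullet> Z) Z (Z' \<bullet> Z') Z' \<cdot> (((d \<bullet> Z) \<cdot> d) \<odot> ((d' \<bullet> Z') \<cdot> d'))"
    using circ.ext2[OF zeta_nat[of d Z d' Z' "Z \<bullet> Z" Z "Z' \<bullet> Z'" Z'], of "d \<odot> d'"] by simp
  also have "\<dots> = (?W \<bullet> \<zeta> Z Z Z' Z') \<cdot> \<zeta> Z (Z \<bullet> Z) Z' (Z' \<bullet> Z') \<cdot> ((ab Z Z Z \<cdot> (d \<bullet> Z) \<cdot> d) \<odot> (ab Z' Z' Z' \<cdot> (d' \<bullet> Z') \<cdot> d'))"
    using circ.ext3[OF zeta_assoc_blt[of Z Z Z Z' Z' Z', symmetric], of "((d \<bullet> Z) \<cdot> d) \<odot> ((d' \<bullet> Z') \<cdot> d')"] by simp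
  also have "\<dots> = (?W \<bullet> \<zeta> Z Z Z' Z') \<cdot> \<zeta> Z (Z \<bullet> Z) Z' (Z' \<bullet> Z') \<cdot> ((Z \<bullet> d) \<odot> (Z' \<bullet> d')) \<cdot> (d \<odot> d')"
    unfolding comonoid_laws[OF Z] comonoid_laws[OF Z'] by simp
  also have "\<dots> = (?W \<bullet> ?D) \<cdot> ?D"
    using circ.ext2[OF zeta_nat[of Z d Z' d' Z "Z \<bullet> Z" Z' "Z' \<bullet> Z'"], of "d \<odot> d'"] by simp
  finally have assoc: "ab ?W ?W ?W \<cdot> (?D \<bullet> ?W) \<cdot> ?D = (?W \<bullet> ?D) \<cdot> ?D" .
  have "lb ?W \<cdot> (tens_counit e e' \<bullet> ?W) \<cdot> ?D = lb ?W \<cdot> (m\<^sub>J \<bullet> ?W) \<cdot> ((e \<odot> e') \<bullet> ?W) \<cdot> ?D" by simp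
  also have "\<dots> = lb ?W \<cdot> (m\<^sub>J \<bullet> ?W) \<cdot> \<zeta> J Z J Z' \<cdot> (((e \<bullet> Z) \<cdot> d) \<odot> ((e' \<bullet> Z') \<cdot> d'))"
    using circ.ext2[OF zeta_nat[of e Z e' Z' J Z J Z'], of "d \<odot> d'"] by simp
  also have "\<dots> = (lb Z \<odot> lb Z') \<cdot> (((e \<bullet> Z) \<cdot> d) \<odot> ((e' \<bullet> Z') \<cdot> d'))"
    using circ.ext3[OF zeta_lb[of Z Z'], of "((e \<bullet> Z) \<cdot> d) \<odot> ((e' \<bullet> Z') \<cdot> d')"] by simp
  finally have l: "lb ?W \<cdot> (tens_counit e e' \<bullet> ?W) \<cdot> ?D = ?W"
    by (simp add: comonoid_laws[OF Z] comonoid_laws[OF Z'])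
  have "rb ?W \<cdot> (?W \<bullet> tens_counit e e') \<cdot> ?D = rb ?W \<cdot> (?W \<bullet> m\<^sub>J) \<cdot> (?W \<bullet> (e \<odot> e')) \<cdot> ?D" by simp
  also have "\<dots> = rb ?W \<cdot> (?W \<bullet> m\<^sub>J) \<cdot> \<zeta> Z J Z' J \<cdot> (((Z \<bullet> e) \<cdot> d) \<odot> ((Z' \<bullet> e') \<cdot> d'))"
    using circ.ext2[OF zeta_nat[of Z e Z' e' Z J Z' J], of "d \<odot> d'"] by simp
  also have "\<dots> = (rb Z \<odot> rb Z') \<cdot> (((Z \<bullet> e) \<cdot> d) \<odot> ((Z' \<bullet> e') \<cdot> d'))"
    using circ.ext3[OF zeta_rb[of Z Z'], of "((Z \<bullet> e) \<cdot> d) \<odot> ((Z' \<bullet> e') \<cdot> d')"] by simp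
  finally have r: "rb ?W \<cdot> (?W \<bullet> tens_counit e e') \<cdot> ?D = ?W"
    by (simp add: comonoid_laws[OF Z] comonoid_laws[OF Z'])
  show ?thesis using assoc l r by (intro comonoid_inI) simp_all
qed

text \<open>Dual to \<open>comonoid_tens\<close>, with \<open>zeta_assoc_circ\<close> for
  associativity and \<open>zeta_lc\<close>, \<open>zeta_rc\<close> for the unit laws.\<close>

lemma monoid_prod:
  assumes X: "monoid_in \<C> T X mX uX" and Y: "monoid_in \<C> T Y mY uY"
  shows "monoid_in \<C> T (X \<bullet> Y) (prod_mult X mX Y mY) (prod_unit uX uY)"
proof -
  note [simp] = monoid_arr[OF X] monoid_arr[OF Y]
  let ?W = "X \<bullet> Y" and ?z = "\<zeta> X Y X Y"
  have "prod_mult X mX Y mY \<cdot> (prod_mult X mX Y mY \<odot> ?W) = (mX \<bullet> mY) \<cdot> ?z \<cdot> ((mX \<bullet> mY) \<odot> (X \<bullet> Y)) \<cdot> (?z \<odot> ?W)"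
    by simp
  also have "\<dots> = ((mX \<cdot> (mX \<odot> X)) \<bullet> (mY \<cdot> (mY \<odot> Y))) \<cdot> \<zeta> (X \<odot> X) (Y \<odot> Y) X Y \<cdot> (?z \<odot> ?W)"
    using circ.ext2[OF zeta_nat[of mX mY X Y X Y X Y], of "?z \<odot> ?W"] by simp
  also have "\<dots> = ((mX \<cdot> (X \<odot> mX)) \<bullet> (mY \<cdot> (Y \<odot> mY))) \<cdot> (ac X X X \<bullet> ac Y Y Y) \<cdot> \<zeta> (X \<odot> X) (Y \<odot> Y) X Y \<cdot> (?z \<odot> ?W)"
    by (simp add: monoid_laws[OF X] monoid_laws[OF Y])
  also have "\<dots> = ((mX \<cdot> (X \<odot> mX)) \<bullet> (mY \<cdot> (Y \<odot> mY))) \<cdot> \<zeta> X Y (X \<odot> X) (Y \<odot> Y) \<cdot> (?W \<odot> ?z) \<cdot> ac ?W ?W ?W"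
    by (simp add: zeta_assoc_circ)
  also have "\<dots> = (mX \<bullet> mY) \<cdot> ?z \<cdot> ((X \<bullet> Y) \<odot> (mX \<bullet> mY)) \<cdot> (?W \<odot> ?z) \<cdot> ac ?W ?W ?W"
    using circ.ext2[OF zeta_nat[of X Y mX mY X Y X Y], of "(?W \<odot> ?z) \<cdot> ac ?W ?W ?W"] by simp
  finally have assoc: "prod_mult X mX Y mY \<cdot> (prod_mult X mX Y mY \<odot> ?W) =
    prod_mult X mX Y mY \<cdot> (?W \<odot> prod_mult X mX Y mY) \<cdot> ac ?W ?W ?W" by simp
  have "prod_mult X mX Y mY \<cdot> (prod_unit uX uY \<odot> ?W) = (mX \<bullet> mY) \<cdot> ?z \<cdot> ((uX \<bullet> uY) \<odot> (X \<bullet> Y)) \<cdot> (\<Delta>\<^sub>I \<odot> ?W)"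
    by simp
  also have "\<dots> = ((mX \<cdot> (uX \<odot> X)) \<bullet> (mY \<cdot> (uY \<odot> Y))) \<cdot> \<zeta> I I X Y \<cdot> (\<Delta>\<^sub>I \<odot> ?W)"
    using circ.ext2[OF zeta_nat[of uX uY X Y X Y X Y], of "\<Delta>\<^sub>I \<odot> ?W"] by simp
  also have "\<dots> = lc ?W" by (simp add: monoid_laws[OF X] monoid_laws[OF Y] zeta_lc)
  finally have l: "prod_mult X mX Y mY \<cdot> (prod_unit uX uY \<odot> ?W) = lc ?W" .
  have "prod_mult X mX Y mY \<cdot> (?W \<odot> prod_unit uX uY) = (mX \<bullet> mY) \<cdot> ?z \<cdot> ((X \<bullet> Y) \<odot> (uX \<bullet> uY)) \<cdot> (?W \<odot> \<Delta>\<^sub>I)"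
    by simp
  also have "\<dots> = ((mX \<cdot> (X \<odot> uX)) \<bullet> (mY \<cdot> (Y \<odot> uY))) \<cdot> \<zeta> X Y I I \<cdot> (?W \<odot> \<Delta>\<^sub>I)"
    using circ.ext2[OF zeta_nat[of X Y uX uY X Y X Y], of "?W \<odot> \<Delta>\<^sub>I"] by simp
  also have "\<dots> = rc ?W" by (simp add: monoid_laws[OF X] monoid_laws[OF Y] zeta_rc)
  finally have r: "prod_mult X mX Y mY \<cdot> (?W \<odot> prod_unit uX uY) = rc ?W" .
  show ?thesis using assoc l r by (intro monoid_inI) simp_all
qed

lemma monoid_map_prod:
  assumes "monoid_in \<C> T X mX uX" "monoid_in \<C> T Y mY uY" "monoid_in \<C> T X' mX' uX'" "monoid_in \<C> T Y' mY' uY'"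
    and f: "monoid_map X mX uX X' mX' uX' f" and g: "monoid_map Y mY uY Y' mY' uY' g"
  shows "monoid_map (X \<bullet> Y) (prod_mult X mX Y mY) (prod_unit uX uY) (X' \<bullet> Y') (prod_mult X' mX' Y' mY') (prod_unit uX' uY') (f \<bullet> g)"
proof -
  note [simp] = monoid_arr[OF assms(1)] monoid_arr[OF assms(2)] monoid_arr[OF assms(3)] monoid_arr[OF assms(4)]
  have fg [simp]: "f \<in> Arr \<C>" "Dom \<C> f = X" "Cod \<C> f = X'" "g \<in> Arr \<C>" "Dom \<C> g = Y" "Cod \<C> g = Y'"
    "f \<cdot> mX = mX' \<cdot> (f \<odot> f)" "g \<cdot> mY = mY' \<cdot> (g \<odot> g)" "f \<cdot> uX = uX'" "g \<cdot> uY = uY'"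
    using f g by (auto simp: monoid_map_def)
  have "(f \<bullet> g) \<cdot> prod_mult X mX Y mY = prod_mult X' mX' Y' mY' \<cdot> ((f \<bullet> g) \<odot> (f \<bullet> g))"
    using zeta_nat[of f g f g X' Y' X' Y'] by simp
  then show ?thesis by (simp add: monoid_map_def)
qed

text \<open>Multiplicativity is \<open>zeta_assoc_blt\<close>, the law behind coassociativity of
  tensor products; preservation of the unit is coassociativity of I.\<close>

lemma monoid_map_assoc:
  assumes X: "monoid_in \<C> T X mX uX" and Y: "monoid_in \<C> T Y mY uY" and W: "monoid_in \<C> T W mW uW"
  shows "monoid_map ((X \<bullet> Y) \<bullet> W) (prod_mult (X \<bullet> Y) (prod_mult X mX Y mY) W mW) (prod_unit (prod_unit uX uY) uW)
    (X \<bullet> (Y \<bullet> W)) (prod_mult X mX (Y \<bullet> W) (prod_mult Y mY W mW)) (prod_unit uX (prod_unit uY uW)) (ab X Y W)"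
proof -
  note [simp] = monoid_arr[OF X] monoid_arr[OF Y] monoid_arr[OF W]
  let ?a = "ab X Y W"
  have "?a \<cdot> prod_mult (X \<bullet> Y) (prod_mult X mX Y mY) W mW =
     ?a \<cdot> ((mX \<bullet> mY) \<bullet> mW) \<cdot> (\<zeta> X Y X Y \<bullet> (W \<odot> W)) \<cdot> \<zeta> (X \<bullet> Y) W (X \<bullet> Y) W" by simp
  also have "\<dots> = (mX \<bullet> (mY \<bullet> mW)) \<cdot> ab (X \<odot> X) (Y \<odot> Y) (W \<odot> W) \<cdot> (\<zeta> X Y X Y \<bullet> (W \<odot> W)) \<cdot> \<zeta> (X \<bullet> Y) W (X \<bullet> Y) W"
    using circ.ext2[OF blt.assoc_nat[of mX mY mW X Y W], of "(\<zeta> X Y X Y \<bullet> (W \<odot> W)) \<cdot> \<zeta> (X \<bullet> Y) W (X \<bullet> Y) W"] by simp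
  also have "\<dots> = (mX \<bullet> (mY \<bullet> mW)) \<cdot> ((X \<odot> X) \<bullet> \<zeta> Y W Y W) \<cdot> \<zeta> X (Y \<bullet> W) X (Y \<bullet> W) \<cdot> (?a \<odot> ?a)"
    by (simp add: zeta_assoc_blt[symmetric] del: blt.merge_ext)
  also have "\<dots> = prod_mult X mX (Y \<bullet> W) (prod_mult Y mY W mW) \<cdot> (?a \<odot> ?a)" by simp
  finally have m: "?a \<cdot> prod_mult (X \<bullet> Y) (prod_mult X mX Y mY) W mW = prod_mult X mX (Y \<bullet> W) (prod_mult Y mY W mW) \<cdot> (?a \<odot> ?a)" .
  have "?a \<cdot> prod_unit (prod_unit uX uY) uW = ?a \<cdot> ((uX \<bullet> uY) \<bullet> uW) \<cdot> (\<Delta>\<^sub>I \<bullet> I) \<cdot> \<Delta>\<^sub>I" by simp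
  also have "\<dots> = (uX \<bullet> (uY \<bullet> uW)) \<cdot> (I \<bullet> \<Delta>\<^sub>I) \<cdot> \<Delta>\<^sub>I"
    using circ.ext2[OF blt.assoc_nat[of uX uY uW X Y W], of "(\<Delta>\<^sub>I \<bullet> I) \<cdot> \<Delta>\<^sub>I"] by (simp add: I_coassoc)
  finally show ?thesis using m by (simp add: monoid_map_def)
qed

lemma monoid_map_comp:
  assumes f: "monoid_map M m u M' m' u' f" and g: "monoid_map M' m' u' M'' m'' u'' g"
    and M: "monoid_in \<C> T M m u" "monoid_in \<C> T M' m' u'" "monoid_in \<C> T M'' m'' u''"
  shows "monoid_map M m u M'' m'' u'' (g \<cdot> f)"
proof -
  note [simp] = monoid_arr[OF M(1)] monoid_arr[OF M(2)] monoid_arr[OF M(3)]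
  have [simp]: "f \<in> Arr \<C>" "Dom \<C> f = M" "Cod \<C> f = M'" "g \<in> Arr \<C>" "Dom \<C> g = M'" "Cod \<C> g = M''"
    and e: "f \<cdot> m = m' \<cdot> (f \<odot> f)" "g \<cdot> m' = m'' \<cdot> (g \<odot> g)" "f \<cdot> u = u'" "g \<cdot> u' = u''"
    using f g by (auto simp: monoid_map_def)
  have "(g \<cdot> f) \<cdot> m = m'' \<cdot> ((g \<cdot> f) \<odot> (g \<cdot> f))"
    using circ.ext2[OF e(2), of "f \<odot> f"] by (simp add: e(1))
  then show ?thesis by (simp add: monoid_map_def e)
qed

lemma monoid_map_id: "monoid_in \<C> T M m u \<Longrightarrow> monoid_map M m u M m u M"
  using monoid_arr[of M m u] by (simp add: monoid_map_def)

text \<open>The regular action of M restricted along t. Every instance of \<open>Hopf_module\<close>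
  below is obtained in this way.\<close>

lemma action_of_monoid_map:
  assumes M: "monoid_in \<C> T M m u" and H: "monoid_in \<C> T H mH uH" and t: "monoid_map H mH uH M m u t"
  defines "a \<equiv> m \<cdot> (M \<odot> t)"
  shows "a \<in> hom \<C> (M \<odot> H) M" "a \<cdot> (a \<odot> H) = a \<cdot> (M \<odot> mH) \<cdot> ac M H H" "a \<cdot> (M \<odot> uH) = rc M"
proof -
  note [simp] = monoid_arr[OF M] monoid_arr[OF H]
  have [simp]: "t \<in> Arr \<C>" "Dom \<C> t = H" "Cod \<C> t = M" and e: "t \<cdot> mH = m \<cdot> (t \<odot> t)" "t \<cdot> uH = u"
    using t by (auto simp: monoid_map_def)
  show "a \<in> hom \<C> (M \<odot> H) M" by (simp add: a_def hom_def)
  have "a \<cdot> (a \<odot> H) = (m \<cdot> (m \<odot> M)) \<cdot> ((M \<odot> t) \<odot> t)" by (simp add: a_def)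
  also have "\<dots> = m \<cdot> (M \<odot> m) \<cdot> ac M M M \<cdot> ((M \<odot> t) \<odot> t)" unfolding monoid_laws[OF M] by simp
  also have "\<dots> = m \<cdot> (M \<odot> (t \<cdot> mH)) \<cdot> ac M H H"
    using circ.assoc_nat[of M t t M M M] by (simp add: e)
  finally show "a \<cdot> (a \<odot> H) = a \<cdot> (M \<odot> mH) \<cdot> ac M H H" by (simp add: a_def)
  show "a \<cdot> (M \<odot> uH) = rc M" by (simp add: a_def e monoid_laws[OF M])
qed

lemma comonoid_map_comp:
  assumes f: "comonoid_map Z d e Z' d' e' f" and g: "comonoid_map Z' d' e' Z'' d'' e'' g"
    and Z: "comonoid_in \<C> S Z d e" "comonoid_in \<C> S Z' d' e'" "comonoid_in \<C> S Z'' d'' e''"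
  shows "comonoid_map Z d e Z'' d'' e'' (g \<cdot> f)"
proof -
  note [simp] = comonoid_arr[OF Z(1)] comonoid_arr[OF Z(2)] comonoid_arr[OF Z(3)]
  have [simp]: "f \<in> Arr \<C>" "Dom \<C> f = Z" "Cod \<C> f = Z'" "g \<in> Arr \<C>" "Dom \<C> g = Z'" "Cod \<C> g = Z''"
    and e: "d' \<cdot> f = (f \<bullet> f) \<cdot> d" "d'' \<cdot> g = (g \<bullet> g) \<cdot> d'" "e' \<cdot> f = e" "e'' \<cdot> g = e'"
    using f g by (auto simp: comonoid_map_def)
  have "d'' \<cdot> g \<cdot> f = ((g \<cdot> f) \<bullet> (g \<cdot> f)) \<cdot> d"
    using circ.ext2[OF e(2), of f] by (simp add: e(1))
  moreover have "e'' \<cdot> g \<cdot> f = e"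
    using circ.ext2[OF e(4), of f] by (simp add: e(3))
  ultimately show ?thesis by (simp add: comonoid_map_def)
qed

lemma comonoid_map_id: "comonoid_in \<C> S Z d e \<Longrightarrow> comonoid_map Z d e Z d e Z"
  using comonoid_arr[of Z d e] by (simp add: comonoid_map_def)

lemma comonoid_map_tens:
  assumes Z: "comonoid_in \<C> S Z d e" "comonoid_in \<C> S Z' d' e'" "comonoid_in \<C> S W c h" "comonoid_in \<C> S W' c' h'"
    and f: "comonoid_map Z d e W c h f" and g: "comonoid_map Z' d' e' W' c' h' g"
  shows "comonoid_map (Z \<odot> Z') (tens_comult Z d Z' d') (tens_counit e e') (W \<odot> W') (tens_comult W c W' c') (tens_counit h h') (f \<odot> g)"
proof -
  note [simp] = comonoid_arr[OF Z(1)] comonoid_arr[OF Z(2)] comonoid_arr[OF Z(3)] comonoid_arr[OF Z(4)]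
  have [simp]: "f \<in> Arr \<C>" "Dom \<C> f = Z" "Cod \<C> f = W" "g \<in> Arr \<C>" "Dom \<C> g = Z'" "Cod \<C> g = W'"
    and e [simp]: "c \<cdot> f = (f \<bullet> f) \<cdot> d" "c' \<cdot> g = (g \<bullet> g) \<cdot> d'" "h \<cdot> f = e" "h' \<cdot> g = e'"
    using f g by (auto simp: comonoid_map_def)
  have "tens_comult W c W' c' \<cdot> (f \<odot> g) = ((f \<odot> g) \<bullet> (f \<odot> g)) \<cdot> tens_comult Z d Z' d'"
    using circ.ext2[OF zeta_nat[of f f g g W W W' W'], of "d \<odot> d'"] by simp
  then show ?thesis by (simp add: comonoid_map_def)
qed

text \<open>The unit constraint respects comonoids by the unit laws of \<zeta> and of J. With the
  analogous facts for \<open>rc\<close> and \<open>ac\<close>, the monoid laws of the pullback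
  become equations between comonoid maps and can be tested by a universal property.\<close>

lemma comonoid_map_lc:
  assumes Z: "comonoid_in \<C> S Z d e"
  shows "comonoid_map (I \<odot> Z) (tens_comult I \<Delta>\<^sub>I Z d) (tens_counit \<epsilon>\<^sub>I e) Z d e (lc Z)"
proof -
  note [simp] = comonoid_arr[OF Z]
  have "d \<cdot> lc Z = ((lc Z \<bullet> lc Z) \<cdot> \<zeta> I I Z Z \<cdot> (\<Delta>\<^sub>I \<odot> (Z \<bullet> Z))) \<cdot> (I \<odot> d)"
    by (subst zeta_lc) (simp_all add: circ.lunit_nat)
  moreover have "tens_counit \<epsilon>\<^sub>I e = (m\<^sub>J \<cdot> (\<epsilon>\<^sub>I \<odot> J)) \<cdot> (I \<odot> e)" by simp
  then have "tens_counit \<epsilon>\<^sub>I e = e \<cdot> lc Z" unfolding mJ_unit by (simp add: circ.lunit_nat)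
  ultimately show ?thesis by (simp add: comonoid_map_def)
qed

lemma comonoid_map_rc:
  assumes Z: "comonoid_in \<C> S Z d e"
  shows "comonoid_map (Z \<odot> I) (tens_comult Z d I \<Delta>\<^sub>I) (tens_counit e \<epsilon>\<^sub>I) Z d e (rc Z)"
proof -
  note [simp] = comonoid_arr[OF Z]
  have "d \<cdot> rc Z = ((rc Z \<bullet> rc Z) \<cdot> \<zeta> Z Z I I \<cdot> ((Z \<bullet> Z) \<odot> \<Delta>\<^sub>I)) \<cdot> (d \<odot> I)"
    by (subst zeta_rc) (simp_all add: circ.runit_nat)
  moreover have "tens_counit e \<epsilon>\<^sub>I = (m\<^sub>J \<cdot> (J \<odot> \<epsilon>\<^sub>I)) \<cdot> (e \<odot> I)" by simp
  then have "tens_counit e \<epsilon>\<^sub>I = e \<cdot> rc Z" unfolding mJ_unit by (simp add: circ.runit_nat)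
  ultimately show ?thesis by (simp add: comonoid_map_def)
qed

lemma comonoid_map_ac:
  assumes Z: "comonoid_in \<C> S X d e" "comonoid_in \<C> S Y d' e'" "comonoid_in \<C> S Z d'' e''"
  shows "comonoid_map ((X \<odot> Y) \<odot> Z) (tens_comult (X \<odot> Y) (tens_comult X d Y d') Z d'') (tens_counit (tens_counit e e') e'')
   (X \<odot> (Y \<odot> Z)) (tens_comult X d (Y \<odot> Z) (tens_comult Y d' Z d'')) (tens_counit e (tens_counit e' e'')) (ac X Y Z)"
proof -
  note [simp] = comonoid_arr[OF Z(1)] comonoid_arr[OF Z(2)] comonoid_arr[OF Z(3)]
  let ?a = "ac X Y Z"
  have "tens_comult X d (Y \<odot> Z) (tens_comult Y d' Z d'') \<cdot> ?a
    = \<zeta> X X (Y \<odot> Z) (Y \<odot> Z) \<cdot> ((X \<bullet> X) \<odot> \<zeta> Y Y Z Z) \<cdot> (d \<odot> (d' \<odot> d'')) \<cdot> ?a" by simp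
  also have "\<dots> = \<zeta> X X (Y \<odot> Z) (Y \<odot> Z) \<cdot> ((X \<bullet> X) \<odot> \<zeta> Y Y Z Z) \<cdot> ac (X \<bullet> X) (Y \<bullet> Y) (Z \<bullet> Z) \<cdot> ((d \<odot> d') \<odot> d'')"
    by (simp add: circ.assoc_nat)
  also have "\<dots> = (?a \<bullet> ?a) \<cdot> \<zeta> (X \<odot> Y) (X \<odot> Y) Z Z \<cdot> (\<zeta> X X Y Y \<odot> (Z \<bullet> Z)) \<cdot> ((d \<odot> d') \<odot> d'')"
    using circ.ext3[OF zeta_assoc_circ[of X X Y Y Z Z], of "(d \<odot> d') \<odot> d''"] by simp
  finally have c: "tens_comult X d (Y \<odot> Z) (tens_comult Y d' Z d'') \<cdot> ?a
    = (?a \<bullet> ?a) \<cdot> tens_comult (X \<odot> Y) (tens_comult X d Y d') Z d''" by simp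
  have "tens_counit e (tens_counit e' e'') \<cdot> ?a = m\<^sub>J \<cdot> (J \<odot> m\<^sub>J) \<cdot> (e \<odot> (e' \<odot> e'')) \<cdot> ?a" by simp
  also have "\<dots> = (m\<^sub>J \<cdot> (J \<odot> m\<^sub>J) \<cdot> ac J J J) \<cdot> ((e \<odot> e') \<odot> e'')" by (simp add: circ.assoc_nat)
  also have "\<dots> = (m\<^sub>J \<cdot> (m\<^sub>J \<odot> J)) \<cdot> ((e \<odot> e') \<odot> e'')" unfolding monoid_laws[OF J_monoid] ..
  finally have "tens_counit e (tens_counit e' e'') \<cdot> ?a = tens_counit (tens_counit e e') e''" by simp
  then show ?thesis using c by (simp add: comonoid_map_def)
qed

lemma pair_comonoid_map:
  assumes f: "comonoid_map Z d e Z' d' e' f"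
    and Z: "comonoid_in \<C> S Z d e" "comonoid_in \<C> S Z' d' e'"
    and [simp]: "x \<in> Arr \<C>" "Dom \<C> x = Z'" "y \<in> Arr \<C>" "Dom \<C> y = Z'"
  shows "(x \<bullet> y) \<cdot> d' \<cdot> f = ((x \<cdot> f) \<bullet> (y \<cdot> f)) \<cdot> d"
proof -
  note [simp] = comonoid_arr[OF Z(1)] comonoid_arr[OF Z(2)]
  have [simp]: "f \<in> Arr \<C>" "Dom \<C> f = Z" "Cod \<C> f = Z'" "d' \<cdot> f = (f \<bullet> f) \<cdot> d"
    using f by (auto simp: comonoid_map_def)
  show ?thesis by simp
qed

lemma pair_tens:
  assumes Z: "comonoid_in \<C> S Z d e" "comonoid_in \<C> S Z' d' e'"
    and [simp]: "x \<in> Arr \<C>" "Dom \<C> x = Z" "y \<in> Arr \<C>" "Dom \<C> y = Z"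
      "x' \<in> Arr \<C>" "Dom \<C> x' = Z'" "y' \<in> Arr \<C>" "Dom \<C> y' = Z'"
    and c: "Cod \<C> x = X" "Cod \<C> y = Y" "Cod \<C> x' = X'" "Cod \<C> y' = Y'"
  shows "((x \<odot> x') \<bullet> (y \<odot> y')) \<cdot> \<zeta> Z Z Z' Z' \<cdot> (d \<odot> d') = \<zeta> X Y X' Y' \<cdot> (((x \<bullet> y) \<cdot> d) \<odot> ((x' \<bullet> y') \<cdot> d'))"
proof -
  note [simp] = comonoid_arr[OF Z(1)] comonoid_arr[OF Z(2)]
  have [simp]: "X \<in> Ob \<C>" "Y \<in> Ob \<C>" "X' \<in> Ob \<C>" "Y' \<in> Ob \<C>"
    using c circ.cod_ob[of x] circ.cod_ob[of y] circ.cod_ob[of x'] circ.cod_ob[of y'] by simp_all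
  show ?thesis using circ.ext2[OF zeta_nat[of x y x' y' X Y X' Y'], of "d \<odot> d'"] by (simp add: c)
qed

text \<open>An arrow is monic iff the square of identities over it is a pullback. For a monomorphism
  this square is a binary intersection of f with itself, so F preserves it.\<close>

lemma preserves_mono:
  assumes "preserves_binary_intersections \<C> F" "mono_arrow \<C> f" "F (Dom \<C> f) \<in> Ob \<C>"
    and "Dom \<C> (F f) = F (Dom \<C> f)" "F f \<in> Arr \<C>"
  shows "mono_arrow \<C> (F f)"
proof -
  have f: "f \<in> Arr \<C>" using assms(2) by (simp add: mono_arrow_def)
  have "\<exists>!u. u \<in> hom \<C> X (Dom \<C> (Dom \<C> f)) \<and> Dom \<C> f \<cdot> u = h \<and> Dom \<C> f \<cdot> u = k"
    if "X \<in> Ob \<C>" "h \<in> hom \<C> X (Dom \<C> f)" "k \<in> hom \<C> X (Dom \<C> f)" "f \<cdot> h = f \<cdot> k" for X h k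
  proof -
    have "h = k" using that assms(2) unfolding mono_arrow_def by blast
    moreover have "Dom \<C> f \<cdot> u = u" if "u \<in> hom \<C> X (Dom \<C> f)" for u
      using that f by (simp add: hom_def)
    ultimately show ?thesis using that f by (intro ex1I[of _ h]) auto
  qed
  then have "is_pullback \<C> f f (Dom \<C> f) (Dom \<C> f)"
    unfolding is_pullback_def using f by (intro conjI ballI impI) simp_all
  then have p: "is_pullback \<C> (F f) (F f) (F (Dom \<C> f)) (F (Dom \<C> f))"
    using assms(1,2) unfolding preserves_binary_intersections_def by blast
  show ?thesis
  proof (rule circ.mono_arrowI)
    fix x y assume xy: "x \<in> Arr \<C>" "y \<in> Arr \<C>" "Dom \<C> x = Dom \<C> y" "Cod \<C> x = Dom \<C> (F f)" "Cod \<C> y = Dom \<C> (F f)" "F f \<cdot> x = F f \<cdot> y"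
    have "x \<in> hom \<C> (Dom \<C> x) (Dom \<C> (F f))" "y \<in> hom \<C> (Dom \<C> x) (Dom \<C> (F f))" "Dom \<C> x \<in> Ob \<C>"
      using xy by (auto simp: hom_def)
    then obtain u where "u \<in> hom \<C> (Dom \<C> x) (Dom \<C> (F (Dom \<C> f)))" "F (Dom \<C> f) \<cdot> u = x" "F (Dom \<C> f) \<cdot> u = y"
      using p xy(6) unfolding is_pullback_def by blast
    then show "x = y" by simp
  qed (fact assms(5))
qed

end

section \<open>Cocommutative comonoids\<close>

context bullet_braided_duoidal_category
begin

lemma sigma_arr [simp]:
  assumes "X \<in> Ob \<C>" "Y \<in> Ob \<C>"
  shows "\<sigma> X Y \<in> Arr \<C>" "Dom \<C> (\<sigma> X Y) = X \<bullet> Y" "Cod \<C> (\<sigma> X Y) = Y \<bullet> X"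
  using natural2_arr[OF sigma_braiding[unfolded braiding_def, THEN conjunct1] assms] by simp_all

lemma sigma_nat:
  assumes "f \<in> Arr \<C>" "g \<in> Arr \<C>" "Cod \<C> f = X" "Cod \<C> g = Y"
  shows "\<sigma> X Y \<cdot> (f \<bullet> g) = (g \<bullet> f) \<cdot> \<sigma> (Dom \<C> f) (Dom \<C> g)"
  using natural2_nat[OF sigma_braiding[unfolded braiding_def, THEN conjunct1] assms] .

definition cocomm where
  "cocomm Z d e \<longleftrightarrow> comonoid_in \<C> S Z d e \<and> \<sigma> Z Z \<cdot> d = d"

lemma cocomm_comonoid: "cocomm Z d e \<Longrightarrow> comonoid_in \<C> S Z d e"
  by (simp add: cocomm_def)

lemma cocomm_I: "cocomm I \<Delta>\<^sub>I \<epsilon>\<^sub>I"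
  by (simp add: cocomm_def I_comonoid sigma_Delta)

lemma cocomm_tens:
  assumes "cocomm Z d e" "cocomm Z' d' e'"
  shows "cocomm (Z \<odot> Z') (tens_comult Z d Z' d') (tens_counit e e')"
proof -
  have Z: "comonoid_in \<C> S Z d e" "comonoid_in \<C> S Z' d' e'" and c: "\<sigma> Z Z \<cdot> d = d" "\<sigma> Z' Z' \<cdot> d' = d'"
    using assms by (auto simp: cocomm_def)
  note [simp] = comonoid_arr[OF Z(1)] comonoid_arr[OF Z(2)]
  have "\<sigma> (Z \<odot> Z') (Z \<odot> Z') \<cdot> \<zeta> Z Z Z' Z' \<cdot> (d \<odot> d') = \<zeta> Z Z Z' Z' \<cdot> (\<sigma> Z Z \<odot> \<sigma> Z' Z') \<cdot> (d \<odot> d')"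
    using circ.ext2[OF sigma_zeta[of Z Z Z' Z'], of "d \<odot> d'"] by simp
  then show ?thesis using comonoid_tens[OF Z] by (simp add: cocomm_def c)
qed

lemma pair_swap:
  assumes Z: "cocomm Z d e" and [simp]: "x \<in> Arr \<C>" "y \<in> Arr \<C>" "Dom \<C> x = Z" "Dom \<C> y = Z"
    and c: "Cod \<C> x = X" "Cod \<C> y = Y"
  shows "\<sigma> X Y \<cdot> (x \<bullet> y) \<cdot> d = (y \<bullet> x) \<cdot> d"
proof -
  note [simp] = comonoid_arr[OF cocomm_comonoid[OF Z]]
  have [simp]: "X \<in> Ob \<C>" "Y \<in> Ob \<C>" using c circ.cod_ob[of x] circ.cod_ob[of y] by simp_all
  show ?thesis using circ.ext2[OF sigma_nat[of x y X Y], of d] Z by (simp add: c cocomm_def)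
qed

text \<open>Since \<open>\<sigma>\<close> need not be a symmetry, \<open>X \<bullet> Y\<close> need not be cocommutative even if \<open>X\<close> and \<open>Y\<close> are. The
  comultiplication \<open>shuffle\<close> is therefore only used on arrows out of cocommutative comonoids.\<close>

definition shuffle where
  "shuffle X d Y d' = abi X Y (X \<bullet> Y) \<cdot> (X \<bullet> (ab Y X Y \<cdot> (\<sigma> X Y \<bullet> Y) \<cdot> abi X Y Y)) \<cdot> ab X X (Y \<bullet> Y) \<cdot> (d \<bullet> d')"

lemma shuffle_arr [simp]:
  assumes "X \<in> Ob \<C>" "Y \<in> Ob \<C>" "d \<in> Arr \<C>" "Dom \<C> d = X" "Cod \<C> d = X \<bullet> X" "d' \<in> Arr \<C>" "Dom \<C> d' = Y" "Cod \<C> d' = Y \<bullet> Y"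
  shows "shuffle X d Y d' \<in> Arr \<C>" "Dom \<C> (shuffle X d Y d') = X \<bullet> Y" "Cod \<C> (shuffle X d Y d') = (X \<bullet> Y) \<bullet> (X \<bullet> Y)"
  using assms by (simp_all add: shuffle_def)

text \<open>In the fourfold pair x, x, y, y the braiding swaps the two middle components, and
  \<open>pair_swap\<close> absorbs the swap because Z is cocommutative.\<close>

lemma shuffle_pair:
  assumes Z: "cocomm Z d e" and X: "comonoid_in \<C> S X dX eX" and Y: "comonoid_in \<C> S Y dY eY"
    and x: "comonoid_map Z d e X dX eX x" and y: "comonoid_map Z d e Y dY eY y"
  shows "shuffle X dX Y dY \<cdot> (x \<bullet> y) \<cdot> d = (((x \<bullet> y) \<cdot> d) \<bullet> ((x \<bullet> y) \<cdot> d)) \<cdot> d"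
proof -
  note Zc = cocomm_comonoid[OF Z]
  note [simp] = comonoid_arr[OF Zc] comonoid_arr[OF X] comonoid_arr[OF Y]
  have [simp]: "x \<in> Arr \<C>" "Dom \<C> x = Z" "Cod \<C> x = X" "y \<in> Arr \<C>" "Dom \<C> y = Z" "Cod \<C> y = Y"
    and e [simp]: "dX \<cdot> x = (x \<bullet> x) \<cdot> d" "dY \<cdot> y = (y \<bullet> y) \<cdot> d"
    using x y by (auto simp: comonoid_map_def)
  let ?yy = "(y \<bullet> y) \<cdot> d" and ?xy = "(x \<bullet> y) \<cdot> d"
  have "shuffle X dX Y dY \<cdot> ?xy = abi X Y (X \<bullet> Y) \<cdot> (X \<bullet> (ab Y X Y \<cdot> (\<sigma> X Y \<bullet> Y) \<cdot> abi X Y Y)) \<cdot> ab X X (Y \<bullet> Y) \<cdot> (((x \<bullet> x) \<cdot> d) \<bullet> ?yy) \<cdot> d"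
    by (simp add: shuffle_def)
  also have "\<dots> = abi X Y (X \<bullet> Y) \<cdot> (X \<bullet> (ab Y X Y \<cdot> (\<sigma> X Y \<bullet> Y) \<cdot> abi X Y Y)) \<cdot> (x \<bullet> ((x \<bullet> ?yy) \<cdot> d)) \<cdot> d"
    using pair_assoc[OF Zc, of x x ?yy] by simp
  also have "\<dots> = abi X Y (X \<bullet> Y) \<cdot> (x \<bullet> (ab Y X Y \<cdot> ((\<sigma> X Y \<cdot> ?xy) \<bullet> y) \<cdot> d)) \<cdot> d"
    using pair_assoc_inv[OF Zc, of x y y] by simp
  also have "\<dots> = abi X Y (X \<bullet> Y) \<cdot> (x \<bullet> ((y \<bullet> ?xy) \<cdot> d)) \<cdot> d"
    using pair_swap[OF Z, of x y] pair_assoc[OF Zc, of y x y] by simp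
  also have "\<dots> = (?xy \<bullet> ?xy) \<cdot> d"
    using pair_assoc_inv[OF Zc, of x y ?xy] by simp
  finally show ?thesis .
qed

end

section \<open>Transport of convolution inverses and naturality of antipodes\<close>

context reversion
begin

text \<open>By naturality of \<open>\<phi>\<close> and multiplicativity of f, the product of the two
  images is the image of the product, and f sends the unit to the unit.\<close>

lemma right_inverse_monoid_map:
  assumes f: "monoid_map M m u M' m' u' f" and M: "monoid_in \<C> T M m u" "monoid_in \<C> T M' m' u'"
    and Z: "comonoid_in \<C> S Z d e"
    and [simp]: "x \<in> Arr \<C>" "Dom \<C> x = Z" "Cod \<C> x = M" "y \<in> Arr \<C>" "Dom \<C> y = Z" "Cod \<C> y = M\<^sup>-"
    and r: "right_inverse d e M m u x y"
  shows "right_inverse d e M' m' u' (f \<cdot> x) (f\<^sup>- \<cdot> y)"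
proof -
  note [simp] = monoid_arr[OF M(1)] monoid_arr[OF M(2)] comonoid_arr[OF Z]
  have [simp]: "f \<in> Arr \<C>" "Dom \<C> f = M" "Cod \<C> f = M'" and e: "f \<cdot> m = m' \<cdot> (f \<odot> f)" "f \<cdot> u = u'"
    using f by (auto simp: monoid_map_def)
  have "((m' \<bullet> I) \<odot> J) \<cdot> \<phi> M' M' \<cdot> ((f \<cdot> x) \<bullet> (f\<^sup>- \<cdot> y)) \<cdot> d = (((m' \<cdot> (f \<odot> f)) \<bullet> I) \<odot> J) \<cdot> \<phi> M M \<cdot> (x \<bullet> y) \<cdot> d"
    using circ.ext2[OF phi_nat[of f f M M' M M'], of "(x \<bullet> y) \<cdot> d"] by simp
  also have "\<dots> = ((f \<bullet> I) \<odot> J) \<cdot> ((m \<bullet> I) \<odot> J) \<cdot> \<phi> M M \<cdot> (x \<bullet> y) \<cdot> d" by (simp add: e)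
  also have "\<dots> = (((u' \<bullet> I) \<cdot> \<Delta>\<^sub>I) \<odot> J) \<cdot> lci J \<cdot> e" using r unfolding right_inverse_def by (simp add: e)
  finally show ?thesis unfolding right_inverse_def .
qed

lemma left_inverse_monoid_map:
  assumes f: "monoid_map M m u M' m' u' f" and M: "monoid_in \<C> T M m u" "monoid_in \<C> T M' m' u'"
    and Z: "comonoid_in \<C> S Z d e"
    and [simp]: "x \<in> Arr \<C>" "Dom \<C> x = Z" "Cod \<C> x = M" "y \<in> Arr \<C>" "Dom \<C> y = Z" "Cod \<C> y = M\<^sup>-"
    and l: "left_inverse d e M m u x y"
  shows "left_inverse d e M' m' u' (f \<cdot> x) (f\<^sup>- \<cdot> y)"
proof -
  note [simp] = monoid_arr[OF M(1)] monoid_arr[OF M(2)] comonoid_arr[OF Z]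
  have [simp]: "f \<in> Arr \<C>" "Dom \<C> f = M" "Cod \<C> f = M'" and e: "f \<cdot> m = m' \<cdot> (f \<odot> f)" "f \<cdot> u = u'"
    using f by (auto simp: monoid_map_def)
  have "(J \<odot> (I \<bullet> m')) \<cdot> \<psi> M' M' \<cdot> ((f\<^sup>- \<cdot> y) \<bullet> (f \<cdot> x)) \<cdot> d = (J \<odot> (I \<bullet> (m' \<cdot> (f \<odot> f)))) \<cdot> \<psi> M M \<cdot> (y \<bullet> x) \<cdot> d"
    using circ.ext2[OF psi_nat[of f f M M' M M'], of "(y \<bullet> x) \<cdot> d"] by simp
  also have "\<dots> = (J \<odot> (I \<bullet> f)) \<cdot> (J \<odot> (I \<bullet> m)) \<cdot> \<psi> M M \<cdot> (y \<bullet> x) \<cdot> d" by (simp add: e)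
  also have "\<dots> = (J \<odot> ((I \<bullet> u') \<cdot> \<Delta>\<^sub>I)) \<cdot> rci J \<cdot> e" using l unfolding left_inverse_def by (simp add: e)
  finally show ?thesis unfolding left_inverse_def .
qed

text \<open>A comonoid map x commutes with comultiplication and counit, so the antipode equations of
  H may be precomposed with x.\<close>

lemma antipode_inverse:
  assumes s: "antipode H s" and H: "monoid_in \<C> T (und H) (mult H) (unt H)" "comonoid_in \<C> S (und H) (comult H) (counit H)"
    and Z: "comonoid_in \<C> S Z d e" and x: "comonoid_map Z d e (und H) (comult H) (counit H) x"
  shows "right_inverse d e (und H) (mult H) (unt H) x (s \<cdot> x)" "left_inverse d e (und H) (mult H) (unt H) x (s \<cdot> x)"
proof -
  note [simp] = monoid_arr[OF H(1)] comonoid_arr[OF H(2)] comonoid_arr[OF Z]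
  have [simp]: "x \<in> Arr \<C>" "Dom \<C> x = Z" "Cod \<C> x = und H"
    and e: "comult H \<cdot> x = (x \<bullet> x) \<cdot> d" "counit H \<cdot> x = e"
    using x by (auto simp: comonoid_map_def)
  have [simp]: "s \<in> Arr \<C>" "Dom \<C> s = und H" "Cod \<C> s = (und H)\<^sup>-"
    and r: "((mult H \<bullet> I) \<odot> J) \<cdot> \<phi> (und H) (und H) \<cdot> (und H \<bullet> s) \<cdot> comult H =
      ((unt H \<bullet> I) \<odot> J) \<cdot> (\<Delta>\<^sub>I \<odot> J) \<cdot> lci J \<cdot> counit H"
    and l: "(J \<odot> (I \<bullet> mult H)) \<cdot> \<psi> (und H) (und H) \<cdot> (s \<bullet> und H) \<cdot> comult H =
      (J \<odot> (I \<bullet> unt H)) \<cdot> (J \<odot> \<Delta>\<^sub>I) \<cdot> rci J \<cdot> counit H"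
    using s unfolding antipode_def by (auto simp: hom_def)
  show "right_inverse d e (und H) (mult H) (unt H) x (s \<cdot> x)"
    unfolding right_inverse_def using arg_cong[OF r, of "\<lambda>f. f \<cdot> x"] by (simp add: e)
  show "left_inverse d e (und H) (mult H) (unt H) x (s \<cdot> x)"
    unfolding left_inverse_def using arg_cong[OF l, of "\<lambda>f. f \<cdot> x"] by (simp add: e)
qed

lemma bimonoid_parts:
  assumes "bimonoid H"
  shows "monoid_in \<C> T (und H) (mult H) (unt H)" "comonoid_in \<C> S (und H) (comult H) (counit H)"
    "comonoid_map (und H \<odot> und H) (tens_comult (und H) (comult H) (und H) (comult H)) (tens_counit (counit H) (counit H))
      (und H) (comult H) (counit H) (mult H)"
    "comonoid_map I \<Delta>\<^sub>I \<epsilon>\<^sub>I (und H) (comult H) (counit H) (unt H)"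
    "monoid_map (und H) (mult H) (unt H) (und H \<bullet> und H) (prod_mult (und H) (mult H) (und H) (mult H)) (prod_unit (unt H) (unt H)) (comult H)"
proof -
  show 1: "monoid_in \<C> T (und H) (mult H) (unt H)" and 2: "comonoid_in \<C> S (und H) (comult H) (counit H)"
    using assms by (auto simp: bimonoid_def)
  note [simp] = monoid_arr[OF 1] comonoid_arr[OF 2]
  show "comonoid_map (und H \<odot> und H) (tens_comult (und H) (comult H) (und H) (comult H)) (tens_counit (counit H) (counit H))
      (und H) (comult H) (counit H) (mult H)"
    "comonoid_map I \<Delta>\<^sub>I \<epsilon>\<^sub>I (und H) (comult H) (counit H) (unt H)"
    "monoid_map (und H) (mult H) (unt H) (und H \<bullet> und H) (prod_mult (und H) (mult H) (und H) (mult H)) (prod_unit (unt H) (unt H)) (comult H)"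
    using assms by (simp_all add: bimonoid_def comonoid_map_def monoid_map_def)
qed

lemma bimonoid_morphism_parts:
  assumes "bimonoid H" "bimonoid K" "bimonoid_morphism H f K"
  shows "comonoid_map (und H) (comult H) (counit H) (und K) (comult K) (counit K) f"
    "monoid_map (und H) (mult H) (unt H) (und K) (mult K) (unt K) f"
  using assms by (auto simp: bimonoid_morphism_def comonoid_map_def monoid_map_def hom_def)

text \<open>Both sides are convolution inverses of f: one is the antipode of K restricted along f,
  the other is the antipode of H pushed forward along f. Uniqueness makes them equal.\<close>

lemma antipode_natural:
  assumes H: "bimonoid H" and K: "bimonoid K" and f: "bimonoid_morphism H f K" and s: "antipode H s" and t: "antipode K t"
  shows "t \<cdot> f = f\<^sup>- \<cdot> s"
proof -
  note H' = bimonoid_parts[OF H] and K' = bimonoid_parts[OF K] and f' = bimonoid_morphism_parts[OF H K f]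
  note [simp] = monoid_arr[OF H'(1)] comonoid_arr[OF H'(2)] monoid_arr[OF K'(1)] comonoid_arr[OF K'(2)]
  have [simp]: "f \<in> Arr \<C>" "Dom \<C> f = und H" "Cod \<C> f = und K" using f'(1) by (auto simp: comonoid_map_def)
  have [simp]: "s \<in> Arr \<C>" "Dom \<C> s = und H" "Cod \<C> s = (und H)\<^sup>-" "t \<in> Arr \<C>" "Dom \<C> t = und K" "Cod \<C> t = (und K)\<^sup>-"
    using s t unfolding antipode_def by (auto simp: hom_def)
  have "right_inverse (comult H) (counit H) (und H) (mult H) (unt H) (und H) (s \<cdot> und H)"
    by (rule antipode_inverse(1)[OF s H'(1,2) H'(2) comonoid_map_id[OF H'(2)]])
  then have "right_inverse (comult H) (counit H) (und K) (mult K) (unt K) (f \<cdot> und H) (f\<^sup>- \<cdot> s)"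
    using right_inverse_monoid_map[OF f'(2) H'(1) K'(1) H'(2), of "und H" s] by simp
  moreover have "left_inverse (comult H) (counit H) (und K) (mult K) (unt K) f (t \<cdot> f)"
    by (rule antipode_inverse(2)[OF t K'(1,2) H'(2) f'(1)])
  ultimately show ?thesis
    using left_inverse_eq_right_inverse[OF H'(2) K'(1), of f "f\<^sup>- \<cdot> s" "t \<cdot> f"] by simp
qed

end

section \<open>Kernels of split epimorphisms\<close>

text \<open>\<open>\<kappa>\<close> and \<open>\<kappa>'\<close> are the legs of the intersection
  that defines the kernel K. The second leg matters as much as the first: it places K in A \<bullet>
  I, where division takes its values up to the factor J.\<close>

locale Hopf_point = bullet_braided_duoidal_category_with_reversion +
  fixes A B t p s \<kappa> \<kappa>'
  assumes A: "bimonoid A" and A_cocomm: "cocommutative A"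
    and B: "bimonoid B" and t: "antipode B t" and unt_mono: "mono_arrow \<C> (unt B)"
    and p: "bimonoid_morphism A p B" and s: "bimonoid_morphism B s A" and ps: "p \<cdot> s = und B"
    and preserves: "bullet_preserves_binary_intersections \<C> S"
    and kernel: "is_pullback \<C> ((und A \<bullet> p) \<cdot> comult A) (und A \<bullet> unt B) \<kappa> \<kappa>'"
begin

abbreviation A\<^sub>0 where "A\<^sub>0 \<equiv> und A"
abbreviation B\<^sub>0 where "B\<^sub>0 \<equiv> und B"
abbreviation a where "a \<equiv> mult A \<cdot> (A\<^sub>0 \<odot> s)"
abbreviation N where "N \<equiv> A\<^sub>0 \<bullet> I"
abbreviation pi1 where "pi1 X \<equiv> rb X \<cdot> (X \<bullet> \<epsilon>\<^sub>I)"
abbreviation p\<^sub>1 where "p\<^sub>1 \<equiv> (A\<^sub>0 \<bullet> p) \<cdot> comult A"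
definition b where "b = prod_mult A\<^sub>0 (mult A) B\<^sub>0 (mult B) \<cdot> ((A\<^sub>0 \<bullet> B\<^sub>0) \<odot> ((s \<bullet> B\<^sub>0) \<cdot> comult B))"

lemmas A_parts = bimonoid_parts[OF A]
lemmas B_parts = bimonoid_parts[OF B]
lemmas p_parts = bimonoid_morphism_parts[OF A B p]
lemmas s_parts = bimonoid_morphism_parts[OF B A s]
lemmas A_laws = monoid_laws[OF A_parts(1)] comonoid_laws[OF A_parts(2)]
lemmas B_laws = monoid_laws[OF B_parts(1)] comonoid_laws[OF B_parts(2)]

lemma A_cocomm': "cocomm A\<^sub>0 (comult A) (counit A)"
  using A_cocomm A_parts(2) by (simp add: cocomm_def cocommutative_def)

lemma AB_arr [simp]: "A\<^sub>0 \<in> Ob \<C>" "mult A \<in> Arr \<C>" "Dom \<C> (mult A) = A\<^sub>0 \<odot> A\<^sub>0" "Cod \<C> (mult A) = A\<^sub>0"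
  "unt A \<in> Arr \<C>" "Dom \<C> (unt A) = I" "Cod \<C> (unt A) = A\<^sub>0"
  "comult A \<in> Arr \<C>" "Dom \<C> (comult A) = A\<^sub>0" "Cod \<C> (comult A) = A\<^sub>0 \<bullet> A\<^sub>0"
  "counit A \<in> Arr \<C>" "Dom \<C> (counit A) = A\<^sub>0" "Cod \<C> (counit A) = J"
  "B\<^sub>0 \<in> Ob \<C>" "mult B \<in> Arr \<C>" "Dom \<C> (mult B) = B\<^sub>0 \<odot> B\<^sub>0" "Cod \<C> (mult B) = B\<^sub>0"
  "unt B \<in> Arr \<C>" "Dom \<C> (unt B) = I" "Cod \<C> (unt B) = B\<^sub>0"
  "comult B \<in> Arr \<C>" "Dom \<C> (comult B) = B\<^sub>0" "Cod \<C> (comult B) = B\<^sub>0 \<bullet> B\<^sub>0"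
  "counit B \<in> Arr \<C>" "Dom \<C> (counit B) = B\<^sub>0" "Cod \<C> (counit B) = J"
  "p \<in> Arr \<C>" "Dom \<C> p = A\<^sub>0" "Cod \<C> p = B\<^sub>0" "s \<in> Arr \<C>" "Dom \<C> s = B\<^sub>0" "Cod \<C> s = A\<^sub>0"
  using monoid_arr[OF A_parts(1)] comonoid_arr[OF A_parts(2)] monoid_arr[OF B_parts(1)] comonoid_arr[OF B_parts(2)]
    p_parts(1) s_parts(1) by (simp_all add: comonoid_map_def)

lemma p_laws: "comult B \<cdot> p = (p \<bullet> p) \<cdot> comult A" "counit B \<cdot> p = counit A" "p \<cdot> mult A = mult B \<cdot> (p \<odot> p)" "p \<cdot> unt A = unt B"
  using p_parts by (auto simp: comonoid_map_def monoid_map_def)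

lemma s_laws: "comult A \<cdot> s = (s \<bullet> s) \<cdot> comult B" "counit A \<cdot> s = counit B" "s \<cdot> mult B = mult A \<cdot> (s \<odot> s)" "s \<cdot> unt B = unt A"
  using s_parts by (auto simp: comonoid_map_def monoid_map_def)

lemma A_bim: "comult A \<cdot> mult A = (mult A \<bullet> mult A) \<cdot> \<zeta> A\<^sub>0 A\<^sub>0 A\<^sub>0 A\<^sub>0 \<cdot> (comult A \<odot> comult A)"
    "counit A \<cdot> mult A = m\<^sub>J \<cdot> (counit A \<odot> counit A)" "comult A \<cdot> unt A = (unt A \<bullet> unt A) \<cdot> \<Delta>\<^sub>I" "counit A \<cdot> unt A = \<epsilon>\<^sub>I"
  using A by (auto simp: bimonoid_def)

lemma B_bim: "comult B \<cdot> mult B = (mult B \<bullet> mult B) \<cdot> \<zeta> B\<^sub>0 B\<^sub>0 B\<^sub>0 B\<^sub>0 \<cdot> (comult B \<odot> comult B)"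
    "counit B \<cdot> mult B = m\<^sub>J \<cdot> (counit B \<odot> counit B)" "comult B \<cdot> unt B = (unt B \<bullet> unt B) \<cdot> \<Delta>\<^sub>I" "counit B \<cdot> unt B = \<epsilon>\<^sub>I"
  using B by (auto simp: bimonoid_def)

lemma AB_monoid: "monoid_in \<C> T (A\<^sub>0 \<bullet> B\<^sub>0) (prod_mult A\<^sub>0 (mult A) B\<^sub>0 (mult B)) (prod_unit (unt A) (unt B))"
  by (rule monoid_prod[OF A_parts(1) B_parts(1)])

lemma graph_monoid_map: "monoid_map B\<^sub>0 (mult B) (unt B) (A\<^sub>0 \<bullet> B\<^sub>0) (prod_mult A\<^sub>0 (mult A) B\<^sub>0 (mult B)) (prod_unit (unt A) (unt B))
    ((s \<bullet> B\<^sub>0) \<cdot> comult B)"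
  by (rule monoid_map_comp[OF B_parts(5) monoid_map_prod[OF B_parts(1) B_parts(1) A_parts(1) B_parts(1) s_parts(2) monoid_map_id[OF B_parts(1)]]
    B_parts(1) monoid_prod[OF B_parts(1) B_parts(1)] AB_monoid])

sublocale M1: Hopf_module \<C> T S \<zeta> \<Delta>\<^sub>I m\<^sub>J \<epsilon>\<^sub>I reverse \<phi>c \<phi>c\<^sub>0 \<phi>b \<phi>b\<^sub>0 \<gamma> \<delta> \<gamma>' \<delta>' B t A\<^sub>0 a
  by unfold_locales (use B t action_of_monoid_map[OF A_parts(1) B_parts(1) s_parts(2)] in simp_all)

lemma b_arr [simp]: "b \<in> Arr \<C>" "Dom \<C> b = (A\<^sub>0 \<bullet> B\<^sub>0) \<odot> B\<^sub>0" "Cod \<C> b = A\<^sub>0 \<bullet> B\<^sub>0"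
  by (simp_all add: b_def)

sublocale M2: Hopf_module \<C> T S \<zeta> \<Delta>\<^sub>I m\<^sub>J \<epsilon>\<^sub>I reverse \<phi>c \<phi>c\<^sub>0 \<phi>b \<phi>b\<^sub>0 \<gamma> \<delta> \<gamma>' \<delta>' B t "A\<^sub>0 \<bullet> B\<^sub>0" b
  by unfold_locales (use B t action_of_monoid_map[OF AB_monoid B_parts(1) graph_monoid_map, folded b_def] in simp_all)

lemma b_eq: "b = (a \<bullet> mult B) \<cdot> \<zeta> A\<^sub>0 B\<^sub>0 B\<^sub>0 B\<^sub>0 \<cdot> ((A\<^sub>0 \<bullet> B\<^sub>0) \<odot> comult B)"
  using circ.ext2[OF zeta_nat[of A\<^sub>0 B\<^sub>0 s B\<^sub>0 A\<^sub>0 B\<^sub>0 A\<^sub>0 B\<^sub>0], of "(A\<^sub>0 \<bullet> B\<^sub>0) \<odot> comult B"] by (simp add: b_def)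

text \<open>Since p s is the identity, p(a s(h)) = p(a) h; hence the graph of p is linear for the
  two actions of B.\<close>

lemma p1_action: "b \<cdot> (p\<^sub>1 \<odot> B\<^sub>0) = p\<^sub>1 \<cdot> a"
proof -
  have "p\<^sub>1 \<cdot> a = (A\<^sub>0 \<bullet> p) \<cdot> (comult A \<cdot> mult A) \<cdot> (A\<^sub>0 \<odot> s)" by simp
  also have "\<dots> = (mult A \<bullet> (p \<cdot> mult A)) \<cdot> \<zeta> A\<^sub>0 A\<^sub>0 A\<^sub>0 A\<^sub>0 \<cdot> (comult A \<odot> (comult A \<cdot> s))"
    unfolding A_bim by simp
  also have "\<dots> = (mult A \<bullet> mult B) \<cdot> ((A\<^sub>0 \<odot> A\<^sub>0) \<bullet> (p \<odot> p)) \<cdot> \<zeta> A\<^sub>0 A\<^sub>0 A\<^sub>0 A\<^sub>0 \<cdot> (comult A \<odot> ((s \<bullet> s) \<cdot> comult B))"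
    by (simp add: p_laws s_laws)
  also have "\<dots> = (mult A \<bullet> mult B) \<cdot> \<zeta> A\<^sub>0 B\<^sub>0 A\<^sub>0 B\<^sub>0 \<cdot> (p\<^sub>1 \<odot> ((s \<bullet> (p \<cdot> s)) \<cdot> comult B))"
    using circ.ext2[OF zeta_nat[of A\<^sub>0 p A\<^sub>0 p A\<^sub>0 B\<^sub>0 A\<^sub>0 B\<^sub>0], of "comult A \<odot> ((s \<bullet> s) \<cdot> comult B)"] by simp
  finally show ?thesis by (simp add: ps b_def)
qed

text \<open>Division is natural in the module, and the graph of p is a module map by
  \<open>p1_action\<close>.\<close>

lemma kap_graph: "M2.kap \<cdot> (p\<^sub>1 \<bullet> B\<^sub>0) = ((p\<^sub>1 \<bullet> I) \<odot> J) \<cdot> M1.kap"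
proof -
  have "M2.kap \<cdot> (p\<^sub>1 \<bullet> B\<^sub>0) = ((b \<bullet> I) \<odot> J) \<cdot> \<phi> (A\<^sub>0 \<bullet> B\<^sub>0) B\<^sub>0 \<cdot> (p\<^sub>1 \<bullet> B\<^sub>0\<^sup>-) \<cdot> (A\<^sub>0 \<bullet> t)"
    by (simp add: M2.kap_def)
  also have "\<dots> = (((b \<cdot> (p\<^sub>1 \<odot> B\<^sub>0)) \<bullet> I) \<odot> J) \<cdot> \<phi> A\<^sub>0 B\<^sub>0 \<cdot> (A\<^sub>0 \<bullet> t)"
    using circ.ext2[OF phi_nat[of p\<^sub>1 B\<^sub>0 A\<^sub>0 "A\<^sub>0 \<bullet> B\<^sub>0" B\<^sub>0 B\<^sub>0], of "A\<^sub>0 \<bullet> t"] by simp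
  also have "\<dots> = ((p\<^sub>1 \<bullet> I) \<odot> J) \<cdot> M1.kap"
    unfolding p1_action by (simp add: M1.kap_def)
  finally show ?thesis .
qed

text \<open>On elements a to (a, 1): one copy of I becomes the unit of B, the other is kept so that
  the codomain is again cofree over I. Agreement of \<open>beta\<close> with
  \<open>p\<^sub>1 \<bullet> I\<close> expresses the condition p(a) = 1.\<close>

definition beta where "beta = ((A\<^sub>0 \<bullet> unt B) \<bullet> I) \<cdot> co A\<^sub>0"

lemma beta_arr [simp]: "beta \<in> Arr \<C>" "Dom \<C> beta = N" "Cod \<C> beta = (A\<^sub>0 \<bullet> B\<^sub>0) \<bullet> I"
  by (simp_all add: beta_def)

lemma beta_colinear: "co (A\<^sub>0 \<bullet> B\<^sub>0) \<cdot> beta = (beta \<bullet> I) \<cdot> co A\<^sub>0"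
proof -
  have "co (A\<^sub>0 \<bullet> B\<^sub>0) \<cdot> beta = (((A\<^sub>0 \<bullet> unt B) \<bullet> I) \<bullet> I) \<cdot> co N \<cdot> co A\<^sub>0"
    using circ.ext2[OF co_nat[of "A\<^sub>0 \<bullet> unt B" N "A\<^sub>0 \<bullet> B\<^sub>0"], of "co A\<^sub>0"] by (simp add: beta_def)
  also have "\<dots> = (beta \<bullet> I) \<cdot> co A\<^sub>0" by (simp add: co_coassoc beta_def)
  finally show ?thesis .
qed

text \<open>On elements both sides send a \<odot> h to (a s(h_1), h_2, h_3), because the unit of B
  inserted by \<open>beta\<close> is absorbed by the multiplication. The associativity and unit laws
  of \<zeta> account for the remaining factors.\<close>

lemma Gam_beta: "M2.Gam \<cdot> (beta \<odot> B\<^sub>0) = abi A\<^sub>0 B\<^sub>0 B\<^sub>0 \<cdot> (A\<^sub>0 \<bullet> comult B) \<cdot> M1.Gam"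
proof -
  let ?d = "comult B" and ?G = "A\<^sub>0 \<odot> B\<^sub>0" and ?IB = "I \<odot> B\<^sub>0"
  let ?u = "A\<^sub>0 \<bullet> unt B"
  have "M2.Gam \<cdot> (beta \<odot> B\<^sub>0) = (((a \<bullet> mult B) \<cdot> \<zeta> A\<^sub>0 B\<^sub>0 B\<^sub>0 B\<^sub>0) \<bullet> lc B\<^sub>0) \<cdot> (((A\<^sub>0 \<bullet> B\<^sub>0) \<odot> ?d) \<bullet> ?IB) \<cdot> \<zeta> (A\<^sub>0 \<bullet> B\<^sub>0) I B\<^sub>0 B\<^sub>0 \<cdot> (beta \<odot> ?d)"
    by (simp only: M2.Gam_def) (simp add: b_eq)
  also have "\<dots> = (((a \<bullet> mult B) \<cdot> \<zeta> A\<^sub>0 B\<^sub>0 B\<^sub>0 B\<^sub>0) \<bullet> lc B\<^sub>0) \<cdot> \<zeta> (A\<^sub>0 \<bullet> B\<^sub>0) I (B\<^sub>0 \<bullet> B\<^sub>0) B\<^sub>0 \<cdot> ((?u \<bullet> I) \<odot> ((B\<^sub>0 \<bullet> B\<^sub>0) \<bullet> B\<^sub>0)) \<cdot> (co A\<^sub>0 \<odot> ((?d \<bullet> B\<^sub>0) \<cdot> ?d))"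
    using circ.ext2[OF zeta_nat[of "A\<^sub>0 \<bullet> B\<^sub>0" I ?d B\<^sub>0 "A\<^sub>0 \<bullet> B\<^sub>0" I "B\<^sub>0 \<bullet> B\<^sub>0" B\<^sub>0], of "beta \<odot> ?d"] by (simp add: beta_def)
  also have "\<dots> = (((a \<bullet> mult B) \<cdot> \<zeta> A\<^sub>0 B\<^sub>0 B\<^sub>0 B\<^sub>0 \<cdot> (?u \<odot> (B\<^sub>0 \<bullet> B\<^sub>0))) \<bullet> lc B\<^sub>0) \<cdot> \<zeta> N I (B\<^sub>0 \<bullet> B\<^sub>0) B\<^sub>0 \<cdot> (co A\<^sub>0 \<odot> ((?d \<bullet> B\<^sub>0) \<cdot> ?d))"
    using circ.ext2[OF zeta_nat[of ?u I "B\<^sub>0 \<bullet> B\<^sub>0" B\<^sub>0 "A\<^sub>0 \<bullet> B\<^sub>0" I "B\<^sub>0 \<bullet> B\<^sub>0" B\<^sub>0], of "co A\<^sub>0 \<odot> ((?d \<bullet> B\<^sub>0) \<cdot> ?d)"] by simp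
  also have "\<dots> = (((a \<bullet> (mult B \<cdot> (unt B \<odot> B\<^sub>0))) \<cdot> \<zeta> A\<^sub>0 I B\<^sub>0 B\<^sub>0) \<bullet> lc B\<^sub>0) \<cdot> \<zeta> N I (B\<^sub>0 \<bullet> B\<^sub>0) B\<^sub>0 \<cdot> (co A\<^sub>0 \<odot> ((?d \<bullet> B\<^sub>0) \<cdot> ?d))"
    using zeta_nat[of A\<^sub>0 "unt B" B\<^sub>0 B\<^sub>0 A\<^sub>0 B\<^sub>0 B\<^sub>0 B\<^sub>0] by simp
  also have "\<dots> = ((a \<bullet> lc B\<^sub>0) \<bullet> lc B\<^sub>0) \<cdot> abi ?G ?IB ?IB \<cdot> ab ?G ?IB ?IB \<cdot> (\<zeta> A\<^sub>0 I B\<^sub>0 B\<^sub>0 \<bullet> ?IB) \<cdot> \<zeta> N I (B\<^sub>0 \<bullet> B\<^sub>0) B\<^sub>0 \<cdot> (co A\<^sub>0 \<odot> ((?d \<bullet> B\<^sub>0) \<cdot> ?d))"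
    unfolding B_laws by simp
  also have "\<dots> = ((a \<bullet> lc B\<^sub>0) \<bullet> lc B\<^sub>0) \<cdot> abi ?G ?IB ?IB \<cdot> (?G \<bullet> \<zeta> I I B\<^sub>0 B\<^sub>0) \<cdot> \<zeta> A\<^sub>0 (I \<bullet> I) B\<^sub>0 (B\<^sub>0 \<bullet> B\<^sub>0) \<cdot> (ab A\<^sub>0 I I \<odot> ab B\<^sub>0 B\<^sub>0 B\<^sub>0) \<cdot> (co A\<^sub>0 \<odot> ((?d \<bullet> B\<^sub>0) \<cdot> ?d))"
    using arg_cong[OF zeta_assoc_blt[of A\<^sub>0 I I B\<^sub>0 B\<^sub>0 B\<^sub>0], of "\<lambda>f. ((a \<bullet> lc B\<^sub>0) \<bullet> lc B\<^sub>0) \<cdot> abi ?G ?IB ?IB \<cdot> f \<cdot> (co A\<^sub>0 \<odot> ((?d \<bullet> B\<^sub>0) \<cdot> ?d))"] by simp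
  also have "\<dots> = ((a \<bullet> lc B\<^sub>0) \<bullet> lc B\<^sub>0) \<cdot> abi ?G ?IB ?IB \<cdot> (?G \<bullet> \<zeta> I I B\<^sub>0 B\<^sub>0) \<cdot> \<zeta> A\<^sub>0 (I \<bullet> I) B\<^sub>0 (B\<^sub>0 \<bullet> B\<^sub>0) \<cdot> ((A\<^sub>0 \<bullet> \<Delta>\<^sub>I) \<odot> (B\<^sub>0 \<bullet> ?d)) \<cdot> (N \<odot> ?d)"
    by (simp add: B_laws co_def)
  also have "\<dots> = ((a \<bullet> lc B\<^sub>0) \<bullet> lc B\<^sub>0) \<cdot> abi ?G ?IB ?IB \<cdot> (?G \<bullet> ((\<zeta> I I B\<^sub>0 B\<^sub>0 \<cdot> (\<Delta>\<^sub>I \<odot> (B\<^sub>0 \<bullet> B\<^sub>0))) \<cdot> (I \<odot> ?d))) \<cdot> \<zeta> A\<^sub>0 I B\<^sub>0 B\<^sub>0 \<cdot> (N \<odot> ?d)"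
    using circ.ext2[OF zeta_nat[of A\<^sub>0 "\<Delta>\<^sub>I" B\<^sub>0 ?d A\<^sub>0 "I \<bullet> I" B\<^sub>0 "B\<^sub>0 \<bullet> B\<^sub>0"], of "N \<odot> ?d"] by simp
  also have "\<dots> = ((a \<bullet> lc B\<^sub>0) \<bullet> lc B\<^sub>0) \<cdot> abi ?G ?IB ?IB \<cdot> (?G \<bullet> ((lci B\<^sub>0 \<bullet> lci B\<^sub>0) \<cdot> ?d \<cdot> lc B\<^sub>0)) \<cdot> \<zeta> A\<^sub>0 I B\<^sub>0 B\<^sub>0 \<cdot> (N \<odot> ?d)"
    unfolding zeta_lc_inv[OF AB_arr(14) AB_arr(14)] by (simp add: circ.lunit_nat)
  also have "\<dots> = abi A\<^sub>0 B\<^sub>0 B\<^sub>0 \<cdot> (a \<bullet> (?d \<cdot> lc B\<^sub>0)) \<cdot> \<zeta> A\<^sub>0 I B\<^sub>0 B\<^sub>0 \<cdot> (N \<odot> ?d)"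
    using circ.ext2[OF blt.inv_assoc_nat[of a "lc B\<^sub>0" "lc B\<^sub>0" A\<^sub>0 B\<^sub>0 B\<^sub>0, symmetric], of "(?G \<bullet> ((lci B\<^sub>0 \<bullet> lci B\<^sub>0) \<cdot> ?d \<cdot> lc B\<^sub>0)) \<cdot> \<zeta> A\<^sub>0 I B\<^sub>0 B\<^sub>0 \<cdot> (N \<odot> ?d)"]
    by simp
  also have "\<dots> = abi A\<^sub>0 B\<^sub>0 B\<^sub>0 \<cdot> (A\<^sub>0 \<bullet> ?d) \<cdot> M1.Gam" by (simp add: M1.Gam_def)
  finally show ?thesis .
qed

lemma Gam_epi:
  assumes "x \<cdot> M1.Gam = y \<cdot> M1.Gam" "x \<in> Arr \<C>" "y \<in> Arr \<C>" "Dom \<C> x = A\<^sub>0 \<bullet> B\<^sub>0" "Dom \<C> y = A\<^sub>0 \<bullet> B\<^sub>0"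
  shows "x = y"
proof (rule circ.split_epi[where f=M1.Gam])
  show "M1.Gam \<cdot> (M1.LamN \<cdot> (M1.kap \<bullet> B\<^sub>0) \<cdot> abi A\<^sub>0 B\<^sub>0 B\<^sub>0 \<cdot> (A\<^sub>0 \<bullet> comult B)) = Cod \<C> M1.Gam"
    using M1.Gam_Lam by simp
qed (use assms in simp_all)

text \<open>On elements, (a, h_1) h_2^-1 = (a h^-1, 1). A direct computation with the antipode in A
  \<bullet> B is avoided: both sides are compared after the split epimorphism \<open>Gam\<close>,
  where \<open>kap_Gam\<close> reduces each of them to a counit.\<close>

lemma kap_beta: "M2.kap \<cdot> abi A\<^sub>0 B\<^sub>0 B\<^sub>0 \<cdot> (A\<^sub>0 \<bullet> comult B) = (beta \<odot> J) \<cdot> M1.kap"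
proof (rule Gam_epi)
  have "(M2.kap \<cdot> abi A\<^sub>0 B\<^sub>0 B\<^sub>0 \<cdot> (A\<^sub>0 \<bullet> comult B)) \<cdot> M1.Gam = M2.kap \<cdot> M2.Gam \<cdot> (beta \<odot> B\<^sub>0)"
    by (simp add: Gam_beta)
  also have "\<dots> = beta \<odot> counit B"
    using circ.ext2[OF M2.kap_Gam, of "beta \<odot> B\<^sub>0"] by simp
  also have "\<dots> = ((beta \<odot> J) \<cdot> M1.kap) \<cdot> M1.Gam" by (simp add: M1.kap_Gam)
  finally show "(M2.kap \<cdot> abi A\<^sub>0 B\<^sub>0 B\<^sub>0 \<cdot> (A\<^sub>0 \<bullet> comult B)) \<cdot> M1.Gam = ((beta \<odot> J) \<cdot> M1.kap) \<cdot> M1.Gam" .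
qed simp_all

text \<open>On elements, \<open>w\<close> is \<open>a \<mapsto> a (s (p a))\<inverse>\<close>. Since there is no comparison from \<open>(A \<bullet> I) \<circ> J\<close> back to \<open>A \<bullet> I\<close>,
  \<open>w\<close> does not yield an arrow from \<open>A\<close> to the kernel; \<open>rho\<close> is the endomorphism of \<open>A \<bullet> I\<close> that replaces it.\<close>

definition w where "w = M1.kap \<cdot> p\<^sub>1"

lemma w_arr [simp]: "w \<in> Arr \<C>" "Dom \<C> w = A\<^sub>0" "Cod \<C> w = N \<odot> J"
  by (simp_all add: w_def)

lemma p1_p1: "(p\<^sub>1 \<bullet> p) \<cdot> comult A = abi A\<^sub>0 B\<^sub>0 B\<^sub>0 \<cdot> (A\<^sub>0 \<bullet> comult B) \<cdot> p\<^sub>1"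
  using pair_assoc_inv[OF A_parts(2), of A\<^sub>0 p p A\<^sub>0 B\<^sub>0 B\<^sub>0] by (simp add: p_laws)

text \<open>On elements, p(a s(p a)^-1) = 1. This is the sense in which \<open>w\<close> takes
  values in the kernel, up to the factor J of its codomain.\<close>

lemma graph_w: "((p\<^sub>1 \<bullet> I) \<odot> J) \<cdot> w = (beta \<odot> J) \<cdot> w"
proof -
  have "((p\<^sub>1 \<bullet> I) \<odot> J) \<cdot> w = M2.kap \<cdot> (p\<^sub>1 \<bullet> B\<^sub>0) \<cdot> p\<^sub>1"
    using circ.ext2[OF kap_graph, of p\<^sub>1] by (simp add: w_def)
  also have "\<dots> = M2.kap \<cdot> abi A\<^sub>0 B\<^sub>0 B\<^sub>0 \<cdot> (A\<^sub>0 \<bullet> comult B) \<cdot> p\<^sub>1"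
    using p1_p1 by simp
  also have "\<dots> = (beta \<odot> J) \<cdot> w"
    using circ.ext3[OF kap_beta, of p\<^sub>1] by (simp add: w_def)
  finally show ?thesis .
qed

text \<open>Both \<open>p\<^sub>1 \<bullet> I\<close> and \<open>beta\<close> are colinear and hence
  commute with \<open>Lam\<close>, so their agreement survives the cancellation of J against
  V.\<close>

lemma graph_Lam:
  assumes [simp]: "x \<in> Arr \<C>" "Cod \<C> x = (N \<odot> J) \<bullet> V" "V \<in> Ob \<C>"
    and x: "(((p\<^sub>1 \<bullet> I) \<odot> J) \<bullet> V) \<cdot> x = ((beta \<odot> J) \<bullet> V) \<cdot> x"
  shows "((p\<^sub>1 \<bullet> I) \<odot> V) \<cdot> Lam N (co A\<^sub>0) V \<cdot> x = (beta \<odot> V) \<cdot> Lam N (co A\<^sub>0) V \<cdot> x"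
proof -
  let ?L = "Lam ((A\<^sub>0 \<bullet> B\<^sub>0) \<bullet> I) (co (A\<^sub>0 \<bullet> B\<^sub>0)) V"
  have "((p\<^sub>1 \<bullet> I) \<odot> V) \<cdot> Lam N (co A\<^sub>0) V \<cdot> x = ?L \<cdot> (((p\<^sub>1 \<bullet> I) \<odot> J) \<bullet> V) \<cdot> x"
    using circ.ext2[OF Lam_nat[of N "co A\<^sub>0" "(A\<^sub>0 \<bullet> B\<^sub>0) \<bullet> I" "co (A\<^sub>0 \<bullet> B\<^sub>0)" "p\<^sub>1 \<bullet> I" V V V, OF _ _ _ _ _ _ _ _ _ _ _ _ _ _ co_nat], of x] by simp
  also have "\<dots> = ?L \<cdot> ((beta \<odot> J) \<bullet> V) \<cdot> x" by (simp only: x)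
  also have "\<dots> = (beta \<odot> V) \<cdot> Lam N (co A\<^sub>0) V \<cdot> x"
    using circ.ext2[OF Lam_nat[of N "co A\<^sub>0" "(A\<^sub>0 \<bullet> B\<^sub>0) \<bullet> I" "co (A\<^sub>0 \<bullet> B\<^sub>0)" beta V V V, OF _ _ _ _ _ _ _ _ _ _ _ _ _ _ beta_colinear], of x] by simp
  finally show ?thesis .
qed

definition rho where "rho = rc N \<cdot> Lam N (co A\<^sub>0) I \<cdot> (w \<bullet> I)"
text \<open>A retraction of \<open>beta\<close>. Together with \<open>graph_rho\<close> it turns
  \<open>p\<^sub>1 \<bullet> I\<close> and \<open>beta\<close> into a split pair, with
  \<open>rho\<close> as the idempotent onto their equalizer; a split equalizer is preserved by every
  functor.\<close>

definition E where "E = rc N \<cdot> Lam N (co A\<^sub>0) I \<cdot> (M1.kap \<bullet> I)"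

lemma rho_E_arr [simp]: "rho \<in> Arr \<C>" "Dom \<C> rho = N" "Cod \<C> rho = N"
   "E \<in> Arr \<C>" "Dom \<C> E = (A\<^sub>0 \<bullet> B\<^sub>0) \<bullet> I" "Cod \<C> E = N"
  by (simp_all add: rho_def E_def)

lemma rho_E: "rho = E \<cdot> (p\<^sub>1 \<bullet> I)"
  by (simp add: rho_def E_def w_def)

lemma graph_rho: "(p\<^sub>1 \<bullet> I) \<cdot> rho = beta \<cdot> rho"
proof -
  let ?v = "Lam N (co A\<^sub>0) I \<cdot> (w \<bullet> I)"
  have "(p\<^sub>1 \<bullet> I) \<cdot> rho = rc ((A\<^sub>0 \<bullet> B\<^sub>0) \<bullet> I) \<cdot> ((p\<^sub>1 \<bullet> I) \<odot> I) \<cdot> ?v"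
    using circ.ext2[OF circ.runit_nat[of "p\<^sub>1 \<bullet> I" "(A\<^sub>0 \<bullet> B\<^sub>0) \<bullet> I"], of ?v] by (simp add: rho_def)
  also have "\<dots> = rc ((A\<^sub>0 \<bullet> B\<^sub>0) \<bullet> I) \<cdot> (beta \<odot> I) \<cdot> ?v"
    using graph_Lam[of "w \<bullet> I" I] graph_w by simp
  also have "\<dots> = beta \<cdot> rho"
    using circ.ext2[OF circ.runit_nat[of beta "(A\<^sub>0 \<bullet> B\<^sub>0) \<bullet> I"], of ?v] by (simp add: rho_def)
  finally show ?thesis .
qed

lemma pi1_nat:
  assumes [simp]: "f \<in> Arr \<C>" "Dom \<C> f = X" "Cod \<C> f = Y"
  shows "pi1 Y \<cdot> (f \<bullet> I) = f \<cdot> pi1 X"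
proof -
  have [simp]: "X \<in> Ob \<C>" "Y \<in> Ob \<C>" using circ.dom_ob[of f] circ.cod_ob[of f] by simp_all
  show ?thesis using circ.ext2[OF blt.runit_nat[of f Y], of "X \<bullet> \<epsilon>\<^sub>I"] by simp
qed

lemma pi1_beta: "pi1 (A\<^sub>0 \<bullet> B\<^sub>0) \<cdot> beta = A\<^sub>0 \<bullet> unt B"
proof -
  have "pi1 (A\<^sub>0 \<bullet> B\<^sub>0) \<cdot> beta = (pi1 (A\<^sub>0 \<bullet> B\<^sub>0) \<cdot> ((A\<^sub>0 \<bullet> unt B) \<bullet> I)) \<cdot> co A\<^sub>0" by (simp add: beta_def)
  also have "\<dots> = (A\<^sub>0 \<bullet> unt B) \<cdot> pi1 N \<cdot> co A\<^sub>0"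
    by (subst pi1_nat[of _ N]) simp_all
  finally show ?thesis by (simp add: co_counit)
qed

text \<open>Division by 1: the pair (a, 1) is the value of \<open>Gam\<close> at a \<odot> 1, so
  \<open>kap_Gam\<close> applies.\<close>

lemma kap_unit: "M1.kap \<cdot> (A\<^sub>0 \<bullet> unt B) = (N \<odot> \<epsilon>\<^sub>I) \<cdot> rci N"
proof -
  have "M1.Gam \<cdot> (N \<odot> unt B) = (a \<bullet> lc B\<^sub>0) \<cdot> \<zeta> A\<^sub>0 I B\<^sub>0 B\<^sub>0 \<cdot> (N \<odot> (unt B \<bullet> unt B)) \<cdot> (N \<odot> \<Delta>\<^sub>I)"
    by (simp add: M1.Gam_def B_bim)
  also have "\<dots> = ((a \<cdot> (A\<^sub>0 \<odot> unt B)) \<bullet> (lc B\<^sub>0 \<cdot> (I \<odot> unt B))) \<cdot> \<zeta> A\<^sub>0 I I I \<cdot> (N \<odot> \<Delta>\<^sub>I)"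
    using circ.ext2[OF zeta_nat[of A\<^sub>0 I "unt B" "unt B" A\<^sub>0 I B\<^sub>0 B\<^sub>0], of "N \<odot> \<Delta>\<^sub>I"] by simp
  also have "\<dots> = (rc A\<^sub>0 \<bullet> (unt B \<cdot> lc I)) \<cdot> (rci A\<^sub>0 \<bullet> rci I) \<cdot> rc N"
    unfolding zeta_rc_inv[OF AB_arr(1) circ.unit_ob'] M1.action_unit by (simp add: circ.lunit_nat)
  also have "\<dots> = (A\<^sub>0 \<bullet> unt B) \<cdot> rc N" by (simp add: circ.lunit_unit)
  finally have "M1.kap \<cdot> (A\<^sub>0 \<bullet> unt B) = M1.kap \<cdot> M1.Gam \<cdot> (N \<odot> unt B) \<cdot> rci N"
    using circ.ext2[of M1.Gam "N \<odot> unt B" "(A\<^sub>0 \<bullet> unt B) \<cdot> rc N" "rci N"] by simp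
  then show ?thesis using circ.ext2[OF M1.kap_Gam, of "(N \<odot> unt B) \<cdot> rci N"] by (simp add: B_bim)
qed

text \<open>With division by 1 evaluated by \<open>kap_unit\<close>, the composite becomes the left
  side of \<open>Lam_co_unit\<close>.\<close>

lemma E_beta: "E \<cdot> beta = N"
proof -
  have "E \<cdot> beta = rc N \<cdot> Lam N (co A\<^sub>0) I \<cdot> ((M1.kap \<cdot> (A\<^sub>0 \<bullet> unt B)) \<bullet> I) \<cdot> co A\<^sub>0"
    by (simp add: E_def beta_def)
  also have "\<dots> = rc N \<cdot> Lam N (co A\<^sub>0) I \<cdot> (((N \<odot> \<epsilon>\<^sub>I) \<cdot> rci N) \<bullet> I) \<cdot> co A\<^sub>0"
    unfolding kap_unit ..
  also have "\<dots> = N" using Lam_co_unit[of A\<^sub>0] by simp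
  finally show ?thesis .
qed

text \<open>Where the split pair agrees, \<open>p\<^sub>1 \<bullet> I\<close> may be replaced by
  \<open>beta\<close> inside the idempotent, and E cancels \<open>beta\<close>.\<close>

lemma rho_fix:
  assumes [simp]: "v \<in> Arr \<C>" "Cod \<C> v = N \<odot> V" "V \<in> Ob \<C>"
    and v: "((p\<^sub>1 \<bullet> I) \<odot> V) \<cdot> v = (beta \<odot> V) \<cdot> v"
  shows "(rho \<odot> V) \<cdot> v = v"
proof -
  have "(rho \<odot> V) \<cdot> v = (E \<odot> V) \<cdot> ((p\<^sub>1 \<bullet> I) \<odot> V) \<cdot> v" by (simp add: rho_E)
  also have "\<dots> = ((E \<cdot> beta) \<odot> V) \<cdot> v" unfolding v by simp
  finally show ?thesis by (simp add: E_beta)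
qed

lemma rho_Lam:
  assumes [simp]: "x \<in> Arr \<C>" "Cod \<C> x = (N \<odot> J) \<bullet> V" "V \<in> Ob \<C>"
    and x: "(((p\<^sub>1 \<bullet> I) \<odot> J) \<bullet> V) \<cdot> x = ((beta \<odot> J) \<bullet> V) \<cdot> x"
  shows "(rho \<odot> V) \<cdot> Lam N (co A\<^sub>0) V \<cdot> x = Lam N (co A\<^sub>0) V \<cdot> x"
  by (rule rho_fix) (simp_all add: graph_Lam[OF assms])

end

section \<open>Pullbacks and monomorphisms in a category\<close>

context category
begin

lemma pullback_arr:
  assumes "is_pullback \<C> f g p q"
  shows "f \<in> Arr \<C>" "g \<in> Arr \<C>" "Cod \<C> f = Cod \<C> g" "p \<in> Arr \<C>" "q \<in> Arr \<C>" "Dom \<C> p = Dom \<C> q"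
    "Cod \<C> p = Dom \<C> f" "Cod \<C> q = Dom \<C> g" "f \<cdot> p = g \<cdot> q"
  using assms unfolding is_pullback_def by - (elim conjE, assumption)+

lemma pullback_ex1:
  assumes "is_pullback \<C> f g p q" "X \<in> Ob \<C>" "h \<in> hom \<C> X (Dom \<C> f)" "k \<in> hom \<C> X (Dom \<C> g)" "f \<cdot> h = g \<cdot> k"
  shows "\<exists>!u. u \<in> hom \<C> X (Dom \<C> p) \<and> p \<cdot> u = h \<and> q \<cdot> u = k"
proof -
  have "\<forall>X\<in>Ob \<C>. \<forall>h\<in>hom \<C> X (Dom \<C> f). \<forall>k\<in>hom \<C> X (Dom \<C> g). f \<cdot> h = g \<cdot> k \<longrightarrow>
      (\<exists>!u. u \<in> hom \<C> X (Dom \<C> p) \<and> p \<cdot> u = h \<and> q \<cdot> u = k)"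
    using assms(1) unfolding is_pullback_def by - (elim conjE, assumption)
  from this[THEN bspec, OF assms(2), THEN bspec, OF assms(3), THEN bspec, OF assms(4), THEN mp, OF assms(5)]
  show ?thesis .
qed

lemma pullback_lift:
  assumes "is_pullback \<C> f g p q" "h \<in> Arr \<C>" "k \<in> Arr \<C>" "Dom \<C> h = Dom \<C> k" "Cod \<C> h = Dom \<C> f" "Cod \<C> k = Dom \<C> g"
    "f \<cdot> h = g \<cdot> k"
  shows "\<exists>u. u \<in> Arr \<C> \<and> Dom \<C> u = Dom \<C> h \<and> Cod \<C> u = Dom \<C> p \<and> p \<cdot> u = h \<and> q \<cdot> u = k"
proof -
  have "Dom \<C> h \<in> Ob \<C>" "h \<in> hom \<C> (Dom \<C> h) (Dom \<C> f)" "k \<in> hom \<C> (Dom \<C> h) (Dom \<C> g)"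
    using assms by (simp_all add: hom_def)
  from ex1_implies_ex[OF pullback_ex1[OF assms(1) this assms(7)]]
  obtain u where "u \<in> hom \<C> (Dom \<C> h) (Dom \<C> p)" "p \<cdot> u = h" "q \<cdot> u = k" by (elim exE conjE)
  then show ?thesis by (intro exI[of _ u]) (simp add: hom_def)
qed

lemma pullback_unique:
  assumes "is_pullback \<C> f g p q" "u \<in> Arr \<C>" "v \<in> Arr \<C>" "Dom \<C> u = Dom \<C> v" "Cod \<C> u = Dom \<C> p" "Cod \<C> v = Dom \<C> p"
    "p \<cdot> u = p \<cdot> v" "q \<cdot> u = q \<cdot> v"
  shows "u = v"
proof -
  note a = pullback_arr[OF assms(1)]
  have e: "f \<cdot> p \<cdot> u = g \<cdot> q \<cdot> u"
    using assms(2,5) a comp_assoc[of u p f] comp_assoc[of u q g] by (simp del: comp_assoc')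
  have "Dom \<C> v \<in> Ob \<C>" "p \<cdot> u \<in> hom \<C> (Dom \<C> v) (Dom \<C> f)" "q \<cdot> u \<in> hom \<C> (Dom \<C> v) (Dom \<C> g)"
    using assms(2-6) a(1-8) by (simp_all add: hom_def)
  note u = pullback_ex1[OF assms(1) this e]
  have "u \<in> hom \<C> (Dom \<C> v) (Dom \<C> p)" "v \<in> hom \<C> (Dom \<C> v) (Dom \<C> p)"
    using assms(2-6) by (simp_all add: hom_def)
  then show ?thesis using ex1E[OF u] assms(7,8) by metis
qed

lemma mono_comp:
  assumes "mono_arrow \<C> f" "mono_arrow \<C> g" "Dom \<C> g = Cod \<C> f"
  shows "mono_arrow \<C> (g \<cdot> f)"
proof (rule mono_arrowI)
  have [simp]: "f \<in> Arr \<C>" "g \<in> Arr \<C>" using assms by (auto simp: mono_arrow_def)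
  show "g \<cdot> f \<in> Arr \<C>" using assms by simp
  fix x y assume xy: "x \<in> Arr \<C>" "y \<in> Arr \<C>" "Dom \<C> x = Dom \<C> y" "Cod \<C> x = Dom \<C> (g \<cdot> f)" "Cod \<C> y = Dom \<C> (g \<cdot> f)"
    and e: "(g \<cdot> f) \<cdot> x = (g \<cdot> f) \<cdot> y"
  then have "f \<cdot> x = f \<cdot> y"
    using assms by (intro mono_cancel[OF assms(2), of "f \<cdot> x" "f \<cdot> y"]) simp_all
  then show "x = y" using xy assms by (intro mono_cancel[OF assms(1), of x y]) simp_all
qed

lemma split_mono_arrow:
  assumes "r \<cdot> f = Dom \<C> f" "f \<in> Arr \<C>" "r \<in> Arr \<C>" "Dom \<C> r = Cod \<C> f"
  shows "mono_arrow \<C> f"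
proof (rule mono_arrowI)
  fix x y assume "x \<in> Arr \<C>" "y \<in> Arr \<C>" "Dom \<C> x = Dom \<C> y" "Cod \<C> x = Dom \<C> f" "Cod \<C> y = Dom \<C> f" "f \<cdot> x = f \<cdot> y"
  then show "x = y" by (intro split_mono[OF assms, of x y]) assumption+
qed (fact assms(2))

end

context duoidal_category
begin

lemma bullet_mono:
  assumes pres: "bullet_preserves_binary_intersections \<C> S" and f: "mono_arrow \<C> f" and X: "X \<in> Ob \<C>"
  shows "mono_arrow \<C> (X \<bullet> f)" "mono_arrow \<C> (f \<bullet> X)"
proof -
  have [simp]: "f \<in> Arr \<C>" using f by (simp add: mono_arrow_def)
  show "mono_arrow \<C> (X \<bullet> f)" "mono_arrow \<C> (f \<bullet> X)"
    using pres X f by (auto simp: bullet_preserves_binary_intersections_def intro!: preserves_mono[of "\<lambda>f. X \<bullet> f"] preserves_mono[of "\<lambda>f. f \<bullet> X"])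
qed

text \<open>Applying the counit of B to the second component of the graph recovers the first one, so
  the graph is a split monomorphism.\<close>

lemma graph_mono:
  assumes A: "comonoid_in \<C> S A d e" and B: "comonoid_in \<C> S B d' e'" and p: "comonoid_map A d e B d' e' p"
  shows "mono_arrow \<C> ((A \<bullet> p) \<cdot> d)"
proof (rule circ.split_mono_arrow)
  note [simp] = comonoid_arr[OF A] comonoid_arr[OF B]
  have [simp]: "p \<in> Arr \<C>" "Dom \<C> p = A" "Cod \<C> p = B" and e: "e' \<cdot> p = e" using p by (auto simp: comonoid_map_def)
  show "(rb A \<cdot> (A \<bullet> e')) \<cdot> (A \<bullet> p) \<cdot> d = Dom \<C> ((A \<bullet> p) \<cdot> d)" by (simp add: e comonoid_laws[OF A])
  show "(A \<bullet> p) \<cdot> d \<in> Arr \<C>" "rb A \<cdot> (A \<bullet> e') \<in> Arr \<C>" "Dom \<C> (rb A \<cdot> (A \<bullet> e')) = Cod \<C> ((A \<bullet> p) \<cdot> d)" by simp_all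
qed

end

section \<open>The kernel as a retract of A \<bullet> I and as a cocommutative comonoid\<close>

context Hopf_point
begin

lemmas mono_tens = bullet_mono[OF preserves]

lemma mono_tens2:
  assumes f: "mono_arrow \<C> f" and g: "mono_arrow \<C> g"
  shows "mono_arrow \<C> (f \<bullet> g)"
proof -
  have [simp]: "f \<in> Arr \<C>" "g \<in> Arr \<C>" using f g by (simp_all add: mono_arrow_def)
  have "mono_arrow \<C> ((f \<bullet> Cod \<C> g) \<cdot> (Dom \<C> f \<bullet> g))"
    using f g by (intro circ.mono_comp mono_tens) simp_all
  then show ?thesis by simp
qed

lemma p1_mono: "mono_arrow \<C> p\<^sub>1"
  by (rule graph_mono[OF A_parts(2) B_parts(2) p_parts(1)])

abbreviation K where "K \<equiv> Dom \<C> \<kappa>"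

lemma kappa_arr [simp]: "\<kappa> \<in> Arr \<C>" "\<kappa>' \<in> Arr \<C>" "Dom \<C> \<kappa>' = K" "Cod \<C> \<kappa> = A\<^sub>0" "Cod \<C> \<kappa>' = N"
  using circ.pullback_arr[OF kernel] by simp_all

lemma kernel_eq: "p\<^sub>1 \<cdot> \<kappa> = (A\<^sub>0 \<bullet> unt B) \<cdot> \<kappa>'"
  by (rule circ.pullback_arr[OF kernel])

lemma Au_mono: "mono_arrow \<C> (A\<^sub>0 \<bullet> unt B)"
  by (rule mono_tens) (simp_all add: unt_mono)

lemma kappa_mono: "mono_arrow \<C> \<kappa>"
proof (rule circ.mono_arrowI)
  fix x y assume xy: "x \<in> Arr \<C>" "y \<in> Arr \<C>" "Dom \<C> x = Dom \<C> y" "Cod \<C> x = K" "Cod \<C> y = K" "\<kappa> \<cdot> x = \<kappa> \<cdot> y"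
  have "(A\<^sub>0 \<bullet> unt B) \<cdot> \<kappa>' \<cdot> x = p\<^sub>1 \<cdot> \<kappa> \<cdot> x"
    using circ.ext2[OF kernel_eq, of x] xy by simp
  also have "\<dots> = (A\<^sub>0 \<bullet> unt B) \<cdot> \<kappa>' \<cdot> y"
    using circ.ext2[OF kernel_eq, of y] xy by simp
  finally have "\<kappa>' \<cdot> x = \<kappa>' \<cdot> y"
    using xy by (intro circ.mono_cancel[OF Au_mono, of "\<kappa>' \<cdot> x" "\<kappa>' \<cdot> y"]) simp_all
  then show "x = y" using xy by (intro circ.pullback_unique[OF kernel, of x y]) simp_all
qed simp

lemma kernel_left: "X \<in> Ob \<C> \<Longrightarrow> is_pullback \<C> (X \<bullet> p\<^sub>1) (X \<bullet> (A\<^sub>0 \<bullet> unt B)) (X \<bullet> \<kappa>) (X \<bullet> \<kappa>')"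
  and kernel_right: "X \<in> Ob \<C> \<Longrightarrow> is_pullback \<C> (p\<^sub>1 \<bullet> X) ((A\<^sub>0 \<bullet> unt B) \<bullet> X) (\<kappa> \<bullet> X) (\<kappa>' \<bullet> X)"
  using preserves p1_mono Au_mono kernel
  unfolding bullet_preserves_binary_intersections_def preserves_binary_intersections_def by blast+

lemma pi1_kappa': "pi1 A\<^sub>0 \<cdot> \<kappa>' = \<kappa>"
proof -
  have "pi1 A\<^sub>0 \<cdot> \<kappa>' = rb A\<^sub>0 \<cdot> (A\<^sub>0 \<bullet> counit B) \<cdot> (A\<^sub>0 \<bullet> unt B) \<cdot> \<kappa>'" by (simp add: B_bim)
  also have "\<dots> = rb A\<^sub>0 \<cdot> (A\<^sub>0 \<bullet> counit B) \<cdot> p\<^sub>1 \<cdot> \<kappa>" by (simp only: kernel_eq)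
  also have "\<dots> = (rb A\<^sub>0 \<cdot> (A\<^sub>0 \<bullet> counit A) \<cdot> comult A) \<cdot> \<kappa>" by (simp add: p_laws)
  finally show ?thesis unfolding A_laws by simp
qed

definition pi2 where "pi2 = lb I \<cdot> (counit A \<bullet> I)"
text \<open>The I-component of \<open>\<kappa>'\<close>. By \<open>unt_iota\<close> the composite of
  p with the inclusion of the kernel factors through the unit of B by this arrow, which will also be
  a comonoid map.\<close>

definition \<iota> where "\<iota> = pi2 \<cdot> \<kappa>'"

lemma iota_arr [simp]: "\<iota> \<in> Arr \<C>" "Dom \<C> \<iota> = K" "Cod \<C> \<iota> = I" "pi2 \<in> Arr \<C>" "Dom \<C> pi2 = N" "Cod \<C> pi2 = I"
  by (simp_all add: \<iota>_def pi2_def)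

lemma unt_iota: "unt B \<cdot> \<iota> = p \<cdot> \<kappa>"
proof -
  have "unt B \<cdot> \<iota> = lb B\<^sub>0 \<cdot> (J \<bullet> unt B) \<cdot> (counit A \<bullet> I) \<cdot> \<kappa>'"
    using circ.ext2[OF blt.lunit_nat[of "unt B" B\<^sub>0], of "(counit A \<bullet> I) \<cdot> \<kappa>'"] by (simp add: \<iota>_def pi2_def)
  also have "\<dots> = lb B\<^sub>0 \<cdot> (counit A \<bullet> B\<^sub>0) \<cdot> (A\<^sub>0 \<bullet> unt B) \<cdot> \<kappa>'" by simp
  also have "\<dots> = lb B\<^sub>0 \<cdot> (counit A \<bullet> B\<^sub>0) \<cdot> p\<^sub>1 \<cdot> \<kappa>" by (simp only: kernel_eq)
  also have "\<dots> = lb B\<^sub>0 \<cdot> (J \<bullet> p) \<cdot> (counit A \<bullet> A\<^sub>0) \<cdot> comult A \<cdot> \<kappa>" by simp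
  also have "\<dots> = p \<cdot> (lb A\<^sub>0 \<cdot> (counit A \<bullet> A\<^sub>0) \<cdot> comult A) \<cdot> \<kappa>"
    using circ.ext2[OF blt.lunit_nat[of p B\<^sub>0], of "(counit A \<bullet> A\<^sub>0) \<cdot> comult A \<cdot> \<kappa>"] by simp
  finally show ?thesis unfolding A_laws by simp
qed

text \<open>The condition p(k) = 1 with one more copy of I. It is tested after the monomorphism
  \<open>(A\<^sub>0 \<bullet> B\<^sub>0) \<bullet> unt B\<close>, where the kernel equation can be
  used on both sides of the coassociativity fact \<open>p1_p1\<close>.\<close>

lemma graph_kappa': "(p\<^sub>1 \<bullet> I) \<cdot> \<kappa>' = beta \<cdot> \<kappa>'"
proof -
  let ?m = "(A\<^sub>0 \<bullet> B\<^sub>0) \<bullet> unt B"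
  have pp: "(p\<^sub>1 \<bullet> B\<^sub>0) \<cdot> p\<^sub>1 = abi A\<^sub>0 B\<^sub>0 B\<^sub>0 \<cdot> (A\<^sub>0 \<bullet> comult B) \<cdot> p\<^sub>1" using p1_p1 by simp
  have "?m \<cdot> (p\<^sub>1 \<bullet> I) \<cdot> \<kappa>' = (p\<^sub>1 \<bullet> B\<^sub>0) \<cdot> (A\<^sub>0 \<bullet> unt B) \<cdot> \<kappa>'" by simp
  also have "\<dots> = (p\<^sub>1 \<bullet> B\<^sub>0) \<cdot> p\<^sub>1 \<cdot> \<kappa>" by (simp only: kernel_eq)
  also have "\<dots> = abi A\<^sub>0 B\<^sub>0 B\<^sub>0 \<cdot> (A\<^sub>0 \<bullet> comult B) \<cdot> p\<^sub>1 \<cdot> \<kappa>"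
    using circ.ext2[OF pp, of \<kappa>] by simp
  also have "\<dots> = abi A\<^sub>0 B\<^sub>0 B\<^sub>0 \<cdot> (A\<^sub>0 \<bullet> comult B) \<cdot> (A\<^sub>0 \<bullet> unt B) \<cdot> \<kappa>'" by (simp only: kernel_eq)
  also have "\<dots> = abi A\<^sub>0 B\<^sub>0 B\<^sub>0 \<cdot> (A\<^sub>0 \<bullet> (unt B \<bullet> unt B)) \<cdot> (A\<^sub>0 \<bullet> \<Delta>\<^sub>I) \<cdot> \<kappa>'" by (simp add: B_bim)
  also have "\<dots> = ?m \<cdot> beta \<cdot> \<kappa>'"
    using circ.ext2[OF blt.inv_assoc_nat[of A\<^sub>0 "unt B" "unt B" A\<^sub>0 B\<^sub>0 B\<^sub>0], of "(A\<^sub>0 \<bullet> \<Delta>\<^sub>I) \<cdot> \<kappa>'"] by (simp add: beta_def co_def)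
  finally show ?thesis
    by (rule circ.mono_cancel[OF mono_tens(1)[OF unt_mono], rotated]) simp_all
qed

lemma rho_kappa': "rho \<cdot> \<kappa>' = \<kappa>'"
proof -
  have "rho \<cdot> \<kappa>' = (E \<cdot> beta) \<cdot> \<kappa>'" by (simp add: rho_E graph_kappa')
  then show ?thesis by (simp only: E_beta) simp
qed

text \<open>Since \<open>p\<^sub>1 \<bullet> I\<close> and \<open>beta\<close> agree on
  \<open>rho\<close>, it factors through the kernel, and r is this factorization. It is a retraction
  of \<open>\<kappa>'\<close>, so that K is a retract of A \<bullet> I and remains one after -
  \<odot> V.\<close>

definition r where "r = (SOME r. r \<in> Arr \<C> \<and> Dom \<C> r = N \<and> Cod \<C> r = K \<and> \<kappa> \<cdot> r = pi1 A\<^sub>0 \<cdot> rho \<and> \<kappa>' \<cdot> r = rho)"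

lemma r_arr [simp]: "r \<in> Arr \<C>" "Dom \<C> r = N" "Cod \<C> r = K"
  and kappa_r: "\<kappa> \<cdot> r = pi1 A\<^sub>0 \<cdot> rho" and kappa'_r: "\<kappa>' \<cdot> r = rho"
proof -
  have "p\<^sub>1 \<cdot> pi1 A\<^sub>0 \<cdot> rho = (pi1 (A\<^sub>0 \<bullet> B\<^sub>0) \<cdot> (p\<^sub>1 \<bullet> I)) \<cdot> rho"
    by (subst pi1_nat[of p\<^sub>1 A\<^sub>0]) simp_all
  also have "\<dots> = pi1 (A\<^sub>0 \<bullet> B\<^sub>0) \<cdot> (p\<^sub>1 \<bullet> I) \<cdot> rho" by simp
  also have "\<dots> = (pi1 (A\<^sub>0 \<bullet> B\<^sub>0) \<cdot> beta) \<cdot> rho" unfolding graph_rho by simp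
  finally have "p\<^sub>1 \<cdot> pi1 A\<^sub>0 \<cdot> rho = (A\<^sub>0 \<bullet> unt B) \<cdot> rho" unfolding pi1_beta .
  then have ex: "\<exists>r. r \<in> Arr \<C> \<and> Dom \<C> r = N \<and> Cod \<C> r = K \<and> \<kappa> \<cdot> r = pi1 A\<^sub>0 \<cdot> rho \<and> \<kappa>' \<cdot> r = rho"
    using circ.pullback_lift[OF kernel, of "pi1 A\<^sub>0 \<cdot> rho" rho] by simp
  have "r \<in> Arr \<C> \<and> Dom \<C> r = N \<and> Cod \<C> r = K \<and> \<kappa> \<cdot> r = pi1 A\<^sub>0 \<cdot> rho \<and> \<kappa>' \<cdot> r = rho"
    unfolding r_def by (rule someI_ex[OF ex])
  then show "r \<in> Arr \<C>" "Dom \<C> r = N" "Cod \<C> r = K" "\<kappa> \<cdot> r = pi1 A\<^sub>0 \<cdot> rho" "\<kappa>' \<cdot> r = rho" by blast+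
qed

lemma r_kappa': "r \<cdot> \<kappa>' = K"
proof (rule circ.mono_cancel[OF kappa_mono])
  have "\<kappa> \<cdot> r \<cdot> \<kappa>' = pi1 A\<^sub>0 \<cdot> rho \<cdot> \<kappa>'"
    using circ.ext2[OF kappa_r, of \<kappa>'] by simp
  then show "\<kappa> \<cdot> r \<cdot> \<kappa>' = \<kappa> \<cdot> K" unfolding rho_kappa' pi1_kappa' by simp
qed simp_all

text \<open>The intersection is preserved by - \<bullet> I, and \<open>graph_kappa'\<close> is the
  compatibility that a lift needs. So I coacts on K, with \<open>\<kappa>'\<close> as the image of
  the coaction in A \<bullet> I.\<close>

lemma kernel_coaction: "\<exists>k. k \<in> Arr \<C> \<and> Dom \<C> k = K \<and> Cod \<C> k = K \<bullet> I \<and> (\<kappa> \<bullet> I) \<cdot> k = \<kappa>'"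
proof -
  have "(p\<^sub>1 \<bullet> I) \<cdot> \<kappa>' = ((A\<^sub>0 \<bullet> unt B) \<bullet> I) \<cdot> co A\<^sub>0 \<cdot> \<kappa>'" using graph_kappa' by (simp add: beta_def)
  then show ?thesis using circ.pullback_lift[OF kernel_right[of I], of \<kappa>' "co A\<^sub>0 \<cdot> \<kappa>'"] by auto
qed

text \<open>The restricted comultiplication is lifted one factor at a time: into A \<bullet> K, by
  cocommutativity into K \<bullet> A, and from there into K \<bullet> K. Both lifts use that
  \<bullet> preserves the intersection.\<close>

lemma kernel_comult: "\<exists>d. d \<in> Arr \<C> \<and> Dom \<C> d = K \<and> Cod \<C> d = K \<bullet> K \<and> (\<kappa> \<bullet> \<kappa>) \<cdot> d = comult A \<cdot> \<kappa>"
proof -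
  let ?d = "comult A"
  obtain k where k [simp]: "k \<in> Arr \<C>" "Dom \<C> k = K" "Cod \<C> k = K \<bullet> I" and k': "(\<kappa> \<bullet> I) \<cdot> k = \<kappa>'"
    using kernel_coaction by blast
  let ?y = "ab A\<^sub>0 A\<^sub>0 I \<cdot> (?d \<bullet> I) \<cdot> \<kappa>'"
  have pd: "(A\<^sub>0 \<bullet> p\<^sub>1) \<cdot> ?d = ab A\<^sub>0 A\<^sub>0 B\<^sub>0 \<cdot> (?d \<bullet> B\<^sub>0) \<cdot> p\<^sub>1"
    using pair_assoc[OF A_parts(2), of A\<^sub>0 A\<^sub>0 p A\<^sub>0 A\<^sub>0 B\<^sub>0] by simp
  have "(A\<^sub>0 \<bullet> p\<^sub>1) \<cdot> ?d \<cdot> \<kappa> = ab A\<^sub>0 A\<^sub>0 B\<^sub>0 \<cdot> (?d \<bullet> B\<^sub>0) \<cdot> p\<^sub>1 \<cdot> \<kappa>"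
    using circ.ext2[OF pd, of \<kappa>] by simp
  also have "\<dots> = ab A\<^sub>0 A\<^sub>0 B\<^sub>0 \<cdot> (?d \<bullet> B\<^sub>0) \<cdot> (A\<^sub>0 \<bullet> unt B) \<cdot> \<kappa>'" by (simp only: kernel_eq)
  also have "\<dots> = ab A\<^sub>0 A\<^sub>0 B\<^sub>0 \<cdot> ((A\<^sub>0 \<bullet> A\<^sub>0) \<bullet> unt B) \<cdot> (?d \<bullet> I) \<cdot> \<kappa>'" by simp
  also have "\<dots> = (A\<^sub>0 \<bullet> (A\<^sub>0 \<bullet> unt B)) \<cdot> ?y"
    using circ.ext2[OF blt.assoc_nat[of A\<^sub>0 A\<^sub>0 "unt B" A\<^sub>0 A\<^sub>0 B\<^sub>0], of "(?d \<bullet> I) \<cdot> \<kappa>'"] by simp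
  finally have y: "(A\<^sub>0 \<bullet> p\<^sub>1) \<cdot> ?d \<cdot> \<kappa> = (A\<^sub>0 \<bullet> (A\<^sub>0 \<bullet> unt B)) \<cdot> ?y" .
  then obtain d1 where d1 [simp]: "d1 \<in> Arr \<C>" "Dom \<C> d1 = K" "Cod \<C> d1 = A\<^sub>0 \<bullet> K" and d1': "(A\<^sub>0 \<bullet> \<kappa>) \<cdot> d1 = ?d \<cdot> \<kappa>"
    using circ.pullback_lift[OF kernel_left[of A\<^sub>0], of "?d \<cdot> \<kappa>" ?y] by auto
  \<comment> \<open>The braiding brings the lifted factor to the front; cocommutativity of A keeps
    the composite into A \<bullet> A unchanged.\<close>
  define d2 where "d2 = \<sigma> A\<^sub>0 K \<cdot> d1"
  have [simp]: "d2 \<in> Arr \<C>" "Dom \<C> d2 = K" "Cod \<C> d2 = K \<bullet> A\<^sub>0" by (simp_all add: d2_def)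
  have "(\<kappa> \<bullet> A\<^sub>0) \<cdot> d2 = \<sigma> A\<^sub>0 A\<^sub>0 \<cdot> (A\<^sub>0 \<bullet> \<kappa>) \<cdot> d1"
    using circ.ext2[OF sigma_nat[of A\<^sub>0 \<kappa> A\<^sub>0 A\<^sub>0], of d1] by (simp add: d2_def)
  also have "\<dots> = (\<sigma> A\<^sub>0 A\<^sub>0 \<cdot> ?d) \<cdot> \<kappa>" by (simp add: d1')
  also have "\<sigma> A\<^sub>0 A\<^sub>0 \<cdot> ?d = ?d" using A_cocomm' by (simp add: cocomm_def)
  finally have d2': "(\<kappa> \<bullet> A\<^sub>0) \<cdot> d2 = ?d \<cdot> \<kappa>" .
  \<comment> \<open>\<open>?x\<close> is the candidate for the leg into K \<bullet> (A \<bullet> I)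
    of the second lift; its last factor comes from the coaction k of I on K.\<close>
  let ?x = "ab K A\<^sub>0 I \<cdot> (d2 \<bullet> I) \<cdot> k"
  let ?m = "\<kappa> \<bullet> (A\<^sub>0 \<bullet> B\<^sub>0)"
  have "?m \<cdot> (K \<bullet> (A\<^sub>0 \<bullet> unt B)) \<cdot> ?x = (A\<^sub>0 \<bullet> (A\<^sub>0 \<bullet> unt B)) \<cdot> (\<kappa> \<bullet> (A\<^sub>0 \<bullet> I)) \<cdot> ?x" by simp
  also have "\<dots> = (A\<^sub>0 \<bullet> (A\<^sub>0 \<bullet> unt B)) \<cdot> ab A\<^sub>0 A\<^sub>0 I \<cdot> (((\<kappa> \<bullet> A\<^sub>0) \<cdot> d2) \<bullet> I) \<cdot> k"
    using circ.ext2[OF blt.assoc_nat[of \<kappa> A\<^sub>0 I A\<^sub>0 A\<^sub>0 I], of "(d2 \<bullet> I) \<cdot> k"] by simp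
  also have "\<dots> = (A\<^sub>0 \<bullet> (A\<^sub>0 \<bullet> unt B)) \<cdot> ab A\<^sub>0 A\<^sub>0 I \<cdot> (?d \<bullet> I) \<cdot> (\<kappa> \<bullet> I) \<cdot> k"
    unfolding d2' by simp
  also have "\<dots> = (A\<^sub>0 \<bullet> p\<^sub>1) \<cdot> (\<kappa> \<bullet> A\<^sub>0) \<cdot> d2" unfolding k' y[symmetric] d2' ..
  also have "\<dots> = ?m \<cdot> (K \<bullet> p\<^sub>1) \<cdot> d2" by simp
  finally have "(K \<bullet> (A\<^sub>0 \<bullet> unt B)) \<cdot> ?x = (K \<bullet> p\<^sub>1) \<cdot> d2"
    by (rule circ.mono_cancel[OF mono_tens(2)[OF kappa_mono], rotated]) simp_all
  from this[symmetric] obtain d3 where d3 [simp]: "d3 \<in> Arr \<C>" "Dom \<C> d3 = K" "Cod \<C> d3 = K \<bullet> K" and d3': "(K \<bullet> \<kappa>) \<cdot> d3 = d2"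
    using circ.pullback_lift[OF kernel_left[of K], of d2 ?x] by auto
  have "(\<kappa> \<bullet> \<kappa>) \<cdot> d3 = (\<kappa> \<bullet> A\<^sub>0) \<cdot> (K \<bullet> \<kappa>) \<cdot> d3" by simp
  then have "(\<kappa> \<bullet> \<kappa>) \<cdot> d3 = ?d \<cdot> \<kappa>" unfolding d3' d2' .
  then show ?thesis using d3 by blast
qed

definition dK where "dK = (SOME d. d \<in> Arr \<C> \<and> Dom \<C> d = K \<and> Cod \<C> d = K \<bullet> K \<and> (\<kappa> \<bullet> \<kappa>) \<cdot> d = comult A \<cdot> \<kappa>)"
definition eK where "eK = counit A \<cdot> \<kappa>"

lemma dK_arr [simp]: "dK \<in> Arr \<C>" "Dom \<C> dK = K" "Cod \<C> dK = K \<bullet> K" "eK \<in> Arr \<C>" "Dom \<C> eK = K" "Cod \<C> eK = J"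
  and kappa_dK: "(\<kappa> \<bullet> \<kappa>) \<cdot> dK = comult A \<cdot> \<kappa>"
proof -
  have "dK \<in> Arr \<C> \<and> Dom \<C> dK = K \<and> Cod \<C> dK = K \<bullet> K \<and> (\<kappa> \<bullet> \<kappa>) \<cdot> dK = comult A \<cdot> \<kappa>"
    unfolding dK_def by (rule someI_ex[OF kernel_comult])
  then show "dK \<in> Arr \<C>" "Dom \<C> dK = K" "Cod \<C> dK = K \<bullet> K" "(\<kappa> \<bullet> \<kappa>) \<cdot> dK = comult A \<cdot> \<kappa>" by blast+
qed (simp_all add: eK_def)

text \<open>Each law is tested after a monomorphism built from \<open>\<kappa>\<close>, where it
  becomes the corresponding law of A.\<close>

lemma K_comonoid: "comonoid_in \<C> S K dK eK"
proof (rule comonoid_inI)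
  have kk: "(\<kappa> \<bullet> \<kappa>) \<cdot> dK = comult A \<cdot> \<kappa>" by (rule kappa_dK)
  have e1: "((comult A \<cdot> \<kappa>) \<bullet> \<kappa>) \<cdot> dK = (comult A \<bullet> A\<^sub>0) \<cdot> comult A \<cdot> \<kappa>"
    using arg_cong[OF kk, of "\<lambda>f. (comult A \<bullet> A\<^sub>0) \<cdot> f"] by simp
  have e2: "(\<kappa> \<bullet> (comult A \<cdot> \<kappa>)) \<cdot> dK = (A\<^sub>0 \<bullet> comult A) \<cdot> comult A \<cdot> \<kappa>"
    using arg_cong[OF kk, of "\<lambda>f. (A\<^sub>0 \<bullet> comult A) \<cdot> f"] by simp
  have "(\<kappa> \<bullet> (\<kappa> \<bullet> \<kappa>)) \<cdot> ab K K K \<cdot> (dK \<bullet> K) \<cdot> dK = ab A\<^sub>0 A\<^sub>0 A\<^sub>0 \<cdot> (((\<kappa> \<bullet> \<kappa>) \<cdot> dK) \<bullet> \<kappa>) \<cdot> dK"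
    using circ.ext2[OF blt.assoc_nat[of \<kappa> \<kappa> \<kappa> A\<^sub>0 A\<^sub>0 A\<^sub>0], of "(dK \<bullet> K) \<cdot> dK"] by simp
  also have "\<dots> = ab A\<^sub>0 A\<^sub>0 A\<^sub>0 \<cdot> (comult A \<bullet> A\<^sub>0) \<cdot> comult A \<cdot> \<kappa>" unfolding kk e1 ..
  also have "\<dots> = (A\<^sub>0 \<bullet> comult A) \<cdot> comult A \<cdot> \<kappa>" using circ.ext3[OF A_laws(4), of \<kappa>] by simp
  also have "\<dots> = (\<kappa> \<bullet> ((\<kappa> \<bullet> \<kappa>) \<cdot> dK)) \<cdot> dK" unfolding kk e2 ..
  also have "\<dots> = (\<kappa> \<bullet> (\<kappa> \<bullet> \<kappa>)) \<cdot> (K \<bullet> dK) \<cdot> dK" by simp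
  finally show "ab K K K \<cdot> (dK \<bullet> K) \<cdot> dK = (K \<bullet> dK) \<cdot> dK"
    by (rule circ.mono_cancel[OF mono_tens2[OF kappa_mono mono_tens2[OF kappa_mono kappa_mono]]]) simp_all
  have "\<kappa> \<cdot> lb K \<cdot> (eK \<bullet> K) \<cdot> dK = lb A\<^sub>0 \<cdot> (counit A \<bullet> A\<^sub>0) \<cdot> (\<kappa> \<bullet> \<kappa>) \<cdot> dK"
    using circ.ext2[OF blt.lunit_nat[of \<kappa> A\<^sub>0], of "(eK \<bullet> K) \<cdot> dK"] by (simp add: eK_def)
  also have "\<dots> = (lb A\<^sub>0 \<cdot> (counit A \<bullet> A\<^sub>0) \<cdot> comult A) \<cdot> \<kappa>" unfolding kk by simp
  finally have "\<kappa> \<cdot> lb K \<cdot> (eK \<bullet> K) \<cdot> dK = \<kappa> \<cdot> K" unfolding A_laws by simp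
  then show "lb K \<cdot> (eK \<bullet> K) \<cdot> dK = K" by (rule circ.mono_cancel[OF kappa_mono]) simp_all
  have "\<kappa> \<cdot> rb K \<cdot> (K \<bullet> eK) \<cdot> dK = rb A\<^sub>0 \<cdot> (A\<^sub>0 \<bullet> counit A) \<cdot> (\<kappa> \<bullet> \<kappa>) \<cdot> dK"
    using circ.ext2[OF blt.runit_nat[of \<kappa> A\<^sub>0], of "(K \<bullet> eK) \<cdot> dK"] by (simp add: eK_def)
  also have "\<dots> = (rb A\<^sub>0 \<cdot> (A\<^sub>0 \<bullet> counit A) \<cdot> comult A) \<cdot> \<kappa>" unfolding kk by simp
  finally have "\<kappa> \<cdot> rb K \<cdot> (K \<bullet> eK) \<cdot> dK = \<kappa> \<cdot> K" unfolding A_laws by simp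
  then show "rb K \<cdot> (K \<bullet> eK) \<cdot> dK = K" by (rule circ.mono_cancel[OF kappa_mono]) simp_all
qed simp_all

lemma K_cocomm: "cocomm K dK eK"
proof -
  have "(\<kappa> \<bullet> \<kappa>) \<cdot> \<sigma> K K \<cdot> dK = \<sigma> A\<^sub>0 A\<^sub>0 \<cdot> (\<kappa> \<bullet> \<kappa>) \<cdot> dK"
    using circ.ext2[OF sigma_nat[of \<kappa> \<kappa> A\<^sub>0 A\<^sub>0], of dK] by simp
  also have "\<dots> = (\<sigma> A\<^sub>0 A\<^sub>0 \<cdot> comult A) \<cdot> \<kappa>" unfolding kappa_dK by simp
  also have "\<dots> = (\<kappa> \<bullet> \<kappa>) \<cdot> dK" using A_cocomm' by (simp add: cocomm_def kappa_dK)
  finally have "\<sigma> K K \<cdot> dK = dK"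
    by (rule circ.mono_cancel[OF mono_tens2[OF kappa_mono kappa_mono]]) simp_all
  then show ?thesis by (simp add: cocomm_def K_comonoid)
qed

lemma kappa_comonoid_map: "comonoid_map K dK eK A\<^sub>0 (comult A) (counit A) \<kappa>"
  by (simp add: comonoid_map_def kappa_dK eK_def)

text \<open>Compatibility with the comultiplications is tested after
  \<open>unt B \<bullet> unt B\<close>, which is monic because the unit of B is. There
  \<open>unt B \<cdot> \<iota>\<close> may be replaced by \<open>p \<cdot> \<kappa>\<close>, a
  composite of comonoid maps.\<close>

lemma iota_comonoid_map: "comonoid_map K dK eK I \<Delta>\<^sub>I \<epsilon>\<^sub>I \<iota>"
proof -
  have "(unt B \<bullet> unt B) \<cdot> \<Delta>\<^sub>I \<cdot> \<iota> = (comult B \<cdot> unt B) \<cdot> \<iota>" by (simp add: B_bim)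
  also have "\<dots> = (comult B \<cdot> p) \<cdot> \<kappa>" using unt_iota by simp
  also have "\<dots> = (p \<bullet> p) \<cdot> comult A \<cdot> \<kappa>" unfolding p_laws by simp
  also have "\<dots> = ((p \<cdot> \<kappa>) \<bullet> (p \<cdot> \<kappa>)) \<cdot> dK" unfolding kappa_dK[symmetric] by simp
  also have "\<dots> = (unt B \<bullet> unt B) \<cdot> (\<iota> \<bullet> \<iota>) \<cdot> dK" unfolding unt_iota[symmetric] by simp
  finally have 1: "\<Delta>\<^sub>I \<cdot> \<iota> = (\<iota> \<bullet> \<iota>) \<cdot> dK"
    by (rule circ.mono_cancel[OF mono_tens2[OF unt_mono unt_mono]]) simp_all
  have "\<epsilon>\<^sub>I \<cdot> \<iota> = counit B \<cdot> unt B \<cdot> \<iota>" using circ.ext2[OF B_bim(4), of \<iota>] by simp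
  also have "\<dots> = (counit B \<cdot> p) \<cdot> \<kappa>" using unt_iota by simp
  finally have "\<epsilon>\<^sub>I \<cdot> \<iota> = eK" by (simp add: p_laws eK_def)
  with 1 show ?thesis by (simp add: comonoid_map_def)
qed

text \<open>The arrow \<open>A\<^sub>0 \<bullet> unt B\<close> is monic, and after it both sides
  become the graph of p restricted to K. In this form \<open>\<kappa>'\<close> is accessible to the
  rules for pairing.\<close>

lemma kappa'_pair: "\<kappa>' = (\<kappa> \<bullet> \<iota>) \<cdot> dK"
proof (rule circ.mono_cancel[OF Au_mono])
  have "(A\<^sub>0 \<bullet> unt B) \<cdot> (\<kappa> \<bullet> \<iota>) \<cdot> dK = (A\<^sub>0 \<bullet> p) \<cdot> (\<kappa> \<bullet> \<kappa>) \<cdot> dK" by (simp add: unt_iota)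
  then show "(A\<^sub>0 \<bullet> unt B) \<cdot> \<kappa>' = (A\<^sub>0 \<bullet> unt B) \<cdot> (\<kappa> \<bullet> \<iota>) \<cdot> dK"
    unfolding kappa_dK using kernel_eq by simp
qed simp_all

lemma co_kappa': "co A\<^sub>0 \<cdot> \<kappa>' = (\<kappa>' \<bullet> \<iota>) \<cdot> dK"
proof -
  have i: "\<Delta>\<^sub>I \<cdot> \<iota> = (\<iota> \<bullet> \<iota>) \<cdot> dK" using iota_comonoid_map by (simp add: comonoid_map_def)
  have "co A\<^sub>0 \<cdot> \<kappa>' = abi A\<^sub>0 I I \<cdot> (A\<^sub>0 \<bullet> \<Delta>\<^sub>I) \<cdot> \<kappa>'" by (simp add: co_def)
  also have "\<dots> = abi A\<^sub>0 I I \<cdot> (A\<^sub>0 \<bullet> \<Delta>\<^sub>I) \<cdot> (\<kappa> \<bullet> \<iota>) \<cdot> dK" unfolding kappa'_pair[symmetric] ..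
  also have "\<dots> = abi A\<^sub>0 I I \<cdot> (\<kappa> \<bullet> (\<Delta>\<^sub>I \<cdot> \<iota>)) \<cdot> dK" by simp
  also have "\<dots> = (((\<kappa> \<bullet> \<iota>) \<cdot> dK) \<bullet> \<iota>) \<cdot> dK"
    unfolding i using pair_assoc_inv[OF K_comonoid, of \<kappa> \<iota> \<iota> A\<^sub>0 I I] by simp
  finally show ?thesis unfolding kappa'_pair[symmetric] .
qed

end

section \<open>Pullbacks of split epimorphisms\<close>

context Hopf_point
begin

text \<open>On elements \<open>mu\<close> sends k \<odot> b to k s(b), and \<open>nu\<close> sends a
  to a_1 s(p a_2)^-1 \<odot> p(a_3). In \<open>nu\<close> the arrow r leads from A \<bullet> I to
  the kernel after J has been cancelled against B.\<close>

definition mu where "mu = mult A \<cdot> (\<kappa> \<odot> s)"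
definition nu where "nu = (r \<odot> B\<^sub>0) \<cdot> Lam N (co A\<^sub>0) B\<^sub>0 \<cdot> (w \<bullet> B\<^sub>0) \<cdot> p\<^sub>1"

lemma mu_nu_arr [simp]: "mu \<in> Arr \<C>" "Dom \<C> mu = K \<odot> B\<^sub>0" "Cod \<C> mu = A\<^sub>0"
  "nu \<in> Arr \<C>" "Dom \<C> nu = A\<^sub>0" "Cod \<C> nu = K \<odot> B\<^sub>0"
  by (simp_all add: mu_def nu_def)

text \<open>On elements, a_1 s(p a_2)^-1 s(p a_3) = a. This is \<open>division_cancel\<close>
  restricted along the graph of p.\<close>

lemma division: "a \<cdot> (pi1 A\<^sub>0 \<odot> B\<^sub>0) \<cdot> Lam N (co A\<^sub>0) B\<^sub>0 \<cdot> (w \<bullet> p) \<cdot> comult A = A\<^sub>0"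
proof -
  have "a \<cdot> (pi1 A\<^sub>0 \<odot> B\<^sub>0) \<cdot> Lam N (co A\<^sub>0) B\<^sub>0 \<cdot> (w \<bullet> p) \<cdot> comult A =
      a \<cdot> (pi1 A\<^sub>0 \<odot> B\<^sub>0) \<cdot> Lam N (co A\<^sub>0) B\<^sub>0 \<cdot> (M1.kap \<bullet> B\<^sub>0) \<cdot> (p\<^sub>1 \<bullet> p) \<cdot> comult A" by (simp add: w_def)
  also have "\<dots> = a \<cdot> (pi1 A\<^sub>0 \<odot> B\<^sub>0) \<cdot> Lam N (co A\<^sub>0) B\<^sub>0 \<cdot> (M1.kap \<bullet> B\<^sub>0) \<cdot> abi A\<^sub>0 B\<^sub>0 B\<^sub>0 \<cdot> (A\<^sub>0 \<bullet> comult B) \<cdot> p\<^sub>1"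
    unfolding p1_p1 ..
  also have "\<dots> = (a \<cdot> (pi1 A\<^sub>0 \<odot> B\<^sub>0) \<cdot> Lam N (co A\<^sub>0) B\<^sub>0 \<cdot> (M1.kap \<bullet> B\<^sub>0) \<cdot> abi A\<^sub>0 B\<^sub>0 B\<^sub>0 \<cdot> (A\<^sub>0 \<bullet> comult B)) \<cdot> p\<^sub>1" by simp
  also have "\<dots> = rb A\<^sub>0 \<cdot> (A\<^sub>0 \<bullet> counit B) \<cdot> p\<^sub>1" unfolding M1.division_cancel by simp
  also have "\<dots> = A\<^sub>0" by (simp add: p_laws A_laws)
  finally show ?thesis .
qed

lemma rho_w:
  assumes [simp]: "x \<in> Arr \<C>" "Cod \<C> x = A\<^sub>0 \<bullet> V" "V \<in> Ob \<C>"
  shows "(rho \<odot> V) \<cdot> Lam N (co A\<^sub>0) V \<cdot> (w \<bullet> V) \<cdot> x = Lam N (co A\<^sub>0) V \<cdot> (w \<bullet> V) \<cdot> x"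
proof (rule rho_Lam)
  show "(((p\<^sub>1 \<bullet> I) \<odot> J) \<bullet> V) \<cdot> (w \<bullet> V) \<cdot> x = ((beta \<odot> J) \<bullet> V) \<cdot> (w \<bullet> V) \<cdot> x"
    using graph_w by simp
qed simp_all

lemma mu_nu: "mu \<cdot> nu = A\<^sub>0"
proof -
  let ?L = "Lam N (co A\<^sub>0) B\<^sub>0"
  have "mu \<cdot> nu = a \<cdot> ((\<kappa> \<cdot> r) \<odot> B\<^sub>0) \<cdot> ?L \<cdot> (w \<bullet> B\<^sub>0) \<cdot> p\<^sub>1" by (simp add: mu_def nu_def)
  also have "\<dots> = a \<cdot> (pi1 A\<^sub>0 \<odot> B\<^sub>0) \<cdot> (rho \<odot> B\<^sub>0) \<cdot> ?L \<cdot> (w \<bullet> B\<^sub>0) \<cdot> p\<^sub>1"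
    unfolding kappa_r by simp
  also have "\<dots> = a \<cdot> (pi1 A\<^sub>0 \<odot> B\<^sub>0) \<cdot> ?L \<cdot> (w \<bullet> B\<^sub>0) \<cdot> p\<^sub>1"
    using rho_w[of p\<^sub>1 B\<^sub>0] by simp
  also have "\<dots> = A\<^sub>0" using division by simp
  finally show ?thesis .
qed

lemma mu_comonoid_map: "comonoid_map (K \<odot> B\<^sub>0) (tens_comult K dK B\<^sub>0 (comult B)) (tens_counit eK (counit B)) A\<^sub>0 (comult A) (counit A) mu"
  unfolding mu_def
  by (rule comonoid_map_comp[OF comonoid_map_tens[OF K_comonoid B_parts(2) A_parts(2) A_parts(2) kappa_comonoid_map s_parts(1)] A_parts(3)
    comonoid_tens[OF K_comonoid B_parts(2)] comonoid_tens[OF A_parts(2) A_parts(2)] A_parts(2)])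

lemma p_mu: "p \<cdot> mu = lc B\<^sub>0 \<cdot> (\<iota> \<odot> B\<^sub>0)"
proof -
  have "p \<cdot> mu = (p \<cdot> mult A) \<cdot> (\<kappa> \<odot> s)" by (simp add: mu_def)
  also have "\<dots> = mult B \<cdot> ((p \<cdot> \<kappa>) \<odot> (p \<cdot> s))" unfolding p_laws by simp
  also have "\<dots> = (mult B \<cdot> (unt B \<odot> B\<^sub>0)) \<cdot> (\<iota> \<odot> B\<^sub>0)" unfolding ps unt_iota[symmetric] by simp
  finally show ?thesis unfolding B_laws .
qed

text \<open>For k in the kernel, p(k s(b)) = b. So the pair (k s(b), b) formed by \<open>Gam\<close>
  is the graph of p at k s(b).\<close>

lemma Gam_kappa': "M1.Gam \<cdot> (\<kappa>' \<odot> B\<^sub>0) = p\<^sub>1 \<cdot> mu"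
proof -
  let ?D = "dK \<odot> comult B"
  have "M1.Gam \<cdot> (\<kappa>' \<odot> B\<^sub>0) = (a \<bullet> lc B\<^sub>0) \<cdot> \<zeta> A\<^sub>0 I B\<^sub>0 B\<^sub>0 \<cdot> (N \<odot> comult B) \<cdot> (((\<kappa> \<bullet> \<iota>) \<cdot> dK) \<odot> B\<^sub>0)"
    unfolding kappa'_pair[symmetric] by (simp add: M1.Gam_def)
  also have "\<dots> = (mu \<bullet> (lc B\<^sub>0 \<cdot> (\<iota> \<odot> B\<^sub>0))) \<cdot> tens_comult K dK B\<^sub>0 (comult B)"
    using circ.ext2[OF zeta_nat[of \<kappa> \<iota> B\<^sub>0 B\<^sub>0 A\<^sub>0 I B\<^sub>0 B\<^sub>0], of ?D] by (simp add: mu_def)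
  also have "\<dots> = (A\<^sub>0 \<bullet> p) \<cdot> (mu \<bullet> mu) \<cdot> tens_comult K dK B\<^sub>0 (comult B)"
    unfolding p_mu[symmetric] by simp
  also have "\<dots> = p\<^sub>1 \<cdot> mu" using mu_comonoid_map by (simp add: comonoid_map_def)
  finally show ?thesis .
qed

text \<open>Division of k s(b) by its image b under p leaves k, and b survives only through its
  counit. By \<open>Gam_kappa'\<close> this is an instance of \<open>kap_Gam\<close>.\<close>

lemma w_mu: "w \<cdot> mu = \<kappa>' \<odot> counit B"
proof -
  have "w \<cdot> mu = M1.kap \<cdot> M1.Gam \<cdot> (\<kappa>' \<odot> B\<^sub>0)" unfolding Gam_kappa' by (simp add: w_def)
  then show ?thesis using circ.ext2[OF M1.kap_Gam, of "\<kappa>' \<odot> B\<^sub>0"] by simp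
qed

text \<open>By \<open>co_kappa'\<close> the pair to which \<open>Lam\<close> is applied is the value
  of \<open>lam\<close>, so \<open>Lam_lam\<close> cancels both, and r cancels
  \<open>\<kappa>'\<close>. Z is left general because the case of B gives \<open>nu_mu\<close> and
  the case of C gives \<open>nuC_j\<close>.\<close>

lemma Lam_kernel:
  assumes Z: "comonoid_in \<C> S Z d e"
  shows "(r \<odot> Z) \<cdot> Lam N (co A\<^sub>0) Z \<cdot> ((\<kappa>' \<odot> e) \<bullet> (lc Z \<cdot> (\<iota> \<odot> Z))) \<cdot> tens_comult K dK Z d = K \<odot> Z"
proof -
  note [simp] = comonoid_arr[OF Z]
  have "((\<kappa>' \<odot> e) \<bullet> (lc Z \<cdot> (\<iota> \<odot> Z))) \<cdot> tens_comult K dK Z d = ((N \<odot> J) \<bullet> lc Z) \<cdot> ((\<kappa>' \<odot> e) \<bullet> (\<iota> \<odot> Z)) \<cdot> tens_comult K dK Z d" by simp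
  also have "\<dots> = ((N \<odot> J) \<bullet> lc Z) \<cdot> \<zeta> N I J Z \<cdot> (((\<kappa>' \<bullet> \<iota>) \<cdot> dK) \<odot> ((e \<bullet> Z) \<cdot> d))"
    using pair_tens[OF K_comonoid Z, of \<kappa>' \<iota> e Z N I J Z] by simp
  also have "\<dots> = lam N (co A\<^sub>0) Z \<cdot> (\<kappa>' \<odot> Z)"
    unfolding co_kappa'[symmetric] comonoid_counit_inv(1)[OF Z] by (simp add: lam_def)
  finally have "(r \<odot> Z) \<cdot> Lam N (co A\<^sub>0) Z \<cdot> ((\<kappa>' \<odot> e) \<bullet> (lc Z \<cdot> (\<iota> \<odot> Z))) \<cdot> tens_comult K dK Z d =
     (r \<odot> Z) \<cdot> Lam N (co A\<^sub>0) Z \<cdot> lam N (co A\<^sub>0) Z \<cdot> (\<kappa>' \<odot> Z)" by simp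
  also have "\<dots> = (r \<cdot> \<kappa>') \<odot> Z"
    using circ.ext2[OF Lam_lam[of A\<^sub>0 Z], of "\<kappa>' \<odot> Z"] by simp
  finally show ?thesis unfolding r_kappa' .
qed

lemma nu_mu: "nu \<cdot> mu = K \<odot> B\<^sub>0"
proof -
  have "p\<^sub>1 \<cdot> mu = (A\<^sub>0 \<bullet> p) \<cdot> (mu \<bullet> mu) \<cdot> tens_comult K dK B\<^sub>0 (comult B)"
    using mu_comonoid_map by (simp add: comonoid_map_def)
  also have "\<dots> = (mu \<bullet> (lc B\<^sub>0 \<cdot> (\<iota> \<odot> B\<^sub>0))) \<cdot> tens_comult K dK B\<^sub>0 (comult B)" unfolding p_mu[symmetric] by simp
  finally have "(w \<bullet> B\<^sub>0) \<cdot> p\<^sub>1 \<cdot> mu = ((w \<cdot> mu) \<bullet> (lc B\<^sub>0 \<cdot> (\<iota> \<odot> B\<^sub>0))) \<cdot> tens_comult K dK B\<^sub>0 (comult B)" by simp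
  then show ?thesis
    unfolding w_mu using Lam_kernel[OF B_parts(2)] by (simp add: nu_def)
qed

end

section \<open>The pullback of p along c among cocommutative comonoids\<close>

locale Hopf_pullback = Hopf_point +
  fixes C tA tC c
  assumes tA: "antipode A tA" and unt_A_mono: "mono_arrow \<C> (unt A)"
    and C: "bimonoid C" and C_cocomm: "cocommutative C" and tC: "antipode C tC"
    and c: "bimonoid_morphism C c B"
begin

abbreviation C\<^sub>0 where "C\<^sub>0 \<equiv> und C"

lemmas C_parts = bimonoid_parts[OF C]
lemmas c_parts = bimonoid_morphism_parts[OF C B c]
lemma C_cocomm': "cocomm C\<^sub>0 (comult C) (counit C)"
  using C_cocomm C_parts(2) by (simp add: cocomm_def cocommutative_def)

lemma C_arr [simp]:
  "C\<^sub>0 \<in> Ob \<C>" "mult C \<in> Arr \<C>" "Dom \<C> (mult C) = C\<^sub>0 \<odot> C\<^sub>0" "Cod \<C> (mult C) = C\<^sub>0"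
  "unt C \<in> Arr \<C>" "Dom \<C> (unt C) = I" "Cod \<C> (unt C) = C\<^sub>0"
  "comult C \<in> Arr \<C>" "Dom \<C> (comult C) = C\<^sub>0" "Cod \<C> (comult C) = C\<^sub>0 \<bullet> C\<^sub>0"
  "counit C \<in> Arr \<C>" "Dom \<C> (counit C) = C\<^sub>0" "Cod \<C> (counit C) = J"
  "c \<in> Arr \<C>" "Dom \<C> c = C\<^sub>0" "Cod \<C> c = B\<^sub>0"
  using monoid_arr[OF C_parts(1)] comonoid_arr[OF C_parts(2)] c_parts(1) by (simp_all add: comonoid_map_def)

lemma c_laws: "comult B \<cdot> c = (c \<bullet> c) \<cdot> comult C" "counit B \<cdot> c = counit C" "c \<cdot> mult C = mult B \<cdot> (c \<odot> c)" "c \<cdot> unt C = unt B"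
  using c_parts by (auto simp: comonoid_map_def monoid_map_def)

lemma sc_monoid_map: "monoid_map C\<^sub>0 (mult C) (unt C) A\<^sub>0 (mult A) (unt A) (s \<cdot> c)"
  by (rule monoid_map_comp[OF c_parts(2) s_parts(2) C_parts(1) B_parts(1) A_parts(1)])

sublocale M3: Hopf_module \<C> T S \<zeta> \<Delta>\<^sub>I m\<^sub>J \<epsilon>\<^sub>I reverse \<phi>c \<phi>c\<^sub>0 \<phi>b \<phi>b\<^sub>0 \<gamma> \<delta> \<gamma>' \<delta>' C tC A\<^sub>0 "mult A \<cdot> (A\<^sub>0 \<odot> (s \<cdot> c))"
  by unfold_locales (use C tC action_of_monoid_map[OF A_parts(1) C_parts(1) sc_monoid_map] in simp_all)

abbreviation P where "P \<equiv> K \<odot> C\<^sub>0"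
abbreviation dP where "dP \<equiv> tens_comult K dK C\<^sub>0 (comult C)"
abbreviation eP where "eP \<equiv> tens_counit eK (counit C)"
definition pA where "pA = mu \<cdot> (K \<odot> c)"
definition pC where "pC = lc C\<^sub>0 \<cdot> (\<iota> \<odot> C\<^sub>0)"
text \<open>\<open>j\<close> embeds the pullback in A \<bullet> C, as a fibre product is embedded in
  a product. Its retraction \<open>nuC\<close> is, on elements, (a, x) to a_1 s(p a_2)^-1 \<odot>
  x.\<close>

definition j where "j = (pA \<bullet> pC) \<cdot> dP"
definition nuC where "nuC = (r \<odot> C\<^sub>0) \<cdot> Lam N (co A\<^sub>0) C\<^sub>0 \<cdot> (w \<bullet> C\<^sub>0)"

lemma P_arr [simp]: "pA \<in> Arr \<C>" "Dom \<C> pA = P" "Cod \<C> pA = A\<^sub>0" "pC \<in> Arr \<C>" "Dom \<C> pC = P" "Cod \<C> pC = C\<^sub>0"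
  "j \<in> Arr \<C>" "Dom \<C> j = P" "Cod \<C> j = A\<^sub>0 \<bullet> C\<^sub>0" "nuC \<in> Arr \<C>" "Dom \<C> nuC = A\<^sub>0 \<bullet> C\<^sub>0" "Cod \<C> nuC = P"
  by (simp_all add: pA_def pC_def j_def nuC_def)

text \<open>Evaluating the factor C at its unit recovers the inclusion of the kernel, since s and c
  preserve units. This is how arrows between pullbacks are brought back to kernels.\<close>

lemma pA_unit: "pA \<cdot> (K \<odot> unt C) \<cdot> rci K = \<kappa>"
proof -
  have "pA \<cdot> (K \<odot> unt C) \<cdot> rci K = mult A \<cdot> (\<kappa> \<odot> (s \<cdot> c \<cdot> unt C)) \<cdot> rci K" by (simp add: pA_def mu_def)
  also have "\<dots> = (mult A \<cdot> (A\<^sub>0 \<odot> unt A)) \<cdot> (\<kappa> \<odot> I) \<cdot> rci K" by (simp add: c_laws s_laws)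
  also have "\<dots> = rc A\<^sub>0 \<cdot> (\<kappa> \<odot> I) \<cdot> rci K" unfolding A_laws ..
  also have "\<dots> = \<kappa>" using circ.ext2[OF circ.runit_nat[of \<kappa> A\<^sub>0], of "rci K"] by simp
  finally show ?thesis .
qed

lemma P_comonoid: "comonoid_in \<C> S P dP eP"
  by (rule comonoid_tens[OF K_comonoid C_parts(2)])

lemma P_cocomm: "cocomm P dP eP"
  by (rule cocomm_tens[OF K_cocomm C_cocomm'])

lemma pA_comonoid_map: "comonoid_map P dP eP A\<^sub>0 (comult A) (counit A) pA"
  unfolding pA_def
  by (rule comonoid_map_comp[OF comonoid_map_tens[OF K_comonoid C_parts(2) K_comonoid B_parts(2) comonoid_map_id[OF K_comonoid] c_parts(1)] mu_comonoid_map
    P_comonoid comonoid_tens[OF K_comonoid B_parts(2)] A_parts(2)])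

lemma pC_comonoid_map: "comonoid_map P dP eP C\<^sub>0 (comult C) (counit C) pC"
  unfolding pC_def
  by (rule comonoid_map_comp[OF comonoid_map_tens[OF K_comonoid C_parts(2) I_comonoid C_parts(2) iota_comonoid_map comonoid_map_id[OF C_parts(2)]]
    comonoid_map_lc[OF C_parts(2)] P_comonoid comonoid_tens[OF I_comonoid C_parts(2)] C_parts(2)])

lemma p_pA: "p \<cdot> pA = c \<cdot> pC"
  using circ.ext2[OF p_mu, of "K \<odot> c"] circ.ext2[OF circ.lunit_nat[of c B\<^sub>0], of "\<iota> \<odot> C\<^sub>0"] by (simp add: pA_def pC_def)

lemma w_pA: "w \<cdot> pA = \<kappa>' \<odot> counit C"
  using circ.ext2[OF w_mu, of "K \<odot> c"] by (simp add: pA_def c_laws)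

lemma nuC_j: "nuC \<cdot> j = P"
proof -
  have "nuC \<cdot> j = (r \<odot> C\<^sub>0) \<cdot> Lam N (co A\<^sub>0) C\<^sub>0 \<cdot> ((w \<cdot> pA) \<bullet> pC) \<cdot> dP" by (simp add: nuC_def j_def)
  then show ?thesis unfolding w_pA pC_def using Lam_kernel[OF C_parts(2)] by simp
qed

lemma j_Gam: "j = M3.Gam \<cdot> (\<kappa>' \<odot> C\<^sub>0)"
proof -
  let ?D = "dK \<odot> comult C" and ?a = "mult A \<cdot> (A\<^sub>0 \<odot> (s \<cdot> c))"
  have "M3.Gam \<cdot> (\<kappa>' \<odot> C\<^sub>0) = (?a \<bullet> lc C\<^sub>0) \<cdot> \<zeta> A\<^sub>0 I C\<^sub>0 C\<^sub>0 \<cdot> (N \<odot> comult C) \<cdot> (((\<kappa> \<bullet> \<iota>) \<cdot> dK) \<odot> C\<^sub>0)"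
    unfolding kappa'_pair[symmetric] by (simp add: M3.Gam_def)
  also have "\<dots> = (pA \<bullet> pC) \<cdot> dP"
    using circ.ext2[OF zeta_nat[of \<kappa> \<iota> C\<^sub>0 C\<^sub>0 A\<^sub>0 I C\<^sub>0 C\<^sub>0], of ?D] by (simp add: mu_def pA_def pC_def)
  finally show ?thesis by (simp add: j_def)
qed

lemma j_components: "rb A\<^sub>0 \<cdot> (A\<^sub>0 \<bullet> counit C) \<cdot> j = pA" "lb C\<^sub>0 \<cdot> (counit A \<bullet> C\<^sub>0) \<cdot> j = pC" "counit A \<cdot> pA = eP"
proof -
  have e: "counit A \<cdot> pA = eP" "counit C \<cdot> pC = eP"
    using pA_comonoid_map pC_comonoid_map unfolding comonoid_map_def by blast+
  show "counit A \<cdot> pA = eP" by (rule e)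
  have "rb A\<^sub>0 \<cdot> (A\<^sub>0 \<bullet> counit C) \<cdot> j = rb A\<^sub>0 \<cdot> (pA \<bullet> (counit C \<cdot> pC)) \<cdot> dP" by (simp add: j_def)
  then show "rb A\<^sub>0 \<cdot> (A\<^sub>0 \<bullet> counit C) \<cdot> j = pA"
    unfolding e using pair_counit_right[OF P_comonoid, of pA A\<^sub>0] by simp
  have "lb C\<^sub>0 \<cdot> (counit A \<bullet> C\<^sub>0) \<cdot> j = lb C\<^sub>0 \<cdot> ((counit A \<cdot> pA) \<bullet> pC) \<cdot> dP" by (simp add: j_def)
  then show "lb C\<^sub>0 \<cdot> (counit A \<bullet> C\<^sub>0) \<cdot> j = pC"
    unfolding e using pair_counit_left[OF P_comonoid, of pC C\<^sub>0] by simp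
qed

text \<open>On elements z_1 s(p z_2)^-1 \<odot> y. The formula makes sense for arbitrary z and y; it
  yields a factorization of the pair when p z = c y.\<close>

definition lift where "lift d z y = nuC \<cdot> (z \<bullet> y) \<cdot> d"

text \<open>On elements, (z s(p z)^-1 s(c y_1), y_2) = (z, y): replacing c y by p z turns the first
  component into \<open>division\<close>, and \<open>om_Lam\<close> carries the second component
  along.\<close>

lemma Gam_w:
  assumes Z: "comonoid_in \<C> S Z d e" and z: "comonoid_map Z d e A\<^sub>0 (comult A) (counit A) z"
    and y: "comonoid_map Z d e C\<^sub>0 (comult C) (counit C) y" and zy: "p \<cdot> z = c \<cdot> y"
  shows "M3.Gam \<cdot> Lam N (co A\<^sub>0) C\<^sub>0 \<cdot> (w \<bullet> C\<^sub>0) \<cdot> (z \<bullet> y) \<cdot> d = (z \<bullet> y) \<cdot> d"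
proof -
  note [simp] = comonoid_arr[OF Z]
  have [simp]: "z \<in> Arr \<C>" "Dom \<C> z = Z" "Cod \<C> z = A\<^sub>0" "y \<in> Arr \<C>" "Dom \<C> y = Z" "Cod \<C> y = C\<^sub>0"
    and dz: "comult A \<cdot> z = (z \<bullet> z) \<cdot> d" and dy: "comult C \<cdot> y = (y \<bullet> y) \<cdot> d"
    using z y by (auto simp: comonoid_map_def)
  let ?L = "Lam N (co A\<^sub>0)" and ?G = "N \<odot> J" and ?a = "mult A \<cdot> (A\<^sub>0 \<odot> (s \<cdot> c))"
  have "?a \<cdot> (pi1 A\<^sub>0 \<odot> C\<^sub>0) \<cdot> ?L C\<^sub>0 \<cdot> ((w \<cdot> z) \<bullet> y) \<cdot> d = a \<cdot> (pi1 A\<^sub>0 \<odot> B\<^sub>0) \<cdot> (N \<odot> c) \<cdot> ?L C\<^sub>0 \<cdot> ((w \<cdot> z) \<bullet> y) \<cdot> d"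
    by simp
  also have "\<dots> = a \<cdot> (pi1 A\<^sub>0 \<odot> B\<^sub>0) \<cdot> ?L B\<^sub>0 \<cdot> ((w \<cdot> z) \<bullet> (c \<cdot> y)) \<cdot> d"
    using circ.ext2[OF Lam_nat[of N "co A\<^sub>0" N "co A\<^sub>0" N c C\<^sub>0 B\<^sub>0, symmetric], of "((w \<cdot> z) \<bullet> y) \<cdot> d"] by simp
  also have "\<dots> = a \<cdot> (pi1 A\<^sub>0 \<odot> B\<^sub>0) \<cdot> ?L B\<^sub>0 \<cdot> (w \<bullet> p) \<cdot> (z \<bullet> z) \<cdot> d"
    unfolding zy[symmetric] by simp
  also have "\<dots> = (a \<cdot> (pi1 A\<^sub>0 \<odot> B\<^sub>0) \<cdot> ?L B\<^sub>0 \<cdot> (w \<bullet> p) \<cdot> comult A) \<cdot> z" unfolding dz[symmetric] by simp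
  also have "\<dots> = z" unfolding division by simp
  finally have 1: "?a \<cdot> (pi1 A\<^sub>0 \<odot> C\<^sub>0) \<cdot> ?L C\<^sub>0 \<cdot> ((w \<cdot> z) \<bullet> y) \<cdot> d = z" .
  have "M3.Gam \<cdot> ?L C\<^sub>0 \<cdot> (w \<bullet> C\<^sub>0) \<cdot> (z \<bullet> y) \<cdot> d = ((?a \<cdot> (pi1 A\<^sub>0 \<odot> C\<^sub>0)) \<bullet> C\<^sub>0) \<cdot> (M3.om \<cdot> ?L C\<^sub>0) \<cdot> ((w \<cdot> z) \<bullet> y) \<cdot> d"
    unfolding M3.Gam_om by simp
  also have "\<dots> = ((?a \<cdot> (pi1 A\<^sub>0 \<odot> C\<^sub>0) \<cdot> ?L C\<^sub>0) \<bullet> C\<^sub>0) \<cdot> abi ?G C\<^sub>0 C\<^sub>0 \<cdot> ((w \<cdot> z) \<bullet> (comult C \<cdot> y)) \<cdot> d"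
    unfolding M3.om_Lam by simp
  also have "\<dots> = ((?a \<cdot> (pi1 A\<^sub>0 \<odot> C\<^sub>0) \<cdot> ?L C\<^sub>0) \<bullet> C\<^sub>0) \<cdot> ((((w \<cdot> z) \<bullet> y) \<cdot> d) \<bullet> y) \<cdot> d"
    unfolding dy using pair_assoc_inv[OF Z, of "w \<cdot> z" y y] by simp
  also have "\<dots> = ((?a \<cdot> (pi1 A\<^sub>0 \<odot> C\<^sub>0) \<cdot> ?L C\<^sub>0 \<cdot> ((w \<cdot> z) \<bullet> y) \<cdot> d) \<bullet> y) \<cdot> d" by simp
  also have "\<dots> = (z \<bullet> y) \<cdot> d" unfolding 1 ..
  finally show ?thesis .
qed

lemma j_nuC: "j \<cdot> nuC = M3.Gam \<cdot> Lam N (co A\<^sub>0) C\<^sub>0 \<cdot> (w \<bullet> C\<^sub>0)"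
proof -
  have "j \<cdot> nuC = M3.Gam \<cdot> ((\<kappa>' \<cdot> r) \<odot> C\<^sub>0) \<cdot> Lam N (co A\<^sub>0) C\<^sub>0 \<cdot> (w \<bullet> C\<^sub>0)" unfolding j_Gam by (simp add: nuC_def)
  then show ?thesis unfolding kappa'_r using rho_w[of "A\<^sub>0 \<bullet> C\<^sub>0" C\<^sub>0] by simp
qed

lemma j_lift:
  assumes Z: "comonoid_in \<C> S Z d e" and z: "comonoid_map Z d e A\<^sub>0 (comult A) (counit A) z"
    and y: "comonoid_map Z d e C\<^sub>0 (comult C) (counit C) y" and zy: "p \<cdot> z = c \<cdot> y"
  shows "j \<cdot> lift d z y = (z \<bullet> y) \<cdot> d"
proof -
  note [simp] = comonoid_arr[OF Z]
  have [simp]: "z \<in> Arr \<C>" "Dom \<C> z = Z" "Cod \<C> z = A\<^sub>0" "y \<in> Arr \<C>" "Dom \<C> y = Z" "Cod \<C> y = C\<^sub>0"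
    using z y by (auto simp: comonoid_map_def)
  show ?thesis
    using circ.ext2[OF j_nuC, of "(z \<bullet> y) \<cdot> d"] Gam_w[OF assms] by (simp add: lift_def)
qed

lemma j_cancel:
  assumes "j \<cdot> x = j \<cdot> y" "x \<in> Arr \<C>" "y \<in> Arr \<C>" "Cod \<C> x = P" "Cod \<C> y = P"
  shows "x = y"
  using nuC_j assms by (intro circ.split_mono[of nuC j x y]) simp_all

text \<open>Cocommutativity of Z is used for the comultiplication: both sides are compared in (A
  \<bullet> C) \<bullet> (A \<bullet> C) through j, and there \<open>shuffle_pair\<close> handles
  the doubled pair, for P as well as for Z.\<close>

lemma lift_props:
  assumes Z: "cocomm Z d e" and z: "comonoid_map Z d e A\<^sub>0 (comult A) (counit A) z"
    and y: "comonoid_map Z d e C\<^sub>0 (comult C) (counit C) y" and zy: "p \<cdot> z = c \<cdot> y"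
  shows "comonoid_map Z d e P dP eP (lift d z y)" "pA \<cdot> lift d z y = z" "pC \<cdot> lift d z y = y"
proof -
  note Zc = cocomm_comonoid[OF Z]
  note [simp] = comonoid_arr[OF Zc]
  have [simp]: "z \<in> Arr \<C>" "Dom \<C> z = Z" "Cod \<C> z = A\<^sub>0" "y \<in> Arr \<C>" "Dom \<C> y = Z" "Cod \<C> y = C\<^sub>0"
    and ez: "counit A \<cdot> z = e" and ey: "counit C \<cdot> y = e"
    using z y by (auto simp: comonoid_map_def)
  define n where "n = lift d z y"
  have [simp]: "n \<in> Arr \<C>" "Dom \<C> n = Z" "Cod \<C> n = P" by (simp_all add: n_def lift_def)
  have jn: "j \<cdot> n = (z \<bullet> y) \<cdot> d" unfolding n_def by (rule j_lift[OF Zc z y zy])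
  have "pA \<cdot> n = rb A\<^sub>0 \<cdot> (A\<^sub>0 \<bullet> counit C) \<cdot> j \<cdot> n" using circ.ext3[OF j_components(1), of n] by simp
  also have "\<dots> = z" unfolding jn using pair_counit_right[OF Zc, of z A\<^sub>0] by (simp add: ey)
  finally have An: "pA \<cdot> n = z" .
  have "pC \<cdot> n = lb C\<^sub>0 \<cdot> (counit A \<bullet> C\<^sub>0) \<cdot> j \<cdot> n" using circ.ext3[OF j_components(2), of n] by simp
  also have "\<dots> = y" unfolding jn using pair_counit_left[OF Zc, of y C\<^sub>0] by (simp add: ez)
  finally have Cn: "pC \<cdot> n = y" .
  let ?sh = "shuffle A\<^sub>0 (comult A) C\<^sub>0 (comult C)"
  have "(j \<bullet> j) \<cdot> dP \<cdot> n = (?sh \<cdot> j) \<cdot> n"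
    using shuffle_pair[OF P_cocomm A_parts(2) C_parts(2) pA_comonoid_map pC_comonoid_map, folded j_def] by simp
  also have "\<dots> = ?sh \<cdot> (z \<bullet> y) \<cdot> d" using jn by simp
  also have "\<dots> = ((j \<cdot> n) \<bullet> (j \<cdot> n)) \<cdot> d" unfolding jn by (rule shuffle_pair[OF Z A_parts(2) C_parts(2) z y])
  also have "\<dots> = (j \<bullet> j) \<cdot> (n \<bullet> n) \<cdot> d" by simp
  finally have "dP \<cdot> n = (n \<bullet> n) \<cdot> d"
    using nuC_j by (intro circ.split_mono[of "nuC \<bullet> nuC" "j \<bullet> j" "dP \<cdot> n" "(n \<bullet> n) \<cdot> d"]) simp_all
  moreover have "eP \<cdot> n = e"
    using circ.ext2[OF j_components(3), of n] An ez by simp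
  ultimately show "comonoid_map Z d e P dP eP (lift d z y)" "pA \<cdot> lift d z y = z" "pC \<cdot> lift d z y = y"
    using An Cn unfolding n_def[symmetric] by (simp_all add: comonoid_map_def)
qed

text \<open>For a comonoid map n, \<open>j \<cdot> n\<close> is the pair of its two projections, and
  j is a split monomorphism. So the projections are jointly monic on comonoid maps.\<close>

lemma lift_unique:
  assumes Z: "comonoid_in \<C> S Z d e" and n: "comonoid_map Z d e P dP eP n" and n': "comonoid_map Z d e P dP eP n'"
    and e: "pA \<cdot> n = pA \<cdot> n'" "pC \<cdot> n = pC \<cdot> n'"
  shows "n = n'"
proof -
  note [simp] = comonoid_arr[OF Z]
  have [simp]: "n \<in> Arr \<C>" "Dom \<C> n = Z" "Cod \<C> n = P" "n' \<in> Arr \<C>" "Dom \<C> n' = Z" "Cod \<C> n' = P"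
    using n n' by (auto simp: comonoid_map_def)
  have "j \<cdot> n = ((pA \<cdot> n) \<bullet> (pC \<cdot> n)) \<cdot> d" using pair_comonoid_map[OF n Z P_comonoid, of pA pC] by (simp add: j_def)
  also have "\<dots> = j \<cdot> n'" unfolding e using pair_comonoid_map[OF n' Z P_comonoid, of pA pC] by (simp add: j_def)
  finally show ?thesis by (rule j_cancel) simp_all
qed

end

section \<open>Criteria for the bimonoid structure of the pullback\<close>

context duoidal_category
begin

text \<open>A multiplicative arrow f into a monoid makes the monoid laws of P hold after f. Used for
  both projections, this gives the laws of P, because the projections are jointly monic on comonoid
  maps.\<close>

lemma monoid_pullback:
  assumes M: "monoid_in \<C> T M m u" and [simp]: "f \<in> Arr \<C>" "Dom \<C> f = P" "Cod \<C> f = M"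
    "mP \<in> Arr \<C>" "Dom \<C> mP = P \<odot> P" "Cod \<C> mP = P" "uP \<in> Arr \<C>" "Dom \<C> uP = I" "Cod \<C> uP = P"
    and fm: "f \<cdot> mP = m \<cdot> (f \<odot> f)" and fu: "f \<cdot> uP = u"
  shows "f \<cdot> mP \<cdot> (mP \<odot> P) = f \<cdot> mP \<cdot> (P \<odot> mP) \<cdot> ac P P P" "f \<cdot> mP \<cdot> (uP \<odot> P) = f \<cdot> lc P" "f \<cdot> mP \<cdot> (P \<odot> uP) = f \<cdot> rc P"
proof -
  note [simp] = monoid_arr[OF M]
  have [simp]: "P \<in> Ob \<C>" using circ.dom_ob[of f] by simp
  have "f \<cdot> mP \<cdot> (mP \<odot> P) = m \<cdot> (f \<odot> f) \<cdot> (mP \<odot> P)" using circ.ext2[OF fm, of "mP \<odot> P"] by simp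
  also have "\<dots> = (m \<cdot> (m \<odot> M)) \<cdot> ((f \<odot> f) \<odot> f)" by (simp add: fm)
  also have "\<dots> = m \<cdot> (M \<odot> m) \<cdot> (f \<odot> (f \<odot> f)) \<cdot> ac P P P" unfolding monoid_laws[OF M] by (simp add: circ.assoc_nat)
  also have "\<dots> = m \<cdot> (f \<odot> f) \<cdot> (P \<odot> mP) \<cdot> ac P P P" by (simp add: fm)
  also have "\<dots> = f \<cdot> mP \<cdot> (P \<odot> mP) \<cdot> ac P P P" using circ.ext2[OF fm, of "(P \<odot> mP) \<cdot> ac P P P"] by simp
  finally show "f \<cdot> mP \<cdot> (mP \<odot> P) = f \<cdot> mP \<cdot> (P \<odot> mP) \<cdot> ac P P P" .
  have "f \<cdot> mP \<cdot> (uP \<odot> P) = m \<cdot> (f \<odot> f) \<cdot> (uP \<odot> P)" using circ.ext2[OF fm, of "uP \<odot> P"] by simp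
  also have "\<dots> = (m \<cdot> (u \<odot> M)) \<cdot> (I \<odot> f)" by (simp add: fu)
  finally show "f \<cdot> mP \<cdot> (uP \<odot> P) = f \<cdot> lc P" unfolding monoid_laws[OF M] by (simp add: circ.lunit_nat)
  have "f \<cdot> mP \<cdot> (P \<odot> uP) = m \<cdot> (f \<odot> f) \<cdot> (P \<odot> uP)" using circ.ext2[OF fm, of "P \<odot> uP"] by simp
  also have "\<dots> = (m \<cdot> (M \<odot> u)) \<cdot> (f \<odot> I)" by (simp add: fu)
  finally show "f \<cdot> mP \<cdot> (P \<odot> uP) = f \<cdot> rc P" unfolding monoid_laws[OF M] by (simp add: circ.runit_nat)
qed

lemma bimonoidI:
  assumes M: "monoid_in \<C> T (und H) (mult H) (unt H)" and Z: "comonoid_in \<C> S (und H) (comult H) (counit H)"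
    and m: "comonoid_map (und H \<odot> und H) (tens_comult (und H) (comult H) (und H) (comult H)) (tens_counit (counit H) (counit H))
      (und H) (comult H) (counit H) (mult H)"
    and u: "comonoid_map I \<Delta>\<^sub>I \<epsilon>\<^sub>I (und H) (comult H) (counit H) (unt H)"
  shows "bimonoid H"
  using m u by (auto simp: bimonoid_def comonoid_map_def M Z)

lemma bimonoid_morphismI:
  assumes "comonoid_map (und H) (comult H) (counit H) (und K) (comult K) (counit K) f"
    "monoid_map (und H) (mult H) (unt H) (und K) (mult K) (unt K) f"
  shows "bimonoid_morphism H f K"
  using assms by (auto simp: bimonoid_morphism_def comonoid_map_def monoid_map_def hom_def)

end

context Hopf_pullback
begin

abbreviation dPP where "dPP \<equiv> tens_comult P dP P dP"
abbreviation ePP where "ePP \<equiv> tens_counit eP eP"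
text \<open>On elements (a, x) (a', x') = (a a', x x'). It is a lift out of P \<odot> P, which is
  again a cocommutative comonoid.\<close>

definition mP where "mP = lift dPP (mult A \<cdot> (pA \<odot> pA)) (mult C \<cdot> (pC \<odot> pC))"
definition uP where "uP = lift \<Delta>\<^sub>I (unt A) (unt C)"

lemma mP_props: "comonoid_map (P \<odot> P) dPP ePP P dP eP mP"
    "pA \<cdot> mP = mult A \<cdot> (pA \<odot> pA)" "pC \<cdot> mP = mult C \<cdot> (pC \<odot> pC)"
proof -
  have zA: "comonoid_map (P \<odot> P) dPP ePP A\<^sub>0 (comult A) (counit A) (mult A \<cdot> (pA \<odot> pA))"
    by (rule comonoid_map_comp[OF comonoid_map_tens[OF P_comonoid P_comonoid A_parts(2) A_parts(2) pA_comonoid_map pA_comonoid_map] A_parts(3)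
      comonoid_tens[OF P_comonoid P_comonoid] comonoid_tens[OF A_parts(2) A_parts(2)] A_parts(2)])
  have zC: "comonoid_map (P \<odot> P) dPP ePP C\<^sub>0 (comult C) (counit C) (mult C \<cdot> (pC \<odot> pC))"
    by (rule comonoid_map_comp[OF comonoid_map_tens[OF P_comonoid P_comonoid C_parts(2) C_parts(2) pC_comonoid_map pC_comonoid_map] C_parts(3)
      comonoid_tens[OF P_comonoid P_comonoid] comonoid_tens[OF C_parts(2) C_parts(2)] C_parts(2)])
  have "p \<cdot> mult A \<cdot> (pA \<odot> pA) = mult B \<cdot> ((p \<cdot> pA) \<odot> (p \<cdot> pA))" using circ.ext2[OF p_laws(3), of "pA \<odot> pA"] by simp
  also have "\<dots> = c \<cdot> mult C \<cdot> (pC \<odot> pC)" unfolding p_pA using circ.ext2[OF c_laws(3), of "pC \<odot> pC"] by simp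
  finally have e: "p \<cdot> mult A \<cdot> (pA \<odot> pA) = c \<cdot> mult C \<cdot> (pC \<odot> pC)" .
  show "comonoid_map (P \<odot> P) dPP ePP P dP eP mP" "pA \<cdot> mP = mult A \<cdot> (pA \<odot> pA)" "pC \<cdot> mP = mult C \<cdot> (pC \<odot> pC)"
    unfolding mP_def by (rule lift_props[OF cocomm_tens[OF P_cocomm P_cocomm] zA zC e])+
qed

lemma uP_props: "comonoid_map I \<Delta>\<^sub>I \<epsilon>\<^sub>I P dP eP uP" "pA \<cdot> uP = unt A" "pC \<cdot> uP = unt C"
proof -
  have "p \<cdot> unt A = c \<cdot> unt C" by (simp add: p_laws c_laws)
  from lift_props[OF cocomm_I A_parts(4) C_parts(4) this]
  show "comonoid_map I \<Delta>\<^sub>I \<epsilon>\<^sub>I P dP eP uP" "pA \<cdot> uP = unt A" "pC \<cdot> uP = unt C" unfolding uP_def .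
qed

lemma mP_arr [simp]: "mP \<in> Arr \<C>" "Dom \<C> mP = P \<odot> P" "Cod \<C> mP = P" "uP \<in> Arr \<C>" "Dom \<C> uP = I" "Cod \<C> uP = P"
  using mP_props(1) uP_props(1) unfolding comonoid_map_def by blast+

text \<open>In each law both sides are comonoid maps into P, so \<open>lift_unique\<close> reduces
  it to the two projections, where \<open>monoid_pullback\<close> applies. The constraints of
  \<odot> enter as comonoid maps.\<close>

lemma P_monoid: "monoid_in \<C> T P mP uP"
proof (rule monoid_inI)
  note PP = comonoid_tens[OF P_comonoid P_comonoid]
  note idP = comonoid_map_id[OF P_comonoid]
  note A = monoid_pullback[OF A_parts(1) _ _ _ _ _ _ _ _ _ mP_props(2) uP_props(2)]
  note C = monoid_pullback[OF C_parts(1) _ _ _ _ _ _ _ _ _ mP_props(3) uP_props(3)]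
  note m = comonoid_map_comp[OF _ mP_props(1) _ PP P_comonoid]
  have 1: "comonoid_map ((P \<odot> P) \<odot> P) (tens_comult (P \<odot> P) dPP P dP) (tens_counit ePP eP) P dP eP (mP \<cdot> (mP \<odot> P))"
    by (rule m[OF comonoid_map_tens[OF PP P_comonoid P_comonoid P_comonoid mP_props(1) idP] comonoid_tens[OF PP P_comonoid]])
  have 2: "comonoid_map ((P \<odot> P) \<odot> P) (tens_comult (P \<odot> P) dPP P dP) (tens_counit ePP eP) P dP eP (mP \<cdot> (P \<odot> mP) \<cdot> ac P P P)"
    by (rule m[OF comonoid_map_comp[OF comonoid_map_ac[OF P_comonoid P_comonoid P_comonoid]
      comonoid_map_tens[OF P_comonoid PP P_comonoid P_comonoid idP mP_props(1)] comonoid_tens[OF PP P_comonoid] comonoid_tens[OF P_comonoid PP] PP] comonoid_tens[OF PP P_comonoid]])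
  show "mP \<cdot> (mP \<odot> P) = mP \<cdot> (P \<odot> mP) \<cdot> ac P P P"
    by (rule lift_unique[OF comonoid_tens[OF PP P_comonoid] 1 2]; rule A(1) C(1); simp)
  have 3: "comonoid_map (I \<odot> P) (tens_comult I \<Delta>\<^sub>I P dP) (tens_counit \<epsilon>\<^sub>I eP) P dP eP (mP \<cdot> (uP \<odot> P))"
    by (rule m[OF comonoid_map_tens[OF I_comonoid P_comonoid P_comonoid P_comonoid uP_props(1) idP] comonoid_tens[OF I_comonoid P_comonoid]])
  show "mP \<cdot> (uP \<odot> P) = lc P"
    by (rule lift_unique[OF comonoid_tens[OF I_comonoid P_comonoid] 3 comonoid_map_lc[OF P_comonoid]]; rule A(2) C(2); simp)
  have 4: "comonoid_map (P \<odot> I) (tens_comult P dP I \<Delta>\<^sub>I) (tens_counit eP \<epsilon>\<^sub>I) P dP eP (mP \<cdot> (P \<odot> uP))"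
    by (rule m[OF comonoid_map_tens[OF P_comonoid I_comonoid P_comonoid P_comonoid idP uP_props(1)] comonoid_tens[OF P_comonoid I_comonoid]])
  show "mP \<cdot> (P \<odot> uP) = rc P"
    by (rule lift_unique[OF comonoid_tens[OF P_comonoid I_comonoid] 4 comonoid_map_rc[OF P_comonoid]]; rule A(3) C(3); simp)
qed simp_all

definition PB where "PB = \<lparr>und = P, mult = mP, unt = uP, comult = dP, counit = eP\<rparr>"

lemma PB_simps [simp]: "und PB = P" "mult PB = mP" "unt PB = uP" "comult PB = dP" "counit PB = eP"
  by (simp_all only: PB_def bimonoid_data.simps)

lemma PB_bimonoid: "bimonoid PB"
  by (rule bimonoidI; simp only: PB_simps) (rule P_monoid P_comonoid mP_props(1) uP_props(1))+

lemma PB_cocommutative: "cocommutative PB"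
  using P_cocomm unfolding cocomm_def cocommutative_def PB_simps by blast

lemma PB_unt_mono: "mono_arrow \<C> (unt PB)"
proof (rule circ.mono_arrowI)
  fix x y assume xy: "x \<in> Arr \<C>" "y \<in> Arr \<C>" "Dom \<C> x = Dom \<C> y" "Cod \<C> x = Dom \<C> (unt PB)" "Cod \<C> y = Dom \<C> (unt PB)"
    "unt PB \<cdot> x = unt PB \<cdot> y"
  have "pA \<cdot> uP \<cdot> x = pA \<cdot> uP \<cdot> y" using xy(6) unfolding PB_simps by (rule arg_cong)
  then have "unt A \<cdot> x = unt A \<cdot> y"
    using circ.ext2[OF uP_props(2), of x] circ.ext2[OF uP_props(2), of y] xy by simp
  then show "x = y" using xy by (intro circ.mono_cancel[OF unt_A_mono, of x y]) simp_all
qed simp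

lemma pA_monoid_map: "monoid_map P mP uP A\<^sub>0 (mult A) (unt A) pA"
  and pC_monoid_map: "monoid_map P mP uP C\<^sub>0 (mult C) (unt C) pC"
  using mP_props uP_props by (simp_all add: monoid_map_def)

lemma pA_morphism: "bimonoid_morphism PB pA A" and pC_morphism: "bimonoid_morphism PB pC C"
  by (rule bimonoid_morphismI; simp only: PB_simps pA_comonoid_map pC_comonoid_map pA_monoid_map pC_monoid_map)+

text \<open>Multiplicativity of the comonoid lift follows from uniqueness: both sides of each
  condition are comonoid maps with the same projections.\<close>

lemma lift_morphism:
  assumes Z: "bimonoid Z" "cocommutative Z" and z: "bimonoid_morphism Z z A" and y: "bimonoid_morphism Z y C" and zy: "p \<cdot> z = c \<cdot> y"
  shows "bimonoid_morphism Z (lift (comult Z) z y) PB" "pA \<cdot> lift (comult Z) z y = z" "pC \<cdot> lift (comult Z) z y = y"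
proof -
  note Zp = bimonoid_parts[OF Z(1)]
  note zp = bimonoid_morphism_parts[OF Z(1) A z] and yp = bimonoid_morphism_parts[OF Z(1) C y]
  note [simp] = monoid_arr[OF Zp(1)] comonoid_arr[OF Zp(2)]
  have "cocomm (und Z) (comult Z) (counit Z)" using Z(2) Zp(2) by (simp add: cocomm_def cocommutative_def)
  note lp = lift_props[OF this zp(1) yp(1) zy]
  let ?n = "lift (comult Z) z y"
  have [simp]: "?n \<in> Arr \<C>" "Dom \<C> ?n = und Z" "Cod \<C> ?n = P"
    using lp(1) unfolding comonoid_map_def by blast+
  have zm: "z \<cdot> mult Z = mult A \<cdot> (z \<odot> z)" "z \<cdot> unt Z = unt A" and ym: "y \<cdot> mult Z = mult C \<cdot> (y \<odot> y)" "y \<cdot> unt Z = unt C"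
    using zp(2) yp(2) unfolding monoid_map_def by blast+
  have 1: "?n \<cdot> mult Z = mP \<cdot> (?n \<odot> ?n)"
  proof (rule lift_unique[OF comonoid_tens[OF Zp(2) Zp(2)]
      comonoid_map_comp[OF Zp(3) lp(1) comonoid_tens[OF Zp(2) Zp(2)] Zp(2) P_comonoid]
      comonoid_map_comp[OF comonoid_map_tens[OF Zp(2) Zp(2) P_comonoid P_comonoid lp(1) lp(1)] mP_props(1) comonoid_tens[OF Zp(2) Zp(2)] comonoid_tens[OF P_comonoid P_comonoid] P_comonoid]])
    show "pA \<cdot> ?n \<cdot> mult Z = pA \<cdot> mP \<cdot> (?n \<odot> ?n)"
      using circ.ext2[OF lp(2), of "mult Z"] circ.ext2[OF mP_props(2), of "?n \<odot> ?n"] by (simp add: lp zm)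
    show "pC \<cdot> ?n \<cdot> mult Z = pC \<cdot> mP \<cdot> (?n \<odot> ?n)"
      using circ.ext2[OF lp(3), of "mult Z"] circ.ext2[OF mP_props(3), of "?n \<odot> ?n"] by (simp add: lp ym)
  qed
  have 2: "?n \<cdot> unt Z = uP"
  proof (rule lift_unique[OF I_comonoid comonoid_map_comp[OF Zp(4) lp(1) I_comonoid Zp(2) P_comonoid] uP_props(1)])
    show "pA \<cdot> ?n \<cdot> unt Z = pA \<cdot> uP"
      using circ.ext2[OF lp(2), of "unt Z"] by (simp add: uP_props zm)
    show "pC \<cdot> ?n \<cdot> unt Z = pC \<cdot> uP"
      using circ.ext2[OF lp(3), of "unt Z"] by (simp add: uP_props ym)
  qed
  show "bimonoid_morphism Z ?n PB"
    using 1 2 lp(1) by (intro bimonoid_morphismI) (simp_all add: monoid_map_def)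
  show "pA \<cdot> ?n = z" "pC \<cdot> ?n = y" by (rule lp)+
qed

lemma lift_morphism_unique:
  assumes Z: "bimonoid Z" and n: "bimonoid_morphism Z n PB" and n': "bimonoid_morphism Z n' PB"
    and e: "pA \<cdot> n = pA \<cdot> n'" "pC \<cdot> n = pC \<cdot> n'"
  shows "n = n'"
  using lift_unique[OF bimonoid_parts(2)[OF Z] _ _ e] bimonoid_morphism_parts(1)[OF Z PB_bimonoid n]
    bimonoid_morphism_parts(1)[OF Z PB_bimonoid n'] by (simp only: PB_simps)

end

section \<open>The antipode of the pullback\<close>

context reversion
begin

text \<open>The convolution equations of M live in (M \<bullet> I) \<odot> J and J \<odot> (I
  \<bullet> M), and the image of f there is split by the image of g. So an equation between images
  under f already holds in M.\<close>

lemma inverse_reflect: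
  assumes f: "monoid_map M m u M' m' u' f" and M: "monoid_in \<C> T M m u" "monoid_in \<C> T M' m' u'"
    and Z: "comonoid_in \<C> S Z d e"
    and [simp]: "x \<in> Arr \<C>" "Dom \<C> x = Z" "Cod \<C> x = M" "y \<in> Arr \<C>" "Dom \<C> y = Z" "Cod \<C> y = M\<^sup>-"
    and g [simp]: "g \<in> Arr \<C>" "Dom \<C> g = M'" "Cod \<C> g = M" "g \<cdot> f = M"
  shows "right_inverse d e M' m' u' (f \<cdot> x) (f\<^sup>- \<cdot> y) \<Longrightarrow> right_inverse d e M m u x y"
    "left_inverse d e M' m' u' (f \<cdot> x) (f\<^sup>- \<cdot> y) \<Longrightarrow> left_inverse d e M m u x y"
proof -
  note [simp] = monoid_arr[OF M(1)] monoid_arr[OF M(2)] comonoid_arr[OF Z]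
  have [simp]: "f \<in> Arr \<C>" "Dom \<C> f = M" "Cod \<C> f = M'" and e: "f \<cdot> m = m' \<cdot> (f \<odot> f)" "f \<cdot> u = u'"
    using f by (auto simp: monoid_map_def)
  have "((f \<bullet> I) \<odot> J) \<cdot> ((m \<bullet> I) \<odot> J) \<cdot> \<phi> M M \<cdot> (x \<bullet> y) \<cdot> d = (((m' \<cdot> (f \<odot> f)) \<bullet> I) \<odot> J) \<cdot> \<phi> M M \<cdot> (x \<bullet> y) \<cdot> d"
    by (simp add: e)
  also have "\<dots> = ((m' \<bullet> I) \<odot> J) \<cdot> \<phi> M' M' \<cdot> ((f \<cdot> x) \<bullet> (f\<^sup>- \<cdot> y)) \<cdot> d"
    using circ.ext2[OF phi_nat[of f f M M' M M'], of "(x \<bullet> y) \<cdot> d"] by simp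
  finally have r: "((f \<bullet> I) \<odot> J) \<cdot> ((m \<bullet> I) \<odot> J) \<cdot> \<phi> M M \<cdot> (x \<bullet> y) \<cdot> d = ((m' \<bullet> I) \<odot> J) \<cdot> \<phi> M' M' \<cdot> ((f \<cdot> x) \<bullet> (f\<^sup>- \<cdot> y)) \<cdot> d" .
  show "right_inverse d e M m u x y" if "right_inverse d e M' m' u' (f \<cdot> x) (f\<^sup>- \<cdot> y)"
    unfolding right_inverse_def
  proof (rule circ.split_mono[of "(g \<bullet> I) \<odot> J" "(f \<bullet> I) \<odot> J"])
    show "((f \<bullet> I) \<odot> J) \<cdot> ((m \<bullet> I) \<odot> J) \<cdot> \<phi> M M \<cdot> (x \<bullet> y) \<cdot> d = ((f \<bullet> I) \<odot> J) \<cdot> (((u \<bullet> I) \<cdot> \<Delta>\<^sub>I) \<odot> J) \<cdot> lci J \<cdot> e"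
      using that unfolding r right_inverse_def by (simp add: e)
  qed simp_all
  have "(J \<odot> (I \<bullet> f)) \<cdot> (J \<odot> (I \<bullet> m)) \<cdot> \<psi> M M \<cdot> (y \<bullet> x) \<cdot> d = (J \<odot> (I \<bullet> (m' \<cdot> (f \<odot> f)))) \<cdot> \<psi> M M \<cdot> (y \<bullet> x) \<cdot> d"
    by (simp add: e)
  also have "\<dots> = (J \<odot> (I \<bullet> m')) \<cdot> \<psi> M' M' \<cdot> ((f\<^sup>- \<cdot> y) \<bullet> (f \<cdot> x)) \<cdot> d"
    using circ.ext2[OF psi_nat[of f f M M' M M'], of "(y \<bullet> x) \<cdot> d"] by simp
  finally have l: "(J \<odot> (I \<bullet> f)) \<cdot> (J \<odot> (I \<bullet> m)) \<cdot> \<psi> M M \<cdot> (y \<bullet> x) \<cdot> d = (J \<odot> (I \<bullet> m')) \<cdot> \<psi> M' M' \<cdot> ((f\<^sup>- \<cdot> y) \<bullet> (f \<cdot> x)) \<cdot> d" .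
  show "left_inverse d e M m u x y" if "left_inverse d e M' m' u' (f \<cdot> x) (f\<^sup>- \<cdot> y)"
    unfolding left_inverse_def
  proof (rule circ.split_mono[of "J \<odot> (I \<bullet> g)" "J \<odot> (I \<bullet> f)"])
    show "(J \<odot> (I \<bullet> f)) \<cdot> (J \<odot> (I \<bullet> m)) \<cdot> \<psi> M M \<cdot> (y \<bullet> x) \<cdot> d = (J \<odot> (I \<bullet> f)) \<cdot> (J \<odot> ((I \<bullet> u) \<cdot> \<Delta>\<^sub>I)) \<cdot> rci J \<cdot> e"
      using that unfolding l left_inverse_def by (simp add: e)
  qed simp_all
qed

lemma antipodeI:
  assumes H: "bimonoid H" and [simp]: "s \<in> Arr \<C>" "Dom \<C> s = und H" "Cod \<C> s = (und H)\<^sup>-"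
    and "right_inverse (comult H) (counit H) (und H) (mult H) (unt H) (und H) s"
    and "left_inverse (comult H) (counit H) (und H) (mult H) (unt H) (und H) s"
  shows "antipode H s"
proof -
  note [simp] = monoid_arr[OF bimonoid_parts(1)[OF H]] comonoid_arr[OF bimonoid_parts(2)[OF H]]
  show ?thesis using assms(5,6) unfolding antipode_def right_inverse_def left_inverse_def by (simp add: hom_def)
qed

end

context Hopf_pullback
begin

abbreviation mAC where "mAC \<equiv> prod_mult A\<^sub>0 (mult A) C\<^sub>0 (mult C)"
abbreviation uAC where "uAC \<equiv> prod_unit (unt A) (unt C)"
abbreviation mBC where "mBC \<equiv> prod_mult B\<^sub>0 (mult B) C\<^sub>0 (mult C)"
abbreviation uBC where "uBC \<equiv> prod_unit (unt B) (unt C)"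
abbreviation mABC where "mABC \<equiv> prod_mult A\<^sub>0 (mult A) (B\<^sub>0 \<bullet> C\<^sub>0) mBC"
abbreviation uABC where "uABC \<equiv> prod_unit (unt A) uBC"
text \<open>The convolution inverse of j in A \<bullet> C, assembled from the antipodes of A and C
  in reversed order. The antipode of P is its factorization through the reverse of j.\<close>

definition inv_j where "inv_j = \<phi>b C\<^sub>0 A\<^sub>0 \<cdot> ((tC \<cdot> pC) \<bullet> (tA \<cdot> pA)) \<cdot> dP"
text \<open>\<open>j\<close> is a split equalizer of \<open>al\<close> and \<open>be\<close>, with \<open>nuC\<close> as a retraction of \<open>j\<close>. Reversion preserves
  it, so the convolution inverse of \<open>j\<close> factors through the reverse of \<open>j\<close>.\<close>

definition al where "al = ab A\<^sub>0 B\<^sub>0 C\<^sub>0 \<cdot> (p\<^sub>1 \<bullet> C\<^sub>0)"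
definition be where "be = A\<^sub>0 \<bullet> ((c \<bullet> C\<^sub>0) \<cdot> comult C)"

lemma tA_arr [simp]: "tA \<in> Arr \<C>" "Dom \<C> tA = A\<^sub>0" "Cod \<C> tA = A\<^sub>0\<^sup>-"
  using tA by (auto simp: antipode_def hom_def)

lemma inv_j_arr [simp]: "inv_j \<in> Arr \<C>" "Dom \<C> inv_j = P" "Cod \<C> inv_j = (A\<^sub>0 \<bullet> C\<^sub>0)\<^sup>-"
  "al \<in> Arr \<C>" "Dom \<C> al = A\<^sub>0 \<bullet> C\<^sub>0" "Cod \<C> al = A\<^sub>0 \<bullet> (B\<^sub>0 \<bullet> C\<^sub>0)"
  "be \<in> Arr \<C>" "Dom \<C> be = A\<^sub>0 \<bullet> C\<^sub>0" "Cod \<C> be = A\<^sub>0 \<bullet> (B\<^sub>0 \<bullet> C\<^sub>0)"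
  by (simp_all add: inv_j_def al_def be_def)

lemma AC_monoid: "monoid_in \<C> T (A\<^sub>0 \<bullet> C\<^sub>0) mAC uAC"
  by (rule monoid_prod[OF A_parts(1) C_parts(1)])

lemma BC_monoid: "monoid_in \<C> T (B\<^sub>0 \<bullet> C\<^sub>0) mBC uBC"
  by (rule monoid_prod[OF B_parts(1) C_parts(1)])

lemma ABC_monoid: "monoid_in \<C> T (A\<^sub>0 \<bullet> (B\<^sub>0 \<bullet> C\<^sub>0)) mABC uABC"
  by (rule monoid_prod[OF A_parts(1) BC_monoid])

lemma inv_j: "right_inverse dP eP (A\<^sub>0 \<bullet> C\<^sub>0) mAC uAC j inv_j" "left_inverse dP eP (A\<^sub>0 \<bullet> C\<^sub>0) mAC uAC j inv_j"
proof -
  note a = antipode_inverse[OF tA A_parts(1,2) P_comonoid pA_comonoid_map]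
    and c = antipode_inverse[OF tC C_parts(1,2) P_comonoid pC_comonoid_map]
  show "right_inverse dP eP (A\<^sub>0 \<bullet> C\<^sub>0) mAC uAC j inv_j"
    unfolding j_def inv_j_def by (rule right_inverse_pair[OF P_comonoid A_parts(1) C_parts(1)]) (simp_all add: a c)
  show "left_inverse dP eP (A\<^sub>0 \<bullet> C\<^sub>0) mAC uAC j inv_j"
    unfolding j_def inv_j_def by (rule left_inverse_pair[OF P_comonoid A_parts(1) C_parts(1)]) (simp_all add: a c)
qed

lemma p1_monoid_map: "monoid_map A\<^sub>0 (mult A) (unt A) (A\<^sub>0 \<bullet> B\<^sub>0) (prod_mult A\<^sub>0 (mult A) B\<^sub>0 (mult B)) (prod_unit (unt A) (unt B)) p\<^sub>1"
  by (rule monoid_map_comp[OF A_parts(5) monoid_map_prod[OF A_parts(1) A_parts(1) A_parts(1) B_parts(1) monoid_map_id[OF A_parts(1)] p_parts(2)]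
    A_parts(1) monoid_prod[OF A_parts(1) A_parts(1)] AB_monoid])

lemma al_monoid_map: "monoid_map (A\<^sub>0 \<bullet> C\<^sub>0) mAC uAC (A\<^sub>0 \<bullet> (B\<^sub>0 \<bullet> C\<^sub>0)) mABC uABC al"
  unfolding al_def
  by (rule monoid_map_comp[OF monoid_map_prod[OF A_parts(1) C_parts(1) AB_monoid C_parts(1) p1_monoid_map monoid_map_id[OF C_parts(1)]]
    monoid_map_assoc[OF A_parts(1) B_parts(1) C_parts(1)] AC_monoid monoid_prod[OF AB_monoid C_parts(1)] ABC_monoid])

lemma be_monoid_map: "monoid_map (A\<^sub>0 \<bullet> C\<^sub>0) mAC uAC (A\<^sub>0 \<bullet> (B\<^sub>0 \<bullet> C\<^sub>0)) mABC uABC be"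
  unfolding be_def
  by (rule monoid_map_prod[OF A_parts(1) C_parts(1) A_parts(1) BC_monoid monoid_map_id[OF A_parts(1)]
    monoid_map_comp[OF C_parts(5) monoid_map_prod[OF C_parts(1) C_parts(1) B_parts(1) C_parts(1) c_parts(2) monoid_map_id[OF C_parts(1)]]
      C_parts(1) monoid_prod[OF C_parts(1) C_parts(1)] BC_monoid]])

text \<open>On a pair (a, x) the arrow \<open>al\<close> gives (a_1, p a_2, x) and \<open>be\<close>
  gives (a, c x_1, x_2). These agree on the pullback because p a = c x there.\<close>

lemma al_j: "al \<cdot> j = be \<cdot> j"
proof -
  have pAd: "comult A \<cdot> pA = (pA \<bullet> pA) \<cdot> dP" and pCd: "comult C \<cdot> pC = (pC \<bullet> pC) \<cdot> dP"
    using pA_comonoid_map pC_comonoid_map unfolding comonoid_map_def by blast+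
  have "al \<cdot> j = ab A\<^sub>0 B\<^sub>0 C\<^sub>0 \<cdot> (((A\<^sub>0 \<bullet> p) \<cdot> comult A \<cdot> pA) \<bullet> pC) \<cdot> dP" by (simp add: al_def j_def)
  also have "\<dots> = ab A\<^sub>0 B\<^sub>0 C\<^sub>0 \<cdot> (((pA \<bullet> (p \<cdot> pA)) \<cdot> dP) \<bullet> pC) \<cdot> dP" unfolding pAd by simp
  also have "\<dots> = (pA \<bullet> (((p \<cdot> pA) \<bullet> pC) \<cdot> dP)) \<cdot> dP"
    by (rule pair_assoc[OF P_comonoid]) simp_all
  also have "\<dots> = (pA \<bullet> ((c \<bullet> C\<^sub>0) \<cdot> (pC \<bullet> pC) \<cdot> dP)) \<cdot> dP" unfolding p_pA by simp
  also have "\<dots> = be \<cdot> j" unfolding pCd[symmetric] by (simp add: be_def j_def)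
  finally show ?thesis .
qed

text \<open>\<open>al\<close> and \<open>be\<close> are monoid maps, so both sides are convolution
  inverses of \<open>al \<cdot> j = be \<cdot> j\<close>, and such inverses are unique.\<close>

lemma al_be_inv_j: "al\<^sup>- \<cdot> inv_j = be\<^sup>- \<cdot> inv_j"
proof -
  have "right_inverse dP eP (A\<^sub>0 \<bullet> (B\<^sub>0 \<bullet> C\<^sub>0)) mABC uABC (al \<cdot> j) (be\<^sup>- \<cdot> inv_j)"
    unfolding al_j by (rule right_inverse_monoid_map[OF be_monoid_map AC_monoid ABC_monoid P_comonoid _ _ _ _ _ _ inv_j(1)]) simp_all
  moreover have "left_inverse dP eP (A\<^sub>0 \<bullet> (B\<^sub>0 \<bullet> C\<^sub>0)) mABC uABC (al \<cdot> j) (al\<^sup>- \<cdot> inv_j)"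
    by (rule left_inverse_monoid_map[OF al_monoid_map AC_monoid ABC_monoid P_comonoid _ _ _ _ _ _ inv_j(2)]) simp_all
  ultimately show ?thesis
    using left_inverse_eq_right_inverse[OF P_comonoid ABC_monoid, of "al \<cdot> j" "be\<^sup>- \<cdot> inv_j" "al\<^sup>- \<cdot> inv_j"] by simp
qed

text \<open>By naturality of the antipode along c, division by c(x) in the B-module A is division by
  x in the C-module A.\<close>

lemma kap_change: "M3.kap = M1.kap \<cdot> (A\<^sub>0 \<bullet> c)"
proof -
  have "t \<cdot> c = c\<^sup>- \<cdot> tC" by (rule antipode_natural[OF C B c tC t])
  then have "M1.kap \<cdot> (A\<^sub>0 \<bullet> c) = ((a \<bullet> I) \<odot> J) \<cdot> \<phi> A\<^sub>0 B\<^sub>0 \<cdot> (A\<^sub>0 \<bullet> c\<^sup>-) \<cdot> (A\<^sub>0 \<bullet> tC)"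
    by (simp add: M1.kap_def)
  also have "\<dots> = M3.kap"
    using circ.ext2[OF phi_nat[of A\<^sub>0 c A\<^sub>0 A\<^sub>0 C\<^sub>0 B\<^sub>0], of "A\<^sub>0 \<bullet> tC"] by (simp add: M3.kap_def)
  finally show ?thesis by (rule sym)
qed

text \<open>The two equations \<open>E' \<cdot> be = A\<^sub>0 \<bullet> C\<^sub>0\<close> and
  \<open>E' \<cdot> al = j \<cdot> nuC\<close> split the pair \<open>al\<close>, \<open>be\<close>.
  Being equations between composites, they are preserved by the reversion, and
  \<open>al_be_inv_j\<close> then gives the claim.\<close>

lemma inv_j_fix: "(j \<cdot> nuC)\<^sup>- \<cdot> inv_j = inv_j"
proof -
  \<comment> \<open>On elements E' sends (a, b, x) to (a s(b)^-1 s(c x_1), x_2). For b = p a this is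
    the idempotent of the pullback, for b = c x the identity.\<close>
  define E' where "E' = M3.Gam \<cdot> Lam N (co A\<^sub>0) C\<^sub>0 \<cdot> (M1.kap \<bullet> C\<^sub>0) \<cdot> abi A\<^sub>0 B\<^sub>0 C\<^sub>0"
  have [simp]: "E' \<in> Arr \<C>" "Dom \<C> E' = A\<^sub>0 \<bullet> (B\<^sub>0 \<bullet> C\<^sub>0)" "Cod \<C> E' = A\<^sub>0 \<bullet> C\<^sub>0" by (simp_all add: E'_def)
  have 1: "E' \<cdot> al = j \<cdot> nuC" unfolding j_nuC by (simp add: E'_def al_def w_def)
  have "E' \<cdot> be = M3.Gam \<cdot> Lam N (co A\<^sub>0) C\<^sub>0 \<cdot> (M1.kap \<bullet> C\<^sub>0) \<cdot> abi A\<^sub>0 B\<^sub>0 C\<^sub>0 \<cdot> (A\<^sub>0 \<bullet> (c \<bullet> C\<^sub>0)) \<cdot> (A\<^sub>0 \<bullet> comult C)"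
    by (simp add: E'_def be_def)
  also have "\<dots> = M3.Gam \<cdot> Lam N (co A\<^sub>0) C\<^sub>0 \<cdot> ((M1.kap \<cdot> (A\<^sub>0 \<bullet> c)) \<bullet> C\<^sub>0) \<cdot> abi A\<^sub>0 C\<^sub>0 C\<^sub>0 \<cdot> (A\<^sub>0 \<bullet> comult C)"
    using circ.ext2[OF blt.inv_assoc_nat[of A\<^sub>0 c C\<^sub>0 A\<^sub>0 B\<^sub>0 C\<^sub>0], of "A\<^sub>0 \<bullet> comult C"] by simp
  also have "\<dots> = A\<^sub>0 \<bullet> C\<^sub>0" unfolding kap_change[symmetric] by (rule M3.Gam_Lam)
  finally have 2: "E' \<cdot> be = A\<^sub>0 \<bullet> C\<^sub>0" .
  have "(j \<cdot> nuC)\<^sup>- \<cdot> inv_j = E'\<^sup>- \<cdot> al\<^sup>- \<cdot> inv_j" unfolding 1[symmetric] by simp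
  also have "\<dots> = (E' \<cdot> be)\<^sup>- \<cdot> inv_j" unfolding al_be_inv_j by simp
  finally show ?thesis unfolding 2 by simp
qed

lemma j_monoid_map: "monoid_map P mP uP (A\<^sub>0 \<bullet> C\<^sub>0) mAC uAC j"
  unfolding j_def
  by (rule monoid_map_comp[OF bimonoid_parts(5)[OF PB_bimonoid, unfolded PB_simps]
    monoid_map_prod[OF P_monoid P_monoid A_parts(1) C_parts(1) pA_monoid_map pC_monoid_map] P_monoid monoid_prod[OF P_monoid P_monoid] AC_monoid])

text \<open>By \<open>inv_j_fix\<close> the inverse of j has the form of \<open>j\<^sup>-\<close>
  after an arrow. As j is a monoid map with a retraction, \<open>inverse_reflect\<close> makes that
  arrow a convolution inverse of the identity of P.\<close>

lemma PB_antipode: "antipode PB (nuC\<^sup>- \<cdot> inv_j)"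
proof -
  have e: "j\<^sup>- \<cdot> nuC\<^sup>- \<cdot> inv_j = inv_j" using inv_j_fix by simp
  have "right_inverse dP eP P mP uP P (nuC\<^sup>- \<cdot> inv_j)"
    by (rule inverse_reflect(1)[OF j_monoid_map P_monoid AC_monoid P_comonoid, of _ _ nuC]) (use inv_j e in \<open>simp_all add: nuC_j del: rev_merge_ext\<close>)
  moreover have "left_inverse dP eP P mP uP P (nuC\<^sup>- \<cdot> inv_j)"
    by (rule inverse_reflect(2)[OF j_monoid_map P_monoid AC_monoid P_comonoid, of _ _ nuC]) (use inv_j e in \<open>simp_all add: nuC_j del: rev_merge_ext\<close>)
  ultimately show ?thesis
    by (intro antipodeI PB_bimonoid) simp_all
qed

end

section \<open>Reflection of isomorphisms\<close>

context reversion
begin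

lemma bimonoid_morphism_inverse:
  assumes H: "bimonoid H" and K: "bimonoid K" and f: "bimonoid_morphism H f K"
    and [simp]: "g \<in> Arr \<C>" "Dom \<C> g = und K" "Cod \<C> g = und H" and gf: "g \<cdot> f = und H" and fg: "f \<cdot> g = und K"
  shows "bimonoid_morphism K g H"
proof -
  note [simp] = monoid_arr[OF bimonoid_parts(1)[OF H]] comonoid_arr[OF bimonoid_parts(2)[OF H]]
    monoid_arr[OF bimonoid_parts(1)[OF K]] comonoid_arr[OF bimonoid_parts(2)[OF K]]
  have [simp]: "f \<in> Arr \<C>" "Dom \<C> f = und H" "Cod \<C> f = und K"
    and e: "f \<cdot> mult H = mult K \<cdot> (f \<odot> f)" "f \<cdot> unt H = unt K"
      "comult K \<cdot> f = (f \<bullet> f) \<cdot> comult H" "counit K \<cdot> f = counit H"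
    using f by (auto simp: bimonoid_morphism_def hom_def)
  have "g \<cdot> mult K = g \<cdot> (mult K \<cdot> (f \<odot> f)) \<cdot> (g \<odot> g)" by (simp add: fg)
  also have "\<dots> = (g \<cdot> f) \<cdot> mult H \<cdot> (g \<odot> g)" unfolding e[symmetric] by simp
  finally have 1: "g \<cdot> mult K = mult H \<cdot> (g \<odot> g)" unfolding gf by simp
  have "g \<cdot> unt K = (g \<cdot> f) \<cdot> unt H" unfolding e[symmetric] by simp
  then have 2: "g \<cdot> unt K = unt H" unfolding gf by simp
  have "(g \<bullet> g) \<cdot> comult K = (g \<bullet> g) \<cdot> (comult K \<cdot> f) \<cdot> g" by (simp add: fg)
  also have "\<dots> = comult H \<cdot> g" unfolding e by (simp add: gf)
  finally have 3: "comult H \<cdot> g = (g \<bullet> g) \<cdot> comult K" by (rule sym)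
  have "counit H \<cdot> g = counit K \<cdot> f \<cdot> g" using circ.ext2[OF e(4), of g] by simp
  then have 4: "counit H \<cdot> g = counit K" unfolding fg by simp
  show ?thesis using 1 2 3 4 by (simp add: bimonoid_morphism_def hom_def)
qed

end

text \<open>Everything with prefix \<open>Q\<close> belongs to the point on the codomain of f. The
  two points share B, the base change c : C \<rightarrow> B and the antipodes of B and C.\<close>

locale Hopf_pullback_map = Hopf_pullback \<C> T S \<zeta> \<Delta>\<^sub>I m\<^sub>J \<epsilon>\<^sub>I \<sigma> reverse \<phi>c \<phi>c\<^sub>0 \<phi>b \<phi>b\<^sub>0 \<gamma> \<delta> \<gamma>' \<delta>' A B t p s \<kappa> \<kappa>' C tA tC c +
  Q: Hopf_pullback \<C> T S \<zeta> \<Delta>\<^sub>I m\<^sub>J \<epsilon>\<^sub>I \<sigma> reverse \<phi>c \<phi>c\<^sub>0 \<phi>b \<phi>b\<^sub>0 \<gamma> \<delta> \<gamma>' \<delta>' A' B t p' s' k k' C tA' tC c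
  for \<C> :: "'a cat" (structure) and T S \<zeta> \<Delta>\<^sub>I m\<^sub>J \<epsilon>\<^sub>I \<sigma>
    and reverse :: "'a \<Rightarrow> 'a"  (\<open>_\<^sup>-\<close> [1000] 1000)
    and \<phi>c \<phi>c\<^sub>0 \<phi>b \<phi>b\<^sub>0 \<gamma> \<delta> \<gamma>' \<delta>' A B t p s \<kappa> \<kappa>' C tA tC c A' p' s' k k' tA' +
  fixes f
  assumes f: "bimonoid_morphism A f A'" and pf: "p' \<cdot> f = p" and fs: "f \<cdot> s = s'"
begin

lemmas f_parts = bimonoid_morphism_parts[OF A Q.A f]

lemma f_arr [simp]: "f \<in> Arr \<C>" "Dom \<C> f = A\<^sub>0" "Cod \<C> f = und A'"
  using f_parts(1) by (simp_all add: comonoid_map_def)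

lemma f_laws: "comult A' \<cdot> f = (f \<bullet> f) \<cdot> comult A" "counit A' \<cdot> f = counit A" "f \<cdot> mult A = mult A' \<cdot> (f \<odot> f)" "f \<cdot> unt A = unt A'"
  using f_parts by (auto simp: comonoid_map_def monoid_map_def)

text \<open>As p' f = p, the arrow f carries the graph of p to the graph of p', and so one
  intersection to the other.\<close>

lemma kernel_map: "\<exists>h. h \<in> Arr \<C> \<and> Dom \<C> h = K \<and> Cod \<C> h = Q.K \<and> k \<cdot> h = f \<cdot> \<kappa> \<and> k' \<cdot> h = (f \<bullet> I) \<cdot> \<kappa>'"
proof -
  have "Q.p\<^sub>1 \<cdot> f \<cdot> \<kappa> = (und A' \<bullet> p') \<cdot> (comult A' \<cdot> f) \<cdot> \<kappa>" by simp
  also have "\<dots> = (f \<bullet> B\<^sub>0) \<cdot> p\<^sub>1 \<cdot> \<kappa>" unfolding f_laws by (simp add: pf)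
  also have "\<dots> = (und A' \<bullet> unt B) \<cdot> (f \<bullet> I) \<cdot> \<kappa>'" unfolding kernel_eq by simp
  finally show ?thesis
    using circ.pullback_lift[OF Q.kernel, of "f \<cdot> \<kappa>" "(f \<bullet> I) \<cdot> \<kappa>'"] by simp
qed

definition fK where "fK = (SOME h. h \<in> Arr \<C> \<and> Dom \<C> h = K \<and> Cod \<C> h = Q.K \<and> k \<cdot> h = f \<cdot> \<kappa> \<and> k' \<cdot> h = (f \<bullet> I) \<cdot> \<kappa>')"

lemma fK_arr [simp]: "fK \<in> Arr \<C>" "Dom \<C> fK = K" "Cod \<C> fK = Q.K"
  and k_fK: "k \<cdot> fK = f \<cdot> \<kappa>" and k'_fK: "k' \<cdot> fK = (f \<bullet> I) \<cdot> \<kappa>'"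
proof -
  have "fK \<in> Arr \<C> \<and> Dom \<C> fK = K \<and> Cod \<C> fK = Q.K \<and> k \<cdot> fK = f \<cdot> \<kappa> \<and> k' \<cdot> fK = (f \<bullet> I) \<cdot> \<kappa>'"
    unfolding fK_def by (rule someI_ex[OF kernel_map])
  then show "fK \<in> Arr \<C>" "Dom \<C> fK = K" "Cod \<C> fK = Q.K" "k \<cdot> fK = f \<cdot> \<kappa>" "k' \<cdot> fK = (f \<bullet> I) \<cdot> \<kappa>'" by blast+
qed

lemma iota_fK: "Q.\<iota> \<cdot> fK = \<iota>"
proof -
  have "Q.\<iota> \<cdot> fK = lb I \<cdot> (counit A' \<bullet> I) \<cdot> k' \<cdot> fK" by (simp add: Q.\<iota>_def Q.pi2_def)
  also have "\<dots> = \<iota>" unfolding k'_fK by (simp add: \<iota>_def pi2_def f_laws)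
  finally show ?thesis .
qed

lemma fK_comonoid_map: "comonoid_map K dK eK Q.K Q.dK Q.eK fK"
proof -
  have "(k \<bullet> k) \<cdot> Q.dK \<cdot> fK = (comult A' \<cdot> k) \<cdot> fK"
    using circ.ext2[OF Q.kappa_dK, of fK] by simp
  also have "\<dots> = (comult A' \<cdot> f) \<cdot> \<kappa>" by (simp add: k_fK)
  also have "\<dots> = (f \<bullet> f) \<cdot> comult A \<cdot> \<kappa>" unfolding f_laws by simp
  also have "\<dots> = ((f \<cdot> \<kappa>) \<bullet> (f \<cdot> \<kappa>)) \<cdot> dK" unfolding kappa_dK[symmetric] by simp
  also have "\<dots> = (k \<bullet> k) \<cdot> (fK \<bullet> fK) \<cdot> dK" unfolding k_fK[symmetric] by simp
  finally have "Q.dK \<cdot> fK = (fK \<bullet> fK) \<cdot> dK"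
    by (rule circ.mono_cancel[OF Q.mono_tens2[OF Q.kappa_mono Q.kappa_mono]]) simp_all
  moreover have "Q.eK \<cdot> fK = eK"
    using circ.ext2[OF f_laws(2), of \<kappa>] by (simp add: Q.eK_def eK_def k_fK)
  ultimately show ?thesis by (simp add: comonoid_map_def)
qed

lemma f_mu: "f \<cdot> mu = Q.mu \<cdot> (fK \<odot> B\<^sub>0)"
  using circ.ext2[OF f_laws(3), of "\<kappa> \<odot> s"] by (simp add: mu_def Q.mu_def fs k_fK)

text \<open>\<open>fK \<odot> C\<^sub>0\<close> is a comonoid map with the same two projections as
  u, so uniqueness of lifts identifies them.\<close>

lemma pullback_map_eq:
  assumes u: "comonoid_map P dP eP Q.P Q.dP Q.eP u" and uA: "Q.pA \<cdot> u = f \<cdot> pA" and uC: "Q.pC \<cdot> u = pC"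
  shows "u = fK \<odot> C\<^sub>0"
proof (rule Q.lift_unique[OF P_comonoid u])
  show "comonoid_map P dP eP Q.P Q.dP Q.eP (fK \<odot> C\<^sub>0)"
    by (rule comonoid_map_tens[OF K_comonoid C_parts(2) Q.K_comonoid C_parts(2) fK_comonoid_map comonoid_map_id[OF C_parts(2)]])
  show "Q.pA \<cdot> u = Q.pA \<cdot> (fK \<odot> C\<^sub>0)"
    unfolding uA using circ.ext2[OF f_mu, of "K \<odot> c"] by (simp add: pA_def Q.pA_def)
  show "Q.pC \<cdot> u = Q.pC \<cdot> (fK \<odot> C\<^sub>0)"
    unfolding uC by (simp add: pC_def Q.pC_def iota_fK)
qed

lemma inverse_of_pullback_inverse:
  assumes u: "bimonoid_morphism PB u Q.PB" and uA: "Q.pA \<cdot> u = f \<cdot> pA" and uC: "Q.pC \<cdot> u = pC"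
    and [simp]: "v \<in> Arr \<C>" "Dom \<C> v = Q.P" "Cod \<C> v = P" and vu: "v \<cdot> u = P" and uv: "u \<cdot> v = Q.P"
  shows "\<exists>h. h \<in> Arr \<C> \<and> Dom \<C> h = und A' \<and> Cod \<C> h = A\<^sub>0 \<and> h \<cdot> f = A\<^sub>0 \<and> f \<cdot> h = und A'"
proof -
  have "comonoid_map P dP eP Q.P Q.dP Q.eP u"
    using bimonoid_morphism_parts(1)[OF PB_bimonoid Q.PB_bimonoid u] by (simp only: PB_simps Q.PB_simps)
  then have u_eq: "u = fK \<odot> C\<^sub>0" by (rule pullback_map_eq[OF _ uA uC])
  \<comment> \<open>On elements x(k) is the A-component of v(k \<odot> 1). It satisfies
    \<open>f \<cdot> x = k\<close> and \<open>x \<cdot> fK = \<kappa>\<close>, which replaces an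
    inverse of \<open>fK\<close> in the rest of the argument.\<close>
  define x where "x = pA \<cdot> v \<cdot> (Q.K \<odot> unt C) \<cdot> rci Q.K"
  have [simp]: "x \<in> Arr \<C>" "Dom \<C> x = Q.K" "Cod \<C> x = A\<^sub>0" by (simp_all add: x_def)
  have u_arr [simp]: "u \<in> Arr \<C>" "Dom \<C> u = P" "Cod \<C> u = Q.P" by (simp_all add: u_eq)
  have "f \<cdot> x = (Q.pA \<cdot> u) \<cdot> v \<cdot> (Q.K \<odot> unt C) \<cdot> rci Q.K" unfolding uA by (simp add: x_def)
  also have "\<dots> = Q.pA \<cdot> (Q.K \<odot> unt C) \<cdot> rci Q.K"
    using circ.ext2[OF uv, of "(Q.K \<odot> unt C) \<cdot> rci Q.K"] by simp
  finally have fx: "f \<cdot> x = k" unfolding Q.pA_unit .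
  have "x \<cdot> fK = pA \<cdot> v \<cdot> u \<cdot> (K \<odot> unt C) \<cdot> rci K"
    by (simp add: x_def u_eq circ.inv_runit_nat[of fK Q.K])
  also have "\<dots> = pA \<cdot> (K \<odot> unt C) \<cdot> rci K"
    using circ.ext2[OF vu, of "(K \<odot> unt C) \<cdot> rci K"] by simp
  finally have xf: "x \<cdot> fK = \<kappa>" unfolding pA_unit .
  \<comment> \<open>Every element of the codomain of f decomposes as k s'(b), and an inverse of f
    has to send it to x(k) s(b).\<close>
  define h where "h = mult A \<cdot> (x \<odot> s) \<cdot> Q.nu"
  have [simp]: "h \<in> Arr \<C>" "Dom \<C> h = und A'" "Cod \<C> h = A\<^sub>0" by (simp_all add: h_def)
  have "f \<cdot> h = mult A' \<cdot> ((f \<cdot> x) \<odot> (f \<cdot> s)) \<cdot> Q.nu"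
    using circ.ext2[OF f_laws(3), of "(x \<odot> s) \<cdot> Q.nu"] by (simp add: h_def)
  also have "\<dots> = Q.mu \<cdot> Q.nu" unfolding fx fs by (simp add: Q.mu_def)
  finally have fh: "f \<cdot> h = und A'" unfolding Q.mu_nu .
  \<comment> \<open>The composite is compared with the identity after \<open>mu\<close>, which is a
    split epimorphism.\<close>
  have "(h \<cdot> f) \<cdot> mu = h \<cdot> Q.mu \<cdot> (fK \<odot> B\<^sub>0)" by (simp add: f_mu)
  also have "\<dots> = mult A \<cdot> (x \<odot> s) \<cdot> (fK \<odot> B\<^sub>0)"
    using circ.ext2[OF Q.nu_mu, of "fK \<odot> B\<^sub>0"] by (simp add: h_def)
  also have "\<dots> = A\<^sub>0 \<cdot> mu" by (simp add: xf mu_def)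
  finally have "h \<cdot> f = A\<^sub>0"
    using mu_nu by (intro circ.split_epi[of mu nu "h \<cdot> f" A\<^sub>0]) simp_all
  with fh show ?thesis by (intro exI[of _ h]) simp
qed

end

section \<open>Protomodularity\<close>

context category
begin

text \<open>Invertibility of the induced arrow does not depend on the pullbacks taken, since the
  canonical comparisons are invertible. This passes from arbitrarily given pullbacks to the
  explicitly constructed ones.\<close>

lemma pullback_iso_transfer:
  assumes pb: "is_pullback \<C> f g p q" and pb1: "is_pullback \<C> f g p\<^sub>1 q\<^sub>1"
    and pb': "is_pullback \<C> f' g p' q'" and pb1': "is_pullback \<C> f' g p\<^sub>1' q\<^sub>1'"
    and [simp]: "h \<in> Arr \<C>" "Dom \<C> h = Dom \<C> f" "Cod \<C> h = Dom \<C> f'"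
    and [simp]: "u \<in> Arr \<C>" "Dom \<C> u = Dom \<C> p" "Cod \<C> u = Dom \<C> p'" and u: "p' \<cdot> u = h \<cdot> p" "q' \<cdot> u = q"
    and [simp]: "v \<in> Arr \<C>" "Dom \<C> v = Dom \<C> p'" "Cod \<C> v = Dom \<C> p" and vu: "v \<cdot> u = Dom \<C> p" and uv: "u \<cdot> v = Dom \<C> p'"
    and [simp]: "u\<^sub>1 \<in> Arr \<C>" "Dom \<C> u\<^sub>1 = Dom \<C> p\<^sub>1" "Cod \<C> u\<^sub>1 = Dom \<C> p\<^sub>1'" and u1: "p\<^sub>1' \<cdot> u\<^sub>1 = h \<cdot> p\<^sub>1" "q\<^sub>1' \<cdot> u\<^sub>1 = q\<^sub>1"
  shows "\<exists>v\<^sub>1. v\<^sub>1 \<in> Arr \<C> \<and> Dom \<C> v\<^sub>1 = Dom \<C> p\<^sub>1' \<and> Cod \<C> v\<^sub>1 = Dom \<C> p\<^sub>1 \<and> v\<^sub>1 \<cdot> u\<^sub>1 = Dom \<C> p\<^sub>1 \<and> u\<^sub>1 \<cdot> v\<^sub>1 = Dom \<C> p\<^sub>1'"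
proof -
  note a = pullback_arr[OF pb] and a1 = pullback_arr[OF pb1] and a' = pullback_arr[OF pb'] and a1' = pullback_arr[OF pb1']
  note [simp] = a(1,2,4,5) a(6)[symmetric] a(7,8) a1(4,5) a1(6)[symmetric] a1(7,8)
    a'(1,4,5) a'(6)[symmetric] a'(7,8) a1'(4,5) a1'(6)[symmetric] a1'(7,8)
  obtain x where [simp]: "x \<in> Arr \<C>" "Dom \<C> x = Dom \<C> p" "Cod \<C> x = Dom \<C> p\<^sub>1" and x: "p\<^sub>1 \<cdot> x = p" "q\<^sub>1 \<cdot> x = q"
    using pullback_lift[OF pb1, of p q] a(9) by auto
  obtain e where [simp]: "e \<in> Arr \<C>" "Dom \<C> e = Dom \<C> p\<^sub>1" "Cod \<C> e = Dom \<C> p" and e: "p \<cdot> e = p\<^sub>1" "q \<cdot> e = q\<^sub>1"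
    using pullback_lift[OF pb, of p\<^sub>1 q\<^sub>1] a1(9) by auto
  obtain d where [simp]: "d \<in> Arr \<C>" "Dom \<C> d = Dom \<C> p\<^sub>1'" "Cod \<C> d = Dom \<C> p'" and d: "p' \<cdot> d = p\<^sub>1'" "q' \<cdot> d = q\<^sub>1'"
    using pullback_lift[OF pb', of p\<^sub>1' q\<^sub>1'] a1'(9) by auto
  have du: "d \<cdot> u\<^sub>1 = u \<cdot> e"
  proof (rule pullback_unique[OF pb'])
    show "p' \<cdot> d \<cdot> u\<^sub>1 = p' \<cdot> u \<cdot> e"
      using ext2[OF d(1), of u\<^sub>1] ext2[OF u(1), of e] by (simp add: u1 e)
    show "q' \<cdot> d \<cdot> u\<^sub>1 = q' \<cdot> u \<cdot> e"
      using ext2[OF d(2), of u\<^sub>1] ext2[OF u(2), of e] by (simp add: u1 e)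
  qed simp_all
  \<comment> \<open>The given inverse v conjugated by the comparisons: d leads into the given
    pullback of f' and x out of the given pullback of f.\<close>
  let ?v = "x \<cdot> v \<cdot> d"
  have "v \<cdot> d \<cdot> u\<^sub>1 = e" unfolding du using ext2[OF vu, of e] by simp
  then have vu1: "?v \<cdot> u\<^sub>1 = x \<cdot> e" by simp
  have "x \<cdot> e = Dom \<C> p\<^sub>1"
  proof (rule pullback_unique[OF pb1])
    show "p\<^sub>1 \<cdot> x \<cdot> e = p\<^sub>1 \<cdot> Dom \<C> p\<^sub>1" using ext2[OF x(1), of e] by (simp add: e)
    show "q\<^sub>1 \<cdot> x \<cdot> e = q\<^sub>1 \<cdot> Dom \<C> p\<^sub>1" using ext2[OF x(2), of e] by (simp add: e)
  qed simp_all
  moreover have "u\<^sub>1 \<cdot> ?v = Dom \<C> p\<^sub>1'"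
  proof (rule pullback_unique[OF pb1'])
    have "p\<^sub>1' \<cdot> u\<^sub>1 \<cdot> ?v = h \<cdot> p \<cdot> v \<cdot> d"
      using ext2[OF u1(1), of ?v] ext2[OF x(1), of "v \<cdot> d"] by simp
    also have "\<dots> = p' \<cdot> d" using ext2[OF u(1), of "v \<cdot> d"] ext2[OF uv, of d] by simp
    finally show "p\<^sub>1' \<cdot> u\<^sub>1 \<cdot> ?v = p\<^sub>1' \<cdot> Dom \<C> p\<^sub>1'" by (simp add: d)
    have "q\<^sub>1' \<cdot> u\<^sub>1 \<cdot> ?v = q \<cdot> v \<cdot> d"
      using ext2[OF u1(2), of ?v] ext2[OF x(2), of "v \<cdot> d"] by simp
    also have "\<dots> = q' \<cdot> d" using ext2[OF u(2), of "v \<cdot> d"] ext2[OF uv, of d] by simp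
    finally show "q\<^sub>1' \<cdot> u\<^sub>1 \<cdot> ?v = q\<^sub>1' \<cdot> Dom \<C> p\<^sub>1'" by (simp add: d)
  qed simp_all
  ultimately show ?thesis unfolding vu1[symmetric] by (intro exI[of _ ?v]) simp
qed

lemma points_arrD:
  assumes "F \<in> Arr (points \<C> B)"
  obtains p s f q t where "F = ((p, s), f, (q, t))" "is_point \<C> B (p, s)" "is_point \<C> B (q, t)"
    "f \<in> hom \<C> (Dom \<C> p) (Dom \<C> q)" "q \<cdot> f = p" "f \<cdot> s = t"
  using assms unfolding points_def by auto

lemma points_isoD:
  assumes "iso_arrow (points \<C> B) (X, u, Y)"
  shows "u \<in> hom \<C> (Dom \<C> (fst X)) (Dom \<C> (fst Y))"
    "\<exists>v. v \<in> hom \<C> (Dom \<C> (fst Y)) (Dom \<C> (fst X)) \<and> v \<cdot> u = Dom \<C> (fst X) \<and> u \<cdot> v = Dom \<C> (fst Y)"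
proof -
  obtain G where G: "inverse_arrows (points \<C> B) (X, u, Y) G" using assms unfolding iso_arrow_def by blast
  then have F: "(X, u, Y) \<in> Arr (points \<C> B)" and G': "G \<in> Arr (points \<C> B)" "Dom (points \<C> B) G = Cod (points \<C> B) (X, u, Y)"
    "Cod (points \<C> B) G = Dom (points \<C> B) (X, u, Y)" "Comp (points \<C> B) G (X, u, Y) = Dom (points \<C> B) (X, u, Y)"
    "Comp (points \<C> B) (X, u, Y) G = Cod (points \<C> B) (X, u, Y)"
    unfolding inverse_arrows_def hom_def by blast+
  show "u \<in> hom \<C> (Dom \<C> (fst X)) (Dom \<C> (fst Y))" using F by (auto simp: points_def)
  obtain p s v q t where v: "G = ((p, s), v, (q, t))" "v \<in> hom \<C> (Dom \<C> p) (Dom \<C> q)"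
    using points_arrD[OF G'(1)] by metis
  show "\<exists>v. v \<in> hom \<C> (Dom \<C> (fst Y)) (Dom \<C> (fst X)) \<and> v \<cdot> u = Dom \<C> (fst X) \<and> u \<cdot> v = Dom \<C> (fst Y)"
    using G'(2-) v(2) unfolding v(1) by (intro exI[of _ v]) (auto simp: points_def)
qed

text \<open>An inverse of the underlying arrow automatically commutes with the projections and the
  sections, so it is an inverse in the fibre.\<close>

lemma points_isoI:
  assumes "is_point \<C> B (p, s)" "is_point \<C> B (q, t)" and f: "f \<in> hom \<C> (Dom \<C> p) (Dom \<C> q)" and qf: "q \<cdot> f = p" and fs: "f \<cdot> s = t"
    and g: "g \<in> hom \<C> (Dom \<C> q) (Dom \<C> p)" and gf: "g \<cdot> f = Dom \<C> p" and fg: "f \<cdot> g = Dom \<C> q"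
  shows "iso_arrow (points \<C> B) ((p, s), f, (q, t))"
proof -
  have a: "f \<in> Arr \<C>" "Dom \<C> f = Dom \<C> p" "Cod \<C> f = Dom \<C> q" "g \<in> Arr \<C>" "Dom \<C> g = Dom \<C> q" "Cod \<C> g = Dom \<C> p"
    "p \<in> Arr \<C>" "q \<in> Arr \<C>" "s \<in> Arr \<C>" "Cod \<C> s = Dom \<C> p"
    using f g assms(1,2) by (simp_all add: hom_def is_point_def)
  have "p \<cdot> g = q \<cdot> f \<cdot> g" using ext2[OF qf, of g] a by simp
  also have "\<dots> = q" unfolding fg using a by simp
  finally have pg: "p \<cdot> g = q" .
  have "g \<cdot> t = Dom \<C> p \<cdot> s" unfolding fs[symmetric] using ext2[OF gf, of s] a by simp
  also have "\<dots> = s" using a by simp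
  finally have gt: "g \<cdot> t = s" .
  have F: "((p, s), f, (q, t)) \<in> Arr (points \<C> B)"
    unfolding points_def cat.simps mem_Collect_eq using assms(1-5) by blast
  have G: "((q, t), g, (p, s)) \<in> Arr (points \<C> B)"
    unfolding points_def cat.simps mem_Collect_eq using assms(1,2) g pg gt by blast
  have "inverse_arrows (points \<C> B) ((p, s), f, (q, t)) ((q, t), g, (p, s))"
    unfolding inverse_arrows_def hom_def mem_Collect_eq by (intro conjI F G) (simp_all add: points_def gf fg)
  then show ?thesis unfolding iso_arrow_def by blast
qed

text \<open>This removes the choice operators from the definition. A chosen pullback is some
  pullback, the described arrow is the induced one, and isomorphisms of points are isomorphisms of
  the underlying arrows; so the second premise speaks of arbitrary pullback squares in the base
  category.\<close>

lemma protomodularI: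
  assumes ex: "\<And>p s b. \<lbrakk>b \<in> Arr \<C>; is_point \<C> (Cod \<C> b) (p, s)\<rbrakk> \<Longrightarrow> \<exists>\<pi> \<rho>. is_pullback \<C> p b \<pi> \<rho>"
    and reflect: "\<And>p s q t f b \<pi> \<rho> \<pi>' \<rho>' u v. \<lbrakk>b \<in> Arr \<C>; is_point \<C> (Cod \<C> b) (p, s); is_point \<C> (Cod \<C> b) (q, t);
      f \<in> hom \<C> (Dom \<C> p) (Dom \<C> q); q \<cdot> f = p; f \<cdot> s = t; is_pullback \<C> p b \<pi> \<rho>; is_pullback \<C> q b \<pi>' \<rho>';
      u \<in> hom \<C> (Dom \<C> \<pi>) (Dom \<C> \<pi>'); \<pi>' \<cdot> u = f \<cdot> \<pi>; \<rho>' \<cdot> u = \<rho>;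
      v \<in> hom \<C> (Dom \<C> \<pi>') (Dom \<C> \<pi>); v \<cdot> u = Dom \<C> \<pi>; u \<cdot> v = Dom \<C> \<pi>'\<rbrakk>
      \<Longrightarrow> \<exists>g. g \<in> hom \<C> (Dom \<C> q) (Dom \<C> p) \<and> g \<cdot> f = Dom \<C> p \<and> f \<cdot> g = Dom \<C> q"
  shows "protomodular \<C>"
proof -
  have chosen: "is_pullback \<C> p b \<pi> \<rho>" if "b \<in> Arr \<C>" "is_point \<C> (Cod \<C> b) (p, s)" "chosen_pullback \<C> p b = (\<pi>, \<rho>)" for b p s \<pi> \<rho>
  proof -
    have "\<exists>x. case x of (\<pi>, \<rho>) \<Rightarrow> is_pullback \<C> p b \<pi> \<rho>" using ex[OF that(1,2)] by auto
    from someI_ex[OF this] have "case chosen_pullback \<C> p b of (\<pi>, \<rho>) \<Rightarrow> is_pullback \<C> p b \<pi> \<rho>"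
      unfolding chosen_pullback_def .
    then show ?thesis unfolding that(3) by simp
  qed
  have refl: "iso_arrow (points \<C> (Cod \<C> b)) F"
    if b: "b \<in> Arr \<C>" and F: "F \<in> Arr (points \<C> (Cod \<C> b))" and iso: "iso_arrow (points \<C> (Dom \<C> b)) (inverse_image \<C> b F)" for b F
  proof -
    obtain p s f q t where F_eq: "F = ((p, s), f, (q, t))" and ps: "is_point \<C> (Cod \<C> b) (p, s)" and qt: "is_point \<C> (Cod \<C> b) (q, t)"
      and f: "f \<in> hom \<C> (Dom \<C> p) (Dom \<C> q)" "q \<cdot> f = p" "f \<cdot> s = t"
      using points_arrD[OF F] by metis
    obtain \<pi> \<rho> where pr: "chosen_pullback \<C> p b = (\<pi>, \<rho>)" by fastforce
    obtain \<pi>' \<rho>' where pr': "chosen_pullback \<C> q b = (\<pi>', \<rho>')" by fastforce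
    note pb = chosen[OF b ps pr] and pb' = chosen[OF b qt pr']
    note a = pullback_arr[OF pb] and a' = pullback_arr[OF pb']
    have fa: "f \<in> Arr \<C>" "Dom \<C> f = Dom \<C> p" "Cod \<C> f = Dom \<C> q" using f by (simp_all add: hom_def)
    define u where "u = (THE u. u \<in> hom \<C> (Dom \<C> \<rho>) (Dom \<C> \<rho>') \<and> \<pi>' \<cdot> u = f \<cdot> \<pi> \<and> \<rho>' \<cdot> u = \<rho>)"
    have "q \<cdot> f \<cdot> \<pi> = b \<cdot> \<rho>" using ext2[OF f(2), of \<pi>] a a' fa by simp
    moreover have "f \<cdot> \<pi> \<in> hom \<C> (Dom \<C> \<rho>) (Dom \<C> q)" "\<rho> \<in> hom \<C> (Dom \<C> \<rho>) (Dom \<C> b)" "Dom \<C> \<rho> \<in> Ob \<C>"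
      using a fa by (simp_all add: hom_def)
    ultimately have "\<exists>!u. u \<in> hom \<C> (Dom \<C> \<rho>) (Dom \<C> \<pi>') \<and> \<pi>' \<cdot> u = f \<cdot> \<pi> \<and> \<rho>' \<cdot> u = \<rho>"
      by (intro pullback_ex1[OF pb']) simp_all
    from theI'[OF this] have u: "u \<in> hom \<C> (Dom \<C> \<rho>) (Dom \<C> \<rho>')" "\<pi>' \<cdot> u = f \<cdot> \<pi>" "\<rho>' \<cdot> u = \<rho>"
      unfolding u_def a'(6) by blast+
    have e: "inverse_image \<C> b F = (inverse_image_point \<C> b (p, s), u, inverse_image_point \<C> b (q, t))"
      by (simp add: inverse_image_def F_eq pr pr' u_def)
    have e': "fst (inverse_image_point \<C> b (p, s)) = \<rho>" "fst (inverse_image_point \<C> b (q, t)) = \<rho>'"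
      by (simp_all add: inverse_image_point_def pr pr')
    obtain v where v: "v \<in> hom \<C> (Dom \<C> \<rho>') (Dom \<C> \<rho>)" "v \<cdot> u = Dom \<C> \<rho>" "u \<cdot> v = Dom \<C> \<rho>'"
      using points_isoD(2)[OF iso[unfolded e]] unfolding e' by blast
    obtain g where "g \<in> hom \<C> (Dom \<C> q) (Dom \<C> p)" "g \<cdot> f = Dom \<C> p" "f \<cdot> g = Dom \<C> q"
      using reflect[OF b ps qt f pb pb', of u v] u v unfolding a(6) a'(6) by blast
    then show ?thesis unfolding F_eq by (intro points_isoI ps qt f)
  qed
  show ?thesis
    unfolding protomodular_def reflects_isos_def
  proof (intro conjI allI ballI impI)
    show "category \<C>" by (rule category_axioms)
    show "\<exists>\<pi> \<rho>. is_pullback \<C> p b \<pi> \<rho>" if "b \<in> Arr \<C> \<and> is_point \<C> (Cod \<C> b) (p, s)" for p s b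
      using ex that by blast
  qed (rule refl)
qed

end

section \<open>The category of cocommutative Hopf monoids\<close>

context bullet_braided_duoidal_category_with_reversion
begin

text \<open>The condition that selects the objects of the full subcategory, stated for the bimonoid
  and not for its identity arrow.\<close>

definition cocommutative_Hopf where
  "cocommutative_Hopf H \<longleftrightarrow> Hopf_monoid H \<and> cocommutative H \<and> mono_arrow \<C> (unt H)"

abbreviation \<D> where "\<D> \<equiv> Hopf_m_coc"

lemma Hopf_m_coc_simps [simp]:
  "(H, f, K) \<in> Arr \<D> \<longleftrightarrow> cocommutative_Hopf H \<and> cocommutative_Hopf K \<and> bimonoid_morphism H f K"
  "Dom \<D> (H, f, K) = (H, und H, H)" "Cod \<D> (H, f, K) = (K, und K, K)"
  "Comp \<D> (K', g, L) (H, f, K) = (H, g \<cdot> f, L)"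
  by (auto simp: Hopf_m_coc_def full_subcategory_def bimonoids_def cocommutative_Hopf_def Hopf_monoid_def)

lemma cocommutative_HopfD:
  assumes "cocommutative_Hopf H"
  shows "bimonoid H" "cocommutative H" "mono_arrow \<C> (unt H)" "\<exists>s. antipode H s"
  using assms by (auto simp: cocommutative_Hopf_def Hopf_monoid_def)

lemma bimonoid_morphism_arr:
  assumes "bimonoid_morphism H f K"
  shows "f \<in> Arr \<C>" "Dom \<C> f = und H" "Cod \<C> f = und K"
  using assms by (auto simp: bimonoid_morphism_def hom_def)

lemma bimonoid_morphism_id: "bimonoid H \<Longrightarrow> bimonoid_morphism H (und H) H"
  by (intro bimonoid_morphismI comonoid_map_id monoid_map_id bimonoid_parts)

lemma bimonoid_morphism_comp:
  assumes "bimonoid H" "bimonoid K" "bimonoid L" "bimonoid_morphism H f K" "bimonoid_morphism K g L"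
  shows "bimonoid_morphism H (g \<cdot> f) L"
  by (rule bimonoid_morphismI; rule comonoid_map_comp monoid_map_comp;
    rule bimonoid_parts(1)[OF assms(1)] bimonoid_parts(1)[OF assms(2)] bimonoid_parts(1)[OF assms(3)]
      bimonoid_parts(2)[OF assms(1)] bimonoid_parts(2)[OF assms(2)] bimonoid_parts(2)[OF assms(3)]
      bimonoid_morphism_parts[OF assms(1,2,4)] bimonoid_morphism_parts[OF assms(2,3,5)])

lemma Hopf_m_coc_category: "category \<D>"
proof
  fix f assume f: "f \<in> Arr \<D>"
  obtain H f' K where f': "f = (H, f', K)" by (cases f)
  have m: "cocommutative_Hopf H" "cocommutative_Hopf K" "bimonoid_morphism H f' K" using f by (simp_all add: f')
  note a = bimonoid_morphism_arr[OF m(3)]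
  have [simp]: "und H \<in> Ob \<C>" "und K \<in> Ob \<C>" using circ.dom_ob[OF a(1)] circ.cod_ob[OF a(1)] a by simp_all
  show "Dom \<D> f \<in> Arr \<D>" "Cod \<D> f \<in> Arr \<D>"
    using m bimonoid_morphism_id cocommutative_HopfD(1) by (simp_all add: f')
  show "Dom \<D> (Dom \<D> f) = Dom \<D> f" "Cod \<D> (Dom \<D> f) = Dom \<D> f" "Dom \<D> (Cod \<D> f) = Cod \<D> f" "Cod \<D> (Cod \<D> f) = Cod \<D> f"
    by (simp_all add: f')
  show "Comp \<D> f (Dom \<D> f) = f" "Comp \<D> (Cod \<D> f) f = f" using a by (simp_all add: f')
  fix g assume g: "g \<in> Arr \<D>" and gf: "Dom \<D> g = Cod \<D> f"
  obtain L g' M where g': "g = (L, g', M)" by (cases g)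
  have LK: "L = K" using gf by (simp add: f' g')
  have n: "cocommutative_Hopf M" "bimonoid_morphism K g' M" using g by (simp_all add: g' LK)
  note b = bimonoid_morphism_arr[OF n(2)]
  show "Comp \<D> g f \<in> hom \<D> (Dom \<D> f) (Cod \<D> g)"
    using m n bimonoid_morphism_comp[OF cocommutative_HopfD(1) cocommutative_HopfD(1) cocommutative_HopfD(1), OF m(1,2) n(1) m(3) n(2)]
    by (simp add: hom_def[of \<D>] f' g' LK)
  fix h assume h: "h \<in> Arr \<D>" and hg: "Dom \<D> h = Cod \<D> g"
  obtain L' h' M' where h': "h = (L', h', M')" by (cases h)
  have LM: "L' = M" using hg by (simp add: g' h')
  have "bimonoid_morphism M h' M'" using h by (simp add: h' LM)
  note c = bimonoid_morphism_arr[OF this]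
  show "Comp \<D> (Comp \<D> h g) f = Comp \<D> h (Comp \<D> g f)" using a b c by (simp add: f' g' h')
qed

text \<open>The graph of p is a split monomorphism, and the unit of B remains monic after tensoring
  with A because \<bullet> preserves intersections. So the required pullback is a binary
  intersection.\<close>

lemma kernel_exists:
  assumes has: "has_binary_intersections \<C>" and pres: "bullet_preserves_binary_intersections \<C> S"
    and A: "bimonoid A" and B: "bimonoid B" and p: "bimonoid_morphism A p B" and u: "mono_arrow \<C> (unt B)"
  shows "\<exists>\<kappa> \<kappa>'. is_pullback \<C> ((und A \<bullet> p) \<cdot> comult A) (und A \<bullet> unt B) \<kappa> \<kappa>'"
proof -
  note A' = bimonoid_parts[OF A] and B' = bimonoid_parts[OF B]
  note [simp] = monoid_arr[OF A'(1)] comonoid_arr[OF A'(2)] monoid_arr[OF B'(1)] bimonoid_morphism_arr[OF p]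
  have 1: "mono_arrow \<C> ((und A \<bullet> p) \<cdot> comult A)"
    by (rule graph_mono[OF A'(2) B'(2) bimonoid_morphism_parts(1)[OF A B p]])
  have 2: "mono_arrow \<C> (und A \<bullet> unt B)" by (rule bullet_mono[OF pres u]) simp
  have "Cod \<C> ((und A \<bullet> p) \<cdot> comult A) = Cod \<C> (und A \<bullet> unt B)" by simp
  with 1 2 show ?thesis using has unfolding has_binary_intersections_def by blast
qed

lemma (in Hopf_pullback) PB_cocommutative_Hopf: "cocommutative_Hopf PB"
  unfolding cocommutative_Hopf_def Hopf_monoid_def
  using PB_bimonoid PB_antipode PB_cocommutative PB_unt_mono by blast

lemma (in Hopf_pullback) PB_pullback:
  assumes Hopf: "cocommutative_Hopf A" "cocommutative_Hopf B" "cocommutative_Hopf C"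
  shows "is_pullback \<D> (A, p, B) (C, c, B) (PB, pA, A) (PB, pC, C)"
  unfolding is_pullback_def
proof (intro conjI ballI impI)
  show "(A, p, B) \<in> Arr \<D>" "(C, c, B) \<in> Arr \<D>" "(PB, pA, A) \<in> Arr \<D>" "(PB, pC, C) \<in> Arr \<D>"
    using Hopf p c pA_morphism pC_morphism PB_cocommutative_Hopf by simp_all
  show "Comp \<D> (A, p, B) (PB, pA, A) = Comp \<D> (C, c, B) (PB, pC, C)" by (simp add: p_pA)
  fix X h k assume X: "X \<in> Ob \<D>" and h: "h \<in> hom \<D> X (Dom \<D> (A, p, B))" and k: "k \<in> hom \<D> X (Dom \<D> (C, c, B))"
    and hk: "Comp \<D> (A, p, B) h = Comp \<D> (C, c, B) k"
  obtain Z x Z' where X': "X = (Z, x, Z')" by (cases X)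
  obtain H z A' where h': "h = (H, z, A')" by (cases h)
  obtain H' y C' where k': "k = (H', y, C')" by (cases k)
  \<comment> \<open>Objects are identity arrows, so a test object is the identity triple of a Hopf
    monoid Z.\<close>
  have X_eq: "X = (Z, und Z, Z)" using X by (auto simp: Ob_def X')
  have hh: "H = Z" "A' = A" "bimonoid_morphism Z z A" using h by (auto simp: hom_def[of \<D>] h' X_eq)
  have kk: "H' = Z" "C' = C" "bimonoid_morphism Z y C" using k by (auto simp: hom_def[of \<D>] k' X_eq)
  have Z: "cocommutative_Hopf Z" using X by (simp add: Ob_def X_eq)
  note Z' = cocommutative_HopfD[OF Z]
  have "p \<cdot> z = c \<cdot> y" using hk by (simp add: h' k')
  note l = lift_morphism[OF Z'(1,2) hh(3) kk(3) this]
  show "\<exists>!u. u \<in> hom \<D> X (Dom \<D> (PB, pA, A)) \<and> Comp \<D> (PB, pA, A) u = h \<and> Comp \<D> (PB, pC, C) u = k"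
  proof (rule ex1I[of _ "(Z, lift (comult Z) z y, PB)"])
    show "(Z, lift (comult Z) z y, PB) \<in> hom \<D> X (Dom \<D> (PB, pA, A)) \<and>
      Comp \<D> (PB, pA, A) (Z, lift (comult Z) z y, PB) = h \<and> Comp \<D> (PB, pC, C) (Z, lift (comult Z) z y, PB) = k"
      using Z l PB_cocommutative_Hopf by (simp add: hom_def[of \<D>] X_eq h' k' hh kk)
    fix u assume u: "u \<in> hom \<D> X (Dom \<D> (PB, pA, A)) \<and> Comp \<D> (PB, pA, A) u = h \<and> Comp \<D> (PB, pC, C) u = k"
    obtain U n U' where u': "u = (U, n, U')" by (cases u)
    have U: "U = Z" "U' = PB" "bimonoid_morphism Z n PB" using u by (auto simp: hom_def[of \<D>] u' X_eq)
    have "h = (Z, z, A)" "k = (Z, y, C)" using h' k' hh kk by simp_all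
    then have "pA \<cdot> n = z" "pC \<cdot> n = y" using u by (simp_all add: u')
    then show "u = (Z, lift (comult Z) z y, PB)"
      using lift_morphism_unique[OF Z'(1) U(3) l(1)] l(2,3) by (simp add: u' U)
  qed
qed simp_all

lemma pointE:
  assumes "is_point \<D> (B, und B, B) (p, s)"
  obtains A p' s' where "p = (A, p', B)" "s = (B, s', A)" "cocommutative_Hopf A" "cocommutative_Hopf B"
    "bimonoid_morphism A p' B" "bimonoid_morphism B s' A" "p' \<cdot> s' = und B"
proof -
  obtain A p' B' where p: "p = (A, p', B')" by (cases p)
  obtain B'' s' A' where s: "s = (B'', s', A')" by (cases s)
  show ?thesis using assms by (intro that[of A p' s']) (auto simp: is_point_def hom_def[of \<D>] p s)
qed

lemma Hopf_pullbackI: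
  assumes pres: "bullet_preserves_binary_intersections \<C> S"
    and Hopf: "cocommutative_Hopf A" "cocommutative_Hopf B" "cocommutative_Hopf C"
    and "bimonoid_morphism A p B" "bimonoid_morphism B s A" "p \<cdot> s = und B" "bimonoid_morphism C c B"
    and "antipode A tA" "antipode B t" "antipode C tC"
    and "is_pullback \<C> ((und A \<bullet> p) \<cdot> comult A) (und A \<bullet> unt B) \<kappa> \<kappa>'"
  shows "Hopf_pullback \<C> T S \<zeta> \<Delta>\<^sub>I m\<^sub>J \<epsilon>\<^sub>I \<sigma> reverse \<phi>c \<phi>c\<^sub>0 \<phi>b \<phi>b\<^sub>0 \<gamma> \<delta> \<gamma>' \<delta>' A B t p s \<kappa> \<kappa>' C tA tC c"
  using assms cocommutative_HopfD[OF Hopf(1)] cocommutative_HopfD[OF Hopf(2)] cocommutative_HopfD[OF Hopf(3)]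
  by unfold_locales

theorem Hopf_m_coc_protomodular:
  assumes has: "has_binary_intersections \<C>" and pres: "bullet_preserves_binary_intersections \<C> S"
  shows "protomodular \<D>"
proof -
  interpret D: category \<D> by (rule Hopf_m_coc_category)
  show ?thesis
  proof (rule D.protomodularI)
    fix p s b assume b: "b \<in> Arr \<D>" and ps: "is_point \<D> (Cod \<D> b) (p, s)"
    obtain C c B where b_eq: "b = (C, c, B)" by (cases b)
    have bm: "cocommutative_Hopf C" "bimonoid_morphism C c B" using b by (simp_all add: b_eq)
    obtain A p\<^sub>0 s\<^sub>0 where p: "p = (A, p\<^sub>0, B)" "s = (B, s\<^sub>0, A)" and h: "cocommutative_Hopf A" "cocommutative_Hopf B"
      "bimonoid_morphism A p\<^sub>0 B" "bimonoid_morphism B s\<^sub>0 A" "p\<^sub>0 \<cdot> s\<^sub>0 = und B"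
      using pointE[of B p s] ps by (auto simp: b_eq)
    obtain \<kappa> \<kappa>' where k: "is_pullback \<C> ((und A \<bullet> p\<^sub>0) \<cdot> comult A) (und A \<bullet> unt B) \<kappa> \<kappa>'"
      using kernel_exists[OF has pres cocommutative_HopfD(1)[OF h(1)] cocommutative_HopfD(1)[OF h(2)] h(3) cocommutative_HopfD(3)[OF h(2)]] by blast
    obtain tA t tC where an: "antipode A tA" "antipode B t" "antipode C tC"
      using cocommutative_HopfD(4)[OF h(1)] cocommutative_HopfD(4)[OF h(2)] cocommutative_HopfD(4)[OF bm(1)] by blast
    interpret P: Hopf_pullback \<C> T S \<zeta> \<Delta>\<^sub>I m\<^sub>J \<epsilon>\<^sub>I \<sigma> reverse \<phi>c \<phi>c\<^sub>0 \<phi>b \<phi>b\<^sub>0 \<gamma> \<delta> \<gamma>' \<delta>' A B t p\<^sub>0 s\<^sub>0 \<kappa> \<kappa>' C tA tC c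
      by (rule Hopf_pullbackI[OF pres h(1,2) bm(1) h(3-5) bm(2) an k])
    show "\<exists>\<pi> \<rho>. is_pullback \<D> p b \<pi> \<rho>"
      unfolding p b_eq using P.PB_pullback[OF h(1,2) bm(1)] by blast
  next
    fix p s q t' f b \<pi> \<rho> \<pi>' \<rho>' u v
    assume b: "b \<in> Arr \<D>" and ps: "is_point \<D> (Cod \<D> b) (p, s)" and qt: "is_point \<D> (Cod \<D> b) (q, t')"
      and f: "f \<in> hom \<D> (Dom \<D> p) (Dom \<D> q)" and qf: "Comp \<D> q f = p" and fs: "Comp \<D> f s = t'"
      and pb: "is_pullback \<D> p b \<pi> \<rho>" and pb': "is_pullback \<D> q b \<pi>' \<rho>'"
      and u: "u \<in> hom \<D> (Dom \<D> \<pi>) (Dom \<D> \<pi>')" "Comp \<D> \<pi>' u = Comp \<D> f \<pi>" "Comp \<D> \<rho>' u = \<rho>"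
      and v: "v \<in> hom \<D> (Dom \<D> \<pi>') (Dom \<D> \<pi>)" "Comp \<D> v u = Dom \<D> \<pi>" "Comp \<D> u v = Dom \<D> \<pi>'"
    obtain C c B where b_eq: "b = (C, c, B)" by (cases b)
    have bm: "cocommutative_Hopf C" "bimonoid_morphism C c B" using b by (simp_all add: b_eq)
    obtain A p\<^sub>0 s\<^sub>0 where p: "p = (A, p\<^sub>0, B)" "s = (B, s\<^sub>0, A)" and h: "cocommutative_Hopf A" "cocommutative_Hopf B"
      "bimonoid_morphism A p\<^sub>0 B" "bimonoid_morphism B s\<^sub>0 A" "p\<^sub>0 \<cdot> s\<^sub>0 = und B"
      using pointE[of B p s] ps by (auto simp: b_eq)
    obtain A' q\<^sub>0 t\<^sub>0 where q: "q = (A', q\<^sub>0, B)" "t' = (B, t\<^sub>0, A')" and A': "cocommutative_Hopf A'" "cocommutative_Hopf B"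
      and q': "bimonoid_morphism A' q\<^sub>0 B" "bimonoid_morphism B t\<^sub>0 A'" "q\<^sub>0 \<cdot> t\<^sub>0 = und B"
      using pointE[of B q t'] qt by (auto simp: b_eq)
    note h' = A'(1) q'
    obtain F f\<^sub>0 F' where f_eq: "f = (F, f\<^sub>0, F')" by (cases f)
    have F: "F = A" "F' = A'" "bimonoid_morphism A f\<^sub>0 A'" using f by (auto simp: hom_def[of \<D>] f_eq p q)
    have f0: "q\<^sub>0 \<cdot> f\<^sub>0 = p\<^sub>0" "f\<^sub>0 \<cdot> s\<^sub>0 = t\<^sub>0" using qf fs by (simp_all add: f_eq p q)
    obtain \<kappa> \<kappa>' where k: "is_pullback \<C> ((und A \<bullet> p\<^sub>0) \<cdot> comult A) (und A \<bullet> unt B) \<kappa> \<kappa>'"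
      using kernel_exists[OF has pres cocommutative_HopfD(1)[OF h(1)] cocommutative_HopfD(1)[OF h(2)] h(3) cocommutative_HopfD(3)[OF h(2)]] by blast
    obtain k k' where k': "is_pullback \<C> ((und A' \<bullet> q\<^sub>0) \<cdot> comult A') (und A' \<bullet> unt B) k k'"
      using kernel_exists[OF has pres cocommutative_HopfD(1)[OF h'(1)] cocommutative_HopfD(1)[OF h(2)] h'(2) cocommutative_HopfD(3)[OF h(2)]] by blast
    obtain tA tA' t tC where an: "antipode A tA" "antipode A' tA'" "antipode B t" "antipode C tC"
      using cocommutative_HopfD(4)[OF h(1)] cocommutative_HopfD(4)[OF h'(1)] cocommutative_HopfD(4)[OF h(2)] cocommutative_HopfD(4)[OF bm(1)] by blast
    interpret P: Hopf_pullback_map \<C> T S \<zeta> \<Delta>\<^sub>I m\<^sub>J \<epsilon>\<^sub>I \<sigma> reverse \<phi>c \<phi>c\<^sub>0 \<phi>b \<phi>b\<^sub>0 \<gamma> \<delta> \<gamma>' \<delta>' A B t p\<^sub>0 s\<^sub>0 \<kappa> \<kappa>' C tA tC c A' q\<^sub>0 t\<^sub>0 k k' tA' f\<^sub>0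
      by (intro Hopf_pullback_map.intro Hopf_pullback_map_axioms.intro Hopf_pullbackI[OF pres h(1,2) bm(1) h(3-5) bm(2) an(1,3,4) k]
        Hopf_pullbackI[OF pres h'(1) h(2) bm(1) h'(2-4) bm(2) an(2,3,4) k'] F(3) f0)
    note PB = P.PB_pullback[OF h(1,2) bm(1)] and QB = P.Q.PB_pullback[OF h'(1) h(2) bm(1)]
    have zm: "bimonoid_morphism P.PB (f\<^sub>0 \<cdot> P.pA) A'"
      by (rule bimonoid_morphism_comp[OF P.PB_bimonoid P.A P.Q.A P.pA_morphism F(3)])
    have zy: "q\<^sub>0 \<cdot> f\<^sub>0 \<cdot> P.pA = c \<cdot> P.pC"
      using circ.ext2[OF f0(1), of P.pA] P.p_pA by simp
    \<comment> \<open>\<open>l\<close> is the comparison between the two explicit pullbacks, whereas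
      u and v belong to the given ones. The transfer below produces the inverse
      \<open>v\<^sub>1\<close> of \<open>l\<close>.\<close>
    define l where "l = P.Q.lift (comult P.PB) (f\<^sub>0 \<cdot> P.pA) P.pC"
    have l: "bimonoid_morphism P.PB l P.Q.PB" "P.Q.pA \<cdot> l = f\<^sub>0 \<cdot> P.pA" "P.Q.pC \<cdot> l = P.pC"
      unfolding l_def by (rule P.Q.lift_morphism[OF P.PB_bimonoid P.PB_cocommutative zm P.pC_morphism zy])+
    obtain v\<^sub>1 where v1: "v\<^sub>1 \<in> Arr \<D>" "Dom \<D> v\<^sub>1 = Dom \<D> (P.Q.PB, P.Q.pA, A')" "Cod \<D> v\<^sub>1 = Dom \<D> (P.PB, P.pA, A)"
      "Comp \<D> v\<^sub>1 (P.PB, l, P.Q.PB) = Dom \<D> (P.PB, P.pA, A)" "Comp \<D> (P.PB, l, P.Q.PB) v\<^sub>1 = Dom \<D> (P.Q.PB, P.Q.pA, A')"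
    proof -
      have "\<exists>v\<^sub>1. v\<^sub>1 \<in> Arr \<D> \<and> Dom \<D> v\<^sub>1 = Dom \<D> (P.Q.PB, P.Q.pA, A') \<and> Cod \<D> v\<^sub>1 = Dom \<D> (P.PB, P.pA, A) \<and>
        Comp \<D> v\<^sub>1 (P.PB, l, P.Q.PB) = Dom \<D> (P.PB, P.pA, A) \<and> Comp \<D> (P.PB, l, P.Q.PB) v\<^sub>1 = Dom \<D> (P.Q.PB, P.Q.pA, A')"
        by (rule D.pullback_iso_transfer[OF pb PB[folded p(1) b_eq] pb' QB[folded q(1) b_eq], of f u v])
          (use f u v l in \<open>auto simp: hom_def[of \<D>] f_eq F p q P.PB_cocommutative_Hopf P.Q.PB_cocommutative_Hopf simp del: P.PB_simps P.Q.PB_simps\<close>)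
      then show ?thesis using that by blast
    qed
    obtain V v\<^sub>0 V' where v_eq: "v\<^sub>1 = (V, v\<^sub>0, V')" by (cases v\<^sub>1)
    have V: "bimonoid_morphism P.Q.PB v\<^sub>0 P.PB" "v\<^sub>0 \<cdot> l = P.P" "l \<cdot> v\<^sub>0 = P.Q.P" using v1 by (auto simp: v_eq)
    obtain g where g: "g \<in> Arr \<C>" "Dom \<C> g = und A'" "Cod \<C> g = und A" "g \<cdot> f\<^sub>0 = und A" "f\<^sub>0 \<cdot> g = und A'"
      using P.inverse_of_pullback_inverse[OF l _ _ _ V(2,3)] bimonoid_morphism_arr[OF V(1)] by auto
    have "bimonoid_morphism A' g A"
      by (rule bimonoid_morphism_inverse[OF P.A P.Q.A F(3) g])
    then show "\<exists>g. g \<in> hom \<D> (Dom \<D> q) (Dom \<D> p) \<and> Comp \<D> g f = Dom \<D> p \<and> Comp \<D> f g = Dom \<D> q"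
      using g h(1) h'(1) by (intro exI[of _ "(A', g, A)"]) (simp add: hom_def[of \<D>] p q f_eq F)
  qed
qed

end

theorem theorem3p13:
  fixes \<C> :: "'a cat"
    and circ bullet :: "'a monoidal_structure"
  assumes "bullet_braided_duoidal_category_with_reversion \<C> circ bullet \<zeta> \<Delta>\<^sub>I m\<^sub>J \<epsilon>\<^sub>I \<sigma>
      reverse \<phi>c \<phi>c\<^sub>0 \<phi>b \<phi>b\<^sub>0 \<gamma> \<delta> \<gamma>' \<delta>'"
    and "has_binary_intersections \<C>"
    and "bullet_preserves_binary_intersections \<C> bullet"
  shows "protomodular (bullet_braided_duoidal_category_with_reversion.Hopf_m_coc
      \<C> circ bullet \<zeta> \<Delta>\<^sub>I m\<^sub>J \<epsilon>\<^sub>I \<sigma> reverse \<gamma> \<delta>)"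
  using bullet_braided_duoidal_category_with_reversion.Hopf_m_coc_protomodular[OF assms] .

end
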